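(* Fix $\delta\in(0,1/4)$. There is a constant $C_1>0$ (depending on $\delta$) such that the following holds. Let $\mu\ge0$, let $\Gamma\in L^\infty(\mathbb R;\mathbb R^{2\times2})$ be symmetric with $\|\Gamma\|_\infty\le\mu$. Let $v$ be compactly supported in $t$ and belong to the finite-energy class. Assume that, in $L^2(\mathbb R;\mathcal V^* )$, \[ \bigl((\partial_t+\tau)^2-L_0\bigr)v=C^*\Gamma(t)Cv+F,\qquad F\in L^2(\mathbb R;\mathcal H). \] If $\tau$ is $\delta$-admissible and $\tau\ge C_1(1+\mu^2)$, then \[ \tau\|v\|_{L^2_t\mathcal H}+\|v_t\|_{L^2_t\mathcal H}+\|L_0^{1/2}v\|_{L^2_t\mathcal H}+\tau^{3/4}\|Cv\|_{L^2_t}\le C_1\|F\|_{L^2_t\mathcal H}. \]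
   Context: Let $\omega(\varphi)=(\sin\varphi)^{1/2}$, $\mathcal H=L^2((0,\pi),\omega\,d\varphi)$, $\mathfrak a_0[f,g]=4\int_0^\pi\omega f'\,\overline{g'}\,d\varphi$ with form domain $\mathcal V=\{f\in\mathcal H:f\in H^1_{\mathrm{loc}}(0,\pi),\int_0^\pi\omega|f'|^2d\varphi<\infty\}$, $\|f\|_{\mathcal V}^2=\mathfrak a_0[f,f]+\|f\|_{\mathcal H}^2$, $\mathcal V^*$ the (anti)dual with pivot $\mathcal H$; $A_0$ is the self-adjoint operator of $\mathfrak a_0$ (also a bounded map $\mathcal V\to\mathcal V^*$), $A_0f=-4\omega^{-1}(\omega f')'$, whose eigenvalues are $2n(2n+1)$, $n\ge0$. Put $L_0=A_0+\frac14I$, with eigenvalues $(2n+\frac12)^2$. The trace operator $C:\mathcal V\to\mathbb C^2$, $Cf=(f(0),f(\pi))^{\mathsf T}$ (endpoint values), is bounded, with dual $C^*:\mathbb C^2\to\mathcal V^*$. The finite-energy class consists of $v\in L^2(\mathbb R;\mathcal V)\cap H^1(\mathbb R;\mathcal H)$ with $v_{tt}\in L^2(\mathbb R;\mathcal V^* )$. $L^2_t\mathcal H=L^2(\mathbb R;\mathcal H)$ and $L^2_t=L^2(\mathbb R;\mathbb C^2)$ for traces. A number $\tau\ge2$ is $\delta$-admissible if $\operatorname{dist}\bigl(\tau,\{2n+\frac12:n\in\mathbb N_0\}\bigr)\ge\delta$. *)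

theory Defs
  imports "HOL-Analysis.Analysis" "HOL-Probability.Essential_Supremum"
begin

section \<open>Conventions\<close>

text \<open>
  Elements of the function spaces on \<open>(0,\<pi>)\<close> are represented by functions
  \<^typ>\<open>real \<Rightarrow> complex\<close>; only their values on \<open>(0,\<pi>)\<close> matter, and equality in \<open>H\<close> is equality
  almost everywhere. Sesquilinear forms are antilinear in the second argument, and elements of the
  antidual of \<open>V\<close> are represented by functionals \<^typ>\<open>(real \<Rightarrow> complex) \<Rightarrow> complex\<close> of which
  only the values on \<open>V\<close> matter.
\<close>

section \<open>Test functions and weak derivatives on the interval\<close>

definition test_functions :: "real set \<Rightarrow> (real \<Rightarrow> real) set" where
  "test_functions S = {\<theta>. (\<forall>k x. ((deriv ^^ k) \<theta>) differentiable (at x)) \<and>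
     (\<exists>K. compact K \<and> K \<subseteq> S \<and> (\<forall>x. x \<notin> K \<longrightarrow> \<theta> x = 0))}"

definition L2_loc :: "(real \<Rightarrow> complex) set" where
  "L2_loc = {f. f \<in> borel_measurable (lebesgue_on {0<..<pi}) \<and>
     (\<forall>a b. 0 < a \<and> b < pi \<longrightarrow> integrable (lebesgue_on {a..b}) (\<lambda>\<phi>. (cmod (f \<phi>))\<^sup>2))}"

definition is_weak_deriv :: "(real \<Rightarrow> complex) \<Rightarrow> (real \<Rightarrow> complex) \<Rightarrow> bool" where
  "is_weak_deriv f g \<longleftrightarrow> (\<forall>\<theta>\<in>test_functions {0<..<pi}.
     (LINT \<phi>|lebesgue_on {0<..<pi}. complex_of_real (deriv \<theta> \<phi>) * f \<phi>) =
     - (LINT \<phi>|lebesgue_on {0<..<pi}. complex_of_real (\<theta> \<phi>) * g \<phi>))"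

definition H1_loc :: "(real \<Rightarrow> complex) set" where
  "H1_loc = {f \<in> L2_loc. \<exists>g\<in>L2_loc. is_weak_deriv f g}"

text \<open>The weak derivative of an element of \<open>H1_loc\<close>; it is determined almost everywhere.\<close>

definition wderiv :: "(real \<Rightarrow> complex) \<Rightarrow> real \<Rightarrow> complex" where
  "wderiv f = (SOME g. g \<in> L2_loc \<and> is_weak_deriv f g)"

section \<open>The weighted space, the form and its domain\<close>

definition \<omega> :: "real \<Rightarrow> real" where
  "\<omega> \<phi> = sqrt (sin \<phi>)"

definition hmeas :: "real measure" where
  "hmeas = density (lebesgue_on {0<..<pi}) (\<lambda>\<phi>. ennreal (\<omega> \<phi>))"

definition H_space :: "(real \<Rightarrow> complex) set" where
  "H_space = {f \<in> borel_measurable hmeas. integrable hmeas (\<lambda>\<phi>. (cmod (f \<phi>))\<^sup>2)}"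

definition H_inner :: "(real \<Rightarrow> complex) \<Rightarrow> (real \<Rightarrow> complex) \<Rightarrow> complex" where
  "H_inner f g = (LINT \<phi>|hmeas. f \<phi> * cnj (g \<phi>))"

definition H_norm :: "(real \<Rightarrow> complex) \<Rightarrow> real" where
  "H_norm f = sqrt (LINT \<phi>|hmeas. (cmod (f \<phi>))\<^sup>2)"

definition V_space :: "(real \<Rightarrow> complex) set" where
  "V_space = {f \<in> H_space. f \<in> H1_loc \<and> integrable hmeas (\<lambda>\<phi>. (cmod (wderiv f \<phi>))\<^sup>2)}"

definition a0 :: "(real \<Rightarrow> complex) \<Rightarrow> (real \<Rightarrow> complex) \<Rightarrow> complex" where
  "a0 f g = 4 * (LINT \<phi>|hmeas. wderiv f \<phi> * cnj (wderiv g \<phi>))"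

definition V_norm :: "(real \<Rightarrow> complex) \<Rightarrow> real" where
  "V_norm f = sqrt (Re (a0 f f) + (H_norm f)\<^sup>2)"

section \<open>The antidual of the form domain\<close>

definition V_dual :: "((real \<Rightarrow> complex) \<Rightarrow> complex) set" where
  "V_dual = {l. (\<forall>f\<in>V_space. \<forall>g\<in>V_space. l (\<lambda>\<phi>. f \<phi> + g \<phi>) = l f + l g) \<and>
     (\<forall>c. \<forall>f\<in>V_space. l (\<lambda>\<phi>. c * f \<phi>) = cnj c * l f) \<and>
     (\<exists>B. \<forall>f\<in>V_space. cmod (l f) \<le> B * V_norm f)}"

definition V_dual_norm :: "((real \<Rightarrow> complex) \<Rightarrow> complex) \<Rightarrow> real" where
  "V_dual_norm l = Sup {cmod (l g) | g. g \<in> V_space \<and> V_norm g \<le> 1}"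

text \<open>The pivot embedding of \<open>H\<close> into the antidual is \<^const>\<open>H_inner\<close>, partially applied, and
  \<^const>\<open>a0\<close>, partially applied, is \<open>A\<^sub>0\<close> as a map from \<open>V\<close> to its antidual.\<close>

definition L0_form :: "(real \<Rightarrow> complex) \<Rightarrow> (real \<Rightarrow> complex) \<Rightarrow> complex" where
  "L0_form f = (\<lambda>g. a0 f g + (1/4) * H_inner f g)"

section \<open>Operators in the weighted space and the square root\<close>

text \<open>Unbounded operators in \<open>H\<close> are given by their graphs, which are closed under replacing
  either component by an almost everywhere equal one.\<close>

definition A0_op :: "((real \<Rightarrow> complex) \<times> (real \<Rightarrow> complex)) set" where
  "A0_op = {(f, h). f \<in> V_space \<and> h \<in> H_space \<and> (\<forall>g\<in>V_space. a0 f g = H_inner h g)}"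

definition L0_op :: "((real \<Rightarrow> complex) \<times> (real \<Rightarrow> complex)) set" where
  "L0_op = {(f, \<lambda>\<phi>. h \<phi> + (1/4) * f \<phi>) | f h. (f, h) \<in> A0_op}"

definition H_adjoint ::
  "((real \<Rightarrow> complex) \<times> (real \<Rightarrow> complex)) set \<Rightarrow> ((real \<Rightarrow> complex) \<times> (real \<Rightarrow> complex)) set" where
  "H_adjoint R = {(y, z). y \<in> H_space \<and> z \<in> H_space \<and> (\<forall>(f, h)\<in>R. H_inner h y = H_inner f z)}"

text \<open>For a nonnegative self-adjoint operator \<open>T\<close>, this determines \<open>S\<close> uniquely. If \<open>(0, h)\<close> lies in
  \<open>S\<close>, then it lies in \<open>S O S = T\<close>, so \<open>S\<close> is single-valued up to equality almost everywhere and
  hence, being its own adjoint, densely defined.\<close>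

definition is_nonneg_sqrt ::
  "((real \<Rightarrow> complex) \<times> (real \<Rightarrow> complex)) set \<Rightarrow> ((real \<Rightarrow> complex) \<times> (real \<Rightarrow> complex)) set \<Rightarrow> bool" where
  "is_nonneg_sqrt T S \<longleftrightarrow> S = H_adjoint S \<and>
     (\<forall>(f, h)\<in>S. Im (H_inner h f) = 0 \<and> Re (H_inner h f) \<ge> 0) \<and> S O S = T"

definition L0_sqrt_op :: "((real \<Rightarrow> complex) \<times> (real \<Rightarrow> complex)) set" where
  "L0_sqrt_op = (THE S. is_nonneg_sqrt L0_op S)"

definition L0_sqrt :: "(real \<Rightarrow> complex) \<Rightarrow> real \<Rightarrow> complex" where
  "L0_sqrt f = (SOME h. (f, h) \<in> L0_sqrt_op)"

section \<open>The trace operator\<close>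

text \<open>Since \<open>1/\<omega>\<close> is integrable, every element of \<open>V\<close> has a (unique) representative that is
  continuous up to the endpoints; endpoint values are those of this representative.\<close>

definition cont_rep :: "(real \<Rightarrow> complex) \<Rightarrow> real \<Rightarrow> complex" where
  "cont_rep f = (SOME h. continuous_on {0..pi} h \<and> (AE \<phi> in hmeas. h \<phi> = f \<phi>))"

definition trace_op :: "(real \<Rightarrow> complex) \<Rightarrow> complex^2" where
  "trace_op f = vector [cont_rep f 0, cont_rep f pi]"

definition trace_dual :: "complex^2 \<Rightarrow> (real \<Rightarrow> complex) \<Rightarrow> complex" where
  "trace_dual z = (\<lambda>g. \<Sum>i\<in>UNIV. z $ i * cnj (trace_op g $ i))"

definition complex_matrix :: "real^2^2 \<Rightarrow> complex^2^2" where
  "complex_matrix M = (\<chi> i j. complex_of_real (M $ i $ j))"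

section \<open>Bochner spaces over the real line\<close>

text \<open>The seminormed space \<open>(X, N)\<close> is \<open>H\<close>, \<open>V\<close> or the antidual of \<open>V\<close>; its elements are
  functions on \<^typ>\<open>'a\<close>, with \<open>N\<close> vanishing exactly on differences of representatives of the same element.\<close>

definition strongly_measurable ::
  "('a \<Rightarrow> complex) set \<Rightarrow> (('a \<Rightarrow> complex) \<Rightarrow> real) \<Rightarrow> (real \<Rightarrow> 'a \<Rightarrow> complex) \<Rightarrow> bool" where
  "strongly_measurable X N u \<longleftrightarrow> (\<exists>s :: nat \<Rightarrow> real \<Rightarrow> 'a \<Rightarrow> complex.
     (\<forall>n. simple_function lebesgue (s n) \<and> range (s n) \<subseteq> X) \<and>
     (AE t in lebesgue. (\<lambda>n. N (\<lambda>x. s n t x - u t x)) \<longlonglongrightarrow> 0))"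

definition L2_time ::
  "('a \<Rightarrow> complex) set \<Rightarrow> (('a \<Rightarrow> complex) \<Rightarrow> real) \<Rightarrow> (real \<Rightarrow> 'a \<Rightarrow> complex) set" where
  "L2_time X N = {u. (AE t in lebesgue. u t \<in> X) \<and> strongly_measurable X N u \<and>
     integrable lebesgue (\<lambda>t. (N (u t))\<^sup>2)}"

definition L2_time_norm :: "('b \<Rightarrow> real) \<Rightarrow> (real \<Rightarrow> 'b) \<Rightarrow> real" where
  "L2_time_norm N u = sqrt (LINT t|lebesgue. (N (u t))\<^sup>2)"

text \<open>\<open>w\<close> is the distributional time derivative of \<open>u\<close>, both being functional-valued; the
  vector-valued identity is tested on all elements of \<open>X\<close>.\<close>

definition is_time_deriv ::
  "(real \<Rightarrow> complex) set \<Rightarrow> (real \<Rightarrow> (real \<Rightarrow> complex) \<Rightarrow> complex) \<Rightarrow>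
    (real \<Rightarrow> (real \<Rightarrow> complex) \<Rightarrow> complex) \<Rightarrow> bool" where
  "is_time_deriv X u w \<longleftrightarrow> (\<forall>\<theta>\<in>test_functions UNIV. \<forall>g\<in>X.
     (LINT t|lebesgue. complex_of_real (deriv \<theta> t) * u t g) =
     - (LINT t|lebesgue. complex_of_real (\<theta> t) * w t g))"

text \<open>The finite-energy class, with the (almost everywhere unique) time derivatives \<open>vt\<close> in
  \<open>L\<^sup>2(\<real>;H)\<close> and \<open>vtt\<close> in \<open>L\<^sup>2(\<real>;V\<^sup>*)\<close> made explicit.\<close>

definition finite_energy ::
  "(real \<Rightarrow> real \<Rightarrow> complex) \<Rightarrow> (real \<Rightarrow> real \<Rightarrow> complex) \<Rightarrow>
    (real \<Rightarrow> (real \<Rightarrow> complex) \<Rightarrow> complex) \<Rightarrow> bool" where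
  "finite_energy v vt vtt \<longleftrightarrow>
     v \<in> L2_time V_space V_norm \<and>
     v \<in> L2_time H_space H_norm \<and> vt \<in> L2_time H_space H_norm \<and>
     is_time_deriv H_space (\<lambda>t. H_inner (v t)) (\<lambda>t. H_inner (vt t)) \<and>
     vtt \<in> L2_time V_dual V_dual_norm \<and>
     is_time_deriv V_space (\<lambda>t. H_inner (vt t)) vtt"

definition compactly_supported_in_time :: "(real \<Rightarrow> real \<Rightarrow> complex) \<Rightarrow> bool" where
  "compactly_supported_in_time v \<longleftrightarrow>
     (\<exists>R. AE t in lebesgue. \<bar>t\<bar> > R \<longrightarrow> (AE \<phi> in hmeas. v t \<phi> = 0))"

section \<open>The equation and the spectral parameter\<close>

text \<open>Equality in \<open>L\<^sup>2(\<real>;V\<^sup>*)\<close>, with \<open>(\<partial>\<^sub>t + \<tau>)\<^sup>2 v = vtt + 2 \<tau> vt + \<tau>\<^sup>2 v\<close>.\<close>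

definition solves_conjugated ::
  "real \<Rightarrow> (real \<Rightarrow> real^2^2) \<Rightarrow> (real \<Rightarrow> real \<Rightarrow> complex) \<Rightarrow> (real \<Rightarrow> real \<Rightarrow> complex) \<Rightarrow>
    (real \<Rightarrow> (real \<Rightarrow> complex) \<Rightarrow> complex) \<Rightarrow> (real \<Rightarrow> real \<Rightarrow> complex) \<Rightarrow> bool" where
  "solves_conjugated \<tau> \<Gamma> v vt vtt F \<longleftrightarrow> (AE t in lebesgue. \<forall>g\<in>V_space.
     vtt t g + 2 * complex_of_real \<tau> * H_inner (vt t) g
       + (complex_of_real \<tau>)\<^sup>2 * H_inner (v t) g - L0_form (v t) g
     = trace_dual (complex_matrix (\<Gamma> t) *v trace_op (v t)) g + H_inner (F t) g)"

text \<open>\<open>\<Gamma> \<in> L\<^sup>\<infinity>\<close>, symmetric, with essential supremum of the operator norm at most \<open>\<mu>\<close>.\<close>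

definition bounded_symmetric_coeff :: "real \<Rightarrow> (real \<Rightarrow> real^2^2) \<Rightarrow> bool" where
  "bounded_symmetric_coeff \<mu> \<Gamma> \<longleftrightarrow> \<Gamma> \<in> borel_measurable lebesgue \<and>
     (AE t in lebesgue. transpose (\<Gamma> t) = \<Gamma> t) \<and>
     esssup lebesgue (\<lambda>t. ereal (onorm (\<lambda>x. \<Gamma> t *v x))) \<le> ereal \<mu>"

definition admissible :: "real \<Rightarrow> real \<Rightarrow> bool" where
  "admissible \<delta> \<tau> \<longleftrightarrow> \<tau> \<ge> 2 \<and> infdist \<tau> (range (\<lambda>n::nat. 2 * real n + 1/2)) \<ge> \<delta>"

end

theory Submission
  imports Defs
begin

text \<open>
  The operator \<open>A\<^sub>0\<close> has a complete system of eigenfunctions, the Gegenbauer polynomials of index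
  \<open>1/4\<close> in \<open>cos \<phi>\<close>, and a compactly supported \<open>v\<close> is given on its time interval by a Fourier series.
  In both expansions the equation becomes algebraic. At frequency \<open>\<xi>\<close> the coefficient of mode \<open>n\<close>,
  for \<open>\<lambda>\<^sub>n = 2n + 1/2\<close>, satisfies
  \<open>((\<tau> + \<i>\<xi>)\<^sup>2 - \<lambda>\<^sub>n\<^sup>2) V\<^sub>n = \<Sum>\<^sub>j G\<^sub>j a\<^sub>n\<^sub>j + F\<^sub>n\<close>, where \<open>a\<^sub>n\<^sub>0\<close> and \<open>a\<^sub>n\<^sub>\<pi>\<close> are the endpoint values of the
  normalized eigenfunction and \<open>G\<close> comes from the boundary source \<open>\<Gamma> C v\<close>. Estimates that are uniform
  in \<open>\<xi>\<close> and Parseval's identity in space and in time give the theorem. The square root of \<open>L\<^sub>0\<close> enters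
  through its coefficients, which are \<open>\<lambda>\<^sub>n V\<^sub>n\<close>.

  The symbol factors as \<open>(s - \<lambda>)(s + \<lambda>)\<close> with \<open>s = \<tau> + \<i>\<xi>\<close>. Its first factor is at least
  \<open>\<bar>\<tau> - \<lambda>\<^sub>n\<bar> \<ge> \<delta>\<close> in modulus, and its second at least \<open>(\<tau>\<^sup>2 + \<xi>\<^sup>2 + \<lambda>\<^sub>n\<^sup>2)\<^sup>1\<^sup>/\<^sup>2\<close>. This controls the energy of the
  response to \<open>F\<close>. For the boundary source, where \<open>a\<^sub>n\<^sub>j\<^sup>2\<close> is of order
  \<open>\<surd>n\<close>, two sums over the spectrum matter.

  \<^item> The sum of \<open>a\<^sub>n\<^sub>j\<^sup>2 / (\<tau> - \<lambda>\<^sub>n)\<^sup>2\<close> is of order \<open>\<surd>\<tau>\<close> (\<open>resonance_sum\<close>), because the modes near \<open>\<tau>\<close>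
    dominate. It bounds the energy of the response to the boundary source and, by the Cauchy--Schwarz
    inequality, the trace of the response to \<open>F\<close>. The latter produces the weight \<open>\<tau>\<^sup>3\<^sup>/\<^sup>4\<close> of the trace.

  \<^item> The sum of \<open>a\<^sub>n\<^sub>i a\<^sub>n\<^sub>j / (s\<^sup>2 - \<lambda>\<^sub>n\<^sup>2)\<close>, which maps the boundary source to the trace of its response,
    is of order \<open>\<tau>\<^sup>-\<^sup>1\<^sup>/\<^sup>2\<close> (\<open>trace_symbol\<close>). Absolute values would lose a logarithm. In partial fractions
    its singular part has the slowly varying numerators \<open>binomial(2n, n) / 4\<^sup>n\<close>, and the terms that lie
    symmetrically about the eigenvalue closest to \<open>\<tau>\<close> nearly cancel (\<open>window_principal_value\<close>).

  Since \<open>\<Gamma>\<close> is bounded by \<open>\<mu>\<close>, the trace satisfies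
  \<open>\<parallel>C v\<parallel>\<^sup>2 \<le> K (\<mu>\<^sup>2 / \<tau> \<parallel>C v\<parallel>\<^sup>2 + \<tau>\<^sup>-\<^sup>3\<^sup>/\<^sup>2 \<parallel>F\<parallel>\<^sup>2)\<close>, and for \<open>\<tau> \<ge> 2 K \<mu>\<^sup>2\<close> the first term on the right is absorbed
  (\<open>absorption\<close>). The bound on the trace then bounds the energy.
\<close>

section \<open>Square-integrable functions and orthonormal bases\<close>

text \<open>Functions rather than classes of functions. The squared norm \<open>nsq\<close> vanishes exactly on the
  functions that are almost everywhere zero.\<close>

definition L2 :: "'a measure \<Rightarrow> ('a \<Rightarrow> complex) set" where
  "L2 M = {f \<in> borel_measurable M. integrable M (\<lambda>x. (cmod (f x))\<^sup>2)}"

definition ip :: "'a measure \<Rightarrow> ('a \<Rightarrow> complex) \<Rightarrow> ('a \<Rightarrow> complex) \<Rightarrow> complex" where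
  "ip M f g = (LINT x|M. f x * cnj (g x))"

definition nsq :: "'a measure \<Rightarrow> ('a \<Rightarrow> complex) \<Rightarrow> real" where
  "nsq M f = (LINT x|M. (cmod (f x))\<^sup>2)"

lemma cnj_measurable [measurable]: "cnj \<in> borel_measurable borel"
  by (intro borel_measurable_continuous_onI continuous_intros)

lemma L2D: "f \<in> L2 M \<Longrightarrow> f \<in> borel_measurable M" "f \<in> L2 M \<Longrightarrow> integrable M (\<lambda>x. (cmod (f x))\<^sup>2)"
  by (auto simp: L2_def)

lemma L2I: "f \<in> borel_measurable M \<Longrightarrow> integrable M (\<lambda>x. (cmod (f x))\<^sup>2) \<Longrightarrow> f \<in> L2 M"
  by (auto simp: L2_def)

lemma nsq_nonneg [simp]: "0 \<le> nsq M f"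
  by (simp add: nsq_def)

lemma L2_mult_integrable:
  assumes "f \<in> L2 M" "g \<in> L2 M"
  shows "integrable M (\<lambda>x. f x * g x)" "integrable M (\<lambda>x. f x * cnj (g x))"
    "integrable M (\<lambda>x. cmod (f x) * cmod (g x))"
proof -
  note [measurable] = L2D(1)[OF assms(1)] L2D(1)[OF assms(2)]
  have I: "integrable M (\<lambda>x. (cmod (f x))\<^sup>2 + (cmod (g x))\<^sup>2)"
    using assms by (intro Bochner_Integration.integrable_add L2D)
  have B: "cmod (f x) * cmod (g x) \<le> (cmod (f x))\<^sup>2 + (cmod (g x))\<^sup>2" for x
    using sum_squares_bound[of "cmod (f x)" "cmod (g x)"] mult_nonneg_nonneg[of "cmod (f x)" "cmod (g x)"]
      norm_ge_zero[of "f x"] norm_ge_zero[of "g x"] by linarith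
  show "integrable M (\<lambda>x. f x * g x)" "integrable M (\<lambda>x. f x * cnj (g x))"
    "integrable M (\<lambda>x. cmod (f x) * cmod (g x))"
    by (rule Bochner_Integration.integrable_bound[OF I], measurable, simp add: norm_mult B)+
qed

lemma L2_zero [simp]: "(\<lambda>x. 0) \<in> L2 M"
  by (simp add: L2_def)

lemma L2_add [intro]:
  assumes "f \<in> L2 M" "g \<in> L2 M" shows "(\<lambda>x. f x + g x) \<in> L2 M"
proof (rule L2I)
  note [measurable] = L2D(1)[OF assms(1)] L2D(1)[OF assms(2)]
  show "(\<lambda>x. f x + g x) \<in> borel_measurable M" by simp
  have "integrable M (\<lambda>x. 2 * (cmod (f x))\<^sup>2 + 2 * (cmod (g x))\<^sup>2)"
    using assms by (intro Bochner_Integration.integrable_add integrable_mult_right L2D)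
  then show "integrable M (\<lambda>x. (cmod (f x + g x))\<^sup>2)"
  proof (rule Bochner_Integration.integrable_bound)
    have "(cmod (f x + g x))\<^sup>2 \<le> 2 * (cmod (f x))\<^sup>2 + 2 * (cmod (g x))\<^sup>2" for x
    proof -
      have "(cmod (f x + g x))\<^sup>2 \<le> (cmod (f x) + cmod (g x))\<^sup>2"
        by (intro power_mono norm_triangle_ineq) auto
      also have "\<dots> \<le> 2 * (cmod (f x))\<^sup>2 + 2 * (cmod (g x))\<^sup>2"
        using sum_squares_bound[of "cmod (f x)" "cmod (g x)"] by (simp add: power2_sum)
      finally show ?thesis .
    qed
    then show "AE x in M. norm ((cmod (f x + g x))\<^sup>2) \<le> norm (2 * (cmod (f x))\<^sup>2 + 2 * (cmod (g x))\<^sup>2)"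
      by (intro AE_I2) (simp add: abs_of_nonneg)
  qed measurable
qed

lemma L2_scale [intro]: "f \<in> L2 M \<Longrightarrow> (\<lambda>x. c * f x) \<in> L2 M"
  by (auto simp: L2_def norm_mult power_mult_distrib)

lemma L2_diff [intro]: "f \<in> L2 M \<Longrightarrow> g \<in> L2 M \<Longrightarrow> (\<lambda>x. f x - g x) \<in> L2 M"
  using L2_add[of f M "\<lambda>x. (-1) * g x"] L2_scale[of g M "-1"] by simp

lemma L2_sum [intro]: "(\<And>i. i \<in> I \<Longrightarrow> f i \<in> L2 M) \<Longrightarrow> (\<lambda>x. \<Sum>i\<in>I. f i x) \<in> L2 M"
  by (induction I rule: infinite_finite_induct) auto

lemma L2_cong_AE:
  assumes "f \<in> L2 M" "g \<in> borel_measurable M" "AE x in M. g x = f x" shows "g \<in> L2 M"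
proof (rule L2I[OF assms(2)])
  note [measurable] = L2D(1)[OF assms(1)] assms(2)
  show "integrable M (\<lambda>x. (cmod (g x))\<^sup>2)"
    by (rule integrable_cong_AE_imp[OF L2D(2)[OF assms(1)]]) (use assms(3) in auto)
qed

lemma ip_add_left: "f \<in> L2 M \<Longrightarrow> g \<in> L2 M \<Longrightarrow> h \<in> L2 M \<Longrightarrow> ip M (\<lambda>x. f x + g x) h = ip M f h + ip M g h"
  by (simp add: ip_def distrib_right L2_mult_integrable)

lemma ip_diff_left: "f \<in> L2 M \<Longrightarrow> g \<in> L2 M \<Longrightarrow> h \<in> L2 M \<Longrightarrow> ip M (\<lambda>x. f x - g x) h = ip M f h - ip M g h"
  by (simp add: ip_def left_diff_distrib L2_mult_integrable)

lemma ip_scale_left [simp]: "ip M (\<lambda>x. c * f x) h = c * ip M f h"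
  by (simp add: ip_def mult.assoc)

lemma ip_zero_left [simp]: "ip M (\<lambda>x. 0) h = 0"
  by (simp add: ip_def)

lemma ip_commute: "ip M g f = cnj (ip M f g)"
  unfolding ip_def using Bochner_Integration.integral_cnj[of M "\<lambda>x. f x * cnj (g x)"]
  by (simp add: mult.commute del: integral_cnj)

lemma ip_scale_right [simp]: "ip M h (\<lambda>x. c * f x) = cnj c * ip M h f"
  using ip_commute[of M h "\<lambda>x. c * f x"] ip_commute[of M h f] by simp

lemma ip_diff_right: "f \<in> L2 M \<Longrightarrow> g \<in> L2 M \<Longrightarrow> h \<in> L2 M \<Longrightarrow> ip M h (\<lambda>x. f x - g x) = ip M h f - ip M h g"
  using ip_commute[of M h "\<lambda>x. f x - g x"] ip_commute[of M h f] ip_commute[of M h g] by (simp add: ip_diff_left)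

lemma ip_sum_left:
  "(\<And>i. i \<in> I \<Longrightarrow> f i \<in> L2 M) \<Longrightarrow> h \<in> L2 M \<Longrightarrow> ip M (\<lambda>x. \<Sum>i\<in>I. f i x) h = (\<Sum>i\<in>I. ip M (f i) h)"
proof (induction I rule: infinite_finite_induct)
  case (insert i I)
  then show ?case by (simp add: ip_add_left L2_sum)
qed auto

lemma ip_self: "ip M f f = complex_of_real (nsq M f)"
proof -
  have "ip M f f = (LINT x|M. complex_of_real ((cmod (f x))\<^sup>2))"
    unfolding ip_def by (simp add: complex_norm_square del: of_real_power)
  then show ?thesis by (simp add: nsq_def del: of_real_power)
qed

lemma ip_cong_AE:
  assumes "f \<in> borel_measurable M" "f' \<in> borel_measurable M" "g \<in> borel_measurable M" "g' \<in> borel_measurable M"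
    "AE x in M. f x = f' x" "AE x in M. g x = g' x"
  shows "ip M f g = ip M f' g'"
proof -
  note [measurable] = assms(1-4)
  show ?thesis unfolding ip_def
  proof (rule integral_cong_AE)
    show "AE x in M. f x * cnj (g x) = f' x * cnj (g' x)" using assms(5,6) by eventually_elim simp
  qed measurable
qed

lemma nsq_cong_AE:
  assumes "f \<in> borel_measurable M" "f' \<in> borel_measurable M" "AE x in M. f x = f' x"
  shows "nsq M f = nsq M f'"
  unfolding nsq_def using assms by (intro integral_cong_AE) auto

lemma nsq_scale: "nsq M (\<lambda>x. c * f x) = (cmod c)\<^sup>2 * nsq M f"
  by (simp add: nsq_def norm_mult power_mult_distrib)

lemma nsq_diff_commute: "nsq M (\<lambda>x. f x - g x) = nsq M (\<lambda>x. g x - f x)"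
  by (simp add: nsq_def norm_minus_commute)

lemma nsq_eq_0_iff: "f \<in> L2 M \<Longrightarrow> nsq M f = 0 \<longleftrightarrow> (AE x in M. f x = 0)"
  unfolding nsq_def by (subst integral_nonneg_eq_0_iff_AE) (auto dest: L2D)

lemma nsq_diff:
  assumes "f \<in> L2 M" "g \<in> L2 M"
  shows "nsq M (\<lambda>x. f x - g x) = nsq M f - 2 * Re (ip M f g) + nsq M g"
proof -
  have d: "(\<lambda>x. f x - g x) \<in> L2 M" using assms by auto
  have "complex_of_real (nsq M (\<lambda>x. f x - g x)) = ip M (\<lambda>x. f x - g x) (\<lambda>x. f x - g x)"
    by (rule ip_self[symmetric])
  also have "\<dots> = ip M f f - ip M g f - (ip M f g - ip M g g)"
    using assms d by (simp add: ip_diff_right ip_diff_left)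
  finally have "Re (complex_of_real (nsq M (\<lambda>x. f x - g x))) = Re (ip M f f - ip M g f - (ip M f g - ip M g g))"
    by (rule arg_cong)
  then show ?thesis by (simp add: ip_self ip_commute[of M g f])
qed

lemma Cauchy_Schwarz_integral:
  assumes "f \<in> L2 M" "g \<in> L2 M"
  shows "(LINT x|M. cmod (f x) * cmod (g x))\<^sup>2 \<le> nsq M f * nsq M g"
proof -
  define u v where "u = (\<lambda>x. complex_of_real (cmod (f x)))" and "v = (\<lambda>x. complex_of_real (cmod (g x)))"
  define a b c where "a = nsq M f" and "b = nsq M g" and "c = (LINT x|M. cmod (f x) * cmod (g x))"
  note [measurable] = L2D(1)[OF assms(1)] L2D(1)[OF assms(2)]
  have uv: "u \<in> L2 M" "v \<in> L2 M"
    using assms by (auto simp: u_def v_def L2_def)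
  have n: "nsq M u = a" "nsq M v = b" by (auto simp: u_def v_def nsq_def a_def b_def)
  have i: "ip M u v = of_real c"
    unfolding ip_def u_def v_def c_def by (subst integral_complex_of_real[symmetric]) simp
  have q: "0 \<le> a - 2 * t * c + t\<^sup>2 * b" for t :: real
  proof -
    have "nsq M (\<lambda>x. u x - of_real t * v x) = a - 2 * t * c + t\<^sup>2 * b"
      using uv by (subst nsq_diff) (auto simp: n i nsq_scale)
    then show ?thesis using nsq_nonneg[of M "\<lambda>x. u x - of_real t * v x"] by simp
  qed
  have ab: "0 \<le> a" "0 \<le> b" by (auto simp: a_def b_def)
  show ?thesis
  proof (cases "b = 0")
    case True
    have "c = 0"
    proof (rule ccontr)
      assume "c \<noteq> 0"
      then show False using q[of "(a + 1) / (2 * c)"] True ab by (simp add: field_simps)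
    qed
    then show ?thesis using True by (simp add: a_def b_def c_def)
  next
    case False
    have "0 \<le> a - 2 * (c / b) * c + (c / b)\<^sup>2 * b" by (rule q)
    then have "0 \<le> a - c\<^sup>2 / b" using False by (simp add: power2_eq_square)
    then have "c\<^sup>2 \<le> a * b" using False ab by (simp add: field_simps)
    then show ?thesis by (simp add: a_def b_def c_def)
  qed
qed

lemma Cauchy_Schwarz_ip:
  assumes "f \<in> L2 M" "g \<in> L2 M"
  shows "(cmod (ip M f g))\<^sup>2 \<le> nsq M f * nsq M g"
proof -
  have "cmod (ip M f g) \<le> (LINT x|M. cmod (f x) * cmod (g x))"
    unfolding ip_def by (rule order_trans[OF integral_norm_bound]) (simp add: norm_mult)
  then have "(cmod (ip M f g))\<^sup>2 \<le> (LINT x|M. cmod (f x) * cmod (g x))\<^sup>2"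
    by (intro power_mono) auto
  then show ?thesis using Cauchy_Schwarz_integral[OF assms] by (rule order_trans)
qed

lemma ip_tendsto:
  assumes "\<And>n. u n \<in> L2 M" "f \<in> L2 M" "g \<in> L2 M" "(\<lambda>n. nsq M (\<lambda>x. f x - u n x)) \<longlonglongrightarrow> 0"
  shows "(\<lambda>n. ip M (u n) g) \<longlonglongrightarrow> ip M f g"
proof -
  have "(\<lambda>n. ip M f g - ip M (u n) g) \<longlonglongrightarrow> 0"
  proof (rule Lim_null_comparison)
    show "\<forall>\<^sub>F n in sequentially. norm (ip M f g - ip M (u n) g) \<le> sqrt (nsq M (\<lambda>x. f x - u n x) * nsq M g)"
    proof (rule always_eventually, rule allI)
      fix n
      show "norm (ip M f g - ip M (u n) g) \<le> sqrt (nsq M (\<lambda>x. f x - u n x) * nsq M g)"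
        using Cauchy_Schwarz_ip[of "\<lambda>x. f x - u n x" M g] assms(1)[of n] assms(2,3)
        by (intro real_le_rsqrt) (simp add: ip_diff_left L2_diff)
    qed
    show "(\<lambda>n. sqrt (nsq M (\<lambda>x. f x - u n x) * nsq M g)) \<longlonglongrightarrow> 0"
      using tendsto_real_sqrt[OF tendsto_mult_right[OF assms(4), of "nsq M g"]] by simp
  qed
  from tendsto_diff[OF tendsto_const this, of "ip M f g"] show ?thesis by simp
qed

text \<open>The weighted sum of \<open>2\<^sup>k a\<^sub>k\<^sup>2\<close> has a finite integral, and \<open>2 a\<^sub>k \<le> 2\<^sup>-\<^sup>k + 2\<^sup>k a\<^sub>k\<^sup>2\<close>.\<close>

lemma AE_summable_if_L2_geometric:
  assumes a: "\<And>k. a k \<in> borel_measurable M" "\<And>k x. 0 \<le> a k x"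
    and i: "\<And>k::nat. (\<integral>\<^sup>+x. ennreal ((a k x)\<^sup>2) \<partial>M) \<le> ennreal ((1/4)^k)"
  shows "AE x in M. summable (\<lambda>k. a k x :: real)"
proof -
  note [measurable] = a(1)
  have "(\<integral>\<^sup>+x. (\<Sum>k. ennreal (2^k * (a k x)\<^sup>2)) \<partial>M) = (\<Sum>k. \<integral>\<^sup>+x. ennreal (2^k * (a k x)\<^sup>2) \<partial>M)"
    by (rule nn_integral_suminf) simp
  also have "\<dots> \<le> (\<Sum>k. ennreal ((1/2)^k))"
  proof (rule suminf_le)
    fix k :: nat
    have "(\<integral>\<^sup>+x. ennreal (2^k * (a k x)\<^sup>2) \<partial>M) = ennreal (2^k) * (\<integral>\<^sup>+x. ennreal ((a k x)\<^sup>2) \<partial>M)"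
      by (subst nn_integral_cmult[symmetric]) (auto simp: ennreal_mult)
    also have "\<dots> \<le> ennreal (2^k) * ennreal ((1/4)^k)" by (intro mult_left_mono i) auto
    also have "\<dots> = ennreal ((1/2)^k)"
      by (subst ennreal_mult[symmetric]) (auto simp: power_mult_distrib[symmetric])
    finally show "(\<integral>\<^sup>+x. ennreal (2^k * (a k x)\<^sup>2) \<partial>M) \<le> ennreal ((1/2)^k)" .
  qed auto
  also have "\<dots> < \<infinity>"
    by (subst suminf_ennreal_eq[OF _ geometric_sums[of "1/2::real"]]) auto
  finally have "AE x in M. (\<Sum>k. ennreal (2^k * (a k x)\<^sup>2)) \<noteq> \<infinity>"
    by (intro nn_integral_PInf_AE) auto
  then show ?thesis
  proof eventually_elim
    case (elim x)
    have s: "summable (\<lambda>k. 2^k * (a k x)\<^sup>2)"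
      using elim by (intro summable_suminf_not_top) auto
    have "summable (\<lambda>k. (1/2::real)^k)" by (simp add: summable_geometric)
    then have "summable (\<lambda>k. (1/2)^k + 2^k * (a k x)\<^sup>2)" using s by (rule summable_add)
    then show ?case
    proof (rule summable_comparison_test_ev[rotated], intro always_eventually allI)
      fix k
      have "2 * ((sqrt (1/2))^k * ((sqrt 2)^k * a k x)) \<le> ((sqrt (1/2))^k)\<^sup>2 + ((sqrt 2)^k * a k x)\<^sup>2"
        by (metis mult.assoc sum_squares_bound)
      moreover have "(sqrt (1/2))^k * (sqrt 2)^k = 1" by (simp add: power_mult_distrib[symmetric] real_sqrt_mult[symmetric])
      moreover have "((sqrt (1/2))^k)\<^sup>2 = (1/2)^k" "((sqrt 2)^k)\<^sup>2 = 2^k"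
        by (simp_all only: power_mult[symmetric] mult.commute[of k 2]) (simp_all add: power_mult)
      ultimately have "2 * a k x \<le> (1/2)^k + 2^k * (a k x)\<^sup>2"
        by (simp add: power_mult_distrib mult.assoc[symmetric])
      then show "norm (a k x) \<le> (1/2)^k + 2^k * (a k x)\<^sup>2" using a(2)[of k x] by simp
    qed
  qed
qed

lemma L2_nn: "f \<in> L2 M \<Longrightarrow> (\<integral>\<^sup>+x. ennreal ((cmod (f x))\<^sup>2) \<partial>M) = ennreal (nsq M f)"
  unfolding nsq_def by (rule nn_integral_eq_integral) (auto dest: L2D)

text \<open>Riesz--Fischer: along a rapidly Cauchy subsequence the sum of the consecutive
  differences is finite almost everywhere, and Fatou's lemma turns the pointwise limit into a
  limit in the mean.\<close>

lemma L2_complete: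
  fixes u :: "nat \<Rightarrow> 'a \<Rightarrow> complex"
  assumes u: "\<And>n. u n \<in> L2 M"
    and cau: "\<And>e. e > 0 \<Longrightarrow> \<exists>N. \<forall>m\<ge>N. \<forall>n\<ge>N. nsq M (\<lambda>x. u m x - u n x) \<le> e"
  shows "\<exists>g\<in>L2 M. (\<lambda>n. nsq M (\<lambda>x. g x - u n x)) \<longlonglongrightarrow> 0"
proof -
  note [measurable] = L2D(1)[OF u]
  define N where "N k = (SOME N. \<forall>m\<ge>N. \<forall>n\<ge>N. nsq M (\<lambda>x. u m x - u n x) \<le> (1/4)^k)" for k
  have N: "nsq M (\<lambda>x. u m x - u n x) \<le> (1/4)^k" if "m \<ge> N k" "n \<ge> N k" for m n k
    using someI_ex[OF cau[of "(1/4)^k"]] that unfolding N_def by auto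
  define r where "r k = sum N {..k} + k" for k
  have r: "N k \<le> r k" "r k \<le> r (Suc k)" "k \<le> r k" for k
    unfolding r_def using member_le_sum[of k "{..k}" N] by auto
  have D: "nsq M (\<lambda>x. u (r (Suc k)) x - u (r k) x) \<le> (1/4)^k" for k
    using r[of k] by (intro N) auto
  have "AE x in M. summable (\<lambda>k. cmod (u (r (Suc k)) x - u (r k) x))"
  proof (rule AE_summable_if_L2_geometric)
    show "(\<integral>\<^sup>+x. ennreal ((cmod (u (r (Suc k)) x - u (r k) x))\<^sup>2) \<partial>M) \<le> ennreal ((1/4)^k)" for k
      using D[of k] u by (subst L2_nn) (auto intro!: ennreal_leI)
  qed auto
  then have conv: "AE x in M. convergent (\<lambda>k. u (r k) x)"
  proof eventually_elim
    case (elim x)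
    then have "summable (\<lambda>k. u (r (Suc k)) x - u (r k) x)" by (rule summable_norm_cancel)
    then have "convergent (\<lambda>n. \<Sum>k<n. u (r (Suc k)) x - u (r k) x)"
      by (simp add: summable_iff_convergent)
    then have "convergent (\<lambda>n. u (r n) x - u (r 0) x)"
      by (simp add: sum_lessThan_telescope[of "\<lambda>k. u (r k) x"])
    then have "convergent (\<lambda>n. (u (r n) x - u (r 0) x) + u (r 0) x)"
      by (intro convergent_add convergent_const)
    then show ?case by simp
  qed
  define g where "g x = lim (\<lambda>k. u (r k) x)" for x
  have [measurable]: "g \<in> borel_measurable M" unfolding g_def by simp
  have lim: "AE x in M. (\<lambda>k. u (r k) x) \<longlonglongrightarrow> g x"
    using conv by eventually_elim (simp add: g_def convergent_LIMSEQ_iff)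
  have F: "(\<integral>\<^sup>+x. ennreal ((cmod (g x - u n x))\<^sup>2) \<partial>M) \<le> ennreal e"
    if e: "e > 0" and n: "\<forall>m\<ge>n. nsq M (\<lambda>x. u m x - u n x) \<le> e" for e n
  proof -
    have "(\<integral>\<^sup>+x. ennreal ((cmod (g x - u n x))\<^sup>2) \<partial>M)
        = (\<integral>\<^sup>+x. liminf (\<lambda>k. ennreal ((cmod (u (r k) x - u n x))\<^sup>2)) \<partial>M)"
    proof (rule nn_integral_cong_AE)
      show "AE x in M. ennreal ((cmod (g x - u n x))\<^sup>2) = liminf (\<lambda>k. ennreal ((cmod (u (r k) x - u n x))\<^sup>2))"
        using lim
      proof eventually_elim
        case (elim x)
        have "(\<lambda>k. ennreal ((cmod (u (r k) x - u n x))\<^sup>2)) \<longlonglongrightarrow> ennreal ((cmod (g x - u n x))\<^sup>2)"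
          by (intro tendsto_ennrealI tendsto_power tendsto_norm tendsto_diff elim tendsto_const)
        then show ?case by (intro lim_imp_Liminf[symmetric]) auto
      qed
    qed
    also have "\<dots> \<le> liminf (\<lambda>k. \<integral>\<^sup>+x. ennreal ((cmod (u (r k) x - u n x))\<^sup>2) \<partial>M)"
      by (rule nn_integral_liminf) simp
    also have "\<dots> \<le> ennreal e"
    proof (rule Liminf_le)
      have "\<forall>k\<ge>n. (\<integral>\<^sup>+x. ennreal ((cmod (u (r k) x - u n x))\<^sup>2) \<partial>M) \<le> ennreal e"
      proof (intro allI impI)
        fix k assume "k \<ge> n"
        then have "r k \<ge> n" using r(3)[of k] by simp
        then show "(\<integral>\<^sup>+x. ennreal ((cmod (u (r k) x - u n x))\<^sup>2) \<partial>M) \<le> ennreal e"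
          using u n e by (subst L2_nn) (auto intro!: ennreal_leI)
      qed
      then show "\<forall>\<^sub>F k in sequentially. (\<integral>\<^sup>+x. ennreal ((cmod (u (r k) x - u n x))\<^sup>2) \<partial>M) \<le> ennreal e"
        by (auto simp: eventually_sequentially)
    qed auto
    finally show ?thesis .
  qed
  have G: "(\<lambda>x. g x - u n x) \<in> L2 M \<and> nsq M (\<lambda>x. g x - u n x) \<le> e"
    if e: "e > 0" and n: "\<forall>m\<ge>n. nsq M (\<lambda>x. u m x - u n x) \<le> e" for e n
  proof
    have "(\<integral>\<^sup>+x. ennreal ((cmod (g x - u n x))\<^sup>2) \<partial>M) < \<infinity>"
      using F[OF that] by (rule le_less_trans) simp
    then show L: "(\<lambda>x. g x - u n x) \<in> L2 M"
      by (intro L2I) (auto simp: integrable_iff_bounded)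
    show "nsq M (\<lambda>x. g x - u n x) \<le> e" using F[OF that] e unfolding L2_nn[OF L] by simp
  qed
  have g: "g \<in> L2 M"
  proof -
    obtain n where "\<forall>m\<ge>n. nsq M (\<lambda>x. u m x - u n x) \<le> 1" using cau[of 1] by auto
    then have "(\<lambda>x. g x - u n x) \<in> L2 M" using G[of 1 n] by auto
    from L2_add[OF this u[of n]] show ?thesis by simp
  qed
  moreover have "(\<lambda>n. nsq M (\<lambda>x. g x - u n x)) \<longlonglongrightarrow> 0"
  proof (rule LIMSEQ_I)
    fix e :: real assume "e > 0"
    then obtain N where N: "\<forall>m\<ge>N. \<forall>n\<ge>N. nsq M (\<lambda>x. u m x - u n x) \<le> e / 2"
      using cau[of "e/2"] by auto
    show "\<exists>no. \<forall>n\<ge>no. norm (nsq M (\<lambda>x. g x - u n x) - 0) < e"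
    proof (intro exI[of _ N] allI impI)
      fix n assume "n \<ge> N"
      then have "nsq M (\<lambda>x. g x - u n x) \<le> e / 2" using N \<open>e > 0\<close> by (intro G[THEN conjunct2]) auto
      then show "norm (nsq M (\<lambda>x. g x - u n x) - 0) < e" using \<open>e > 0\<close> by simp
    qed
  qed
  ultimately show ?thesis by auto
qed

locale orthonormal =
  fixes M :: "'a measure" and e :: "nat \<Rightarrow> 'a \<Rightarrow> complex"
  assumes e_L2: "e n \<in> L2 M"
    and ortho: "ip M (e m) (e n) = of_bool (m = n)"
begin

definition psum :: "(nat \<Rightarrow> complex) \<Rightarrow> nat \<Rightarrow> 'a \<Rightarrow> complex" where
  "psum c N x = (\<Sum>n<N. c n * e n x)"

lemma psum_L2 [intro]: "psum c N \<in> L2 M"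
  unfolding psum_def using e_L2 by (intro L2_sum L2_scale) auto

lemma ip_psum_left: "g \<in> L2 M \<Longrightarrow> ip M (psum c N) g = (\<Sum>n<N. c n * ip M (e n) g)"
  unfolding psum_def using e_L2 by (subst ip_sum_left) auto

lemma ip_psum: "ip M (psum c N) (e m) = (if m < N then c m else 0)"
  by (simp add: ip_psum_left e_L2 ortho of_bool_def if_distrib cong: if_cong)

lemma nsq_diff_psum:
  assumes "f \<in> L2 M"
  shows "nsq M (\<lambda>x. f x - psum (\<lambda>n. ip M f (e n)) N x) = nsq M f - (\<Sum>n<N. (cmod (ip M f (e n)))\<^sup>2)"
proof -
  let ?p = "psum (\<lambda>n. ip M f (e n)) N"
  have "ip M ?p ?p = (\<Sum>n<N. ip M f (e n) * cnj (ip M ?p (e n)))"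
    by (subst ip_psum_left[OF psum_L2]) (simp add: ip_commute[of M "e _"])
  also have "\<dots> = complex_of_real (\<Sum>n<N. (cmod (ip M f (e n)))\<^sup>2)"
    by (simp add: ip_psum complex_norm_square del: of_real_power)
  finally have 1: "nsq M ?p = (\<Sum>n<N. (cmod (ip M f (e n)))\<^sup>2)"
    unfolding ip_self by (simp only: of_real_eq_iff)
  have "ip M ?p f = complex_of_real (\<Sum>n<N. (cmod (ip M f (e n)))\<^sup>2)"
    using assms by (simp add: ip_psum_left ip_commute[of M "e _" f] complex_norm_square del: of_real_power)
  then have "Re (ip M f ?p) = (\<Sum>n<N. (cmod (ip M f (e n)))\<^sup>2)"
    by (subst ip_commute) (simp del: of_real_sum)
  then show ?thesis using assms 1 by (simp add: nsq_diff psum_L2)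
qed

lemma Bessel: "f \<in> L2 M \<Longrightarrow> (\<Sum>n<N. (cmod (ip M f (e n)))\<^sup>2) \<le> nsq M f"
  using nsq_diff_psum[of f N] nsq_nonneg[of M "\<lambda>x. f x - psum (\<lambda>n. ip M f (e n)) N x"] by simp

lemma psum_diff: "m \<le> n \<Longrightarrow> psum c n x - psum c m x = psum (\<lambda>i. if m \<le> i then c i else 0) n x"
proof -
  assume "m \<le> n"
  then have "{..<n} - {..<m} = {..<n} \<inter> {i. m \<le> i}" and "{..<m} \<subseteq> {..<n}" by auto
  then show ?thesis
    unfolding psum_def by (simp add: sum_diff[symmetric] if_distrib[of "\<lambda>c. c * _"] sum.If_cases)
qed

lemma nsq_psum: "nsq M (psum c N) = (\<Sum>n<N. (cmod (c n))\<^sup>2)"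
proof -
  have "ip M (psum c N) (psum c N) = (\<Sum>n<N. c n * cnj (ip M (psum c N) (e n)))"
    by (subst ip_psum_left[OF psum_L2]) (simp add: ip_commute[of M "e _"])
  also have "\<dots> = complex_of_real (\<Sum>n<N. (cmod (c n))\<^sup>2)"
    by (simp add: ip_psum complex_norm_square del: of_real_power)
  finally show ?thesis unfolding ip_self by (simp only: of_real_eq_iff)
qed

lemma Riesz_Fischer:
  assumes "summable (\<lambda>n. (cmod (c n))\<^sup>2)"
  obtains g where "g \<in> L2 M" "\<And>n. ip M g (e n) = c n" "(\<lambda>N. nsq M (\<lambda>x. g x - psum c N x)) \<longlonglongrightarrow> 0"
proof -
  have E: "nsq M (\<lambda>x. psum c n x - psum c m x) = (\<Sum>i=m..<n. (cmod (c i))\<^sup>2)" if "m \<le> n" for m n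
  proof -
    have "{..<n} \<inter> {i. m \<le> i} = {m..<n}" using that by auto
    then show ?thesis
      using that by (simp add: psum_diff nsq_psum if_distrib[of cmod] if_distrib[of "\<lambda>x. x\<^sup>2"] sum.If_cases cong: if_cong)
  qed
  have "\<exists>g\<in>L2 M. (\<lambda>N. nsq M (\<lambda>x. g x - psum c N x)) \<longlonglongrightarrow> 0"
  proof (rule L2_complete)
    fix d :: real assume "d > 0"
    then obtain N where N: "\<And>m n. m \<ge> N \<Longrightarrow> norm (\<Sum>i=m..<n. (cmod (c i))\<^sup>2) < d"
      using assms unfolding summable_Cauchy by blast
    have *: "nsq M (\<lambda>x. psum c n x - psum c m x) \<le> d" if "m \<ge> N" "m \<le> n" for m n
      using N[of m n] that by (simp add: E)
    show "\<exists>N. \<forall>m\<ge>N. \<forall>n\<ge>N. nsq M (\<lambda>x. psum c m x - psum c n x) \<le> d"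
    proof (intro exI[of _ N] allI impI)
      fix m n assume "m \<ge> N" "n \<ge> N"
      then show "nsq M (\<lambda>x. psum c m x - psum c n x) \<le> d"
        using *[of m n] *[of n m] nsq_diff_commute[of M "psum c m" "psum c n"] by (cases "m \<le> n") auto
    qed
  qed auto
  then obtain g where g: "g \<in> L2 M" "(\<lambda>N. nsq M (\<lambda>x. g x - psum c N x)) \<longlonglongrightarrow> 0" by auto
  have "ip M g (e n) = c n" for n
  proof (rule LIMSEQ_unique[OF ip_tendsto[OF _ g(1) e_L2 g(2)]])
    show "(\<lambda>N. ip M (psum c N) (e n)) \<longlonglongrightarrow> c n"
      by (rule tendsto_eventually) (auto simp: ip_psum eventually_sequentially intro!: exI[of _ "Suc n"])
  qed auto
  with g that show ?thesis by blast
qed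

end

locale orthonormal_basis = orthonormal +
  assumes total: "f \<in> L2 M \<Longrightarrow> (\<And>n. ip M f (e n) = 0) \<Longrightarrow> AE x in M. f x = 0"
begin

lemma expansion:
  assumes f: "f \<in> L2 M"
  shows "(\<lambda>N. nsq M (\<lambda>x. f x - psum (\<lambda>n. ip M f (e n)) N x)) \<longlonglongrightarrow> 0"
proof -
  have "summable (\<lambda>n. (cmod (ip M f (e n)))\<^sup>2)"
    using Bessel[OF f] by (intro summableI_nonneg_bounded) auto
  then obtain g where g: "g \<in> L2 M" "\<And>n. ip M g (e n) = ip M f (e n)"
    "(\<lambda>N. nsq M (\<lambda>x. g x - psum (\<lambda>n. ip M f (e n)) N x)) \<longlonglongrightarrow> 0"
    by (rule Riesz_Fischer) blast
  have ae: "AE x in M. f x - g x = 0"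
    using f g(1,2) by (intro total) (auto simp: ip_diff_left e_L2)
  have "nsq M (\<lambda>x. g x - psum (\<lambda>n. ip M f (e n)) N x) = nsq M (\<lambda>x. f x - psum (\<lambda>n. ip M f (e n)) N x)" for N
    using ae L2_diff[OF f psum_L2] L2_diff[OF g(1) psum_L2] by (intro nsq_cong_AE) (auto simp: L2_def)
  with g(3) show ?thesis by simp
qed

lemma Parseval:
  assumes f: "f \<in> L2 M"
  shows "(\<lambda>n. (cmod (ip M f (e n)))\<^sup>2) sums nsq M f"
proof -
  have "(\<lambda>N. nsq M f - (\<Sum>n<N. (cmod (ip M f (e n)))\<^sup>2)) \<longlonglongrightarrow> 0"
    using expansion[OF f] by (simp add: nsq_diff_psum[OF f])
  from tendsto_diff[OF tendsto_const this, of "nsq M f"] show ?thesis by (simp add: sums_def)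
qed

lemma Parseval_ip:
  assumes f: "f \<in> L2 M" and g: "g \<in> L2 M"
  shows "(\<lambda>n. ip M f (e n) * cnj (ip M g (e n))) sums ip M f g"
  using ip_tendsto[OF psum_L2 f g expansion[OF f]] g
  by (simp add: sums_def ip_psum_left ip_commute[of M "e _" g])

end

section \<open>Test functions and the fundamental lemma\<close>

text \<open>The positive and the negative part of the function are densities of finite measures that agree on
  all half-lines, so the measures coincide.\<close>

lemma AE_zero_if_tail_integrals_zero:
  fixes H :: "real \<Rightarrow> real"
  assumes H: "integrable lebesgue H"
    and 0: "\<And>x. (LINT t|lebesgue. indicator {x<..} t * H t) = 0"
  shows "AE t in lebesgue. H t = 0"
proof -
  obtain G where G[measurable]: "G \<in> borel_measurable lborel" and HG: "AE t in lborel. H t = G t"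
    using completion_ex_borel_measurable_real[of H lborel] H by auto
  have HG': "AE t in lebesgue. H t = G t" using HG by (rule AE_completion)
  have Gm[measurable]: "G \<in> borel_measurable borel" using G by simp
  have Gl: "G \<in> borel_measurable lebesgue" using G by (rule measurable_completion)
  have "integrable lebesgue G"
    by (rule integrable_cong_AE_imp[OF H Gl]) (use HG' in eventually_elim, simp)
  then have Gi: "integrable lborel G" by (simp add: integrable_completion)
  have z: "(LINT t|lborel. indicator {x<..} t * G t) = 0" for x
  proof -
    have "(LINT t|lborel. indicator {x<..} t * G t) = (LINT t|lebesgue. indicator {x<..} t * G t)"
      by (rule integral_completion[symmetric]) simp
    also have "\<dots> = (LINT t|lebesgue. indicator {x<..} t * H t)"
    proof (rule integral_cong_AE)
      show "(\<lambda>t. indicator {x<..} t * G t) \<in> borel_measurable lebesgue"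
        by (rule measurable_completion) simp
      show "(\<lambda>t. indicator {x<..} t * H t) \<in> borel_measurable lebesgue"
        using H by (intro borel_measurable_times borel_measurable_indicator) auto
      show "AE t in lebesgue. indicator {x<..} t * G t = indicator {x<..} t * H t"
        using HG' by eventually_elim simp
    qed
    finally show ?thesis using 0 by simp
  qed
  define P N where "P t = ennreal (max 0 (G t))" and "N t = ennreal (max 0 (- G t))" for t
  have [measurable]: "P \<in> borel_measurable borel" "N \<in> borel_measurable borel"
    unfolding P_def N_def by auto
  have im: "integrable lborel (\<lambda>t. indicator {x<..} t * max 0 (s * G t))" for x s
    by (rule Bochner_Integration.integrable_bound[OF integrable_mult_right[OF Gi, of s]])
      (auto intro!: AE_I2 simp: indicator_def)
  have em: "emeasure (density lborel (\<lambda>t. ennreal (max 0 (s * G t)))) {x<..}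
      = ennreal (LINT t|lborel. indicator {x<..} t * max 0 (s * G t))" for x s
  proof -
    have "emeasure (density lborel (\<lambda>t. ennreal (max 0 (s * G t)))) {x<..}
        = (\<integral>\<^sup>+t. ennreal (indicator {x<..} t * max 0 (s * G t)) \<partial>lborel)"
      by (subst emeasure_density) (auto intro!: nn_integral_cong simp: indicator_def)
    also have "\<dots> = ennreal (LINT t|lborel. indicator {x<..} t * max 0 (s * G t))"
      by (rule nn_integral_eq_integral[OF im]) (auto intro!: AE_I2 simp: indicator_def)
    finally show ?thesis .
  qed
  have "density lborel P = density lborel N"
  proof (rule measure_eqI_lessThan)
    fix x
    have "(LINT t|lborel. indicator {x<..} t * max 0 (1 * G t)) - (LINT t|lborel. indicator {x<..} t * max 0 ((-1) * G t))
       = (LINT t|lborel. indicator {x<..} t * G t)"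
      by (subst Bochner_Integration.integral_diff[symmetric, OF im im])
        (auto intro!: Bochner_Integration.integral_cong simp: indicator_def max_def)
    then show "emeasure (density lborel P) {x<..} = emeasure (density lborel N) {x<..}"
      using em[of 1 x] em[of "-1" x] z[of x] by (simp add: P_def[abs_def] N_def[abs_def])
    show "emeasure (density lborel P) {x<..} < \<infinity>"
      using em[of 1 x] by (simp add: P_def[abs_def])
  qed auto
  moreover have "integral\<^sup>N lborel P \<noteq> \<infinity>"
  proof -
    have "integrable lborel (\<lambda>t. max 0 (G t))" using Gi by simp
    then show ?thesis unfolding P_def by (subst nn_integral_eq_integral) auto
  qed
  ultimately have "AE t in lborel. P t = N t"
    by (subst (asm) finite_density_unique) auto
  then have "AE t in lborel. H t = 0"
    using HG by eventually_elim (auto simp: P_def N_def max_def split: if_splits)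
  then show ?thesis by (rule AE_completion)
qed

text \<open>After extension by zero, the integral over a half-line is a limit of integrals over intervals
  inside \<open>{a<..<b}\<close>.\<close>

lemma AE_zero_if_interval_integrals_zero_integrable:
  fixes h :: "real \<Rightarrow> complex"
  assumes h: "integrable (lebesgue_on {a<..<b}) h"
    and 0: "\<And>p q. a < p \<Longrightarrow> p < q \<Longrightarrow> q < b \<Longrightarrow> (LINT x|lebesgue_on {p<..<q}. h x) = 0"
  shows "AE x in lebesgue_on {a<..<b}. h x = 0"
proof -
  define H where "H x = (if x \<in> {a<..<b} then h x else 0)" for x
  have H: "integrable lebesgue H"
    unfolding H_def using h by (subst Lebesgue_Measure.integrable_restrict_UNIV) auto
  have Z: "(LINT t|lebesgue. indicator {x<..} t *\<^sub>R H t) = 0" for x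
  proof (cases "max x a < b")
    case False
    then have "indicator {x<..} t *\<^sub>R H t = 0" for t by (auto simp: H_def indicator_def)
    then have "(\<lambda>t. indicator {x<..} t *\<^sub>R H t) = (\<lambda>t. 0)" by (rule ext)
    then show ?thesis by simp
  next
    case True
    define m where "m = max x a"
    have m: "m < b" using True by (simp add: m_def)
    define p q where "p n = m + (b - m) / (real n + 3)" and "q n = b - (b - m) / (real n + 3)" for n
    have pq: "m < p n" "p n < q n" "q n < b" for n
    proof -
      define d where "d = (b - m) / (real n + 3)"
      have "d \<le> (b - m) / 3" unfolding d_def using m by (intro divide_left_mono) auto
      moreover have "0 < d" using m by (simp add: d_def)
      ultimately show "m < p n" "p n < q n" "q n < b"
        using m unfolding p_def q_def d_def[symmetric] by (auto simp: field_simps)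
    qed
    have lim: "p \<longlonglongrightarrow> m" "q \<longlonglongrightarrow> b"
      unfolding p_def q_def by real_asymp+
    have "(\<lambda>n. LINT t|lebesgue. indicator {p n<..<q n} t *\<^sub>R H t) \<longlonglongrightarrow> (LINT t|lebesgue. indicator {x<..} t *\<^sub>R H t)"
    proof (rule integral_dominated_convergence[where w="\<lambda>t. norm (H t)"])
      show "AE t in lebesgue. (\<lambda>n. indicator {p n<..<q n} t *\<^sub>R H t) \<longlonglongrightarrow> indicator {x<..} t *\<^sub>R H t"
      proof (rule AE_I2)
        fix t
        show "(\<lambda>n. indicator {p n<..<q n} t *\<^sub>R H t) \<longlonglongrightarrow> indicator {x<..} t *\<^sub>R H t"
        proof (cases "t \<in> {m<..<b}")
          case True
          then have "\<forall>\<^sub>F n in sequentially. p n < t" "\<forall>\<^sub>F n in sequentially. t < q n"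
            using order_tendstoD[OF lim(1)] order_tendstoD[OF lim(2)] by auto
          then have "\<forall>\<^sub>F n in sequentially. indicator {p n<..<q n} t *\<^sub>R H t = indicator {x<..} t *\<^sub>R H t"
            by eventually_elim (use True in \<open>auto simp: indicator_def m_def\<close>)
          then show ?thesis by (rule tendsto_eventually)
        next
          case False
          then have "indicator {p n<..<q n} t *\<^sub>R H t = 0" for n
            using pq[of n] by (auto simp: indicator_def)
          moreover have "indicator {x<..} t *\<^sub>R H t = 0"
            using False by (auto simp: indicator_def H_def m_def)
          ultimately show ?thesis by (simp only: tendsto_const)
        qed
      qed
      have [measurable]: "H \<in> borel_measurable lebesgue" using H by auto
      show "(\<lambda>t. indicator {x<..} t *\<^sub>R H t) \<in> borel_measurable lebesgue"
        "(\<lambda>t. indicator {p n<..<q n} t *\<^sub>R H t) \<in> borel_measurable lebesgue" for n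
        by (rule borel_measurable_scaleR[OF borel_measurable_indicator]; simp)+
      show "integrable lebesgue (\<lambda>t. norm (H t))" using H by simp
      show "AE t in lebesgue. norm (indicator {p n<..<q n} t *\<^sub>R H t) \<le> norm (H t)" for n
        by (rule AE_I2) (auto simp: indicator_def)
    qed
    moreover have "(LINT t|lebesgue. indicator {p n<..<q n} t *\<^sub>R H t) = 0" for n
    proof -
      have "(LINT t|lebesgue. indicator {p n<..<q n} t *\<^sub>R H t)
          = (LINT t|lebesgue. (if t \<in> {p n<..<q n} then h t else 0))"
        using pq[of n] m_def by (intro Bochner_Integration.integral_cong) (auto simp: indicator_def H_def)
      also have "\<dots> = (LINT t|lebesgue_on {p n<..<q n}. h t)"
        by (rule Lebesgue_Measure.integral_restrict_UNIV) auto
      also have "\<dots> = 0" using pq[of n] m_def by (intro 0) auto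
      finally show ?thesis .
    qed
    ultimately show ?thesis by (simp add: LIMSEQ_const_iff)
  qed
  have *: "integrable lebesgue (\<lambda>t. indicator {x<..} t *\<^sub>R H t)" for x
    using H by (intro integrable_mult_indicator) auto
  have "AE t in lebesgue. Re (H t) = 0"
  proof (rule AE_zero_if_tail_integrals_zero)
    show "(LINT t|lebesgue. indicator {x<..} t * Re (H t)) = 0" for x
      using integral_Re[OF *[of x]] Z[of x] by simp
  qed (use H in auto)
  moreover have "AE t in lebesgue. Im (H t) = 0"
  proof (rule AE_zero_if_tail_integrals_zero)
    show "(LINT t|lebesgue. indicator {x<..} t * Im (H t)) = 0" for x
      using integral_Im[OF *[of x]] Z[of x] by simp
  qed (use H in auto)
  ultimately have "AE t in lebesgue. t \<in> {a<..<b} \<longrightarrow> h t = 0"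
    by eventually_elim (auto simp: H_def complex_eq_iff)
  then show ?thesis by (subst AE_restrict_space_iff) auto
qed

definition L1_loc :: "real \<Rightarrow> real \<Rightarrow> (real \<Rightarrow> complex) \<Rightarrow> bool" where
  "L1_loc a b h \<longleftrightarrow> (\<forall>p q. a < p \<and> q < b \<longrightarrow> integrable (lebesgue_on {p..q}) h)"

lemma integrable_lebesgue_on_subset:
  fixes h :: "real \<Rightarrow> 'b::euclidean_space"
  assumes "integrable (lebesgue_on S) h" "S' \<subseteq> S" "S \<in> sets lebesgue" "S' \<in> sets lebesgue"
  shows "integrable (lebesgue_on S') h"
proof -
  have "integrable lebesgue (\<lambda>x. indicator S x *\<^sub>R h x)"
    using assms(1) integrable_restrict_space[of S lebesgue h] assms(3) by simp
  then have "integrable lebesgue (\<lambda>x. indicator S' x *\<^sub>R indicator S x *\<^sub>R h x)"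
    using assms(4) by (rule integrable_mult_indicator[rotated])
  also have "(\<lambda>x. indicator S' x *\<^sub>R indicator S x *\<^sub>R h x) = (\<lambda>x. indicator S' x *\<^sub>R h x)"
    using assms by (auto simp: indicator_def fun_eq_iff)
  finally show ?thesis using assms by (subst integrable_restrict_space) auto
qed

lemma AE_zero_if_interval_integrals_zero:
  assumes h: "L1_loc a b h"
    and 0: "\<And>p q. a < p \<Longrightarrow> p < q \<Longrightarrow> q < b \<Longrightarrow> (LINT x|lebesgue_on {p<..<q}. h x) = 0"
  shows "AE x in lebesgue_on {a<..<b}. h x = 0"
proof -
  define p q where "p n = a + (b - a) / (real n + 3)" and "q n = b - (b - a) / (real n + 3)" for n
  have "AE x in lebesgue. x \<in> {a<..<b} \<longrightarrow> h x = 0"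
  proof (cases "a < b")
    case True
    have pq: "a < p n" "q n < b" for n
      using True by (auto simp: p_def q_def)
    have lim: "p \<longlonglongrightarrow> a" "q \<longlonglongrightarrow> b"
      unfolding p_def q_def by real_asymp+
    have "AE x in lebesgue. x \<in> {p n<..<q n} \<longrightarrow> h x = 0" for n
    proof -
      have "integrable (lebesgue_on {p n..q n}) h" using h pq[of n] by (auto simp: L1_loc_def)
      then have "integrable (lebesgue_on {p n<..<q n}) h"
        by (rule integrable_lebesgue_on_subset) auto
      then have "AE x in lebesgue_on {p n<..<q n}. h x = 0"
        by (rule AE_zero_if_interval_integrals_zero_integrable) (use pq[of n] in \<open>auto intro!: 0\<close>)
      then show ?thesis by (subst (asm) AE_restrict_space_iff) auto
    qed
    then have "AE x in lebesgue. \<forall>n. x \<in> {p n<..<q n} \<longrightarrow> h x = 0"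
      by (subst AE_all_countable) blast
    then show ?thesis
    proof eventually_elim
      case (elim x)
      show ?case
      proof
        assume x: "x \<in> {a<..<b}"
        then have "\<forall>\<^sub>F n in sequentially. p n < x" "\<forall>\<^sub>F n in sequentially. x < q n"
          using order_tendstoD[OF lim(1)] order_tendstoD[OF lim(2)] by auto
        then have "\<forall>\<^sub>F n in sequentially. x \<in> {p n<..<q n}" by eventually_elim auto
        then obtain n where "x \<in> {p n<..<q n}" by (auto simp: eventually_sequentially)
        then show "h x = 0" using elim by auto
      qed
    qed
  qed auto
  then show ?thesis by (subst AE_restrict_space_iff) auto
qed

subsection \<open>Smooth functions\<close>

definition smooth :: "(real \<Rightarrow> real) \<Rightarrow> bool" where
  "smooth f \<longleftrightarrow> (\<forall>k x. ((deriv ^^ k) f) differentiable (at x))"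

text \<open>Smoothness is the largest predicate that implies differentiability and is inherited by the
  derivative. This replaces inductions on the order of the derivative.\<close>

lemma smooth_coinduct:
  assumes "f \<in> X" and X: "\<And>g x. g \<in> X \<Longrightarrow> g differentiable (at x)" "\<And>g. g \<in> X \<Longrightarrow> deriv g \<in> X"
  shows "smooth f"
proof -
  have "(deriv ^^ k) f \<in> X" for k using assms(1) X(2) by (induction k) auto
  then show ?thesis using X(1) by (auto simp: smooth_def)
qed

lemma smooth_differentiable: "smooth f \<Longrightarrow> f differentiable (at x)"
  unfolding smooth_def by (metis funpow_0)

lemma smooth_DERIV: "smooth f \<Longrightarrow> (f has_real_derivative deriv f x) (at x)"
  using smooth_differentiable[of f x] by (simp add: DERIV_deriv_iff_real_differentiable)

lemma smooth_deriv [intro]: "smooth f \<Longrightarrow> smooth (deriv f)"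
  unfolding smooth_def by (metis comp_apply funpow_Suc_right)

lemma smooth_continuous: "smooth f \<Longrightarrow> continuous_on S f"
  using smooth_DERIV by (meson DERIV_continuous_on has_field_derivative_at_within)

lemma smooth_affine [intro]: "smooth f \<Longrightarrow> smooth (\<lambda>x. k * f (c * x + d))"
proof (rule smooth_coinduct[where X="{(\<lambda>x. k * f (c * x + d)) | k f. smooth f}"])
  have D: "((\<lambda>x. k * f (c * x + d)) has_real_derivative (k * c) * deriv f (c * x + d)) (at x)" if "smooth f" for f k x
  proof -
    have "((\<lambda>x. c * x + d) has_real_derivative c) (at x)" by (auto intro!: derivative_eq_intros)
    from DERIV_cmult[OF DERIV_chain2[OF smooth_DERIV[OF that] this], of k]
    show ?thesis by (simp add: algebra_simps)
  qed
  fix g x assume "g \<in> {(\<lambda>x. k * f (c * x + d)) | k f. smooth f}"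
  then obtain k f where g: "g = (\<lambda>x. k * f (c * x + d))" "smooth f" by auto
  then show "g differentiable (at x)" using D[of f k x] real_differentiable_def by blast
  have "deriv g = (\<lambda>x. (k * c) * deriv f (c * x + d))"
    unfolding g by (rule ext, rule DERIV_imp_deriv, rule D[OF g(2)])
  then show "deriv g \<in> {(\<lambda>x. k * f (c * x + d)) | k f. smooth f}" using g(2) by blast
qed auto

text \<open>Sums of products of smooth functions are closed under differentiation, so the first-order product
  rule implies that products are smooth.\<close>

inductive_set smooth_products :: "(real \<Rightarrow> real) set" where
  prod: "smooth f \<Longrightarrow> smooth g \<Longrightarrow> (\<lambda>x. f x * g x) \<in> smooth_products"
| add: "f \<in> smooth_products \<Longrightarrow> g \<in> smooth_products \<Longrightarrow> (\<lambda>x. f x + g x) \<in> smooth_products"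

lemma smooth_products_DERIV:
  "h \<in> smooth_products \<Longrightarrow> \<exists>h'\<in>smooth_products. \<forall>x. (h has_real_derivative h' x) (at x)"
proof (induction rule: smooth_products.induct)
  case (prod f g)
  have "\<forall>x. ((\<lambda>x. f x * g x) has_real_derivative deriv f x * g x + deriv g x * f x) (at x)"
    using prod by (auto intro!: DERIV_mult smooth_DERIV)
  moreover have "(\<lambda>x. deriv f x * g x + deriv g x * f x) \<in> smooth_products"
    using prod by (intro smooth_products.intros) auto
  ultimately show ?case by (intro bexI[of _ "\<lambda>x. deriv f x * g x + deriv g x * f x"])
next
  case (add f g)
  then obtain f' g' where "f' \<in> smooth_products" "g' \<in> smooth_products"
    "\<forall>x. (f has_real_derivative f' x) (at x)" "\<forall>x. (g has_real_derivative g' x) (at x)" by auto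
  then show ?case by (intro bexI[of _ "\<lambda>x. f' x + g' x"]) (auto intro: DERIV_add smooth_products.add)
qed

lemma smooth_products_smooth: "h \<in> smooth_products \<Longrightarrow> smooth h"
proof (rule smooth_coinduct[where X=smooth_products])
  fix g x assume "g \<in> smooth_products"
  from smooth_products_DERIV[OF this] obtain g' where g: "g' \<in> smooth_products"
    "\<And>x. (g has_real_derivative g' x) (at x)" by auto
  then show "g differentiable (at x)" using real_differentiable_def by blast
  have "deriv g = g'" by (rule ext, rule DERIV_imp_deriv, rule g(2))
  then show "deriv g \<in> smooth_products" using g by simp
qed auto

lemma smooth_const [simp]: "smooth (\<lambda>x. c)"
  by (rule smooth_coinduct[where X="range (\<lambda>c x. c)"]) auto

lemma smooth_mult [intro]: "smooth f \<Longrightarrow> smooth g \<Longrightarrow> smooth (\<lambda>x. f x * g x)"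
  by (rule smooth_products_smooth[OF smooth_products.prod])

lemma smooth_add [intro]: "smooth f \<Longrightarrow> smooth g \<Longrightarrow> smooth (\<lambda>x. f x + g x)"
  using smooth_products_smooth[OF smooth_products.add[OF smooth_products.prod[of "\<lambda>x. 1" f] smooth_products.prod[of "\<lambda>x. 1" g]]]
  by simp

lemma smooth_diff [intro]: "smooth f \<Longrightarrow> smooth g \<Longrightarrow> smooth (\<lambda>x. f x - g x)"
  using smooth_add[of f "\<lambda>x. (-1) * g x"] smooth_mult[of "\<lambda>x. -1" g] by simp

lemma smooth_antiderivative:
  assumes F: "\<And>x. (F has_real_derivative f x) (at x)" and f: "smooth f"
  shows "smooth F"
  unfolding smooth_def
proof (intro allI)
  fix k x
  have d: "deriv F = f" by (rule ext, rule DERIV_imp_deriv, rule F)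
  show "(deriv ^^ k) F differentiable (at x)"
  proof (cases k)
    case 0 then show ?thesis using F real_differentiable_def by auto
  next
    case (Suc j)
    then have "(deriv ^^ k) F = (deriv ^^ j) f" by (simp add: funpow_Suc_right d del: funpow.simps)
    then show ?thesis using f by (simp add: smooth_def)
  qed
qed

lemma smooth_trig: "smooth (\<lambda>x. a * cos (c * x) + b * sin (c * x))"
proof (rule smooth_coinduct[where X="{(\<lambda>x. a * cos (c * x) + b * sin (c * x)) | a b. True}"])
  have D: "((\<lambda>x. a * cos (c * x) + b * sin (c * x)) has_real_derivative (b * c) * cos (c * x) + (- a * c) * sin (c * x)) (at x)" for a b x
    by (auto intro!: derivative_eq_intros)
  fix g x assume "g \<in> {(\<lambda>x. a * cos (c * x) + b * sin (c * x)) | a b. True}"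
  then obtain a b where g: "g = (\<lambda>x. a * cos (c * x) + b * sin (c * x))" by auto
  then show "g differentiable (at x)" using D[of a b x] real_differentiable_def by blast
  have "deriv g = (\<lambda>x. (b * c) * cos (c * x) + (- a * c) * sin (c * x))"
    unfolding g by (rule ext, rule DERIV_imp_deriv, rule D)
  then show "deriv g \<in> {(\<lambda>x. a * cos (c * x) + b * sin (c * x)) | a b. True}" by blast
qed auto

lemma poly_exp_decay: "((\<lambda>y::real. poly p y * exp (- y)) \<longlongrightarrow> 0) at_top"
proof -
  have "((\<lambda>y. \<Sum>i\<le>degree p. coeff p i * (y ^ i / exp y)) \<longlongrightarrow> (\<Sum>i\<le>degree p. coeff p i * 0)) at_top"
    by (intro tendsto_sum tendsto_mult tendsto_const tendsto_power_div_exp_0)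
  then show ?thesis by (simp add: poly_altdef sum_distrib_right sum_divide_distrib exp_minus field_simps)
qed

text \<open>Every derivative of \<open>exp (- (1/x))\<close>, cut off at zero, has this form.\<close>

definition flat :: "real poly \<Rightarrow> real \<Rightarrow> real" where
  "flat p x = (if x > 0 then poly p (1/x) * exp (- (1/x)) else 0)"

lemma flat_DERIV: "(flat p has_real_derivative flat ([:0,0,1:] * (p - pderiv p)) x) (at x)"
proof -
  consider "x > 0" | "x < 0" | "x = 0" by linarith
  then show ?thesis
  proof cases
    case 1
    have "((\<lambda>x. poly p (1/x) * exp (- (1/x))) has_real_derivative flat ([:0,0,1:] * (p - pderiv p)) x) (at x)"
      using 1 by (auto intro!: derivative_eq_intros simp: flat_def power2_eq_square field_simps)
    then show ?thesis
      by (rule has_field_derivative_transform_within_open[where S="{0<..}"]) (use 1 in \<open>auto simp: flat_def\<close>)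
  next
    case 2
    have "((\<lambda>x. 0) has_real_derivative flat ([:0,0,1:] * (p - pderiv p)) x) (at x)"
      using 2 by (auto simp: flat_def)
    then show ?thesis
      by (rule has_field_derivative_transform_within_open[where S="{..<0}"]) (use 2 in \<open>auto simp: flat_def\<close>)
  next
    case 3
    have "((\<lambda>h. (flat p (0 + h) - flat p 0) / h) \<longlongrightarrow> 0) (at_right 0)"
    proof -
      have "((\<lambda>h::real. poly (pCons 0 p) (inverse h) * exp (- inverse h)) \<longlongrightarrow> 0) (at_right 0)"
        by (rule filterlim_compose[OF poly_exp_decay filterlim_inverse_at_top_right])
      moreover have "\<forall>\<^sub>F h in at_right 0. poly (pCons 0 p) (inverse h) * exp (- inverse h) = (flat p (0 + h) - flat p 0) / h"
        using eventually_at_right_less[of 0] by eventually_elim (simp add: flat_def field_simps)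
      ultimately show ?thesis by (rule Lim_transform_eventually)
    qed
    moreover have "((\<lambda>h. (flat p (0 + h) - flat p 0) / h) \<longlongrightarrow> 0) (at_left 0)"
    proof (rule tendsto_eventually)
      show "\<forall>\<^sub>F h in at_left 0. (flat p (0 + h) - flat p 0) / h = 0"
        by (auto simp: eventually_at_filter flat_def)
    qed
    ultimately have "((\<lambda>h. (flat p (0 + h) - flat p 0) / h) \<longlongrightarrow> 0) (at 0)"
      by (simp only: filterlim_split_at)
    moreover have "flat ([:0,0,1:] * (p - pderiv p)) x = 0" using 3 by (simp add: flat_def)
    ultimately show ?thesis unfolding DERIV_def using 3 by simp
  qed
qed

lemma smooth_flat: "smooth (flat p)"
proof (rule smooth_coinduct[where X="range flat"])
  fix g x assume "g \<in> range flat"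
  then obtain p where g: "g = flat p" by auto
  show "g differentiable (at x)" using flat_DERIV[of p x] real_differentiable_def g by blast
  have "deriv g = flat ([:0,0,1:] * (p - pderiv p))"
    unfolding g by (rule ext, rule DERIV_imp_deriv, rule flat_DERIV)
  then show "deriv g \<in> range flat" by simp
qed auto

text \<open>The parameter \<open>j\<close> is the steepness at the two ends. As it grows, the bumps converge to the
  indicator function of \<open>{p<..<q}\<close>.\<close>

definition bump :: "real \<Rightarrow> real \<Rightarrow> nat \<Rightarrow> real \<Rightarrow> real" where
  "bump p q j x = flat 1 (real (Suc j) * (x - p)) * flat 1 (real (Suc j) * (q - x))"

lemma smooth_bump: "smooth (bump p q j)"
proof -
  have "smooth (\<lambda>x. (1 * flat 1 (real (Suc j) * x + (- real (Suc j) * p))) * (1 * flat 1 ((- real (Suc j)) * x + real (Suc j) * q)))"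
    by (intro smooth_mult smooth_affine smooth_flat)
  then show ?thesis unfolding bump_def[abs_def] by (simp add: algebra_simps)
qed

lemma flat_range: "0 \<le> flat 1 x" "flat 1 x \<le> 1"
  by (auto simp: flat_def)

lemma bump_range: "0 \<le> bump p q j x" "bump p q j x \<le> 1"
  unfolding bump_def using flat_range by (auto intro!: mult_nonneg_nonneg mult_le_one)

lemma bump_outside: "x \<notin> {p<..<q} \<Longrightarrow> bump p q j x = 0"
  by (auto simp: bump_def flat_def mult_pos_pos zero_less_mult_iff)

lemma flat_limit: "(\<lambda>j. flat 1 (real (Suc j) * y)) \<longlonglongrightarrow> indicator {0<..} y"
proof (cases "y > 0")
  case True
  have "(\<lambda>j. exp (- (1 / (real (Suc j) * y)))) \<longlonglongrightarrow> exp (- 0)"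
    using True by (intro tendsto_exp tendsto_minus) real_asymp
  then show ?thesis using True by (simp add: flat_def zero_less_mult_iff)
next
  case False
  then have "flat 1 (real (Suc j) * y) = 0" for j by (auto simp: flat_def zero_less_mult_iff)
  then show ?thesis using False by simp
qed

lemma bump_limit: "(\<lambda>j. bump p q j x) \<longlonglongrightarrow> indicator {p<..<q} x"
proof -
  have "(\<lambda>j. bump p q j x) \<longlonglongrightarrow> indicator {0<..} (x - p) * indicator {0<..} (q - x)"
    unfolding bump_def by (intro tendsto_mult flat_limit)
  also have "indicator {0<..} (x - p) * indicator {0<..} (q - x) = (indicator {p<..<q} x :: real)"
    by (auto simp: indicator_def)
  finally show ?thesis .
qed

text \<open>The derivative of \<open>exp (- (1/y))\<close> is at most \<open>1 / y\<^sup>2\<close>, and \<open>y\<close> is at least \<open>j e\<close> here.\<close>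

lemma bump_deriv_bound:
  assumes e: "e > 0" and x: "p + e \<le> x" "x \<le> q - e"
  shows "\<bar>deriv (bump p q j) x\<bar> \<le> 2 / (real (Suc j) * e\<^sup>2)"
proof -
  let ?J = "real (Suc j)" and ?g = "flat ([:0,0,1:] * (1 - pderiv 1))"
  have d: "(bump p q j has_real_derivative
      (?g (?J * (x - p)) * ?J) * flat 1 (?J * (q - x)) + (?g (?J * (q - x)) * (- ?J)) * flat 1 (?J * (x - p))) (at x)"
    unfolding bump_def[abs_def]
    by (intro DERIV_mult DERIV_chain2[OF flat_DERIV]) (auto intro!: derivative_eq_intros)
  have g: "0 \<le> ?g (?J * y) * ?J \<and> ?g (?J * y) * ?J \<le> 1 / (?J * e\<^sup>2)" if "y \<ge> e" for y
  proof -
    have y: "y > 0" using that e by simp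
    have "?g (?J * y) * ?J = 1 / (?J * y\<^sup>2) * exp (- (1 / (?J * y)))"
    proof -
      have "?J * y > 0" using y by (intro mult_pos_pos) auto
      then show ?thesis using y
        by (simp add: flat_def power2_eq_square divide_simps del: of_nat_Suc)
    qed
    also have "\<dots> \<le> 1 / (?J * y\<^sup>2) * 1" using y by (intro mult_left_mono) auto
    also have "\<dots> \<le> 1 / (?J * e\<^sup>2)"
      using that e y by (simp add: frac_le power_mono)
    finally show ?thesis using y by (auto simp: flat_def)
  qed
  have "\<bar>(?g (?J * (x - p)) * ?J) * flat 1 (?J * (q - x))\<bar> \<le> 1 / (?J * e\<^sup>2) * 1"
    unfolding abs_mult using g[of "x - p"] flat_range[of "?J * (q - x)"] x
    by (intro mult_mono) auto
  moreover have "\<bar>(?g (?J * (q - x)) * (- ?J)) * flat 1 (?J * (x - p))\<bar> \<le> 1 / (?J * e\<^sup>2) * 1"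
    unfolding mult_minus_right mult_minus_left abs_minus_cancel unfolding abs_mult[of "?g _ * _"]
    using g[of "q - x"] flat_range[of "?J * (x - p)"] x
    by (intro mult_mono) auto
  ultimately show ?thesis
    unfolding DERIV_imp_deriv[OF d] by (intro order_trans[OF abs_triangle_ineq]) simp
qed

lemma bump_test_function:
  assumes "smooth g" "{p..q} \<subseteq> S"
  shows "(\<lambda>x. bump p q j x * g x) \<in> test_functions S"
proof -
  have "smooth (\<lambda>x. bump p q j x * g x)" using assms smooth_bump by auto
  then show ?thesis using assms(2)
    by (auto simp: test_functions_def smooth_def bump_outside intro!: exI[of _ "{p..q}"])
qed

lemma integral_vanishing_outside:
  fixes h :: "real \<Rightarrow> complex"
  assumes "\<And>x. x \<in> S \<Longrightarrow> x \<notin> T \<Longrightarrow> h x = 0" "T \<subseteq> S" "S \<in> sets lebesgue" "T \<in> sets lebesgue"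
  shows "(LINT x|lebesgue_on S. h x) = (LINT x|lebesgue_on T. h x)"
proof -
  have "(LINT x|lebesgue_on S. h x) = (LINT x|lebesgue_on S. (if x \<in> T then h x else 0))"
    using assms(1) by (intro Bochner_Integration.integral_cong) auto
  also have "\<dots> = (LINT x|lebesgue_on T. h x)" using assms by (intro Lebesgue_Measure.integral_restrict)
  finally show ?thesis .
qed

lemma continuous_times_integrable:
  fixes h :: "real \<Rightarrow> complex"
  assumes "integrable (lebesgue_on {p..q}) h" "continuous_on {p..q} g" "S \<subseteq> {p..q}" "S \<in> sets lebesgue"
  shows "integrable (lebesgue_on S) (\<lambda>x. complex_of_real (g x) * h x)"
proof -
  obtain B where "\<forall>y\<in>g ` {p..q}. norm y \<le> B"
    using compact_imp_bounded[OF compact_continuous_image[OF assms(2) compact_Icc]]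
    unfolding bounded_iff by blast
  then have B: "\<And>x. x \<in> {p..q} \<Longrightarrow> \<bar>g x\<bar> \<le> B" by auto
  have "integrable (lebesgue_on {p..q}) (\<lambda>x. complex_of_real (g x) * h x)"
  proof (rule Bochner_Integration.integrable_bound[OF integrable_mult_right[of B, OF integrable_norm[OF assms(1)]]])
    have "g \<in> borel_measurable (lebesgue_on {p..q})"
      using assms(2) by (intro continuous_imp_measurable_on_sets_lebesgue) auto
    then show "(\<lambda>x. complex_of_real (g x) * h x) \<in> borel_measurable (lebesgue_on {p..q})"
      using assms(1) by (intro borel_measurable_times) auto
    show "AE x in lebesgue_on {p..q}. norm (complex_of_real (g x) * h x) \<le> norm (B * norm (h x))"
    proof (rule AE_I2)
      fix x assume "x \<in> space (lebesgue_on {p..q})"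
      then have "\<bar>g x\<bar> \<le> \<bar>B\<bar>" using B[of x] by auto
      then show "norm (complex_of_real (g x) * h x) \<le> norm (B * norm (h x))"
        by (auto simp: norm_mult abs_mult intro!: mult_right_mono)
    qed
  qed
  then show ?thesis by (rule integrable_lebesgue_on_subset) (use assms(3,4) in auto)
qed

lemma bump_integral_limit:
  fixes h :: "real \<Rightarrow> complex"
  assumes h: "integrable (lebesgue_on {p..q}) h"
  shows "(\<lambda>j. LINT x|lebesgue_on {p<..<q}. complex_of_real (bump p q j x) * h x)
    \<longlonglongrightarrow> (LINT x|lebesgue_on {p<..<q}. h x)"
proof (rule integral_dominated_convergence[where w="\<lambda>x. norm (h x)"])
  have h': "integrable (lebesgue_on {p<..<q}) h"
    using h by (rule integrable_lebesgue_on_subset) auto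
  then show "h \<in> borel_measurable (lebesgue_on {p<..<q})" "integrable (lebesgue_on {p<..<q}) (\<lambda>x. norm (h x))"
    by auto
  show "(\<lambda>x. complex_of_real (bump p q j x) * h x) \<in> borel_measurable (lebesgue_on {p<..<q})" for j
    using continuous_times_integrable[OF h smooth_continuous[OF smooth_bump], of "{p<..<q}" p q j]
    by (auto simp: subset_iff)
  show "AE x in lebesgue_on {p<..<q}. (\<lambda>j. complex_of_real (bump p q j x) * h x) \<longlonglongrightarrow> h x"
  proof (rule AE_I2)
    fix x assume x: "x \<in> space (lebesgue_on {p<..<q})"
    have "(\<lambda>j. complex_of_real (bump p q j x) * h x) \<longlonglongrightarrow> complex_of_real (indicator {p<..<q} x) * h x"
      by (intro tendsto_mult tendsto_of_real bump_limit tendsto_const)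
    then show "(\<lambda>j. complex_of_real (bump p q j x) * h x) \<longlonglongrightarrow> h x" using x by simp
  qed
  show "AE x in lebesgue_on {p<..<q}. norm (complex_of_real (bump p q j x) * h x) \<le> norm (h x)" for j
    using bump_range by (intro AE_I2) (auto simp: norm_mult intro!: mult_left_le_one_le)
qed

lemma bump_test_function':
  assumes "{p..q} \<subseteq> S" shows "bump p q j \<in> test_functions S"
  using bump_test_function[of "\<lambda>x. 1" p q S j] assms by simp

text \<open>Bumps are test functions that converge boundedly to indicator functions of intervals.\<close>

lemma fundamental_lemma:
  fixes h :: "real \<Rightarrow> complex"
  assumes h: "L1_loc a b h"
    and 0: "\<And>\<theta>. \<theta> \<in> test_functions {a<..<b} \<Longrightarrow> (LINT x|lebesgue_on {a<..<b}. complex_of_real (\<theta> x) * h x) = 0"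
  shows "AE x in lebesgue_on {a<..<b}. h x = 0"
proof (rule AE_zero_if_interval_integrals_zero[OF h])
  fix p q assume pq: "a < p" "p < q" "q < b"
  have "(LINT x|lebesgue_on {p<..<q}. complex_of_real (bump p q j x) * h x) = 0" for j
  proof -
    have "(LINT x|lebesgue_on {p<..<q}. complex_of_real (bump p q j x) * h x)
        = (LINT x|lebesgue_on {a<..<b}. complex_of_real (bump p q j x) * h x)"
      using pq by (intro integral_vanishing_outside[symmetric]) (auto simp: bump_outside)
    also have "\<dots> = 0" using pq by (intro 0 bump_test_function') auto
    finally show ?thesis .
  qed
  moreover have "integrable (lebesgue_on {p..q}) h" using h pq by (auto simp: L1_loc_def)
  ultimately show "(LINT x|lebesgue_on {p<..<q}. h x) = 0"
    using bump_integral_limit[of p q h] by (simp add: LIMSEQ_const_iff)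
qed

text \<open>The antiderivative that vanishes to the left of the support of \<open>g\<close> also vanishes to the right,
  because the total integral of \<open>g\<close> is zero.\<close>

lemma compactly_supported_antiderivative:
  assumes g: "smooth g" and out: "\<And>x. x \<notin> {l..u} \<Longrightarrow> g x = 0" and lu: "l \<le> u" "{l..u} \<subseteq> S"
    and 0: "(g has_integral 0) {l..u}"
  obtains G where "G \<in> test_functions S" "\<And>x. deriv G x = g x"
proof -
  have "\<exists>F. \<forall>x. -\<infinity> < ereal x \<longrightarrow> ereal x < \<infinity> \<longrightarrow> (F has_vector_derivative g x) (at x)"
    by (rule einterval_antiderivative)
      (use smooth_continuous[OF g, of UNIV] in \<open>auto simp: continuous_on_eq_continuous_at\<close>)
  then obtain F where F: "\<And>x. (F has_real_derivative g x) (at x)"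
    by (auto simp: has_real_derivative_iff_has_vector_derivative)
  define G where "G x = F x - F l" for x
  have G: "(G has_real_derivative g x) (at x)" for x
    unfolding G_def by (auto intro!: derivative_eq_intros F)
  have "G x = 0" if "x \<notin> {l..u}" for x
  proof -
    have Gl: "G l = 0" by (simp add: G_def)
    consider "x < l" | "x > u" using \<open>x \<notin> {l..u}\<close> by (metis atLeastAtMost_iff not_le)
    then show ?thesis
    proof cases
      case 1
      have "\<exists>z. x < z \<and> z < l \<and> G l - G x = (l - x) * g z"
        using 1 G by (intro MVT2) auto
      then show ?thesis using Gl out by force
    next
      case 2
      have "\<exists>z. u < z \<and> z < x \<and> G x - G u = (x - u) * g z"
        using 2 G by (intro MVT2) auto
      then have "G x = G u" using out by force
      moreover have "(g has_integral (G u - G l)) {l..u}"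
        using lu G by (intro fundamental_theorem_of_calculus)
          (auto simp: has_real_derivative_iff_has_vector_derivative[symmetric] intro: has_field_derivative_at_within)
      then have "G u - G l = 0" using 0 by (rule has_integral_unique)
      ultimately show ?thesis using Gl by simp
    qed
  qed
  moreover have "smooth G" using G g by (rule smooth_antiderivative)
  ultimately have "G \<in> test_functions S"
    using lu by (auto simp: test_functions_def smooth_def intro!: exI[of _ "{l..u}"])
  moreover have "deriv G x = g x" for x using G by (rule DERIV_imp_deriv)
  ultimately show ?thesis using that by blast
qed

lemma bump_pos: "x \<in> {p<..<q} \<Longrightarrow> 0 < bump p q j x"
  by (auto simp: bump_def flat_def)

text \<open>A distribution with vanishing derivative is constant: every bump differs from a multiple of
  one fixed bump by the derivative of a test function.\<close>

lemma du_Bois_Reymond: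
  fixes h :: "real \<Rightarrow> complex"
  assumes ab: "a < b" and h: "L1_loc a b h"
    and 0: "\<And>\<theta>. \<theta> \<in> test_functions {a<..<b} \<Longrightarrow> (LINT x|lebesgue_on {a<..<b}. complex_of_real (deriv \<theta> x) * h x) = 0"
  shows "\<exists>C. AE x in lebesgue_on {a<..<b}. h x = C"
proof -
  define I where "I p q j = integral {p..q} (bump p q j)" for p q j
  have bI: "(bump p q j has_integral I p q j) {l..u}" if "{p..q} \<subseteq> {l..u}" for p q l u j
  proof -
    have "(bump p q j has_integral I p q j) {p..q}"
      unfolding I_def by (intro integrable_integral integrable_continuous_real smooth_continuous smooth_bump)
    then show ?thesis by (rule has_integral_on_superset) (use that in \<open>auto simp: bump_outside\<close>)
  qed
  obtain m1 where m1: "a < m1" "m1 < b" using dense[OF ab] by auto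
  obtain m2 where m2: "m1 < m2" "m2 < b" using dense[OF m1(2)] by auto
  \<comment> \<open>the fixed bump, whose integral \<open>c0\<close> is not zero\<close>
  define \<rho> where "\<rho> = bump m1 m2 0"
  define c0 where "c0 = I m1 m2 0"
  have c0: "c0 \<noteq> 0"
  proof
    assume "c0 = 0"
    then have "(bump m1 m2 0 has_integral 0) (cbox m1 m2)" using bI[of m1 m2 m1 m2 0] by (simp add: c0_def)
    then have "bump m1 m2 0 ((m1 + m2) / 2) = 0"
      by (rule has_integral_0_cbox_imp_0[rotated 2]) (use m2 smooth_continuous[OF smooth_bump] in \<open>auto simp: bump_range\<close>)
    then show False using bump_pos[of "(m1 + m2) / 2" m1 m2 0] m2 by simp
  qed
  define C where "C = (LINT x|lebesgue_on {a<..<b}. complex_of_real (\<rho> x) * h x) / c0"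
  have "L1_loc a b (\<lambda>x. h x - C)"
    using h by (auto simp: L1_loc_def)
  then have "AE x in lebesgue_on {a<..<b}. h x - C = 0"
  proof (rule AE_zero_if_interval_integrals_zero)
    fix p q assume pq: "a < p" "p < q" "q < b"
    have hpq: "integrable (lebesgue_on {p..q}) h" and hm: "integrable (lebesgue_on {m1..m2}) h"
      using h pq m1 m2 by (auto simp: L1_loc_def)
    have key: "(LINT x|lebesgue_on {p<..<q}. complex_of_real (bump p q j x) * (h x - C)) = 0" for j
    proof -
      define r where "r = I p q j / c0"
      \<comment> \<open>\<open>g\<close> has integral zero and is therefore the derivative of a test function\<close>
      define g where "g x = bump p q j x - r * \<rho> x" for x
      define l u where "l = min p m1" and "u = max q m2"
      have lu: "l \<le> u" "{p..q} \<subseteq> {l..u}" "{m1..m2} \<subseteq> {l..u}" "{l..u} \<subseteq> {a<..<b}"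
        using pq m1 m2 by (auto simp: l_def u_def)
      have g0: "g x = 0" if "x \<notin> {l..u}" for x
        using that lu by (force simp: g_def \<rho>_def bump_outside)
      have gs: "smooth g" unfolding g_def[abs_def] \<rho>_def by (intro smooth_diff smooth_mult smooth_const smooth_bump)
      have "(g has_integral (I p q j - r * c0)) {l..u}"
        unfolding g_def[abs_def] \<rho>_def c0_def by (intro has_integral_diff has_integral_mult_right bI lu)
      then have gi: "(g has_integral 0) {l..u}" using c0 by (simp add: r_def)
      obtain G where G: "G \<in> test_functions {a<..<b}" "\<And>x. deriv G x = g x"
        using compactly_supported_antiderivative[OF gs g0 lu(1) lu(4) gi] by blast
      have i1: "integrable (lebesgue_on {a<..<b}) (\<lambda>x. complex_of_real (bump s t k x) * h x)"
        if st: "a < s" "t < b" for s t k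
      proof -
        have "integrable (lebesgue_on {s..t}) h" using h st by (auto simp: L1_loc_def)
        then have "integrable (lebesgue_on {s..t}) (\<lambda>x. complex_of_real (bump s t k x) * h x)"
          by (rule continuous_times_integrable) (auto intro!: smooth_continuous smooth_bump)
        then have "integrable lebesgue (\<lambda>x. if x \<in> {s..t} then complex_of_real (bump s t k x) * h x else 0)"
          by (subst Lebesgue_Measure.integrable_restrict_UNIV) auto
        also have "(\<lambda>x. if x \<in> {s..t} then complex_of_real (bump s t k x) * h x else 0)
            = (\<lambda>x. if x \<in> {a<..<b} then complex_of_real (bump s t k x) * h x else 0)"
          using st by (auto simp: fun_eq_iff bump_outside)
        finally show ?thesis by (subst (asm) Lebesgue_Measure.integrable_restrict_UNIV) auto
      qed
      have "0 = (LINT x|lebesgue_on {a<..<b}. complex_of_real (g x) * h x)" using 0[OF G(1)] by (simp add: G(2))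
      also have "\<dots> = (LINT x|lebesgue_on {a<..<b}. complex_of_real (bump p q j x) * h x - r * (complex_of_real (\<rho> x) * h x))"
        by (intro Bochner_Integration.integral_cong) (auto simp: g_def algebra_simps)
      also have "\<dots> = (LINT x|lebesgue_on {a<..<b}. complex_of_real (bump p q j x) * h x)
          - r * (LINT x|lebesgue_on {a<..<b}. complex_of_real (\<rho> x) * h x)"
        using i1[of p q j] i1[of m1 m2 0] pq m1 m2 by (simp add: \<rho>_def)
      also have "r * (LINT x|lebesgue_on {a<..<b}. complex_of_real (\<rho> x) * h x) = I p q j * C"
        using c0 by (simp add: C_def r_def)
      also have "(LINT x|lebesgue_on {a<..<b}. complex_of_real (bump p q j x) * h x)
          = (LINT x|lebesgue_on {p<..<q}. complex_of_real (bump p q j x) * h x)"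
        using pq by (intro integral_vanishing_outside) (auto simp: bump_outside)
      finally have 1: "(LINT x|lebesgue_on {p<..<q}. complex_of_real (bump p q j x) * h x) = I p q j * C" by simp
      have bi: "integrable (lebesgue_on {p<..<q}) (bump p q j)"
        using continuous_imp_integrable_real[OF smooth_continuous[OF smooth_bump, of "{p..q}" p q j]]
        by (rule integrable_lebesgue_on_subset) auto
      have "(bump p q j has_integral (LINT x|lebesgue_on {p<..<q}. bump p q j x)) {p<..<q}"
        using bi by (intro has_integral_integral_lebesgue_on) auto
      moreover have "(bump p q j has_integral I p q j) {p<..<q}"
        using bI[of p q p q j] by (simp add: has_integral_Icc_iff_Ioo)
      ultimately have 2: "(LINT x|lebesgue_on {p<..<q}. bump p q j x) = I p q j" by (rule has_integral_unique)
      have "(LINT x|lebesgue_on {p<..<q}. complex_of_real (bump p q j x) * (h x - C))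
         = (LINT x|lebesgue_on {p<..<q}. complex_of_real (bump p q j x) * h x)
          - (LINT x|lebesgue_on {p<..<q}. complex_of_real (bump p q j x) * C)"
        unfolding right_diff_distrib
        by (intro Bochner_Integration.integral_diff continuous_times_integrable[OF hpq smooth_continuous[OF smooth_bump]])
          (use bi in auto)
      also have "(LINT x|lebesgue_on {p<..<q}. complex_of_real (bump p q j x) * C) = I p q j * C"
        using 2 by simp
      finally show ?thesis using 1 by simp
    qed
    have "integrable (lebesgue_on {p..q}) (\<lambda>x. h x - C)" using hpq by auto
    from bump_integral_limit[OF this] key
    show "(LINT x|lebesgue_on {p<..<q}. h x - C) = 0" by (simp add: LIMSEQ_const_iff)
  qed
  then show ?thesis by (intro exI[of _ C]) simp
qed

text \<open>If \<open>u\<close> vanishes near the ends of an interval, then its weak derivative may be tested there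
  against any smooth function: cut off by bumps whose slopes tend to zero where \<open>u\<close> lives.\<close>

lemma weak_derivative_supported_inside:
  fixes u w :: "real \<Rightarrow> complex"
  assumes u: "integrable (lebesgue_on {p..q}) u" and w: "integrable (lebesgue_on {p..q}) w"
    and weak: "\<And>\<theta>. \<theta> \<in> test_functions UNIV \<Longrightarrow>
      (LINT t|lebesgue. complex_of_real (deriv \<theta> t) * u t) = - (LINT t|lebesgue. complex_of_real (\<theta> t) * w t)"
    and e: "e > 0" and van: "AE t in lebesgue. t \<in> {p<..<q} \<longrightarrow> t \<notin> {p + e..q - e} \<longrightarrow> u t = 0"
    and g: "smooth g"
  shows "(LINT t|lebesgue_on {p<..<q}. complex_of_real (deriv g t) * u t)
    = - (LINT t|lebesgue_on {p<..<q}. complex_of_real (g t) * w t)"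
proof -
  let ?M = "lebesgue_on {p<..<q}"
  have van': "AE t in ?M. t \<notin> {p + e..q - e} \<longrightarrow> u t = 0"
    using van by (subst AE_restrict_space_iff) auto
  have dg: "smooth (deriv g)" using g by auto
  have gu: "integrable (lebesgue_on {p..q}) (\<lambda>t. complex_of_real (deriv g t) * u t)"
    and gw: "integrable (lebesgue_on {p..q}) (\<lambda>t. complex_of_real (g t) * w t)"
    by (rule continuous_times_integrable[OF u smooth_continuous[OF dg]] continuous_times_integrable[OF w smooth_continuous[OF g]]; auto)+
  have key: "(LINT t|?M. complex_of_real (deriv (bump p q j) t * g t) * u t)
     + (LINT t|?M. complex_of_real (bump p q j t) * (complex_of_real (deriv g t) * u t))
     = - (LINT t|?M. complex_of_real (bump p q j t) * (complex_of_real (g t) * w t))" for j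
  proof -
    let ?b = "\<lambda>x. bump p q j x * g x"
    have d: "deriv ?b t = deriv (bump p q j) t * g t + deriv g t * bump p q j t" for t
      by (intro DERIV_imp_deriv DERIV_mult smooth_DERIV smooth_bump g)
    have d0: "deriv ?b t = 0" if "t \<notin> {p<..<q}" for t
    proof -
      consider "t < p" | "t > q" | "t = p" | "t = q"
        using \<open>t \<notin> {p<..<q}\<close> by (metis greaterThanLessThan_iff linorder_neqE_linordered_idom)
      then show ?thesis
      proof cases
        case 1
        have "((\<lambda>x. 0) has_real_derivative 0) (at t)" by simp
        then have "(?b has_real_derivative 0) (at t)"
          by (rule has_field_derivative_transform_within_open[where S="{..<p}"]) (use 1 in \<open>auto simp: bump_outside\<close>)
        then show ?thesis by (rule DERIV_imp_deriv)
      next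
        case 2
        have "((\<lambda>x. 0) has_real_derivative 0) (at t)" by simp
        then have "(?b has_real_derivative 0) (at t)"
          by (rule has_field_derivative_transform_within_open[where S="{q<..}"]) (use 2 in \<open>auto simp: bump_outside\<close>)
        then show ?thesis by (rule DERIV_imp_deriv)
      next
        case 3
        then have "deriv (bump p q j) t = 0"
          using bump_range bump_outside by (intro DERIV_local_min[OF smooth_DERIV[OF smooth_bump], of 1]) auto
        then show ?thesis unfolding d using 3 by (simp add: bump_outside)
      next
        case 4
        then have "deriv (bump p q j) t = 0"
          using bump_range bump_outside by (intro DERIV_local_min[OF smooth_DERIV[OF smooth_bump], of 1]) auto
        then show ?thesis unfolding d using 4 by (simp add: bump_outside)
      qed
    qed
    have "(LINT t|?M. complex_of_real (deriv ?b t) * u t) = (LINT t|lebesgue_on UNIV. complex_of_real (deriv ?b t) * u t)"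
      by (intro integral_vanishing_outside[symmetric]) (auto simp: d0)
    also have "\<dots> = - (LINT t|lebesgue_on UNIV. complex_of_real (?b t) * w t)"
      using weak[OF bump_test_function[OF g, of p q UNIV j]] by (simp add: lebesgue_on_UNIV_eq)
    also have "(LINT t|lebesgue_on UNIV. complex_of_real (?b t) * w t) = (LINT t|?M. complex_of_real (?b t) * w t)"
      by (intro integral_vanishing_outside) (auto simp: bump_outside)
    also have "(LINT t|?M. complex_of_real (deriv ?b t) * u t)
      = (LINT t|?M. complex_of_real (deriv (bump p q j) t * g t) * u t + complex_of_real (bump p q j t) * (complex_of_real (deriv g t) * u t))"
      unfolding d by (intro Bochner_Integration.integral_cong) (auto simp: algebra_simps)
    also have "\<dots> = (LINT t|?M. complex_of_real (deriv (bump p q j) t * g t) * u t)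
      + (LINT t|?M. complex_of_real (bump p q j t) * (complex_of_real (deriv g t) * u t))"
      by (intro Bochner_Integration.integral_add continuous_times_integrable[OF u] continuous_times_integrable[OF gu]
          smooth_continuous smooth_mult smooth_deriv smooth_bump g) auto
    finally show ?thesis by (simp add: mult.assoc)
  qed
  have L0: "(\<lambda>j. LINT t|?M. complex_of_real (deriv (bump p q j) t * g t) * u t) \<longlonglongrightarrow> 0"
  proof -
    obtain B where "\<forall>y\<in>g ` {p..q}. norm y \<le> B"
      using compact_imp_bounded[OF compact_continuous_image[OF smooth_continuous[OF g] compact_Icc[of p q]]]
      unfolding bounded_iff by blast
    then have B: "\<And>x. x \<in> {p..q} \<Longrightarrow> \<bar>g x\<bar> \<le> B" by auto
    have ui: "integrable ?M u" using u by (rule integrable_lebesgue_on_subset) auto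
    show ?thesis
    proof (rule Lim_null_comparison)
      show "\<forall>\<^sub>F j in sequentially. norm (LINT t|?M. complex_of_real (deriv (bump p q j) t * g t) * u t)
          \<le> 2 / (real (Suc j) * e\<^sup>2) * \<bar>B\<bar> * (LINT t|?M. norm (u t))"
      proof (intro always_eventually allI)
        fix j
        have "norm (LINT t|?M. complex_of_real (deriv (bump p q j) t * g t) * u t)
          \<le> (LINT t|?M. 2 / (real (Suc j) * e\<^sup>2) * \<bar>B\<bar> * norm (u t))"
        proof (rule order_trans[OF integral_norm_bound], rule integral_mono_AE)
          show "integrable ?M (\<lambda>t. norm (complex_of_real (deriv (bump p q j) t * g t) * u t))"
            by (intro integrable_norm continuous_times_integrable[OF u] smooth_continuous smooth_mult smooth_deriv smooth_bump g) auto
          show "integrable ?M (\<lambda>t. 2 / (real (Suc j) * e\<^sup>2) * \<bar>B\<bar> * norm (u t))" using ui by auto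
          show "AE t in ?M. norm (complex_of_real (deriv (bump p q j) t * g t) * u t)
              \<le> 2 / (real (Suc j) * e\<^sup>2) * \<bar>B\<bar> * norm (u t)"
            using van' AE_space
          proof eventually_elim
            case (elim t)
            show ?case
            proof (cases "t \<in> {p + e..q - e}")
              case True
              then have "\<bar>deriv (bump p q j) t\<bar> \<le> 2 / (real (Suc j) * e\<^sup>2)" "\<bar>g t\<bar> \<le> \<bar>B\<bar>"
                using bump_deriv_bound[OF e, of p t q j] B[of t] e by auto
              then show ?thesis by (simp only: norm_mult norm_of_real abs_mult) (intro mult_mono; simp)
            qed (use elim in auto)
          qed
        qed
        then show "norm (LINT t|?M. complex_of_real (deriv (bump p q j) t * g t) * u t)
          \<le> 2 / (real (Suc j) * e\<^sup>2) * \<bar>B\<bar> * (LINT t|?M. norm (u t))" by simp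
      qed
      have "(\<lambda>j. 2 / (real (Suc j) * e\<^sup>2)) \<longlonglongrightarrow> 0" using e by real_asymp
      then show "(\<lambda>j. 2 / (real (Suc j) * e\<^sup>2) * \<bar>B\<bar> * (LINT t|?M. norm (u t))) \<longlonglongrightarrow> 0"
        by (intro tendsto_mult_left_zero)
    qed
  qed
  have "(\<lambda>j. (LINT t|?M. complex_of_real (deriv (bump p q j) t * g t) * u t)
     + (LINT t|?M. complex_of_real (bump p q j t) * (complex_of_real (deriv g t) * u t)))
     \<longlonglongrightarrow> 0 + (LINT t|?M. complex_of_real (deriv g t) * u t)"
    by (intro tendsto_add L0 bump_integral_limit gu)
  moreover have "(\<lambda>j. - (LINT t|?M. complex_of_real (bump p q j t) * (complex_of_real (g t) * w t)))
     \<longlonglongrightarrow> - (LINT t|?M. complex_of_real (g t) * w t)"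
    by (intro tendsto_minus bump_integral_limit gw)
  ultimately show ?thesis unfolding key using LIMSEQ_unique by fastforce
qed

section \<open>The weighted space and its form domain\<close>

abbreviation leb_pi :: "real measure" where "leb_pi \<equiv> lebesgue_on {0<..<pi}"

lemma H_space_L2: "H_space = L2 hmeas"
  by (simp add: H_space_def L2_def)

lemma H_inner_ip: "H_inner = ip hmeas"
  by (simp add: H_inner_def ip_def fun_eq_iff)

lemma H_norm_nsq: "(H_norm f)\<^sup>2 = nsq hmeas f"
  by (simp add: H_norm_def nsq_def)

lemma \<omega>_pos: "0 < x \<Longrightarrow> x < pi \<Longrightarrow> 0 < \<omega> x"
  by (simp add: \<omega>_def sin_gt_zero)

lemma \<omega>_cont: "continuous_on S \<omega>"
  unfolding \<omega>_def by (intro continuous_intros)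

lemma \<omega>_measurable [measurable]: "\<omega> \<in> borel_measurable borel"
  by (intro borel_measurable_continuous_onI \<omega>_cont)

lemma borel_lebesgue_on: "f \<in> borel_measurable borel \<Longrightarrow> f \<in> borel_measurable (lebesgue_on S)"
  by (intro measurable_restrict_space1 measurable_completion) simp

lemma \<omega>_measurable' [measurable]: "\<omega> \<in> borel_measurable (lebesgue_on S)"
  by (rule borel_lebesgue_on) simp

lemma space_hmeas [simp]: "space hmeas = {0<..<pi}"
  by (simp add: hmeas_def)

lemma borel_measurable_hmeas: "borel_measurable hmeas = borel_measurable leb_pi"
  by (rule measurable_cong_sets) (simp_all add: hmeas_def)

lemma AE_hmeas: "(AE x in hmeas. P x) \<longleftrightarrow> (AE x in leb_pi. P x)"
proof -
  have "(AE x in hmeas. P x) \<longleftrightarrow> (AE x in leb_pi. 0 < ennreal (\<omega> x) \<longrightarrow> P x)"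
    unfolding hmeas_def by (subst AE_density) auto
  also have "\<dots> \<longleftrightarrow> (AE x in leb_pi. P x)"
  proof (rule AE_cong)
    fix x assume "x \<in> space leb_pi"
    then show "(0 < ennreal (\<omega> x) \<longrightarrow> P x) = P x" using \<omega>_pos[of x] by simp
  qed
  finally show ?thesis .
qed

lemma integrable_hmeas:
  fixes f :: "real \<Rightarrow> 'b::{banach, second_countable_topology}"
  shows "f \<in> borel_measurable leb_pi \<Longrightarrow> integrable hmeas f \<longleftrightarrow> integrable leb_pi (\<lambda>x. \<omega> x *\<^sub>R f x)"
  unfolding hmeas_def by (rule integrable_density) (auto intro!: AE_I2 less_imp_le[OF \<omega>_pos])

lemma integral_hmeas:
  fixes f :: "real \<Rightarrow> 'b::{banach, second_countable_topology}"
  shows "f \<in> borel_measurable leb_pi \<Longrightarrow> integral\<^sup>L hmeas f = (LINT x|leb_pi. \<omega> x *\<^sub>R f x)"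
  unfolding hmeas_def by (rule integral_density) (auto intro!: AE_I2 less_imp_le[OF \<omega>_pos])

lemma sin_lower_bound:
  assumes "0 < x" "x < pi"
  shows "1 / sqrt (sin x) \<le> 2 * (1 / sqrt x + 1 / sqrt (pi - x))"
proof -
  have c1: "1/2 \<le> cos (1::real)"
  proof -
    have "cos (pi/3) \<le> cos (1::real)" using pi_gt3 by (intro cos_monotone_0_pi_le) auto
    then show ?thesis by (simp add: cos_60)
  qed
  have A: "y / 4 \<le> sin y" if y: "0 < y" "y \<le> pi / 2" for y
  proof (cases "y \<le> 1")
    case True
    obtain z where z: "0 < z" "z < y" "sin y - sin 0 = (y - 0) * cos z"
      using MVT2[of 0 y sin cos] y by (auto intro: DERIV_sin)
    have "cos 1 \<le> cos z" using z True pi_gt3 by (intro cos_monotone_0_pi_le) auto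
    then have "y * (1/4) \<le> y * cos z" using c1 y by (intro mult_left_mono) auto
    then show ?thesis using z by simp
  next
    case False
    obtain z where z: "0 < z" "z < 1" "sin (1::real) - sin 0 = (1 - 0) * cos z"
      using MVT2[of 0 1 sin cos] by (auto intro: DERIV_sin)
    have "cos 1 \<le> cos z" using z pi_gt3 by (intro cos_monotone_0_pi_le) auto
    moreover have "sin 1 \<le> sin y" using False y by (intro sin_monotone_2pi_le) auto
    ultimately show ?thesis using z c1 y pi_less_4 by simp
  qed
  have B: "1 / sqrt (sin y) \<le> 2 * (1 / sqrt y)" if y: "0 < y" "y \<le> pi / 2" for y
  proof -
    have "sqrt (y / 4) \<le> sqrt (sin y)" using A[OF y] by simp
    then have "1 / sqrt (sin y) \<le> 1 / sqrt (y / 4)" using y by (intro divide_left_mono) auto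
    then show ?thesis by (simp add: real_sqrt_divide)
  qed
  show ?thesis
  proof (cases "x \<le> pi / 2")
    case True
    have "0 \<le> 1 / sqrt (pi - x)" using assms by simp
    then show ?thesis using B[of x] True assms by argo
  next
    case False
    have "0 \<le> 1 / sqrt x" using assms by simp
    moreover have "sin (pi - x) = sin x" by simp
    ultimately have "1 / sqrt (sin x) \<le> 2 * (1 / sqrt (pi - x))" "0 \<le> 1 / sqrt x"
      using B[of "pi - x"] False assms by auto
    then show ?thesis by argo
  qed
qed

lemma inverse_weight_integrable: "integrable leb_pi (\<lambda>x. 1 / \<omega> x)"
proof -
  let ?D = "\<lambda>x::real. 1 / sqrt x + 1 / sqrt (pi - x)"
  have "(?D has_integral ((2 * sqrt pi - 2 * sqrt (pi - pi)) - (2 * sqrt 0 - 2 * sqrt (pi - 0)))) {0..pi}"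
  proof (rule fundamental_theorem_of_calculus_interior)
    fix x assume x: "x \<in> {0<..<pi}"
    have "((\<lambda>x. 2 * sqrt x - 2 * sqrt (pi - x)) has_real_derivative ?D x) (at x)"
      using x by (auto intro!: derivative_eq_intros simp: field_simps)
    then show "((\<lambda>x. 2 * sqrt x - 2 * sqrt (pi - x)) has_vector_derivative ?D x) (at x)"
      by (simp add: has_real_derivative_iff_has_vector_derivative)
  qed (auto intro!: continuous_intros)
  then have "?D absolutely_integrable_on {0..pi}"
    by (intro nonnegative_absolutely_integrable_1) auto
  then have "integrable (lebesgue_on {0..pi}) ?D" by (rule absolutely_integrable_imp_integrable) simp
  then have D: "integrable leb_pi ?D" by (rule integrable_lebesgue_on_subset) auto
  show ?thesis
  proof (rule Bochner_Integration.integrable_bound[OF integrable_mult_right[OF D, of 2]])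
    show "AE x in leb_pi. norm (1 / \<omega> x) \<le> norm (2 * ?D x)"
    proof (rule AE_I2)
      fix x assume "x \<in> space leb_pi"
      then have x: "0 < x" "x < pi" by auto
      have "norm (1 / \<omega> x) = 1 / sqrt (sin x)" using \<omega>_pos[OF x] by (simp add: \<omega>_def)
      also have "\<dots> \<le> 2 * ?D x" by (rule sin_lower_bound[OF x])
      finally show "norm (1 / \<omega> x) \<le> norm (2 * ?D x)" by simp
    qed
  qed measurable
qed

definition inverse_weight_total :: real where "inverse_weight_total = (LINT x|leb_pi. 1 / \<omega> x)"

lemma inverse_weight_total_nonneg: "0 \<le> inverse_weight_total"
  unfolding inverse_weight_total_def by (intro Bochner_Integration.integral_nonneg) (auto intro: less_imp_le[OF \<omega>_pos])

text \<open>In \<open>H\<close> the squared norm of \<open>1 / \<omega>\<close> is the unweighted integral of \<open>1 / \<omega>\<close>, which is finite since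
  \<open>\<omega>\<close> vanishes like a square root.\<close>

lemma inverse_weight_L2: "(\<lambda>x. complex_of_real (1 / \<omega> x)) \<in> L2 hmeas" (is ?A)
  and inverse_weight_nsq: "nsq hmeas (\<lambda>x. complex_of_real (1 / \<omega> x)) = inverse_weight_total" (is ?B)
proof -
  have m: "(\<lambda>x. (cmod (complex_of_real (1 / \<omega> x)))\<^sup>2) \<in> borel_measurable leb_pi" by measurable
  have e: "\<omega> x *\<^sub>R (cmod (complex_of_real (1 / \<omega> x)))\<^sup>2 = 1 / \<omega> x" if "x \<in> space leb_pi" for x
    using \<omega>_pos[of x] that by (simp add: norm_divide power2_eq_square)
  have "integrable hmeas (\<lambda>x. (cmod (complex_of_real (1 / \<omega> x)))\<^sup>2)"
    unfolding integrable_hmeas[OF m]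
    using inverse_weight_integrable e by (subst Bochner_Integration.integrable_cong[OF refl, of _ _ "\<lambda>x. 1 / \<omega> x"]) auto
  then show ?A by (intro L2I) (auto simp: borel_measurable_hmeas)
  show ?B unfolding nsq_def integral_hmeas[OF m] inverse_weight_total_def
    using e by (intro Bochner_Integration.integral_cong) auto
qed

text \<open>The Cauchy--Schwarz inequality against \<open>1 / \<omega>\<close>. Derivatives of elements of the form domain are
  integrable up to the endpoints for this reason, which is what makes traces exist.\<close>

lemma L2_hmeas_integrable: "g \<in> L2 hmeas \<Longrightarrow> integrable leb_pi g" (is "_ \<Longrightarrow> ?A")
  and L2_hmeas_L1_bound: "g \<in> L2 hmeas \<Longrightarrow> (LINT x|leb_pi. cmod (g x))\<^sup>2 \<le> inverse_weight_total * nsq hmeas g" (is "_ \<Longrightarrow> ?B")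
proof -
  assume g: "g \<in> L2 hmeas"
  have gm[measurable]: "g \<in> borel_measurable leb_pi" using L2D(1)[OF g] by (simp add: borel_measurable_hmeas)
  have m: "(\<lambda>x. cmod (g x) * cmod (complex_of_real (1 / \<omega> x))) \<in> borel_measurable leb_pi" by measurable
  have e: "\<omega> x *\<^sub>R (cmod (g x) * cmod (complex_of_real (1 / \<omega> x))) = cmod (g x)" if "x \<in> space leb_pi" for x
    using \<omega>_pos[of x] that by (simp add: norm_divide)
  have "integrable hmeas (\<lambda>x. cmod (g x) * cmod (complex_of_real (1 / \<omega> x)))"
    by (rule L2_mult_integrable(3)[OF g inverse_weight_L2])
  then have "integrable leb_pi (\<lambda>x. cmod (g x))"
    unfolding integrable_hmeas[OF m] using e
    by (subst (asm) Bochner_Integration.integrable_cong[OF refl, of _ _ "\<lambda>x. cmod (g x)"]) auto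
  then show ?A by (simp add: integrable_norm_iff)
  have "(LINT x|hmeas. cmod (g x) * cmod (complex_of_real (1 / \<omega> x))) = (LINT x|leb_pi. cmod (g x))"
    unfolding integral_hmeas[OF m] using e by (intro Bochner_Integration.integral_cong) auto
  then show ?B using Cauchy_Schwarz_integral[OF g inverse_weight_L2] unfolding inverse_weight_nsq
    by (simp add: mult.commute)
qed

subsection \<open>Weak derivatives on the interval\<close>

lemma L2_loc_L1_loc:
  assumes "f \<in> L2_loc" shows "L1_loc 0 pi f"
  unfolding L1_loc_def
proof (intro allI impI)
  fix p q :: real assume pq: "0 < p \<and> q < pi"
  have f: "f \<in> borel_measurable leb_pi" "integrable (lebesgue_on {p..q}) (\<lambda>x. (cmod (f x))\<^sup>2)"
    using assms pq by (auto simp: L2_loc_def)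
  have "f \<in> borel_measurable (lebesgue_on {p..q})"
    using f(1) by (rule measurable_restrict_mono) (use pq in auto)
  moreover have "integrable (lebesgue_on {p..q}) (\<lambda>x. 1 + (cmod (f x))\<^sup>2)" using f by auto
  moreover have "cmod z \<le> 1 + (cmod z)\<^sup>2" for z :: complex
    using zero_le_power2[of "cmod z - 1"] by (simp add: power2_diff) (smt (verit) norm_ge_zero)
  ultimately show "integrable (lebesgue_on {p..q}) f"
    by (auto intro: Bochner_Integration.integrable_bound[where f="\<lambda>x. 1 + (cmod (f x))\<^sup>2"])
qed

lemma L2_hmeas_L2_loc:
  assumes "f \<in> L2 hmeas" shows "f \<in> L2_loc"
  unfolding L2_loc_def
proof (intro CollectI conjI allI impI)
  show fm: "f \<in> borel_measurable leb_pi" using L2D(1)[OF assms] by (simp add: borel_measurable_hmeas)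
  fix p q :: real assume pq: "0 < p \<and> q < pi"
  note [measurable] = fm
  have i: "integrable leb_pi (\<lambda>x. \<omega> x *\<^sub>R (cmod (f x))\<^sup>2)"
    using L2D(2)[OF assms] by (subst (asm) integrable_hmeas) auto
  show "integrable (lebesgue_on {p..q}) (\<lambda>x. (cmod (f x))\<^sup>2)"
  proof (cases "p \<le> q")
    case True
    obtain z where z: "z \<in> {p..q}" "\<And>x. x \<in> {p..q} \<Longrightarrow> \<omega> z \<le> \<omega> x"
      using continuous_attains_inf[of "{p..q}" \<omega>] \<omega>_cont True by auto
    have zp: "\<omega> z > 0" using z pq by (intro \<omega>_pos) auto
    have i': "integrable (lebesgue_on {p..q}) (\<lambda>x. \<omega> x *\<^sub>R (cmod (f x))\<^sup>2)"
      using i by (rule integrable_lebesgue_on_subset) (use pq in auto)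
    have fm': "f \<in> borel_measurable (lebesgue_on {p..q})"
      using fm by (rule measurable_restrict_mono) (use pq in auto)
    show ?thesis
    proof (rule Bochner_Integration.integrable_bound[OF integrable_mult_right[OF i', of "1 / \<omega> z"]])
      show "(\<lambda>x. (cmod (f x))\<^sup>2) \<in> borel_measurable (lebesgue_on {p..q})" using fm' by measurable
      show "AE x in lebesgue_on {p..q}. norm ((cmod (f x))\<^sup>2) \<le> norm (1 / \<omega> z * \<omega> x *\<^sub>R (cmod (f x))\<^sup>2)"
      proof (rule AE_I2)
        fix x assume "x \<in> space (lebesgue_on {p..q})"
        then have "1 \<le> \<omega> x / \<omega> z" using z(2)[of x] zp by simp
        then have "1 * (cmod (f x))\<^sup>2 \<le> \<omega> x / \<omega> z * (cmod (f x))\<^sup>2" by (rule mult_right_mono) simp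
        then have "norm ((cmod (f x))\<^sup>2) \<le> 1 / \<omega> z * \<omega> x *\<^sub>R (cmod (f x))\<^sup>2" by simp
        then show "norm ((cmod (f x))\<^sup>2) \<le> norm (1 / \<omega> z * \<omega> x *\<^sub>R (cmod (f x))\<^sup>2)"
          unfolding real_norm_def[of "1 / \<omega> z * \<omega> x *\<^sub>R (cmod (f x))\<^sup>2"] by (rule order_trans[OF _ abs_ge_self])
      qed
    qed
  qed auto
qed

lemma test_function_smooth: "\<theta> \<in> test_functions S \<Longrightarrow> smooth \<theta>"
  by (auto simp: test_functions_def smooth_def)

lemma test_function_support:
  assumes "\<theta> \<in> test_functions {a<..<b}" "a < (b::real)"
  obtains p q where "a < p" "p < q" "q < b" "\<And>x. x \<notin> {p<..<q} \<Longrightarrow> \<theta> x = 0"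
    "\<And>x. x \<notin> {p<..<q} \<Longrightarrow> deriv \<theta> x = 0"
proof -
  obtain K where K: "compact K" "K \<subseteq> {a<..<b}" "\<And>x. x \<notin> K \<Longrightarrow> \<theta> x = 0"
    using assms by (auto simp: test_functions_def)
  obtain l u where lu: "a < l" "l \<le> u" "u < b" "K \<subseteq> {l..u}"
  proof (cases "K = {}")
    case True
    obtain c where "a < c" "c < b" using dense[OF assms(2)] by auto
    then show ?thesis using that[of c c] True by auto
  next
    case False
    obtain l where "l \<in> K" "\<And>x. x \<in> K \<Longrightarrow> l \<le> x" using compact_attains_inf[OF K(1) False] by auto
    moreover obtain u where "u \<in> K" "\<And>x. x \<in> K \<Longrightarrow> x \<le> u" using compact_attains_sup[OF K(1) False] by auto
    ultimately show ?thesis using that[of l u] K(2) by (auto simp: subset_iff)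
  qed
  obtain p where p: "a < p" "p < l" using dense[OF lu(1)] by auto
  obtain q where q: "u < q" "q < b" using dense[OF lu(3)] by auto
  have z: "\<theta> x = 0" if "x \<notin> {l..u}" for x using K(3)[of x] lu(4) that by blast
  have "deriv \<theta> x = 0" if x: "x \<notin> {p<..<q}" for x
  proof -
    have "((\<lambda>x. 0) has_real_derivative 0) (at x)" by simp
    then have "(\<theta> has_real_derivative 0) (at x)"
      by (rule has_field_derivative_transform_within_open[where S="- {l..u}"])
        (use x p q z in \<open>auto intro!: open_Compl\<close>)
    then show ?thesis by (rule DERIV_imp_deriv)
  qed
  moreover have "\<theta> x = 0" if "x \<notin> {p<..<q}" for x using z[of x] that p q by auto
  ultimately show ?thesis using that[of p q] p q lu by auto
qed

lemma test_times_integrable: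
  assumes "\<theta> \<in> test_functions {0<..<pi}" "L1_loc 0 pi f"
  shows "integrable leb_pi (\<lambda>x. complex_of_real (\<theta> x) * f x)"
    "integrable leb_pi (\<lambda>x. complex_of_real (deriv \<theta> x) * f x)"
proof -
  obtain p q where pq: "0 < p" "p < q" "q < pi" "\<And>x. x \<notin> {p<..<q} \<Longrightarrow> \<theta> x = 0"
    "\<And>x. x \<notin> {p<..<q} \<Longrightarrow> deriv \<theta> x = 0"
    using test_function_support[OF assms(1) pi_gt_zero] by metis
  have s: "smooth \<theta>" using assms(1) by (rule test_function_smooth)
  have f: "integrable (lebesgue_on {p..q}) f" using assms(2) pq by (auto simp: L1_loc_def)
  have *: "integrable leb_pi (\<lambda>x. complex_of_real (g x) * f x)"
    if g: "smooth g" "\<And>x. x \<notin> {p<..<q} \<Longrightarrow> g x = 0" for g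
  proof -
    have "integrable (lebesgue_on {p..q}) (\<lambda>x. complex_of_real (g x) * f x)"
      using f by (rule continuous_times_integrable) (auto intro: smooth_continuous g)
    then have "integrable lebesgue (\<lambda>x. if x \<in> {p..q} then complex_of_real (g x) * f x else 0)"
      by (subst Lebesgue_Measure.integrable_restrict_UNIV) auto
    also have "(\<lambda>x. if x \<in> {p..q} then complex_of_real (g x) * f x else 0)
            = (\<lambda>x. if x \<in> {0<..<pi} then complex_of_real (g x) * f x else 0)"
      using pq g(2) by (auto simp: fun_eq_iff)
    finally show ?thesis by (subst (asm) Lebesgue_Measure.integrable_restrict_UNIV) auto
  qed
  show "integrable leb_pi (\<lambda>x. complex_of_real (\<theta> x) * f x)"
    "integrable leb_pi (\<lambda>x. complex_of_real (deriv \<theta> x) * f x)"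
    using s pq by (auto intro!: *)
qed

lemma is_weak_deriv_diff:
  assumes "is_weak_deriv f g" "is_weak_deriv f' g'" "L1_loc 0 pi f" "L1_loc 0 pi g" "L1_loc 0 pi f'" "L1_loc 0 pi g'"
  shows "is_weak_deriv (\<lambda>x. f x - f' x) (\<lambda>x. g x - g' x)"
  using assms unfolding is_weak_deriv_def right_diff_distrib
  by (auto simp: test_times_integrable)

lemma weak_deriv_unique:
  assumes "is_weak_deriv f g" "is_weak_deriv f g'" "L1_loc 0 pi f" "L1_loc 0 pi g" "L1_loc 0 pi g'"
  shows "AE x in leb_pi. g x = g' x"
proof -
  have "AE x in leb_pi. g x - g' x = 0"
  proof (rule fundamental_lemma)
    show "L1_loc 0 pi (\<lambda>x. g x - g' x)" using assms by (auto simp: L1_loc_def)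
    fix \<theta> assume "\<theta> \<in> test_functions {0<..<pi}"
    with is_weak_deriv_diff[OF assms(1,2) assms(3,4,3,5)]
    show "(LINT x|leb_pi. complex_of_real (\<theta> x) * (g x - g' x)) = 0"
      by (simp add: is_weak_deriv_def)
  qed
  then show ?thesis by simp
qed

lemma V_spaceD:
  assumes "f \<in> V_space"
  shows "f \<in> L2 hmeas" "wderiv f \<in> L2 hmeas" "is_weak_deriv f (wderiv f)"
proof -
  have "\<exists>g. g \<in> L2_loc \<and> is_weak_deriv f g" using assms by (auto simp: V_space_def H1_loc_def)
  then have w: "wderiv f \<in> L2_loc \<and> is_weak_deriv f (wderiv f)" unfolding wderiv_def by (rule someI_ex)
  show "f \<in> L2 hmeas" "is_weak_deriv f (wderiv f)" using assms w by (auto simp: V_space_def H_space_L2)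
  show "wderiv f \<in> L2 hmeas"
    using assms w by (intro L2I) (auto simp: V_space_def L2_loc_def borel_measurable_hmeas)
qed

text \<open>Weak derivatives are unique almost everywhere, so any square-integrable candidate may replace the
  derivative that is selected by choice.\<close>

lemma V_spaceI:
  assumes "f \<in> L2 hmeas" "g \<in> L2 hmeas" "is_weak_deriv f g"
  shows "f \<in> V_space" "AE x in hmeas. wderiv f x = g x"
proof -
  note loc = assms(1,2)[THEN L2_hmeas_L2_loc]
  have "\<exists>g. g \<in> L2_loc \<and> is_weak_deriv f g" using assms loc by auto
  then have w: "wderiv f \<in> L2_loc \<and> is_weak_deriv f (wderiv f)" unfolding wderiv_def by (rule someI_ex)
  have "AE x in leb_pi. wderiv f x = g x"
    using w assms loc by (intro weak_deriv_unique[of f]) (auto intro: L2_loc_L1_loc)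
  then show ae: "AE x in hmeas. wderiv f x = g x" by (simp add: AE_hmeas)
  have "wderiv f \<in> L2 hmeas"
    by (rule L2_cong_AE[OF assms(2) _ ae]) (use w in \<open>auto simp: L2_loc_def borel_measurable_hmeas\<close>)
  then show "f \<in> V_space" using assms loc by (auto simp: V_space_def H_space_L2 H1_loc_def dest: L2D)
qed

subsection \<open>Absolutely continuous representatives\<close>

lemma integral_combine_complex:
  fixes g :: "real \<Rightarrow> 'b::euclidean_space"
  assumes "g integrable_on {0..pi}" "0 \<le> x" "x \<le> y" "y \<le> pi"
  shows "integral {0..y} g - integral {0..x} g = integral {x..y} g"
proof -
  have "g integrable_on {0..y}" by (rule integrable_subinterval_real[OF assms(1)]) (use assms in auto)
  then show ?thesis
    using Henstock_Kurzweil_Integration.integral_combine[of 0 x y g] assms by (auto simp: algebra_simps)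
qed

text \<open>Integration by parts against an indefinite integral \<open>G\<close> of an integrable \<open>g\<close>. The function
  \<open>\<theta> G - \<integral> (\<theta>' G + \<theta> g)\<close> has increments of the order \<open>\<bar>y - x\<bar>\<close> times the integral of \<open>\<bar>g\<bar>\<close> over
  the interval, hence derivative zero everywhere.\<close>

lemma indefinite_integral_by_parts:
  fixes g :: "real \<Rightarrow> complex"
  assumes g: "integrable (lebesgue_on {0..pi}) g"
    and \<theta>: "continuous_on {0..pi} \<theta>" "\<And>x. x \<in> {0<..<pi} \<Longrightarrow> (\<theta> has_real_derivative \<theta>' x) (at x)"
    and \<theta>': "continuous_on {0..pi} \<theta>'" and ends: "\<theta> 0 = 0" "\<theta> pi = 0"
  defines "G \<equiv> \<lambda>x. integral {0..x} g"
  shows "((\<lambda>x. complex_of_real (\<theta>' x) * G x + complex_of_real (\<theta> x) * g x) has_integral 0) {0..pi}"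
proof -
  let ?c = "complex_of_real"
  define A where "A x = integral {0..x} (\<lambda>t. cmod (g t))" for x
  define k where "k x = ?c (\<theta>' x) * G x + ?c (\<theta> x) * g x" for x
  define \<Phi> where "\<Phi> x = ?c (\<theta> x) * G x - integral {0..x} k" for x
  have gI: "g integrable_on {0..pi}" "(\<lambda>t. cmod (g t)) integrable_on {0..pi}"
    using g integrable_on_lebesgue_on[OF g] integrable_on_lebesgue_on[OF integrable_norm[OF g]] by auto
  have Gc: "continuous_on {0..pi} G" and Ac: "continuous_on {0..pi} A"
    unfolding G_def A_def by (intro indefinite_integral_continuous_1 gI)+
  have t1: "integrable (lebesgue_on {0..pi}) (\<lambda>x. ?c (\<theta>' x) * G x)"
    by (rule continuous_times_integrable[OF continuous_imp_integrable_real[OF Gc] \<theta>']) auto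
  have t2: "integrable (lebesgue_on {0..pi}) (\<lambda>x. ?c (\<theta> x) * g x)"
    by (rule continuous_times_integrable[OF g \<theta>(1)]) auto
  have kI: "k integrable_on {0..pi}"
    unfolding k_def by (rule integrable_on_lebesgue_on[OF Bochner_Integration.integrable_add[OF t1 t2]]) simp
  obtain B where "\<forall>y\<in>\<theta>' ` {0..pi}. norm y \<le> B"
    using compact_imp_bounded[OF compact_continuous_image[OF \<theta>' compact_Icc]]
    unfolding bounded_iff by blast
  then have B: "\<And>x. x \<in> {0..pi} \<Longrightarrow> \<bar>\<theta>' x\<bar> \<le> B" by auto
  have B0: "0 \<le> B" using B[of 0] by auto
  have ftc: "(\<theta>' has_integral (\<theta> y - \<theta> x)) {x..y}" if "0 \<le> x" "x \<le> y" "y \<le> pi" for x y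
    by (rule fundamental_theorem_of_calculus_interior)
      (use that \<theta>(2) in \<open>auto simp: has_real_derivative_iff_has_vector_derivative[symmetric] intro: continuous_on_subset[OF \<theta>(1)]\<close>)
  have lip': "\<bar>\<theta> y - \<theta> x\<bar> \<le> B * (y - x)" if "0 \<le> x" "x \<le> y" "y \<le> pi" for x y
    using has_integral_bound_real[OF B0 finite.emptyI ftc[OF that]] B that by auto
  have lip: "\<bar>\<theta> x - \<theta> y\<bar> \<le> B * \<bar>x - y\<bar>" if "x \<in> {0..pi}" "y \<in> {0..pi}" for x y
    using lip'[of x y] lip'[of y x] that by (cases "x \<le> y") (auto simp: abs_minus_commute)
  have AG: "cmod (G y - G x) \<le> A y - A x" if "0 \<le> x" "x \<le> y" "y \<le> pi" for x y
    unfolding G_def A_def integral_combine_complex[OF gI(1) that] integral_combine_complex[OF gI(2) that]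
    by (rule integral_norm_bound_integral) (use that in \<open>auto intro!: integrable_subinterval_real[OF gI(1)] integrable_subinterval_real[OF gI(2)]\<close>)
  \<comment> \<open>\<open>A\<close> is continuous, so the increments of \<open>\<Phi>\<close> are of smaller order than \<open>y - x\<close>\<close>
  have inc: "cmod (\<Phi> y - \<Phi> x) \<le> 2 * B * (y - x) * (A y - A x)" if xy: "0 \<le> x" "x \<le> y" "y \<le> pi" for x y
  proof -
    have sub: "{x..y} \<subseteq> {0..pi}" using xy by auto
    have th: "((\<lambda>t. ?c (\<theta>' t) * G y) has_integral ((?c (\<theta> y) - ?c (\<theta> x)) * G y)) {x..y}"
    proof -
      have "(\<theta>' has_integral (\<theta> y - \<theta> x)) {x..y}" by (rule ftc[OF xy])
      then have "((\<lambda>t. ?c (\<theta>' t)) has_integral ?c (\<theta> y - \<theta> x)) {x..y}" by (rule has_integral_of_real)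
      from has_integral_mult_left[OF this, of "G y"] show ?thesis by simp
    qed
    have gh: "((\<lambda>t. ?c (\<theta> x) * g t) has_integral (?c (\<theta> x) * (G y - G x))) {x..y}"
      unfolding G_def integral_combine_complex[OF gI(1) xy]
      by (intro has_integral_mult_right integrable_integral integrable_subinterval_real[OF gI(1) sub])
    have kh: "(k has_integral (integral {0..y} k - integral {0..x} k)) {x..y}"
      unfolding integral_combine_complex[OF kI xy]
      by (intro integrable_integral integrable_subinterval_real[OF kI sub])
    have "((\<lambda>t. ?c (\<theta>' t) * G y + ?c (\<theta> x) * g t - k t) has_integral
        ((?c (\<theta> y) - ?c (\<theta> x)) * G y + ?c (\<theta> x) * (G y - G x) - (integral {0..y} k - integral {0..x} k))) {x..y}"
      by (intro has_integral_diff has_integral_add th gh kh)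
    also have "((?c (\<theta> y) - ?c (\<theta> x)) * G y + ?c (\<theta> x) * (G y - G x) - (integral {0..y} k - integral {0..x} k)) = \<Phi> y - \<Phi> x"
      by (simp add: \<Phi>_def algebra_simps)
    finally have h: "((\<lambda>t. ?c (\<theta>' t) * G y + ?c (\<theta> x) * g t - k t) has_integral (\<Phi> y - \<Phi> x)) {x..y}" .
    have b: "((\<lambda>t. B * (A y - A x) + B * (y - x) * cmod (g t)) has_integral ((y - x) * (B * (A y - A x)) + B * (y - x) * (A y - A x))) {x..y}"
    proof (intro has_integral_add has_integral_mult_right)
      show "((\<lambda>t. B * (A y - A x)) has_integral (y - x) * (B * (A y - A x))) {x..y}"
        using has_integral_const_real[of "B * (A y - A x)" x y] xy by simp
      show "((\<lambda>t. cmod (g t)) has_integral A y - A x) {x..y}"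
        unfolding A_def integral_combine_complex[OF gI(2) xy]
        by (intro integrable_integral integrable_subinterval_real[OF gI(2) sub])
    qed
    have "cmod (\<Phi> y - \<Phi> x) \<le> (y - x) * (B * (A y - A x)) + B * (y - x) * (A y - A x)"
      unfolding integral_unique[OF h, symmetric] integral_unique[OF b, symmetric]
    proof (rule integral_norm_bound_integral)
      fix t assume t: "t \<in> {x..y}"
      have "cmod (?c (\<theta>' t) * G y + ?c (\<theta> x) * g t - k t)
          = cmod (?c (\<theta>' t) * (G y - G t) + ?c (\<theta> x - \<theta> t) * g t)"
        by (simp add: k_def algebra_simps)
      also have "\<dots> \<le> \<bar>\<theta>' t\<bar> * cmod (G y - G t) + \<bar>\<theta> x - \<theta> t\<bar> * cmod (g t)"
        by (rule order_trans[OF norm_triangle_ineq]) (simp add: norm_mult del: of_real_diff)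
      also have "\<dots> \<le> B * (A y - A x) + (B * (y - x)) * cmod (g t)"
      proof (intro add_mono mult_mono mult_right_mono)
        have "0 \<le> A t - A x" using order_trans[OF norm_ge_zero AG[of x t]] t xy by auto
        then show "cmod (G y - G t) \<le> A y - A x" using AG[of t y] t xy by auto
        have "B * \<bar>x - t\<bar> \<le> B * (y - x)" using t B0 by (intro mult_left_mono) auto
        then show "\<bar>\<theta> x - \<theta> t\<bar> \<le> B * (y - x)" using lip[of x t] t xy by auto
        show "\<bar>\<theta>' t\<bar> \<le> B" using B[of t] t xy by auto
      qed (use B0 t in auto)
      finally show "cmod (?c (\<theta>' t) * G y + ?c (\<theta> x) * g t - k t) \<le> B * (A y - A x) + B * (y - x) * cmod (g t)" .
    qed (use h b in blast)+
    then show ?thesis by (simp add: algebra_simps)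
  qed
  have "(\<Phi> has_derivative (\<lambda>h. 0)) (at x within {0..pi})" if x: "x \<in> {0..pi}" for x
    unfolding has_derivative_iff_norm
  proof (intro conjI)
    have "(A \<longlongrightarrow> A x) (at x within {0..pi})" using Ac x by (auto simp: continuous_on_def)
    then have lim: "((\<lambda>y. 2 * B * \<bar>A y - A x\<bar>) \<longlongrightarrow> 2 * B * \<bar>A x - A x\<bar>) (at x within {0..pi})"
      by (intro tendsto_intros)
    show "((\<lambda>y. norm (\<Phi> y - \<Phi> x - 0) / norm (y - x)) \<longlongrightarrow> 0) (at x within {0..pi})"
    proof (rule Lim_null_comparison[OF _ lim[simplified]])
      have "norm (\<Phi> y - \<Phi> x) / norm (y - x) \<le> 2 * B * \<bar>A y - A x\<bar>" if "y \<in> {0..pi}" "y \<noteq> x" for y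
      proof -
        have "norm (\<Phi> y - \<Phi> x) \<le> 2 * B * \<bar>y - x\<bar> * \<bar>A y - A x\<bar>"
        proof (cases "x \<le> y")
          case True
          have "0 \<le> A y - A x" using order_trans[OF norm_ge_zero AG[of x y]] True that x by auto
          then show ?thesis using inc[of x y] True that x by auto
        next
          case False
          have "0 \<le> A x - A y" using order_trans[OF norm_ge_zero AG[of y x]] False that x by auto
          then show ?thesis using inc[of y x] False that x by (auto simp: norm_minus_commute)
        qed
        then show ?thesis using that by (simp add: field_simps)
      qed
      then show "\<forall>\<^sub>F y in at x within {0..pi}. norm (norm (\<Phi> y - \<Phi> x - 0) / norm (y - x)) \<le> 2 * B * \<bar>A y - A x\<bar>"
        by (auto simp: eventually_at_filter)
    qed
  qed auto
  then obtain c where c: "\<And>x. x \<in> {0..pi} \<Longrightarrow> \<Phi> x = c"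
    using has_derivative_zero_constant[of "{0..pi}" \<Phi>] by auto
  have "\<Phi> 0 = \<Phi> pi" using c by simp
  then have "integral {0..pi} k = 0" using ends by (simp add: \<Phi>_def G_def)
  then have "(k has_integral 0) {0..pi}" using kI by (simp add: has_integral_iff)
  then show ?thesis unfolding k_def[abs_def] .
qed

definition antideriv :: "(real \<Rightarrow> complex) \<Rightarrow> real \<Rightarrow> complex" where
  "antideriv g x = integral {0..x} g"

lemma integrable_closed_interval:
  "integrable leb_pi g \<Longrightarrow> integrable (lebesgue_on {0..pi}) (g :: real \<Rightarrow> complex)"
proof -
  assume g: "integrable leb_pi g"
  define g' where "g' x = (if x \<in> {0<..<pi} then g x else 0)" for x
  have "integrable lebesgue g'"
    unfolding g'_def using g by (subst Lebesgue_Measure.integrable_restrict_UNIV) auto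
  then have 1: "integrable lebesgue g'" .
  have ae: "AE x in lebesgue. g' x = (if x \<in> {0..pi} then g x else 0)"
  proof -
    have "{0, pi} \<in> null_sets lebesgue"
      by (simp add: negligible_iff_null_sets[symmetric])
    then have "AE x in lebesgue. x \<notin> {0, pi}" by (rule AE_not_in)
    then show ?thesis by eventually_elim (auto simp: g'_def)
  qed
  have "(\<lambda>x. if x \<in> {0..pi} then g x else 0) \<in> borel_measurable lebesgue"
    by (rule borel_measurable_AE[OF _ ae]) (use 1 in auto)
  with 1 have "integrable lebesgue (\<lambda>x. if x \<in> {0..pi} then g x else 0)"
    by (rule integrable_cong_AE_imp) (use ae in eventually_elim, simp)
  then show ?thesis by (subst (asm) Lebesgue_Measure.integrable_restrict_UNIV) auto
qed

lemma antideriv_continuous: "integrable leb_pi g \<Longrightarrow> continuous_on {0..pi} (antideriv g)"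
  unfolding antideriv_def
  by (intro indefinite_integral_continuous_1 integrable_on_lebesgue_on[OF integrable_closed_interval]) auto

lemma continuous_L2_hmeas:
  assumes "continuous_on {0..pi} h" shows "h \<in> L2 hmeas"
proof (rule L2I)
  have m: "h \<in> borel_measurable leb_pi"
    by (rule continuous_imp_measurable_on_sets_lebesgue[OF continuous_on_subset[OF assms]]) auto
  then show "h \<in> borel_measurable hmeas" by (simp add: borel_measurable_hmeas)
  have "integrable (lebesgue_on {0..pi}) (\<lambda>x. \<omega> x *\<^sub>R (cmod (h x))\<^sup>2)"
    by (intro continuous_imp_integrable_real continuous_intros \<omega>_cont assms)
  then have "integrable leb_pi (\<lambda>x. \<omega> x *\<^sub>R (cmod (h x))\<^sup>2)" by (rule integrable_lebesgue_on_subset) auto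
  then show "integrable hmeas (\<lambda>x. (cmod (h x))\<^sup>2)" using m by (subst integrable_hmeas) auto
qed

lemma antideriv_weak:
  assumes "integrable leb_pi g" shows "is_weak_deriv (antideriv g) g"
  unfolding is_weak_deriv_def
proof
  fix \<theta> assume \<theta>: "\<theta> \<in> test_functions {0<..<pi}"
  have L: "L1_loc 0 pi g"
    unfolding L1_loc_def by (intro allI impI integrable_lebesgue_on_subset[OF assms]) auto
  have L': "L1_loc 0 pi (antideriv g)"
    using continuous_L2_hmeas[OF antideriv_continuous[OF assms]] by (intro L2_loc_L1_loc L2_hmeas_L2_loc)
  note i = test_times_integrable(2)[OF \<theta> L'] test_times_integrable(1)[OF \<theta> L]
  have "((\<lambda>x. complex_of_real (deriv \<theta> x) * antideriv g x + complex_of_real (\<theta> x) * g x) has_integral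
     (LINT x|leb_pi. complex_of_real (deriv \<theta> x) * antideriv g x + complex_of_real (\<theta> x) * g x)) {0<..<pi}"
    by (intro has_integral_integral_lebesgue_on Bochner_Integration.integrable_add i) auto
  moreover have "((\<lambda>x. complex_of_real (deriv \<theta> x) * antideriv g x + complex_of_real (\<theta> x) * g x) has_integral 0) {0<..<pi}"
  proof -
    obtain p q where pq: "0 < p" "p < q" "q < pi" "\<And>x. x \<notin> {p<..<q} \<Longrightarrow> \<theta> x = 0"
      using test_function_support[OF \<theta> pi_gt_zero] by metis
    have s: "smooth \<theta>" "smooth (deriv \<theta>)" using \<theta> test_function_smooth by blast+
    show ?thesis
      using indefinite_integral_by_parts[OF integrable_closed_interval[OF assms] smooth_continuous[OF s(1)]
          smooth_DERIV[OF s(1)] smooth_continuous[OF s(2)]] pq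
      by (simp add: has_integral_Icc_iff_Ioo antideriv_def)
  qed
  ultimately have "(LINT x|leb_pi. complex_of_real (deriv \<theta> x) * antideriv g x + complex_of_real (\<theta> x) * g x) = 0"
    by (rule has_integral_unique)
  then show "(LINT x|leb_pi. complex_of_real (deriv \<theta> x) * antideriv g x) = - (LINT x|leb_pi. complex_of_real (\<theta> x) * g x)"
    using i by (simp add: eq_neg_iff_add_eq_0)
qed

text \<open>The difference of \<open>f\<close> and the indefinite integral of its weak derivative has weak derivative zero.\<close>

lemma V_space_representation:
  assumes "f \<in> V_space"
  obtains c where "AE x in hmeas. c + antideriv (wderiv f) x = f x"
proof -
  note V = V_spaceD[OF assms]
  have g: "integrable leb_pi (wderiv f)" using V(2) by (rule L2_hmeas_integrable)
  have L: "L1_loc 0 pi f" "L1_loc 0 pi (wderiv f)" "L1_loc 0 pi (antideriv (wderiv f))"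
    using V continuous_L2_hmeas[OF antideriv_continuous[OF g]] by (auto intro: L2_loc_L1_loc L2_hmeas_L2_loc)
  have "\<exists>C. AE x in leb_pi. f x - antideriv (wderiv f) x = C"
  proof (rule du_Bois_Reymond)
    show "L1_loc 0 pi (\<lambda>x. f x - antideriv (wderiv f) x)" using L by (auto simp: L1_loc_def)
    fix \<theta> assume "\<theta> \<in> test_functions {0<..<pi}"
    with is_weak_deriv_diff[OF V(3) antideriv_weak[OF g] L(1,2,3,2)]
    show "(LINT x|leb_pi. complex_of_real (deriv \<theta> x) * (f x - antideriv (wderiv f) x)) = 0"
      by (simp add: is_weak_deriv_def)
  qed simp
  then obtain C where "AE x in leb_pi. f x - antideriv (wderiv f) x = C" by auto
  then have "AE x in hmeas. C + antideriv (wderiv f) x = f x"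
    unfolding AE_hmeas by eventually_elim (simp add: algebra_simps)
  with that show ?thesis by blast
qed

subsection \<open>Traces\<close>

lemma continuous_AE_eq:
  fixes h k :: "real \<Rightarrow> complex"
  assumes "continuous_on {0..pi} h" "continuous_on {0..pi} k" "AE x in hmeas. h x = k x" "x \<in> {0..pi}"
  shows "h x = k x"
proof -
  let ?d = "\<lambda>x. cmod (h x - k x)"
  have c: "continuous_on {0..pi} ?d" by (intro continuous_intros assms)
  have i: "integrable (lebesgue_on {0..pi}) ?d" using c by (rule continuous_imp_integrable_real)
  have "(LINT x|lebesgue_on {0..pi}. ?d x) = integral {0..pi} ?d"
    by (rule lebesgue_integral_eq_integral[OF i]) simp
  also have "\<dots> = integral {0<..<pi} ?d" by (simp add: integral_open_interval_real)
  also have "\<dots> = (LINT x|leb_pi. ?d x)"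
    by (rule lebesgue_integral_eq_integral[symmetric, OF integrable_lebesgue_on_subset[OF i]]) auto
  also have "\<dots> = 0"
    using assms(3) by (intro integral_eq_zero_AE) (auto simp: AE_hmeas)
  finally have "\<forall>x\<in>{0..pi}. ?d x = 0"
    using integralL_eq_0_iff[OF c pi_gt_zero] by auto
  then show ?thesis using assms(4) by auto
qed

lemma cont_rep_eq:
  assumes "continuous_on {0..pi} h" "AE x in hmeas. h x = f x" "x \<in> {0..pi}"
  shows "cont_rep f x = h x"
proof -
  have "continuous_on {0..pi} (cont_rep f) \<and> (AE \<phi> in hmeas. cont_rep f \<phi> = f \<phi>)"
    unfolding cont_rep_def by (rule someI[of _ h]) (use assms in auto)
  moreover then have "AE x in hmeas. cont_rep f x = h x" using assms(2) by auto
  ultimately show ?thesis using assms by (intro continuous_AE_eq) auto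
qed

lemma cont_rep_V:
  assumes "f \<in> V_space"
  shows "continuous_on {0..pi} (cont_rep f)" "AE x in hmeas. cont_rep f x = f x"
    "x \<in> {0..pi} \<Longrightarrow> cont_rep f x - cont_rep f 0 = antideriv (wderiv f) x"
proof -
  obtain c where c: "AE x in hmeas. c + antideriv (wderiv f) x = f x" using V_space_representation[OF assms] .
  have cc: "continuous_on {0..pi} (\<lambda>x. c + antideriv (wderiv f) x)"
    by (intro continuous_intros antideriv_continuous L2_hmeas_integrable V_spaceD assms)
  have "continuous_on {0..pi} (cont_rep f) \<and> (AE \<phi> in hmeas. cont_rep f \<phi> = f \<phi>)"
    unfolding cont_rep_def by (rule someI[of _ "\<lambda>x. c + antideriv (wderiv f) x"]) (use c cc in auto)
  then show "continuous_on {0..pi} (cont_rep f)" "AE x in hmeas. cont_rep f x = f x" by auto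
  show "cont_rep f x - cont_rep f 0 = antideriv (wderiv f) x" if "x \<in> {0..pi}"
    using cont_rep_eq[OF cc c] that by (simp add: antideriv_def)
qed

lemma trace_op_component: "trace_op f $ 1 = cont_rep f 0" "trace_op f $ 2 = cont_rep f pi"
  by (simp_all add: trace_op_def)

lemma V_norm_sq: "(V_norm f)\<^sup>2 = 4 * nsq hmeas (wderiv f) + nsq hmeas f"
proof -
  have "a0 f f = complex_of_real (4 * nsq hmeas (wderiv f))"
    unfolding a0_def using ip_self[of hmeas "wderiv f"] by (simp add: ip_def)
  then show ?thesis by (simp add: V_norm_def H_norm_nsq)
qed

definition trace_const :: real where
  "trace_const = 2 * (4 * inverse_weight_total + 1) * (1 + 1 / (LINT x|leb_pi. \<omega> x))"

lemma weight_total_pos: "0 < (LINT x|leb_pi. \<omega> x)"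
proof -
  have i: "integrable (lebesgue_on {0..pi}) \<omega>" by (rule continuous_imp_integrable_real[OF \<omega>_cont])
  have "(LINT x|lebesgue_on {0..pi}. \<omega> x) = (LINT x|leb_pi. \<omega> x)"
    by (simp add: lebesgue_integral_eq_integral[OF i] lebesgue_integral_eq_integral[OF integrable_lebesgue_on_subset[OF i]] integral_open_interval_real subset_iff)
  moreover have "(LINT x|lebesgue_on {0..pi}. \<omega> x) \<noteq> 0"
  proof
    assume "(LINT x|lebesgue_on {0..pi}. \<omega> x) = 0"
    then have "\<forall>x\<in>{0..pi}. \<omega> x = 0"
      by (subst (asm) integralL_eq_0_iff[OF \<omega>_cont pi_gt_zero]) (auto simp: \<omega>_def sin_ge_zero)
    then have "\<omega> (pi/2) = 0" by auto
    then show False using \<omega>_pos[of "pi/2"] by simp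
  qed
  moreover have "0 \<le> (LINT x|leb_pi. \<omega> x)"
    by (intro Bochner_Integration.integral_nonneg) (auto intro: less_imp_le[OF \<omega>_pos])
  ultimately show ?thesis by linarith
qed

text \<open>The continuous representative oscillates by at most the integral of the derivative, which the
  integrability of \<open>1 / \<omega>\<close> bounds by the norm of the derivative. Averaging the square of
  \<open>h e = (h e - h x) + h x\<close> over \<open>x\<close> with the weight \<open>\<omega>\<close> then bounds the endpoint value.\<close>

lemma trace_bound:
  assumes f: "f \<in> V_space"
  shows "(cmod (trace_op f $ i))\<^sup>2 \<le> trace_const * (V_norm f)\<^sup>2"
proof -
  note V = V_spaceD[OF f]
  let ?g = "wderiv f" and ?h = "cont_rep f"
  define W where "W = (LINT x|leb_pi. \<omega> x)"
  have W: "W > 0" unfolding W_def by (rule weight_total_pos)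
  have gi: "integrable leb_pi ?g" using V(2) by (rule L2_hmeas_integrable)
  have gn: "?g integrable_on {0..pi}" "(\<lambda>x. cmod (?g x)) integrable_on {0..pi}"
    using integrable_closed_interval[OF gi] by (auto intro!: integrable_on_lebesgue_on)
  have osc: "cmod (?h y - ?h x) \<le> (LINT x|leb_pi. cmod (?g x))" if xy: "0 \<le> x" "x \<le> y" "y \<le> pi" for x y
  proof -
    have "?h y - ?h x = integral {x..y} ?g"
      using cont_rep_V(3)[OF f, of x] cont_rep_V(3)[OF f, of y] integral_combine_complex[OF gn(1) xy] xy
      by (simp add: antideriv_def algebra_simps)
    then have "cmod (?h y - ?h x) \<le> integral {x..y} (\<lambda>x. cmod (?g x))"
      using xy by (auto intro!: integral_norm_bound_integral integrable_subinterval_real[OF gn(1)] integrable_subinterval_real[OF gn(2)])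
    also have "\<dots> \<le> integral {0..pi} (\<lambda>x. cmod (?g x))"
      by (rule integral_subset_le) (use xy in \<open>auto intro!: integrable_subinterval_real[OF gn(2)] gn\<close>)
    also have "\<dots> = (LINT x|leb_pi. cmod (?g x))"
      using gi by (subst lebesgue_integral_eq_integral) (auto simp: integral_open_interval_real)
    finally show ?thesis .
  qed
  have B: "(cmod (?h e))\<^sup>2 * W \<le> 2 * inverse_weight_total * nsq hmeas ?g * W + 2 * nsq hmeas f" if e: "e = 0 \<or> e = pi" for e
  proof -
    define S where "S = inverse_weight_total * nsq hmeas ?g"
    have p: "(cmod (?h e))\<^sup>2 \<le> 2 * S + 2 * (cmod (?h x))\<^sup>2" if x: "0 < x" "x < pi" for x
    proof -
      have o: "cmod (?h e - ?h x) \<le> (LINT x|leb_pi. cmod (?g x))"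
        using e osc[of 0 x] osc[of x pi] x by (auto simp: norm_minus_commute)
      have "(cmod (?h e - ?h x))\<^sup>2 \<le> (LINT x|leb_pi. cmod (?g x))\<^sup>2" using o by (rule power_mono) simp
      also have "\<dots> \<le> S" unfolding S_def by (rule L2_hmeas_L1_bound[OF V(2)])
      finally have 1: "(cmod (?h e - ?h x))\<^sup>2 \<le> S" .
      have "cmod (?h e) \<le> cmod (?h e - ?h x) + cmod (?h x)" by (metis diff_add_cancel norm_triangle_ineq)
      then have "(cmod (?h e))\<^sup>2 \<le> (cmod (?h e - ?h x) + cmod (?h x))\<^sup>2" by (rule power_mono) simp
      also have "\<dots> \<le> 2 * (cmod (?h e - ?h x))\<^sup>2 + 2 * (cmod (?h x))\<^sup>2"
        using sum_squares_bound[of "cmod (?h e - ?h x)" "cmod (?h x)"] by (simp add: power2_sum)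
      finally show ?thesis using 1 by simp
    qed
    have wi: "integrable leb_pi \<omega>"
      by (rule integrable_lebesgue_on_subset[OF continuous_imp_integrable_real[OF \<omega>_cont, of 0 pi]]) auto
    have hL: "?h \<in> L2 hmeas" by (rule continuous_L2_hmeas[OF cont_rep_V(1)[OF f]])
    have hm: "(\<lambda>x. (cmod (?h x))\<^sup>2) \<in> borel_measurable leb_pi"
      using L2D(1)[OF hL] unfolding borel_measurable_hmeas by measurable
    have hi: "integrable leb_pi (\<lambda>x. \<omega> x * (cmod (?h x))\<^sup>2)"
      using L2D(2)[OF hL] integrable_hmeas[OF hm] by simp
    have hn: "nsq hmeas f = (LINT x|leb_pi. \<omega> x * (cmod (?h x))\<^sup>2)"
    proof -
      have "nsq hmeas f = nsq hmeas ?h"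
        using V(1) hL cont_rep_V(2)[OF f] by (intro nsq_cong_AE) (auto dest: L2D)
      then show ?thesis unfolding nsq_def using integral_hmeas[OF hm] by simp
    qed
    have le: "(LINT x|leb_pi. \<omega> x * (cmod (?h e))\<^sup>2) \<le> (LINT x|leb_pi. \<omega> x * (2 * S) + 2 * (\<omega> x * (cmod (?h x))\<^sup>2))"
    proof (rule integral_mono)
      fix x assume "x \<in> space leb_pi"
      then have x: "0 < x" "x < pi" by auto
      show "\<omega> x * (cmod (?h e))\<^sup>2 \<le> \<omega> x * (2 * S) + 2 * (\<omega> x * (cmod (?h x))\<^sup>2)"
        using mult_left_mono[OF p[OF x] less_imp_le[OF \<omega>_pos[OF x]]] by (simp add: algebra_simps)
    qed (use wi hi in auto)
    have "(LINT x|leb_pi. \<omega> x * (2 * S) + 2 * (\<omega> x * (cmod (?h x))\<^sup>2)) = W * (2 * S) + 2 * nsq hmeas f"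
      using wi hi by (simp add: W_def hn)
    moreover have "(LINT x|leb_pi. \<omega> x * (cmod (?h e))\<^sup>2) = W * (cmod (?h e))\<^sup>2"
      unfolding W_def by (rule integral_mult_left_zero)
    ultimately have "W * (cmod (?h e))\<^sup>2 \<le> W * (2 * S) + 2 * nsq hmeas f" using le by linarith
    then show ?thesis by (simp add: S_def mult_ac)
  qed
  have n: "0 \<le> nsq hmeas ?g" "0 \<le> nsq hmeas f" by auto
  have "(cmod (?h e))\<^sup>2 \<le> trace_const * (V_norm f)\<^sup>2" if "e = 0 \<or> e = pi" for e
  proof -
    have "(cmod (?h e))\<^sup>2 \<le> 2 * inverse_weight_total * nsq hmeas ?g + 2 * nsq hmeas f * (1 / W)"
      using B[OF that] W by (simp add: field_simps)
    also have "\<dots> \<le> 2 * (4 * inverse_weight_total + 1) * (V_norm f)\<^sup>2 + 2 * (4 * inverse_weight_total + 1) * (V_norm f)\<^sup>2 * (1 / W)"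
    proof (intro add_mono mult_right_mono)
      have "inverse_weight_total * nsq hmeas ?g \<le> (4 * inverse_weight_total + 1) * (V_norm f)\<^sup>2"
        unfolding V_norm_sq using inverse_weight_total_nonneg n by (intro mult_mono) auto
      then show "2 * inverse_weight_total * nsq hmeas ?g \<le> 2 * (4 * inverse_weight_total + 1) * (V_norm f)\<^sup>2"
        unfolding mult.assoc[of 2] by (rule mult_left_mono) simp
      have "1 * nsq hmeas f \<le> (4 * inverse_weight_total + 1) * (V_norm f)\<^sup>2"
        unfolding V_norm_sq using inverse_weight_total_nonneg n by (intro mult_mono) auto
      then show "2 * nsq hmeas f \<le> 2 * (4 * inverse_weight_total + 1) * (V_norm f)\<^sup>2"
        unfolding mult.assoc[of 2] by simp
    qed (use W in auto)
    also have "\<dots> = trace_const * (V_norm f)\<^sup>2" by (simp add: trace_const_def W_def algebra_simps)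
    finally show ?thesis .
  qed
  then show ?thesis using exhaust_2[of i] by (auto simp: trace_op_component)
qed

section \<open>Gegenbauer polynomials\<close>

text \<open>Gegenbauer polynomials of index \<open>1/4\<close>, normalized to the value \<open>1\<close> at \<open>1\<close>.\<close>

fun gegenbauer :: "nat \<Rightarrow> real \<Rightarrow> real" where
  "gegenbauer 0 x = 1"
| "gegenbauer (Suc 0) x = x"
| "gegenbauer (Suc (Suc n)) x = ((4 * real n + 5) * x * gegenbauer (Suc n) x - (2 * real n + 2) * gegenbauer n x) / (2 * real n + 3)"

text \<open>The derivatives, by differentiation of the recurrence.\<close>

fun gegenbauer_deriv :: "nat \<Rightarrow> real \<Rightarrow> real" where
  "gegenbauer_deriv 0 x = 0"
| "gegenbauer_deriv (Suc 0) x = 1"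
| "gegenbauer_deriv (Suc (Suc n)) x = ((4 * real n + 5) * (gegenbauer (Suc n) x + x * gegenbauer_deriv (Suc n) x) - (2 * real n + 2) * gegenbauer_deriv n x) / (2 * real n + 3)"

lemma gegenbauer_DERIV: "(gegenbauer n has_real_derivative gegenbauer_deriv n x) (at x)"
proof (induction n x rule: gegenbauer_deriv.induct)
  case (3 n x)
  have e: "gegenbauer (Suc (Suc n)) = (\<lambda>x. ((4 * real n + 5) * x * gegenbauer (Suc n) x - (2 * real n + 2) * gegenbauer n x) / (2 * real n + 3))"
    by (rule ext) simp
  show ?case unfolding e
    by (rule derivative_eq_intros refl 3 | simp)+ (simp add: algebra_simps)
next
  case (1 x)
  have "gegenbauer 0 = (\<lambda>x. 1)" by (rule ext) simp
  then show ?case by simp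
next
  case (2 x)
  have "gegenbauer (Suc 0) = (\<lambda>x. x)" by (rule ext) simp
  then show ?case by simp
qed

lemma gegenbauer_continuous: "continuous_on S (gegenbauer n)"
  using gegenbauer_DERIV by (meson DERIV_continuous_on has_field_derivative_at_within)

lemma gegenbauer_deriv_continuous: "continuous_on S (gegenbauer_deriv n)"
proof (induction n rule: induct_nat_012)
  case (ge2 n)
  have "continuous_on S (\<lambda>x. ((4 * real n + 5) * (gegenbauer (Suc n) x + x * gegenbauer_deriv (Suc n) x) - (2 * real n + 2) * gegenbauer_deriv n x) / (2 * real n + 3))"
    by (intro continuous_intros gegenbauer_continuous ge2) auto
  then show ?case by simp
qed simp_all

lemma gegenbauer_recurrence:
  "(4 * real n + 1) * (x * gegenbauer n x) = (2 * real n + 1) * gegenbauer (Suc n) x + 2 * real n * gegenbauer (n - 1) x"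
proof (cases n)
  case (Suc m) then show ?thesis by (simp add: field_simps)
qed simp

lemma gegenbauer_deriv_recurrence:
  "(4 * real n + 1) * (gegenbauer n x + x * gegenbauer_deriv n x) = (2 * real n + 1) * gegenbauer_deriv (Suc n) x + 2 * real n * gegenbauer_deriv (n - 1) x"
proof (cases n)
  case (Suc m) then show ?thesis by (simp add: field_simps)
qed simp

lemma gegenbauer_at_1: "gegenbauer n 1 = 1"
  by (induction n rule: induct_nat_012) (auto simp: field_simps)

lemma gegenbauer_at_minus_1: "gegenbauer n (-1) = (-1) ^ n"
  by (induction n rule: induct_nat_012) (auto simp: field_simps)

text \<open>The two ladder relations for \<open>(1 - x\<^sup>2) P'\<close>, proved together by induction from the
  three-term recurrence.\<close>

lemma gegenbauer_ladder:
  "(1 - x\<^sup>2) * gegenbauer_deriv (Suc n) x = real (Suc n) * (gegenbauer n x - x * gegenbauer (Suc n) x)"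
  "(1 - x\<^sup>2) * gegenbauer_deriv n x = (real n + 1/2) * (x * gegenbauer n x - gegenbauer (Suc n) x)"
proof (induction n)
  case 0
  show "(1 - x\<^sup>2) * gegenbauer_deriv (Suc 0) x = real (Suc 0) * (gegenbauer 0 x - x * gegenbauer (Suc 0) x)"
    "(1 - x\<^sup>2) * gegenbauer_deriv 0 x = (real 0 + 1/2) * (x * gegenbauer 0 x - gegenbauer (Suc 0) x)" by (simp_all add: power2_eq_square)
next
  case (Suc n)
  define c where "c = 2 * real n + 3"
  have c: "c \<noteq> 0" by (simp add: c_def add_nonneg_eq_0_iff)
  have r: "c * gegenbauer (Suc (Suc n)) x = (4 * real n + 5) * x * gegenbauer (Suc n) x - (2 * real n + 2) * gegenbauer n x"
    using c by (simp add: c_def)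
  have r': "c * gegenbauer_deriv (Suc (Suc n)) x = (4 * real n + 5) * (gegenbauer (Suc n) x + x * gegenbauer_deriv (Suc n) x) - (2 * real n + 2) * gegenbauer_deriv n x"
    using c by (simp add: c_def)
  show "(1 - x\<^sup>2) * gegenbauer_deriv (Suc n) x = (real (Suc n) + 1/2) * (x * gegenbauer (Suc n) x - gegenbauer (Suc (Suc n)) x)"
  proof -
    have "(real (Suc n) + 1/2) * (x * gegenbauer (Suc n) x - gegenbauer (Suc (Suc n)) x)
        = (c * x * gegenbauer (Suc n) x - c * gegenbauer (Suc (Suc n)) x) / 2"
      by (simp add: c_def field_simps del: gegenbauer.simps)
    also have "\<dots> = real (Suc n) * (gegenbauer n x - x * gegenbauer (Suc n) x)"
      unfolding r by (simp add: c_def field_simps)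
    finally show ?thesis using Suc(1) by simp
  qed
  show "(1 - x\<^sup>2) * gegenbauer_deriv (Suc (Suc n)) x = real (Suc (Suc n)) * (gegenbauer (Suc n) x - x * gegenbauer (Suc (Suc n)) x)"
  proof -
    have "c * ((1 - x\<^sup>2) * gegenbauer_deriv (Suc (Suc n)) x) = (1 - x\<^sup>2) * (c * gegenbauer_deriv (Suc (Suc n)) x)" by (simp del: gegenbauer_deriv.simps)
    also have "\<dots> = (4 * real n + 5) * ((1 - x\<^sup>2) * gegenbauer (Suc n) x + x * ((1 - x\<^sup>2) * gegenbauer_deriv (Suc n) x))
        - (2 * real n + 2) * ((1 - x\<^sup>2) * gegenbauer_deriv n x)"
      unfolding r' by (simp add: algebra_simps del: gegenbauer_deriv.simps gegenbauer.simps)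
    also have "\<dots> = real (Suc (Suc n)) * (c * gegenbauer (Suc n) x - x * (c * gegenbauer (Suc (Suc n)) x))"
      unfolding Suc r by (simp add: c_def field_simps power2_eq_square del: gegenbauer.simps)
    also have "\<dots> = c * (real (Suc (Suc n)) * (gegenbauer (Suc n) x - x * gegenbauer (Suc (Suc n)) x))"
      by (simp add: algebra_simps del: gegenbauer.simps)
    finally show ?thesis using c by (simp del: gegenbauer_deriv.simps gegenbauer.simps)
  qed
qed

definition zonal :: "nat \<Rightarrow> real \<Rightarrow> real" where "zonal n \<phi> = gegenbauer n (cos \<phi>)"
definition zonal_deriv :: "nat \<Rightarrow> real \<Rightarrow> real" where "zonal_deriv n \<phi> = - sin \<phi> * gegenbauer_deriv n (cos \<phi>)"

lemma zonal_DERIV: "(zonal n has_real_derivative zonal_deriv n x) (at x)"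
  unfolding zonal_def[abs_def] zonal_deriv_def
  by (rule DERIV_cong[OF DERIV_chain2[OF gegenbauer_DERIV DERIV_cos]]) simp

lemma zonal_continuous: "continuous_on S (zonal n)"
  unfolding zonal_def[abs_def]
  by (rule continuous_on_compose2[OF gegenbauer_continuous[of UNIV]]) (auto intro: continuous_intros)

lemma zonal_deriv_continuous: "continuous_on S (zonal_deriv n)"
  unfolding zonal_deriv_def[abs_def]
  by (intro continuous_intros continuous_on_compose2[OF gegenbauer_deriv_continuous[of UNIV]]) auto

definition ev :: "nat \<Rightarrow> real" where "ev n = 2 * real n * (2 * real n + 1)"

text \<open>The algebra of \<open>flux_DERIV\<close> is separated into two identities. They abbreviate \<open>P\<^sub>n\<^sub>-\<^sub>1, P\<^sub>n\<close> and their
  derivatives at \<open>c = cos x\<close> by \<open>pm, pn, dm, dn\<close>, and \<open>r\<^sup>2\<close> or \<open>q = r\<^sup>4\<close> stand for \<open>sin x\<close> and its square.\<close>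

lemma flux_quotient_rule:
  fixes r :: real assumes "r > 0"
  shows "(-(n*((dm*(-(r*r))) - ((-(r*r))*pn + (dn*(-(r*r)))*c)))*r - (-(n*(pm - c*pn)))*(inverse r/2*c))/(r*r)
    = r*((1/2)*c*(n*(pm-c*pn)/((r*r)*(r*r))) + n*(dm-pn-c*dn))"
proof -
  have "r * r \<noteq> 0" "r \<noteq> 0" using assms by auto
  then show ?thesis by (simp add: field_simps)
qed

lemma flux_ladder:
  fixes q :: real
  assumes "q > 0" and q: "q = 1 - c\<^sup>2"
    and l1: "q * dn = n * (pm - c * pn)" and l2: "q * dm = (n - 1/2) * (c * pm - pn)"
  shows "(1/2) * c * (n * (pm - c * pn) / q) + n * (dm - pn - c * dn) = -(2 * n * (2 * n + 1)/4) * pn"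
proof -
  have "q * ((1/2) * c * (n * (pm - c * pn)/q) + n * (dm - pn - c * dn)) = (1/2) * c * (n * (pm - c * pn)) + n * (q * dm - q * pn - c * (q * dn))"
    using assms(1) by (simp add: field_simps)
  also have "\<dots> = q * (-(2 * n * (2 * n + 1)/4) * pn)"
    unfolding l1 l2 unfolding q by (simp add: field_simps power2_eq_square)
  finally show ?thesis using assms(1) by (simp only: mult_cancel_left) auto
qed

text \<open>The eigenvalue equation in divergence form. By the first ladder relation the flux
  \<open>\<omega> y'\<close> equals \<open>n (x P\<^sub>n - P\<^sub>n\<^sub>-\<^sub>1) / \<surd>sin\<close>, whose derivative involves only first
  derivatives of the polynomials. The second ladder relation eliminates that of \<open>P\<^sub>n\<^sub>-\<^sub>1\<close>.\<close>

lemma flux_DERIV: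
  assumes x: "0 < x" "x < pi"
  shows "((\<lambda>x. \<omega> x * zonal_deriv n x) has_real_derivative (- (ev n / 4) * (\<omega> x * zonal n x))) (at x)"
proof (cases n)
  case 0
  then show ?thesis by (simp add: zonal_deriv_def ev_def)
next
  case (Suc m)
  let ?Q = "\<lambda>x. real n * (gegenbauer m (cos x) - cos x * gegenbauer n (cos x))"
  have fl: "\<omega> x * zonal_deriv n x = - ?Q x / sqrt (sin x)" if "0 < x" "x < pi" for x
  proof -
    have s: "sin x > 0" using that by (rule sin_gt_zero)
    have Q: "(sin x)\<^sup>2 * gegenbauer_deriv n (cos x) = ?Q x"
      using gegenbauer_ladder(1)[of "cos x" m] Suc by (simp add: sin_squared_eq del: gegenbauer.simps gegenbauer_deriv.simps)
    define r where "r = sqrt (sin x)"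
    have r: "r > 0" "sin x = r * r" using s by (auto simp: r_def)
    show ?thesis unfolding Q[symmetric] \<omega>_def zonal_deriv_def r_def[symmetric] unfolding r(2)
      using r(1) by (simp add: power2_eq_square)
  qed
  have s: "sin x > 0" using x by (rule sin_gt_zero)
  let ?s = "sin x" and ?c = "cos x"
  have D: "((\<lambda>x. - ?Q x / sqrt (sin x)) has_real_derivative
     (sqrt ?s * ((1/2) * ?c * (?Q x / (?s * ?s)) + real n * (gegenbauer_deriv m ?c - gegenbauer n ?c - ?c * gegenbauer_deriv n ?c)))) (at x)"
  proof -
    have sq: "sqrt ?s * sqrt ?s = ?s" using s by simp
    have "((\<lambda>x. - ?Q x / sqrt (sin x)) has_real_derivative
      ((- (real n * ((gegenbauer_deriv m ?c * (- ?s)) - ((- ?s) * gegenbauer n ?c + (gegenbauer_deriv n ?c * (- ?s)) * ?c))) * sqrt ?s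
        - (- ?Q x) * (inverse (sqrt ?s) / 2 * ?c)) / (sqrt ?s * sqrt ?s))) (at x)"
      by (intro DERIV_divide DERIV_minus DERIV_cmult DERIV_diff DERIV_mult DERIV_cos DERIV_chain2[OF gegenbauer_DERIV]
          DERIV_chain2[OF DERIV_real_sqrt DERIV_sin] s) (use s in auto)
    also have "(- (real n * ((gegenbauer_deriv m ?c * (- ?s)) - ((- ?s) * gegenbauer n ?c + (gegenbauer_deriv n ?c * (- ?s)) * ?c))) * sqrt ?s
        - (- ?Q x) * (inverse (sqrt ?s) / 2 * ?c)) / (sqrt ?s * sqrt ?s)
       = sqrt ?s * ((1/2) * ?c * (?Q x / (?s * ?s)) + real n * (gegenbauer_deriv m ?c - gegenbauer n ?c - ?c * gegenbauer_deriv n ?c))"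
    proof -
      define r where "r = sqrt ?s"
      have r: "r > 0" "?s = r * r" using s by (auto simp: r_def)
      show ?thesis unfolding r_def[symmetric] unfolding r(2) by (rule flux_quotient_rule[OF r(1)])
    qed
    finally show ?thesis .
  qed
  have alg: "(1/2) * ?c * (?Q x / (?s * ?s)) + real n * (gegenbauer_deriv m ?c - gegenbauer n ?c - ?c * gegenbauer_deriv n ?c) = - (ev n / 4) * zonal n x"
  proof -
    have ss: "?s * ?s = 1 - ?c\<^sup>2" using sin_squared_eq[of x] by (simp add: power2_eq_square)
    have l1: "?s * ?s * gegenbauer_deriv n ?c = ?Q x" using gegenbauer_ladder(1)[of ?c m] Suc ss by (simp del: gegenbauer.simps gegenbauer_deriv.simps)
    have l2: "?s * ?s * gegenbauer_deriv m ?c = (real m + 1/2) * (?c * gegenbauer m ?c - gegenbauer n ?c)"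
      using gegenbauer_ladder(2)[of ?c m] Suc ss by (simp del: gegenbauer.simps gegenbauer_deriv.simps)
    have m: "real m + 1/2 = real n - 1/2" using Suc by simp
    show ?thesis unfolding ev_def zonal_def
      by (rule flux_ladder[OF _ ss l1 l2[unfolded m]]) (use s in simp)
  qed
  have "((\<lambda>x. - ?Q x / sqrt (sin x)) has_real_derivative (- (ev n / 4) * (\<omega> x * zonal n x))) (at x)"
    using D unfolding alg by (simp add: \<omega>_def mult_ac)
  then show ?thesis
    by (rule has_field_derivative_transform_within_open[where S="{0<..<pi}"]) (use x fl in auto)
qed

subsection \<open>The eigenfunctions belong to the form domain\<close>

abbreviation czonal :: "nat \<Rightarrow> real \<Rightarrow> complex" where "czonal n x \<equiv> complex_of_real (zonal n x)"
abbreviation czonal_deriv :: "nat \<Rightarrow> real \<Rightarrow> complex" where "czonal_deriv n x \<equiv> complex_of_real (zonal_deriv n x)"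

lemma czonal_L2: "czonal n \<in> L2 hmeas" and czonal_deriv_L2: "czonal_deriv n \<in> L2 hmeas"
  by (intro continuous_L2_hmeas continuous_intros zonal_continuous zonal_deriv_continuous)+

lemma C1_weak_deriv:
  assumes d: "\<And>x. (f has_real_derivative f' x) (at x)" and c: "continuous_on UNIV f'"
  shows "is_weak_deriv (\<lambda>x. complex_of_real (f x)) (\<lambda>x. complex_of_real (f' x))"
  unfolding is_weak_deriv_def
proof
  fix \<theta> assume \<theta>: "\<theta> \<in> test_functions {0<..<pi}"
  have fc: "continuous_on S f" for S using d by (meson DERIV_continuous_on has_field_derivative_at_within)
  have loc: "L1_loc 0 pi (\<lambda>x. complex_of_real (f x))" "L1_loc 0 pi (\<lambda>x. complex_of_real (f' x))"
    by (auto intro!: L2_loc_L1_loc L2_hmeas_L2_loc continuous_L2_hmeas continuous_intros fc continuous_on_subset[OF c])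
  note i = test_times_integrable(2)[OF \<theta> loc(1)] test_times_integrable(1)[OF \<theta> loc(2)]
  obtain p q where pq: "0 < p" "p < q" "q < pi" "\<And>x. x \<notin> {p<..<q} \<Longrightarrow> \<theta> x = 0"
    using test_function_support[OF \<theta> pi_gt_zero] by metis
  have "((\<lambda>x. deriv \<theta> x * f x + f' x * \<theta> x) has_integral (\<theta> pi * f pi - \<theta> 0 * f 0)) {0..pi}"
  proof (rule fundamental_theorem_of_calculus)
    fix x
    have "((\<lambda>x. \<theta> x * f x) has_real_derivative (deriv \<theta> x * f x + f' x * \<theta> x)) (at x within {0..pi})"
      by (rule has_field_derivative_at_within[OF DERIV_mult[OF smooth_DERIV[OF test_function_smooth[OF \<theta>]] d]])
    then show "((\<lambda>x. \<theta> x * f x) has_vector_derivative (deriv \<theta> x * f x + f' x * \<theta> x)) (at x within {0..pi})"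
      by (simp add: has_real_derivative_iff_has_vector_derivative)
  qed simp
  then have "((\<lambda>x. deriv \<theta> x * f x + f' x * \<theta> x) has_integral 0) {0<..<pi}"
    using pq by (simp add: has_integral_Icc_iff_Ioo)
  from has_integral_of_real[OF this, where 'b=complex]
  have "((\<lambda>x. complex_of_real (deriv \<theta> x) * complex_of_real (f x) + complex_of_real (\<theta> x) * complex_of_real (f' x)) has_integral 0) {0<..<pi}"
    by (simp add: mult.commute)
  moreover have "((\<lambda>x. complex_of_real (deriv \<theta> x) * complex_of_real (f x) + complex_of_real (\<theta> x) * complex_of_real (f' x)) has_integral
     (LINT x|leb_pi. complex_of_real (deriv \<theta> x) * complex_of_real (f x) + complex_of_real (\<theta> x) * complex_of_real (f' x))) {0<..<pi}"
    by (intro has_integral_integral_lebesgue_on Bochner_Integration.integrable_add i) auto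
  ultimately have "(LINT x|leb_pi. complex_of_real (deriv \<theta> x) * complex_of_real (f x) + complex_of_real (\<theta> x) * complex_of_real (f' x)) = 0"
    by (rule has_integral_unique[rotated])
  then show "(LINT x|leb_pi. complex_of_real (deriv \<theta> x) * complex_of_real (f x)) = - (LINT x|leb_pi. complex_of_real (\<theta> x) * complex_of_real (f' x))"
    using i by (simp add: eq_neg_iff_add_eq_0)
qed

lemma czonal_weak_deriv: "is_weak_deriv (czonal n) (czonal_deriv n)"
  by (rule C1_weak_deriv[OF zonal_DERIV zonal_deriv_continuous])

lemma ip_hmeas_real:
  assumes "f \<in> L2 hmeas" "continuous_on {0..pi} c"
  shows "ip hmeas f (\<lambda>x. complex_of_real (c x)) = (LINT x|leb_pi. complex_of_real (\<omega> x * c x) * f x)"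
    "integrable leb_pi (\<lambda>x. complex_of_real (\<omega> x * c x) * f x)"
proof -
  have [measurable]: "c \<in> borel_measurable leb_pi"
    by (rule continuous_imp_measurable_on_sets_lebesgue[OF continuous_on_subset[OF assms(2)]]) auto
  have [measurable]: "f \<in> borel_measurable leb_pi" using L2D(1)[OF assms(1)] by (simp add: borel_measurable_hmeas)
  have e: "\<omega> x *\<^sub>R (f x * cnj (complex_of_real (c x))) = complex_of_real (\<omega> x * c x) * f x" for x
    by (simp add: scaleR_conv_of_real mult_ac)
  have c: "(\<lambda>x. complex_of_real (c x)) \<in> L2 hmeas" by (intro continuous_L2_hmeas continuous_intros assms)
  show "ip hmeas f (\<lambda>x. complex_of_real (c x)) = (LINT x|leb_pi. complex_of_real (\<omega> x * c x) * f x)"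
    unfolding ip_def by (subst integral_hmeas) (measurable, simp only: e)
  have m: "(\<lambda>x. f x * cnj (complex_of_real (c x))) \<in> borel_measurable leb_pi" by measurable
  show "integrable leb_pi (\<lambda>x. complex_of_real (\<omega> x * c x) * f x)"
    using L2_mult_integrable(2)[OF assms(1) c] unfolding integrable_hmeas[OF m] e .
qed

text \<open>The flux \<open>\<omega> y'\<close> vanishes at both ends, so there are no boundary terms.\<close>

lemma Green:
  assumes f: "f \<in> V_space"
  shows "4 * ip hmeas (wderiv f) (czonal_deriv n) = ev n * ip hmeas f (czonal n)"
proof -
  note V = V_spaceD[OF f]
  let ?g = "wderiv f"
  obtain c where c: "AE x in hmeas. c + antideriv ?g x = f x" using V_space_representation[OF f] .
  have gi: "integrable leb_pi ?g" using V(2) by (rule L2_hmeas_integrable)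
  let ?F = "\<lambda>x. \<omega> x * zonal_deriv n x" and ?F' = "\<lambda>x. - (ev n / 4) * (\<omega> x * zonal n x)"
  have F': "continuous_on {0..pi} ?F'" by (intro continuous_intros \<omega>_cont zonal_continuous)
  have F: "continuous_on {0..pi} ?F" by (intro continuous_intros \<omega>_cont zonal_deriv_continuous)
  have ends: "?F 0 = 0" "?F pi = 0" by (simp_all add: zonal_deriv_def)
  have h1: "((\<lambda>x. complex_of_real (?F' x) * antideriv ?g x + complex_of_real (?F x) * ?g x) has_integral 0) {0..pi}"
    unfolding antideriv_def
    by (rule indefinite_integral_by_parts[OF integrable_closed_interval[OF gi] F flux_DERIV F' ends]) auto
  have "(?F' has_integral (?F pi - ?F 0)) {0..pi}"
    by (rule fundamental_theorem_of_calculus_interior)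
      (use F flux_DERIV in \<open>auto simp: has_real_derivative_iff_has_vector_derivative[symmetric]\<close>)
  then have "((\<lambda>x. complex_of_real (?F' x)) has_integral complex_of_real 0) {0..pi}"
    by (intro has_integral_of_real) (simp add: ends)
  from has_integral_mult_left[OF this, of c]
  have h2: "((\<lambda>x. complex_of_real (?F' x) * c) has_integral 0) {0..pi}" by simp
  have "((\<lambda>x. complex_of_real (?F' x) * (c + antideriv ?g x) + complex_of_real (?F x) * ?g x) has_integral 0) {0..pi}"
  proof -
    have "(\<lambda>x. complex_of_real (?F' x) * (c + antideriv ?g x) + complex_of_real (?F x) * ?g x)
      = (\<lambda>x. complex_of_real (?F' x) * c + (complex_of_real (?F' x) * antideriv ?g x + complex_of_real (?F x) * ?g x))"
      by (simp only: distrib_left add.assoc)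
    then show ?thesis using has_integral_add[OF h2 h1] by (simp only: add_0)
  qed
  then have h3: "((\<lambda>x. complex_of_real (?F' x) * (c + antideriv ?g x) + complex_of_real (?F x) * ?g x) has_integral 0) {0<..<pi}"
    by (simp add: has_integral_Icc_iff_Ioo)
  define h where "h x = c + antideriv ?g x" for x
  have hL: "h \<in> L2 hmeas" unfolding h_def
    by (intro continuous_L2_hmeas continuous_intros antideriv_continuous gi)
  note i1 = ip_hmeas_real[OF hL zonal_continuous, of n] and i2 = ip_hmeas_real[OF V(2) zonal_deriv_continuous, of n]
  have i1': "integrable leb_pi (\<lambda>x. - complex_of_real (ev n / 4) * (complex_of_real (\<omega> x * zonal n x) * h x))"
    using i1(2) by (rule integrable_mult_right)
  have "(LINT x|leb_pi. - complex_of_real (ev n / 4) * (complex_of_real (\<omega> x * zonal n x) * h x) + complex_of_real (\<omega> x * zonal_deriv n x) * ?g x) = 0"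
  proof (rule has_integral_unique[rotated])
    show "((\<lambda>x. - complex_of_real (ev n / 4) * (complex_of_real (\<omega> x * zonal n x) * h x) + complex_of_real (\<omega> x * zonal_deriv n x) * ?g x) has_integral 0) {0<..<pi}"
      using h3 by (simp add: h_def mult_ac)
    show "((\<lambda>x. - complex_of_real (ev n / 4) * (complex_of_real (\<omega> x * zonal n x) * h x) + complex_of_real (\<omega> x * zonal_deriv n x) * ?g x) has_integral
      (LINT x|leb_pi. - complex_of_real (ev n / 4) * (complex_of_real (\<omega> x * zonal n x) * h x) + complex_of_real (\<omega> x * zonal_deriv n x) * ?g x)) {0<..<pi}"
      by (intro has_integral_integral_lebesgue_on Bochner_Integration.integrable_add i1' i2(2)) auto
  qed
  also have "(LINT x|leb_pi. - complex_of_real (ev n / 4) * (complex_of_real (\<omega> x * zonal n x) * h x) + complex_of_real (\<omega> x * zonal_deriv n x) * ?g x)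
    = - complex_of_real (ev n / 4) * ip hmeas h (czonal n) + ip hmeas ?g (czonal_deriv n)"
    unfolding i1(1) i2(1) by (subst Bochner_Integration.integral_add[OF i1' i2(2)]) simp
  also have "ip hmeas h (czonal n) = ip hmeas f (czonal n)"
    using hL V(1) czonal_L2[of n] c by (intro ip_cong_AE) (auto simp: h_def dest: L2D)
  finally show ?thesis by (simp add: field_simps)
qed

lemma czonal_V: "czonal n \<in> V_space" "AE x in hmeas. wderiv (czonal n) x = czonal_deriv n x"
  using V_spaceI[OF czonal_L2 czonal_deriv_L2 czonal_weak_deriv] by auto

lemma wderiv_czonal_ip: "f \<in> L2 hmeas \<Longrightarrow> ip hmeas f (wderiv (czonal n)) = ip hmeas f (czonal_deriv n)"
  using czonal_V[of n] V_spaceD(2)[OF czonal_V(1), of n] czonal_deriv_L2[of n]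
  by (intro ip_cong_AE) (auto dest: L2D)

lemma wderiv_czonal_ip': "g \<in> L2 hmeas \<Longrightarrow> ip hmeas (wderiv (czonal n)) g = ip hmeas (czonal_deriv n) g"
  using wderiv_czonal_ip[of g n] ip_commute[of hmeas "wderiv (czonal n)" g] ip_commute[of hmeas "czonal_deriv n" g] by simp

definition zonal_nsq :: "nat \<Rightarrow> real" where "zonal_nsq n = nsq hmeas (czonal n)"

lemma czonal_deriv_ip: "4 * ip hmeas (czonal_deriv m) (czonal_deriv n) = ev n * ip hmeas (czonal m) (czonal n)"
  using Green[OF czonal_V(1), of m n] unfolding wderiv_czonal_ip'[OF czonal_deriv_L2] .

lemma ev_inject: "ev m = ev n \<longleftrightarrow> m = n"
proof -
  have "ev m < ev n" if "m < n" for m n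
  proof -
    have "(real m)\<^sup>2 \<le> (real n)\<^sup>2" "real m < real n" using that by (auto intro: power_mono)
    then show ?thesis unfolding ev_def power2_eq_square by (simp add: algebra_simps)
  qed
  from this[of m n] this[of n m] show ?thesis by (cases m n rule: linorder_cases) auto
qed

text \<open>The form is symmetric, so Green's formula can be read with either factor as the eigenfunction, and
  different eigenvalues force the inner product to vanish.\<close>

lemma zonal_orthogonal: "ip hmeas (czonal m) (czonal n) = (if m = n then complex_of_real (zonal_nsq n) else 0)"
proof (cases "m = n")
  case True then show ?thesis by (simp add: ip_self zonal_nsq_def)
next
  case False
  have r: "ip hmeas (czonal m) (czonal n) = ip hmeas (czonal n) (czonal m)" "ip hmeas (czonal_deriv m) (czonal_deriv n) = ip hmeas (czonal_deriv n) (czonal_deriv m)"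
    by (simp_all add: ip_def mult.commute)
  have "complex_of_real (ev n) * ip hmeas (czonal m) (czonal n) = 4 * ip hmeas (czonal_deriv n) (czonal_deriv m)"
    using czonal_deriv_ip[of m n] by (simp only: r)
  also have "\<dots> = complex_of_real (ev m) * ip hmeas (czonal m) (czonal n)"
    using czonal_deriv_ip[of n m] by (simp only: r)
  finally have "complex_of_real (ev n) * ip hmeas (czonal m) (czonal n) = complex_of_real (ev m) * ip hmeas (czonal m) (czonal n)" .
  then show ?thesis using False ev_inject[of m n] ev_inject[of n m] by auto
qed

lemma zonal_nsq_pos: "zonal_nsq n > 0"
proof -
  have "zonal_nsq n \<noteq> 0"
  proof
    assume "zonal_nsq n = 0"
    then have "AE x in hmeas. czonal n x = 0" by (simp add: zonal_nsq_def nsq_eq_0_iff[OF czonal_L2])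
    then have "czonal n 0 = 0"
      by (intro continuous_AE_eq[where k="\<lambda>x. 0"]) (auto intro!: continuous_intros zonal_continuous)
    then show False by (simp add: zonal_def gegenbauer_at_1)
  qed
  moreover have "0 \<le> zonal_nsq n" unfolding zonal_nsq_def by (rule nsq_nonneg)
  ultimately show ?thesis by linarith
qed

text \<open>The coefficients \<open>(1/2)\<^sub>n / n!\<close>, which equal \<open>binomial(2n, n) / 4^n\<close>.\<close>

fun central_binomial :: "nat \<Rightarrow> real" where
  "central_binomial 0 = 1"
| "central_binomial (Suc n) = central_binomial n * (2 * real n + 1) / (2 * real n + 2)"

text \<open>The inner product of \<open>cos \<phi> y\<^sub>n\<close> with \<open>y\<^sub>n\<^sub>+\<^sub>1\<close>, evaluated by applying the three-term recurrence to
  either factor.\<close>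

lemma zonal_nsq_recurrence: "(2 * real n + 1) * (4 * real n + 5) * zonal_nsq (Suc n) = (4 * real n + 1) * (2 * real n + 2) * zonal_nsq n"
proof -
  define xx where "xx m n = ip hmeas (\<lambda>x. complex_of_real (cos x * zonal m x)) (czonal n)" for m n
  have xs: "xx m n = xx n m" for m n by (simp add: xx_def ip_def mult_ac)
  have rec: "complex_of_real (4 * real j + 1) * xx j m
     = complex_of_real (2 * real j + 1) * ip hmeas (czonal (Suc j)) (czonal m) + complex_of_real (2 * real j) * ip hmeas (czonal (j - 1)) (czonal m)" for j m
  proof -
    have "(\<lambda>x. complex_of_real (4 * real j + 1) * complex_of_real (cos x * zonal j x))
        = (\<lambda>x. complex_of_real (2 * real j + 1) * czonal (Suc j) x + complex_of_real (2 * real j) * czonal (j - 1) x)"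
      using gegenbauer_recurrence[of j "cos _"]
      by (auto simp: fun_eq_iff zonal_def of_real_mult[symmetric] of_real_add[symmetric] simp del: of_real_mult of_real_add gegenbauer.simps)
    then have "ip hmeas (\<lambda>x. complex_of_real (4 * real j + 1) * complex_of_real (cos x * zonal j x)) (czonal m)
      = ip hmeas (\<lambda>x. complex_of_real (2 * real j + 1) * czonal (Suc j) x + complex_of_real (2 * real j) * czonal (j - 1) x) (czonal m)"
      by simp
    then show ?thesis
      unfolding ip_scale_left xx_def[symmetric]
      by (subst (asm) ip_add_left) (auto intro: czonal_L2)
  qed
  have 1: "complex_of_real (4 * real n + 1) * xx n (Suc n) = complex_of_real ((2 * real n + 1) * zonal_nsq (Suc n))"
    using rec[of n "Suc n"] by (simp add: zonal_orthogonal)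
  have 2: "complex_of_real (4 * real n + 5) * xx n (Suc n) = complex_of_real ((2 * real n + 2) * zonal_nsq n)"
    using rec[of "Suc n" n] xs[of n "Suc n"] by (simp add: zonal_orthogonal algebra_simps)
  have "complex_of_real ((4 * real n + 5) * ((2 * real n + 1) * zonal_nsq (Suc n)))
      = complex_of_real (4 * real n + 5) * (complex_of_real (4 * real n + 1) * xx n (Suc n))" unfolding 1 by simp
  also have "\<dots> = complex_of_real (4 * real n + 1) * (complex_of_real (4 * real n + 5) * xx n (Suc n))"
    by (simp add: mult_ac)
  also have "\<dots> = complex_of_real ((4 * real n + 1) * ((2 * real n + 2) * zonal_nsq n))" unfolding 2 by simp
  finally have "(4 * real n + 5) * ((2 * real n + 1) * zonal_nsq (Suc n)) = (4 * real n + 1) * ((2 * real n + 2) * zonal_nsq n)"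
    by (simp only: of_real_eq_iff)
  then show ?thesis by (simp add: mult_ac)
qed

text \<open>The reciprocal of the squared norm, which is the squared endpoint value of the normalized
  eigenfunction, is thus \<open>4n + 1\<close> times the central binomial coefficient, up to a constant.\<close>

lemma zonal_nsq_explicit: "zonal_nsq n * ((4 * real n + 1) * central_binomial n) = zonal_nsq 0"
proof (induction n)
  case (Suc n)
  define d where "d = (2 * real n + 1)"
  have "zonal_nsq (Suc n) * ((4 * real (Suc n) + 1) * central_binomial (Suc n))
     = ((2 * real n + 1) * (4 * real n + 5) * zonal_nsq (Suc n)) * central_binomial n / (2 * real n + 2)"
    by (simp add: field_simps)
  also have "\<dots> = zonal_nsq n * ((4 * real n + 1) * central_binomial n)"
    unfolding zonal_nsq_recurrence by (simp add: field_simps)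
  finally show ?case using Suc by simp
qed simp

subsection \<open>Completeness\<close>

lemma ramp_limit: "(\<lambda>j. min 1 (real j * max 0 d)) \<longlonglongrightarrow> (if d > 0 then 1 else 0)"
proof (cases "d > 0")
  case True
  obtain N where N: "1 / d < real N" using reals_Archimedean2 by blast
  have "min 1 (real j * max 0 d) = 1" if "j \<ge> N" for j
  proof -
    have "1 / d \<le> real j" using N that by simp
    then have "1 \<le> real j * d" using True by (simp add: field_simps)
    then show ?thesis using True by simp
  qed
  then have "\<forall>\<^sub>F j in sequentially. min 1 (real j * max 0 d) = 1" by (auto simp: eventually_sequentially)
  then show ?thesis using True by (simp add: tendsto_eventually)
qed simp

text \<open>By Weierstrass' theorem \<open>h\<close> is orthogonal to all continuous functions of \<open>cos x\<close>. As \<open>cos\<close> is injective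
  on \<open>{0<..<pi}\<close>, steep ramps of \<open>cos x\<close> approximate the indicator function of any interval.\<close>

lemma cos_powers_total:
  fixes h :: "real \<Rightarrow> complex"
  assumes h: "integrable leb_pi h" and 0: "\<And>m. (LINT x|leb_pi. complex_of_real (cos x ^ m) * h x) = 0"
  shows "AE x in leb_pi. h x = 0"
proof (rule AE_zero_if_interval_integrals_zero_integrable[OF h])
  note [measurable] = borel_measurable_integrable[OF h]
  have hI: "integrable leb_pi (\<lambda>x. complex_of_real (c x) * h x)" if "continuous_on {0..pi} c" for c
    by (rule continuous_times_integrable[OF integrable_closed_interval[OF h] that]) auto
  have C: "(LINT x|leb_pi. complex_of_real (C (cos x)) * h x) = 0" if C: "continuous_on {-1..1} C" for C :: "real \<Rightarrow> real"
  proof -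
    have "cmod (LINT x|leb_pi. complex_of_real (C (cos x)) * h x) \<le> e * (1 + (LINT x|leb_pi. cmod (h x)))" if e: "e > 0" for e
    proof -
      obtain g where g: "real_polynomial_function g" "\<And>x. x \<in> {-1..1} \<Longrightarrow> \<bar>C x - g x\<bar> < e"
        using Stone_Weierstrass_real_polynomial_function[OF compact_Icc C e] by metis
      obtain a n where a: "g = (\<lambda>x. \<Sum>i\<le>n. a i * x ^ i)"
        using g(1) by (auto simp: real_polynomial_function_iff_sum)
      have cc: "continuous_on {0..pi} (\<lambda>x. C (cos x))"
        by (rule continuous_on_compose2[OF C]) (auto intro: continuous_intros)
      have gc: "continuous_on {0..pi} (\<lambda>x. g (cos x))" unfolding a by (intro continuous_intros)
      have "(LINT x|leb_pi. complex_of_real (g (cos x)) * h x) = (LINT x|leb_pi. (\<Sum>i\<le>n. complex_of_real (a i) * (complex_of_real (cos x ^ i) * h x)))"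
        by (simp add: a sum_distrib_right mult.assoc)
      also have "\<dots> = (\<Sum>i\<le>n. LINT x|leb_pi. complex_of_real (a i) * (complex_of_real (cos x ^ i) * h x))"
        by (intro Bochner_Integration.integral_sum integrable_mult_right hI continuous_intros)
      also have "\<dots> = 0" by (simp add: 0 del: of_real_power)
      finally have g0: "(LINT x|leb_pi. complex_of_real (g (cos x)) * h x) = 0" .
      have "(LINT x|leb_pi. complex_of_real (C (cos x)) * h x) = (LINT x|leb_pi. complex_of_real (C (cos x)) * h x) - (LINT x|leb_pi. complex_of_real (g (cos x)) * h x)"
        by (simp add: g0)
      also have "\<dots> = (LINT x|leb_pi. complex_of_real (C (cos x)) * h x - complex_of_real (g (cos x)) * h x)"
        by (intro Bochner_Integration.integral_diff[symmetric] hI cc gc)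
      also have "cmod \<dots> \<le> (LINT x|leb_pi. e * cmod (h x))"
      proof (rule order_trans[OF integral_norm_bound], rule integral_mono)
        show "integrable leb_pi (\<lambda>x. cmod (complex_of_real (C (cos x)) * h x - complex_of_real (g (cos x)) * h x))"
          by (intro integrable_norm Bochner_Integration.integrable_diff hI cc gc)
        show "cmod (complex_of_real (C (cos x)) * h x - complex_of_real (g (cos x)) * h x) \<le> e * cmod (h x)" for x
        proof -
          have "complex_of_real (C (cos x)) * h x - complex_of_real (g (cos x)) * h x = complex_of_real (C (cos x) - g (cos x)) * h x"
            by (simp add: algebra_simps)
          then show ?thesis using g(2)[of "cos x"]
            by (simp add: norm_mult mult_right_mono less_imp_le del: of_real_diff)
        qed
      qed (use h in auto)
      also have "\<dots> \<le> e * (1 + (LINT x|leb_pi. cmod (h x)))" using e by simp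
      finally show ?thesis .
    qed
    then have *: "cmod (LINT x|leb_pi. complex_of_real (C (cos x)) * h x) \<le> e * (1 + (LINT x|leb_pi. cmod (h x)))" if "e > 0" for e
      using that by blast
    have p: "0 < 1 + (LINT x|leb_pi. cmod (h x))"
    proof -
      have "0 \<le> (LINT x|leb_pi. cmod (h x))" by (intro Bochner_Integration.integral_nonneg) simp
      then show ?thesis by linarith
    qed
    have "cmod (LINT x|leb_pi. complex_of_real (C (cos x)) * h x) \<le> 0"
    proof (rule field_le_epsilon)
      fix e :: real assume "e > 0"
      then show "cmod (LINT x|leb_pi. complex_of_real (C (cos x)) * h x) \<le> 0 + e"
        using *[of "e / (1 + (LINT x|leb_pi. cmod (h x)))"] p by simp
    qed
    then show ?thesis by simp
  qed
  fix p q assume pq: "0 < p" "p < q" "q < pi"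
  define C where "C j x = min 1 (real j * max 0 (min (x - cos q) (cos p - x)))" for j :: nat and x
  have Cz: "(LINT x|leb_pi. complex_of_real (C j (cos x)) * h x) = 0" for j
    by (rule C) (auto simp: C_def[abs_def] intro!: continuous_intros)
  have "(\<lambda>j. LINT x|leb_pi. complex_of_real (C j (cos x)) * h x) \<longlonglongrightarrow> (LINT x|leb_pi. indicator {p<..<q} x *\<^sub>R h x)"
  proof (rule integral_dominated_convergence[where w="\<lambda>x. cmod (h x)"])
    show "integrable leb_pi (\<lambda>x. cmod (h x))" using h by simp
    show "(\<lambda>x. complex_of_real (C j (cos x)) * h x) \<in> borel_measurable leb_pi" for j
      by (rule borel_measurable_integrable[OF hI]) (auto simp: C_def[abs_def] intro!: continuous_intros)
    have "indicator {p<..<q} \<in> borel_measurable leb_pi"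
      by (rule borel_lebesgue_on) simp
    then show "(\<lambda>x. indicator {p<..<q} x *\<^sub>R h x) \<in> borel_measurable leb_pi"
      by (intro borel_measurable_scaleR) auto
    show "AE x in leb_pi. cmod (complex_of_real (C j (cos x)) * h x) \<le> cmod (h x)" for j
    proof (rule AE_I2)
      fix x
      have "0 \<le> C j (cos x)" "C j (cos x) \<le> 1" by (auto simp: C_def)
      then show "cmod (complex_of_real (C j (cos x)) * h x) \<le> cmod (h x)"
        by (auto simp: norm_mult intro: mult_left_le_one_le)
    qed
    show "AE x in leb_pi. (\<lambda>j. complex_of_real (C j (cos x)) * h x) \<longlonglongrightarrow> indicator {p<..<q} x *\<^sub>R h x"
    proof (rule AE_I2)
      fix x assume "x \<in> space leb_pi"
      then have x: "0 < x" "x < pi" by auto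
      define d where "d = min (cos x - cos q) (cos p - cos x)"
      have d: "d > 0 \<longleftrightarrow> x \<in> {p<..<q}"
        using x pq cos_mono_less_eq[of q x] cos_mono_less_eq[of x p] by (auto simp: d_def)
      have "(\<lambda>j. C j (cos x)) \<longlonglongrightarrow> indicator {p<..<q} x"
      proof -
        have "(if d > 0 then 1 else 0) = (indicator {p<..<q} x :: real)" using d by (simp add: indicator_def)
        then show ?thesis using ramp_limit[of d] by (simp only: C_def d_def)
      qed
      then have "(\<lambda>j. complex_of_real (C j (cos x)) * h x) \<longlonglongrightarrow> complex_of_real (indicator {p<..<q} x) * h x"
        by (intro tendsto_intros)
      then show "(\<lambda>j. complex_of_real (C j (cos x)) * h x) \<longlonglongrightarrow> indicator {p<..<q} x *\<^sub>R h x"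
        by (simp add: scaleR_conv_of_real)
    qed
  qed
  then have "(LINT x|leb_pi. indicator {p<..<q} x *\<^sub>R h x) = 0"
    unfolding Cz by (simp add: LIMSEQ_const_iff)
  moreover have "(LINT x|leb_pi. indicator {p<..<q} x *\<^sub>R h x) = (LINT x|lebesgue_on {p<..<q}. indicator {p<..<q} x *\<^sub>R h x)"
    using pq by (intro integral_vanishing_outside) auto
  moreover have "\<dots> = (LINT x|lebesgue_on {p<..<q}. h x)"
    by (intro Bochner_Integration.integral_cong) auto
  ultimately show "(LINT x|lebesgue_on {p<..<q}. h x) = 0" by simp
qed

text \<open>The three-term recurrence turns orthogonality to all eigenfunctions into orthogonality to
  \<open>cos\<^sup>m \<phi>\<close> times any eigenfunction, by induction on \<open>m\<close>.\<close>

lemma zonal_total: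
  assumes f: "f \<in> L2 hmeas" and orth: "\<And>n. ip hmeas f (czonal n) = 0"
  shows "AE x in hmeas. f x = 0"
proof -
  have i: "integrable leb_pi (\<lambda>x. complex_of_real (\<omega> x * c x) * f x)" if "continuous_on {0..pi} c" for c
    by (rule ip_hmeas_real(2)[OF f that])
  have *: "(LINT x|leb_pi. complex_of_real (\<omega> x * (cos x ^ m * zonal n x)) * f x) = 0" for m n
  proof (induction m arbitrary: n)
    case 0
    then show ?case using orth[of n] ip_hmeas_real(1)[OF f zonal_continuous, of n] by simp
  next
    case (Suc m)
    let ?I = "\<lambda>m n. LINT x|leb_pi. complex_of_real (\<omega> x * (cos x ^ m * zonal n x)) * f x"
    have ii: "integrable leb_pi (\<lambda>x. complex_of_real (\<omega> x * (cos x ^ m * zonal n x)) * f x)" for m n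
      by (intro i continuous_intros zonal_continuous)
    have "complex_of_real (4 * real n + 1) * ?I (Suc m) n
        = (LINT x|leb_pi. complex_of_real (4 * real n + 1) * (complex_of_real (\<omega> x * (cos x ^ Suc m * zonal n x)) * f x))"
      by simp
    also have "\<dots> = (LINT x|leb_pi. complex_of_real (2 * real n + 1) * (complex_of_real (\<omega> x * (cos x ^ m * zonal (Suc n) x)) * f x)
      + complex_of_real (2 * real n) * (complex_of_real (\<omega> x * (cos x ^ m * zonal (n - 1) x)) * f x))"
    proof (rule Bochner_Integration.integral_cong[OF refl])
      fix x
      have "(4 * real n + 1) * (\<omega> x * (cos x ^ Suc m * zonal n x)) = \<omega> x * cos x ^ m * ((4 * real n + 1) * (cos x * gegenbauer n (cos x)))"
        by (simp add: zonal_def mult_ac)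
      also have "\<dots> = (2 * real n + 1) * (\<omega> x * (cos x ^ m * zonal (Suc n) x)) + 2 * real n * (\<omega> x * (cos x ^ m * zonal (n - 1) x))"
        unfolding gegenbauer_recurrence by (simp add: zonal_def algebra_simps del: gegenbauer.simps)
      finally have "complex_of_real ((4 * real n + 1) * (\<omega> x * (cos x ^ Suc m * zonal n x))) * f x
          = complex_of_real ((2 * real n + 1) * (\<omega> x * (cos x ^ m * zonal (Suc n) x)) + 2 * real n * (\<omega> x * (cos x ^ m * zonal (n - 1) x))) * f x"
        by (rule arg_cong)
      then show "complex_of_real (4 * real n + 1) * (complex_of_real (\<omega> x * (cos x ^ Suc m * zonal n x)) * f x)
        = complex_of_real (2 * real n + 1) * (complex_of_real (\<omega> x * (cos x ^ m * zonal (Suc n) x)) * f x)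
          + complex_of_real (2 * real n) * (complex_of_real (\<omega> x * (cos x ^ m * zonal (n - 1) x)) * f x)"
        by (simp only: of_real_mult of_real_add distrib_right mult.assoc)
    qed
    also have "\<dots> = complex_of_real (2 * real n + 1) * ?I m (Suc n) + complex_of_real (2 * real n) * ?I m (n - 1)"
      by (subst Bochner_Integration.integral_add) (intro integrable_mult_right ii, intro integrable_mult_right ii, simp)
    also have "\<dots> = 0" unfolding Suc.IH by simp
    finally have "complex_of_real (4 * real n + 1) * ?I (Suc m) n = 0" .
    moreover have "complex_of_real (4 * real n + 1) \<noteq> 0" unfolding of_real_eq_0_iff by linarith
    ultimately show ?case by (simp only: mult_eq_0_iff simp_thms)
  qed
  have "AE x in leb_pi. complex_of_real (\<omega> x * 1) * f x = 0"
  proof (rule cos_powers_total)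
    show "integrable leb_pi (\<lambda>x. complex_of_real (\<omega> x * 1) * f x)" by (rule i) simp
    show "(LINT x|leb_pi. complex_of_real (cos x ^ m) * (complex_of_real (\<omega> x * 1) * f x)) = 0" for m
      using *[of m 0] by (simp add: zonal_def mult_ac)
  qed
  then show ?thesis unfolding AE_hmeas using AE_space
  proof eventually_elim
    case (elim x) then show ?case using \<omega>_pos[of x] by auto
  qed
qed

text \<open>The derivatives of the eigenfunctions span the functions \<open>sin \<phi> cos\<^sup>m \<phi>\<close>, because the
  eigenfunctions span the powers of \<open>cos \<phi>\<close>.\<close>

lemma zonal_deriv_total:
  assumes f: "f \<in> L2 hmeas" and orth: "\<And>n. ip hmeas f (czonal_deriv (Suc n)) = 0"
  shows "AE x in hmeas. f x = 0"
proof -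
  have i: "integrable leb_pi (\<lambda>x. complex_of_real (\<omega> x * c x) * f x)" if "continuous_on {0..pi} c" for c
    by (rule ip_hmeas_real(2)[OF f that])
  \<comment> \<open>\<open>Z m n\<close> is the derivative of \<open>cos\<^sup>m \<phi> P\<^sub>n(cos \<phi>)\<close>\<close>
  define Z where "Z m n x = - sin x * (real m * cos x ^ (m - 1) * gegenbauer n (cos x) + cos x ^ m * gegenbauer_deriv n (cos x))" for m n x
  have Zc: "continuous_on {0..pi} (Z m n)" for m n
    unfolding Z_def by (intro continuous_intros continuous_on_compose2[OF gegenbauer_continuous[of UNIV]] continuous_on_compose2[OF gegenbauer_deriv_continuous[of UNIV]]) auto
  let ?I = "\<lambda>m n. LINT x|leb_pi. complex_of_real (\<omega> x * Z m n x) * f x"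
  have *: "?I m n = 0" for m n
  proof (induction m arbitrary: n)
    case 0
    have Z0: "Z 0 n x = zonal_deriv n x" for n x by (simp add: Z_def zonal_deriv_def)
    show ?case
    proof (cases n)
      case 0 then show ?thesis by (simp add: Z_def)
    next
      case (Suc k)
      then show ?thesis unfolding Z0 using orth[of k] ip_hmeas_real(1)[OF f zonal_deriv_continuous, of n] by simp
    qed
  next
    case (Suc m)
    have ii: "integrable leb_pi (\<lambda>x. complex_of_real (\<omega> x * Z m n x) * f x)" for m n
      by (intro i Zc)
    have "complex_of_real (4 * real n + 1) * ?I (Suc m) n
        = (LINT x|leb_pi. complex_of_real (4 * real n + 1) * (complex_of_real (\<omega> x * Z (Suc m) n x) * f x))"
      by simp
    also have "\<dots> = (LINT x|leb_pi. complex_of_real (2 * real n + 1) * (complex_of_real (\<omega> x * Z m (Suc n) x) * f x)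
      + complex_of_real (2 * real n) * (complex_of_real (\<omega> x * Z m (n - 1) x) * f x))"
    proof (rule Bochner_Integration.integral_cong[OF refl])
      fix x :: real
      let ?c = "cos x"
      have "(4 * real n + 1) * Z (Suc m) n x
        = - sin x * (real m * ?c ^ (m - 1) * ((4 * real n + 1) * (?c * gegenbauer n ?c)) + ?c ^ m * ((4 * real n + 1) * (gegenbauer n ?c + ?c * gegenbauer_deriv n ?c)))"
        by (cases m) (simp_all add: Z_def algebra_simps)
      also have "\<dots> = (2 * real n + 1) * Z m (Suc n) x + 2 * real n * Z m (n - 1) x"
        unfolding gegenbauer_recurrence gegenbauer_deriv_recurrence by (simp add: Z_def algebra_simps del: gegenbauer.simps gegenbauer_deriv.simps)
      finally have "\<omega> x * ((4 * real n + 1) * Z (Suc m) n x) = \<omega> x * ((2 * real n + 1) * Z m (Suc n) x + 2 * real n * Z m (n - 1) x)"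
        by simp
      then have "complex_of_real (\<omega> x * ((4 * real n + 1) * Z (Suc m) n x)) * f x
          = complex_of_real (\<omega> x * ((2 * real n + 1) * Z m (Suc n) x + 2 * real n * Z m (n - 1) x)) * f x"
        by (rule arg_cong)
      then show "complex_of_real (4 * real n + 1) * (complex_of_real (\<omega> x * Z (Suc m) n x) * f x)
        = complex_of_real (2 * real n + 1) * (complex_of_real (\<omega> x * Z m (Suc n) x) * f x)
          + complex_of_real (2 * real n) * (complex_of_real (\<omega> x * Z m (n - 1) x) * f x)"
        by (simp only: of_real_mult of_real_add distrib_right distrib_left mult_ac)
    qed
    also have "\<dots> = complex_of_real (2 * real n + 1) * ?I m (Suc n) + complex_of_real (2 * real n) * ?I m (n - 1)"
      by (subst Bochner_Integration.integral_add) (intro integrable_mult_right ii, intro integrable_mult_right ii, simp)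
    also have "\<dots> = 0" unfolding Suc.IH by simp
    finally have "complex_of_real (4 * real n + 1) * ?I (Suc m) n = 0" .
    moreover have "complex_of_real (4 * real n + 1) \<noteq> 0" unfolding of_real_eq_0_iff by linarith
    ultimately show ?case by (simp only: mult_eq_0_iff simp_thms)
  qed
  have "AE x in leb_pi. complex_of_real (\<omega> x * sin x) * f x = 0"
  proof (rule cos_powers_total)
    show "integrable leb_pi (\<lambda>x. complex_of_real (\<omega> x * sin x) * f x)" by (rule i) (intro continuous_intros)
    fix m
    have "0 = ?I (Suc m) 0" by (rule *[symmetric])
    also have "\<dots> = (LINT x|leb_pi. - complex_of_real (real (Suc m)) * (complex_of_real (cos x ^ m) * (complex_of_real (\<omega> x * sin x) * f x)))"
      by (intro Bochner_Integration.integral_cong) (auto simp: Z_def algebra_simps)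
    also have "\<dots> = - complex_of_real (real (Suc m)) * (LINT x|leb_pi. complex_of_real (cos x ^ m) * (complex_of_real (\<omega> x * sin x) * f x))"
      by (rule integral_mult_right_zero)
    finally show "(LINT x|leb_pi. complex_of_real (cos x ^ m) * (complex_of_real (\<omega> x * sin x) * f x)) = 0"
      by (simp del: of_nat_Suc of_real_of_nat_eq)
  qed
  then show ?thesis unfolding AE_hmeas using AE_space
  proof eventually_elim
    case (elim x) then show ?case using \<omega>_pos[of x] sin_gt_zero[of x] by auto
  qed
qed

section \<open>Eigenfunction expansions\<close>

definition eig :: "nat \<Rightarrow> real \<Rightarrow> complex" where
  "eig n x = complex_of_real (1 / sqrt (zonal_nsq n)) * czonal n x"

definition deig :: "nat \<Rightarrow> real \<Rightarrow> complex" where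
  "deig n x = complex_of_real (1 / sqrt (zonal_nsq n)) * czonal_deriv n x"

text \<open>The normalized derivatives of the eigenfunctions. The index is shifted because \<open>eig 0\<close> is constant.
  That they are complete as well turns the energy of a function into a sum over its coefficients.\<close>

definition psi :: "nat \<Rightarrow> real \<Rightarrow> complex" where
  "psi n x = complex_of_real (2 / sqrt (ev (Suc n))) * deig (Suc n) x"

definition lam :: "nat \<Rightarrow> real" where "lam n = 2 * real n + 1/2"

lemma lam_sq: "(lam n)\<^sup>2 = ev n + 1/4"
  by (simp add: lam_def ev_def power2_eq_square algebra_simps)

lemma lam_pos: "lam n > 0"
  by (simp add: lam_def add_nonneg_pos)

lemma ev_nonneg: "0 \<le> ev n" and ev_Suc_pos: "0 < ev (Suc n)" and ev_0: "ev 0 = 0"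
  by (simp_all add: ev_def add_pos_nonneg del: of_nat_Suc)

lemma eig_L2: "eig n \<in> L2 hmeas" and deig_L2: "deig n \<in> L2 hmeas" and psi_L2: "psi n \<in> L2 hmeas"
  unfolding eig_def[abs_def] deig_def[abs_def] psi_def[abs_def] by (intro L2_scale czonal_L2 czonal_deriv_L2)+

lemma eig_ip: "ip hmeas (eig m) (eig n) = of_bool (m = n)"
proof -
  have "complex_of_real (sqrt (zonal_nsq n)) * complex_of_real (sqrt (zonal_nsq n)) = complex_of_real (zonal_nsq n)"
    using zonal_nsq_pos[of n] by (simp add: of_real_mult[symmetric] del: of_real_mult)
  then show ?thesis
    unfolding eig_def[abs_def] ip_scale_left ip_scale_right zonal_orthogonal using zonal_nsq_pos[of n]
    by (auto simp: field_simps)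
qed

lemma deig_ip: "4 * ip hmeas f (deig n) = complex_of_real (1 / sqrt (zonal_nsq n)) * (4 * ip hmeas f (czonal_deriv n))"
  unfolding deig_def[abs_def] ip_scale_right by simp

lemma psi_ip: "ip hmeas (psi m) (psi n) = of_bool (m = n)"
proof -
  have e: "ip hmeas (deig (Suc m)) (deig (Suc n)) = complex_of_real (ev (Suc n) / 4) * of_bool (m = n)"
  proof -
    have "4 * ip hmeas (deig (Suc m)) (deig (Suc n)) = complex_of_real (ev (Suc n)) * ip hmeas (eig (Suc m)) (eig (Suc n))"
      unfolding deig_def[abs_def] eig_def[abs_def] ip_scale_left ip_scale_right using czonal_deriv_ip[of "Suc m" "Suc n"]
      by (simp add: mult_ac)
    then show ?thesis by (simp add: eig_ip field_simps)
  qed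
  have "complex_of_real (sqrt (ev (Suc n))) * complex_of_real (sqrt (ev (Suc n))) = complex_of_real (ev (Suc n))"
    using ev_nonneg[of "Suc n"] by (simp add: of_real_mult[symmetric] del: of_real_mult)
  then show ?thesis
    unfolding psi_def[abs_def] ip_scale_left ip_scale_right e using ev_Suc_pos[of n]
    by (auto simp: field_simps)
qed

interpretation E: orthonormal_basis hmeas eig
proof
  fix f assume f: "f \<in> L2 hmeas" and z: "\<And>n. ip hmeas f (eig n) = 0"
  show "AE x in hmeas. f x = 0"
  proof (rule zonal_total[OF f])
    fix n show "ip hmeas f (czonal n) = 0"
      using z[of n] zonal_nsq_pos[of n] unfolding eig_def[abs_def] ip_scale_right by simp
  qed
qed (auto intro: eig_L2 simp: eig_ip)

interpretation D: orthonormal_basis hmeas psi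
proof
  fix f assume f: "f \<in> L2 hmeas" and z: "\<And>n. ip hmeas f (psi n) = 0"
  show "AE x in hmeas. f x = 0"
  proof (rule zonal_deriv_total[OF f])
    fix n show "ip hmeas f (czonal_deriv (Suc n)) = 0"
      using z[of n] zonal_nsq_pos[of "Suc n"] ev_Suc_pos[of n]
      unfolding psi_def[abs_def] deig_def[abs_def] ip_scale_right by simp
  qed
qed (auto intro: psi_L2 simp: psi_ip)

abbreviation coef :: "(real \<Rightarrow> complex) \<Rightarrow> nat \<Rightarrow> complex" where
  "coef f n \<equiv> ip hmeas f (eig n)"

lemma V_loc: "f \<in> V_space \<Longrightarrow> L1_loc 0 pi f" "f \<in> V_space \<Longrightarrow> L1_loc 0 pi (wderiv f)"
  by (auto intro: L2_loc_L1_loc L2_hmeas_L2_loc V_spaceD)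

lemma V_diff_scale:
  assumes "f \<in> V_space" "g \<in> V_space"
  shows "(\<lambda>x. f x - c * g x) \<in> V_space"
    "AE x in hmeas. wderiv (\<lambda>x. f x - c * g x) x = wderiv f x - c * wderiv g x"
proof -
  have "is_weak_deriv (\<lambda>x. c * g x) (\<lambda>x. c * wderiv g x)"
    unfolding is_weak_deriv_def
  proof
    fix \<theta> assume "\<theta> \<in> test_functions {0<..<pi}"
    then have "(LINT x|leb_pi. complex_of_real (deriv \<theta> x) * g x) = - (LINT x|leb_pi. complex_of_real (\<theta> x) * wderiv g x)"
      using V_spaceD(3)[OF assms(2)] by (simp add: is_weak_deriv_def)
    then have "c * (LINT x|leb_pi. complex_of_real (deriv \<theta> x) * g x) = - (c * (LINT x|leb_pi. complex_of_real (\<theta> x) * wderiv g x))"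
      by simp
    then show "(LINT x|leb_pi. complex_of_real (deriv \<theta> x) * (c * g x)) = - (LINT x|leb_pi. complex_of_real (\<theta> x) * (c * wderiv g x))"
      by (simp only: integral_mult_right_zero[symmetric] mult_ac)
  qed
  then have "is_weak_deriv (\<lambda>x. f x - c * g x) (\<lambda>x. wderiv f x - c * wderiv g x)"
    using V_loc[OF assms(1)] V_loc[OF assms(2)] V_spaceD(3)[OF assms(1)]
    by (intro is_weak_deriv_diff) (auto simp: L1_loc_def)
  then show "(\<lambda>x. f x - c * g x) \<in> V_space"
    "AE x in hmeas. wderiv (\<lambda>x. f x - c * g x) x = wderiv f x - c * wderiv g x"
    using V_spaceD[OF assms(1)] V_spaceD[OF assms(2)] by (intro V_spaceI L2_diff L2_scale; simp)+
qed

lemma zero_V: "(\<lambda>x. 0) \<in> V_space"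
  using V_diff_scale(1)[OF czonal_V(1) czonal_V(1), of 0 1 0] by simp

lemma eig_V: "eig n \<in> V_space" "AE x in hmeas. wderiv (eig n) x = deig n x"
proof -
  have e: "eig n = (\<lambda>x. 0 - (- complex_of_real (1 / sqrt (zonal_nsq n))) * czonal n x)"
    by (auto simp: eig_def fun_eq_iff)
  show "eig n \<in> V_space" unfolding e by (intro V_diff_scale(1) zero_V czonal_V)
  have z: "AE x in hmeas. wderiv (\<lambda>x. 0) x = 0"
    by (rule V_spaceI(2)) (auto simp: is_weak_deriv_def)
  show "AE x in hmeas. wderiv (eig n) x = deig n x"
    unfolding e using V_diff_scale(2)[OF zero_V czonal_V(1), of "- complex_of_real (1 / sqrt (zonal_nsq n))" n] z czonal_V(2)[of n]
    by eventually_elim (simp add: deig_def)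
qed

lemma Green_eig:
  assumes "f \<in> V_space"
  shows "4 * ip hmeas (wderiv f) (deig n) = ev n * coef f n"
proof -
  have "coef f n = complex_of_real (1 / sqrt (zonal_nsq n)) * ip hmeas f (czonal n)"
    unfolding eig_def[abs_def] ip_scale_right by simp
  then show ?thesis unfolding deig_ip Green[OF assms] by (simp only: mult.left_commute)
qed

lemma a0_ip: "a0 f g = 4 * ip hmeas (wderiv f) (wderiv g)"
  by (simp add: a0_def ip_def)

lemma a0_eig:
  assumes "f \<in> V_space"
  shows "a0 f (eig n) = ev n * coef f n"
proof -
  have "ip hmeas (wderiv f) (wderiv (eig n)) = ip hmeas (wderiv f) (deig n)"
    using V_spaceD(2)[OF assms] V_spaceD(2)[OF eig_V(1)] deig_L2 eig_V(2)[of n]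
    by (intro ip_cong_AE) (auto dest: L2D)
  then show ?thesis using Green_eig[OF assms] by (simp add: a0_ip)
qed

lemma L0_form_eig:
  assumes "f \<in> V_space"
  shows "L0_form f (eig n) = complex_of_real ((lam n)\<^sup>2) * coef f n"
  unfolding L0_form_def H_inner_ip a0_eig[OF assms] lam_sq of_real_add distrib_right by simp

lemma coef_psi:
  assumes "f \<in> V_space"
  shows "ip hmeas (wderiv f) (psi n) = complex_of_real (sqrt (ev (Suc n)) / 2) * coef f (Suc n)"
proof -
  have q: "complex_of_real (ev (Suc n)) = complex_of_real (sqrt (ev (Suc n))) * complex_of_real (sqrt (ev (Suc n)))"
    using ev_nonneg[of "Suc n"] by (simp add: of_real_mult[symmetric] del: of_real_mult)
  have "4 * ip hmeas (wderiv f) (psi n) = complex_of_real (2 / sqrt (ev (Suc n))) * (4 * ip hmeas (wderiv f) (deig (Suc n)))"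
    unfolding psi_def[abs_def] ip_scale_right by simp
  also have "\<dots> = 4 * (complex_of_real (sqrt (ev (Suc n)) / 2) * coef f (Suc n))"
    unfolding Green_eig[OF assms] q using ev_Suc_pos[of n] by simp
  finally show ?thesis by (simp only: mult_cancel_left) simp
qed

lemma sums_shift_zero: "f 0 = 0 \<Longrightarrow> (\<lambda>n. f (Suc n)) sums s \<Longrightarrow> f sums (s :: 'a :: real_normed_vector)"
  using sums_Suc_iff[of f s] by simp

text \<open>Parseval's identity in the basis of derivatives, with the coefficients given by Green's formula.\<close>

lemma a0_Parseval:
  assumes f: "f \<in> V_space" and g: "g \<in> V_space"
  shows "(\<lambda>n. ev n * (coef f n * cnj (coef g n))) sums a0 f g"
proof (rule sums_shift_zero)
  have "(\<lambda>n. 4 * (ip hmeas (wderiv f) (psi n) * cnj (ip hmeas (wderiv g) (psi n)))) sums (4 * ip hmeas (wderiv f) (wderiv g))"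
    by (intro sums_mult D.Parseval_ip V_spaceD f g)
  moreover have "4 * (ip hmeas (wderiv f) (psi n) * cnj (ip hmeas (wderiv g) (psi n))) = ev (Suc n) * (coef f (Suc n) * cnj (coef g (Suc n)))" for n
  proof -
    have q: "complex_of_real (ev (Suc n)) = complex_of_real (sqrt (ev (Suc n))) * complex_of_real (sqrt (ev (Suc n)))"
      using ev_nonneg[of "Suc n"] by (simp add: of_real_mult[symmetric] del: of_real_mult)
    show ?thesis unfolding coef_psi[OF f] coef_psi[OF g] q by simp
  qed
  ultimately show "(\<lambda>n. ev (Suc n) * (coef f (Suc n) * cnj (coef g (Suc n)))) sums a0 f g"
    by (simp add: a0_ip)
qed (simp add: ev_0)

lemma V_norm_sums:
  assumes f: "f \<in> V_space"
  shows "(\<lambda>n. (ev n + 1) * (cmod (coef f n))\<^sup>2) sums (V_norm f)\<^sup>2"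
proof -
  have "(\<lambda>n. complex_of_real (ev n * (cmod (coef f n))\<^sup>2)) sums complex_of_real (4 * nsq hmeas (wderiv f))"
    using a0_Parseval[OF f f] unfolding a0_ip ip_self complex_norm_square[symmetric]
    by (simp only: of_real_mult of_real_numeral)
  then have "(\<lambda>n. ev n * (cmod (coef f n))\<^sup>2) sums (4 * nsq hmeas (wderiv f))" by (simp only: sums_of_real_iff)
  from sums_add[OF this E.Parseval[OF V_spaceD(1)[OF f]]]
  show ?thesis by (simp add: V_norm_sq distrib_right)
qed

text \<open>Endpoint values of the normalized eigenfunctions, at \<open>0\<close> for the index \<open>1\<close> and at \<open>pi\<close> for the
  index \<open>2\<close>.\<close>

definition amp :: "nat \<Rightarrow> 2 \<Rightarrow> real" where
  "amp n i = (if i = 1 then 1 else (-1) ^ n) / sqrt (zonal_nsq n)"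

lemma trace_eig: "trace_op (eig n) $ i = complex_of_real (amp n i)"
proof -
  have "cont_rep (eig n) x = eig n x" if "x \<in> {0..pi}" for x
  proof (rule cont_rep_eq[OF _ _ that])
    show "continuous_on {0..pi} (eig n)"
      unfolding eig_def[abs_def]
      by (intro continuous_on_mult continuous_on_const continuous_on_of_real zonal_continuous)
  qed simp
  then show ?thesis using exhaust_2[of i]
    by (auto simp: trace_op_component eig_def zonal_def gegenbauer_at_1 gegenbauer_at_minus_1 amp_def)
qed

lemma trace_op_diff_scale:
  assumes "f \<in> V_space" "g \<in> V_space"
  shows "trace_op (\<lambda>x. f x - c * g x) $ i = trace_op f $ i - c * trace_op g $ i"
proof -
  have "cont_rep (\<lambda>x. f x - c * g x) x = cont_rep f x - c * cont_rep g x" if "x \<in> {0..pi}" for x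
  proof (rule cont_rep_eq[OF _ _ that])
    show "AE x in hmeas. cont_rep f x - c * cont_rep g x = f x - c * g x"
      using cont_rep_V(2)[OF assms(1)] cont_rep_V(2)[OF assms(2)] by eventually_elim simp
  qed (intro continuous_intros cont_rep_V assms)
  then show ?thesis using exhaust_2[of i] by (auto simp: trace_op_component)
qed

lemma remainder_V:
  assumes f: "f \<in> V_space"
  shows "(\<lambda>x. f x - E.psum (coef f) N x) \<in> V_space \<and>
    (\<forall>i. trace_op (\<lambda>x. f x - E.psum (coef f) N x) $ i = trace_op f $ i - (\<Sum>n<N. coef f n * amp n i))"
proof (induction N)
  case 0
  then show ?case using f by (simp add: E.psum_def)
next
  case (Suc N)
  have e: "(\<lambda>x. f x - E.psum (coef f) (Suc N) x) = (\<lambda>x. (f x - E.psum (coef f) N x) - coef f N * eig N x)"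
    by (simp add: E.psum_def fun_eq_iff)
  show ?case unfolding e
    using V_diff_scale(1)[OF conjunct1[OF Suc] eig_V(1)] trace_op_diff_scale[OF conjunct1[OF Suc] eig_V(1)] Suc
    by (simp add: trace_eig)
qed

text \<open>The spectral truncation converges in \<open>V\<close>, hence its traces converge.\<close>

lemma trace_expansion_error:
  assumes f: "f \<in> V_space"
  shows "(cmod (trace_op f $ i - (\<Sum>n<N. coef f n * amp n i)))\<^sup>2
    \<le> trace_const * ((V_norm f)\<^sup>2 - (\<Sum>n<N. (ev n + 1) * (cmod (coef f n))\<^sup>2))"
proof -
  let ?r = "\<lambda>x. f x - E.psum (coef f) N x"
  have r: "?r \<in> V_space" using remainder_V[OF f] by simp
  have c: "coef ?r n = (if n < N then 0 else coef f n)" for n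
    using V_spaceD(1)[OF f] by (simp add: ip_diff_left E.psum_L2 E.ip_psum eig_L2)
  have "(\<lambda>n. (ev n + 1) * (cmod (coef f n))\<^sup>2 - (if n \<in> {..<N} then (ev n + 1) * (cmod (coef f n))\<^sup>2 else 0)) sums
      ((V_norm f)\<^sup>2 - (\<Sum>n<N. (ev n + 1) * (cmod (coef f n))\<^sup>2))"
    by (intro sums_diff V_norm_sums f sums_If_finite_set) simp
  also have "(\<lambda>n. (ev n + 1) * (cmod (coef f n))\<^sup>2 - (if n \<in> {..<N} then (ev n + 1) * (cmod (coef f n))\<^sup>2 else 0))
      = (\<lambda>n. (ev n + 1) * (cmod (coef ?r n))\<^sup>2)"
    by (auto simp: c fun_eq_iff)
  finally have "(V_norm ?r)\<^sup>2 = (V_norm f)\<^sup>2 - (\<Sum>n<N. (ev n + 1) * (cmod (coef f n))\<^sup>2)"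
    using V_norm_sums[OF r] by (rule sums_unique2[rotated])
  then show ?thesis using trace_bound[OF r, of i] remainder_V[OF f, of N] by simp
qed

subsection \<open>The form domain in terms of coefficients\<close>

text \<open>Unweighted integrals against a continuous function are inner products in \<open>H\<close> with \<open>c / \<omega>\<close>, and hence
  pass to limits in \<open>H\<close>.\<close>

lemma bounded_over_weight:
  assumes c: "continuous_on {0..pi} c" and u: "u \<in> L2 hmeas"
  shows "(\<lambda>x. complex_of_real (c x / \<omega> x)) \<in> L2 hmeas"
    "ip hmeas u (\<lambda>x. complex_of_real (c x / \<omega> x)) = (LINT x|leb_pi. complex_of_real (c x) * u x)"
proof -
  obtain B where "\<forall>y\<in>c ` {0..pi}. norm y \<le> B"
    using compact_imp_bounded[OF compact_continuous_image[OF c compact_Icc]] unfolding bounded_iff by blast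
  then have B: "\<And>x. x \<in> {0..pi} \<Longrightarrow> \<bar>c x\<bar> \<le> B" by auto
  have cm[measurable]: "c \<in> borel_measurable leb_pi"
    by (rule continuous_imp_measurable_on_sets_lebesgue[OF continuous_on_subset[OF c]]) auto
  have um[measurable]: "u \<in> borel_measurable leb_pi" using L2D(1)[OF u] by (simp add: borel_measurable_hmeas)
  let ?w = "\<lambda>x. complex_of_real (1 / \<omega> x)"
  show "(\<lambda>x. complex_of_real (c x / \<omega> x)) \<in> L2 hmeas"
  proof (rule L2I)
    show "(\<lambda>x. complex_of_real (c x / \<omega> x)) \<in> borel_measurable hmeas"
      unfolding borel_measurable_hmeas by measurable
    then have m: "(\<lambda>x. (cmod (complex_of_real (c x / \<omega> x)))\<^sup>2) \<in> borel_measurable hmeas" by measurable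
    show "integrable hmeas (\<lambda>x. (cmod (complex_of_real (c x / \<omega> x)))\<^sup>2)"
    proof (rule Bochner_Integration.integrable_bound[OF integrable_mult_right[OF L2D(2)[OF inverse_weight_L2], of "B\<^sup>2"] m], rule AE_I2)
      fix x assume "x \<in> space hmeas"
      then have x: "0 < x" "x < pi" by auto
      have "(cmod (complex_of_real (c x / \<omega> x)))\<^sup>2 = \<bar>c x\<bar>\<^sup>2 * (cmod (?w x))\<^sup>2"
        by (simp add: norm_divide power_divide)
      also have "\<dots> \<le> B\<^sup>2 * (cmod (?w x))\<^sup>2"
        using B[of x] x by (intro mult_right_mono power_mono) auto
      finally show "norm ((cmod (complex_of_real (c x / \<omega> x)))\<^sup>2) \<le> norm (B\<^sup>2 * (cmod (?w x))\<^sup>2)"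
        by (simp add: abs_mult)
    qed
  qed
  have m: "(\<lambda>x. u x * cnj (complex_of_real (c x / \<omega> x))) \<in> borel_measurable leb_pi" by measurable
  show "ip hmeas u (\<lambda>x. complex_of_real (c x / \<omega> x)) = (LINT x|leb_pi. complex_of_real (c x) * u x)"
    unfolding ip_def integral_hmeas[OF m]
  proof (rule Bochner_Integration.integral_cong[OF refl])
    fix x assume "x \<in> space leb_pi"
    then have "\<omega> x \<noteq> 0" using \<omega>_pos[of x] by auto
    then show "\<omega> x *\<^sub>R (u x * cnj (complex_of_real (c x / \<omega> x))) = complex_of_real (c x) * u x"
      by (simp add: scaleR_conv_of_real)
  qed
qed

text \<open>The Riesz--Fischer theorem in the basis of derivatives supplies a candidate for the weak
  derivative. The integration by parts holds for partial sums and passes to the limit.\<close>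

lemma V_space_if_summable:
  assumes f: "f \<in> L2 hmeas" and s: "summable (\<lambda>n. ev n * (cmod (coef f n))\<^sup>2)"
  shows "f \<in> V_space"
proof -
  define c where "c n = complex_of_real (sqrt (ev (Suc n)) / 2) * coef f (Suc n)" for n
  have "(cmod (c n))\<^sup>2 = (1/4) * (ev (Suc n) * (cmod (coef f (Suc n)))\<^sup>2)" for n
    using ev_nonneg[of "Suc n"] by (simp add: c_def norm_mult power_mult_distrib power_divide)
  moreover have "summable (\<lambda>n. (1/4) * (ev (Suc n) * (cmod (coef f (Suc n)))\<^sup>2))"
    using s by (intro summable_mult) (subst summable_Suc_iff)
  ultimately have "summable (\<lambda>n. (cmod (c n))\<^sup>2)" by (simp only:)
  then obtain g where g: "g \<in> L2 hmeas" "(\<lambda>N. nsq hmeas (\<lambda>x. g x - D.psum c N x)) \<longlonglongrightarrow> 0"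
    by (rule D.Riesz_Fischer)
  have w: "is_weak_deriv (E.psum (coef f) (Suc N)) (D.psum c N)" for N
  proof -
    have "is_weak_deriv (E.psum (coef f) (Suc N)) (\<lambda>x. \<Sum>n<Suc N. coef f n * deig n x)"
      unfolding is_weak_deriv_def
    proof
      fix \<theta> assume \<theta>: "\<theta> \<in> test_functions {0<..<pi}"
      have L: "L1_loc 0 pi (eig n)" "L1_loc 0 pi (deig n)" for n
        by (auto intro: L2_loc_L1_loc L2_hmeas_L2_loc eig_L2 deig_L2)
      have eq: "(LINT x|leb_pi. complex_of_real (deriv \<theta> x) * eig n x) = - (LINT x|leb_pi. complex_of_real (\<theta> x) * deig n x)" for n
      proof -
        have "(LINT x|leb_pi. complex_of_real (deriv \<theta> x) * czonal n x) = - (LINT x|leb_pi. complex_of_real (\<theta> x) * czonal_deriv n x)"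
          using czonal_weak_deriv[of n] \<theta> by (simp add: is_weak_deriv_def)
        then have "complex_of_real (1 / sqrt (zonal_nsq n)) * (LINT x|leb_pi. complex_of_real (deriv \<theta> x) * czonal n x) = - (complex_of_real (1 / sqrt (zonal_nsq n)) * (LINT x|leb_pi. complex_of_real (\<theta> x) * czonal_deriv n x))"
          by simp
        then show ?thesis unfolding eig_def deig_def
          by (simp only: integral_mult_right_zero[symmetric] mult_ac)
      qed
      have "(LINT x|leb_pi. complex_of_real (deriv \<theta> x) * E.psum (coef f) (Suc N) x)
        = (LINT x|leb_pi. (\<Sum>n<Suc N. coef f n * (complex_of_real (deriv \<theta> x) * eig n x)))"
        unfolding E.psum_def by (simp only: sum_distrib_left mult_ac)
      also have "\<dots> = (\<Sum>n<Suc N. coef f n * (LINT x|leb_pi. complex_of_real (deriv \<theta> x) * eig n x))"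
        by (subst Bochner_Integration.integral_sum) (auto intro!: integrable_mult_right test_times_integrable(2)[OF \<theta>] L)
      also have "\<dots> = - (\<Sum>n<Suc N. coef f n * (LINT x|leb_pi. complex_of_real (\<theta> x) * deig n x))"
        unfolding eq by (simp only: sum_negf[symmetric] mult_minus_right)
      also have "(\<Sum>n<Suc N. coef f n * (LINT x|leb_pi. complex_of_real (\<theta> x) * deig n x))
        = (LINT x|leb_pi. (\<Sum>n<Suc N. coef f n * (complex_of_real (\<theta> x) * deig n x)))"
        by (subst Bochner_Integration.integral_sum) (auto intro!: integrable_mult_right test_times_integrable(1)[OF \<theta>] L)
      also have "\<dots> = (LINT x|leb_pi. complex_of_real (\<theta> x) * (\<Sum>n<Suc N. coef f n * deig n x))"
        by (simp only: sum_distrib_left mult_ac)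
      finally show "(LINT x|leb_pi. complex_of_real (deriv \<theta> x) * E.psum (coef f) (Suc N) x)
        = - (LINT x|leb_pi. complex_of_real (\<theta> x) * (\<Sum>n<Suc N. coef f n * deig n x))" .
    qed
    also have "(\<lambda>x. \<Sum>n<Suc N. coef f n * deig n x) = D.psum c N"
    proof
      fix x
      have q: "c n * psi n x = coef f (Suc n) * deig (Suc n) x" for n
        using ev_Suc_pos[of n] by (simp add: c_def psi_def)
      have "deig 0 x = 0" by (simp add: deig_def zonal_deriv_def)
      then show "(\<Sum>n<Suc N. coef f n * deig n x) = D.psum c N x"
        unfolding D.psum_def q by (subst sum.lessThan_Suc_shift) simp
    qed
    finally show ?thesis .
  qed
  have "is_weak_deriv f g"
    unfolding is_weak_deriv_def
  proof
    fix \<theta> assume \<theta>: "\<theta> \<in> test_functions {0<..<pi}"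
    have s: "continuous_on {0..pi} \<theta>" "continuous_on {0..pi} (deriv \<theta>)"
      using test_function_smooth[OF \<theta>] by (auto intro: smooth_continuous)
    note b = bounded_over_weight[OF s(1)] and b' = bounded_over_weight[OF s(2)]
    have 1: "(\<lambda>N. LINT x|leb_pi. complex_of_real (deriv \<theta> x) * E.psum (coef f) (Suc N) x) \<longlonglongrightarrow> (LINT x|leb_pi. complex_of_real (deriv \<theta> x) * f x)"
      unfolding b'(2)[OF f, symmetric] b'(2)[OF E.psum_L2, symmetric]
      by (intro ip_tendsto f b'(1)[OF f] E.psum_L2 LIMSEQ_Suc[OF E.expansion[OF f]])
    have 2: "(\<lambda>N. LINT x|leb_pi. complex_of_real (\<theta> x) * D.psum c N x) \<longlonglongrightarrow> (LINT x|leb_pi. complex_of_real (\<theta> x) * g x)"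
      unfolding b(2)[OF g(1), symmetric] b(2)[OF D.psum_L2, symmetric]
      by (intro ip_tendsto g b(1)[OF f] D.psum_L2)
    have "(\<lambda>N. - (LINT x|leb_pi. complex_of_real (\<theta> x) * D.psum c N x)) \<longlonglongrightarrow> (LINT x|leb_pi. complex_of_real (deriv \<theta> x) * f x)"
      using 1 w \<theta> by (simp add: is_weak_deriv_def)
    then show "(LINT x|leb_pi. complex_of_real (deriv \<theta> x) * f x) = - (LINT x|leb_pi. complex_of_real (\<theta> x) * g x)"
      using tendsto_minus[OF 2] by (rule LIMSEQ_unique)
  qed
  then show ?thesis by (rule V_spaceI(1)[OF f g(1)])
qed

section \<open>The square root of \<open>L\<^sub>0\<close>\<close>

definition diag_sqrt :: "((real \<Rightarrow> complex) \<times> (real \<Rightarrow> complex)) set" where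
  "diag_sqrt = {(y, z). y \<in> L2 hmeas \<and> z \<in> L2 hmeas \<and> (\<forall>n. coef z n = lam n * coef y n)}"

text \<open>By Parseval's identity for the form, it suffices to test the defining identity of the operator on
  eigenfunctions.\<close>

lemma L0_op_iff:
  "(f, k) \<in> L0_op \<longleftrightarrow> f \<in> V_space \<and> k \<in> L2 hmeas \<and> (\<forall>n. coef k n = complex_of_real ((lam n)\<^sup>2) * coef f n)"
proof
  assume "(f, k) \<in> L0_op"
  then obtain h where h: "k = (\<lambda>x. h x + (1/4) * f x)" "f \<in> V_space" "h \<in> L2 hmeas"
    "\<And>g. g \<in> V_space \<Longrightarrow> a0 f g = ip hmeas h g"
    by (auto simp: L0_op_def A0_op_def H_space_L2 H_inner_ip)
  note fL = V_spaceD(1)[OF h(2)]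
  have "coef k n = complex_of_real ((lam n)\<^sup>2) * coef f n" for n
  proof -
    have "coef k n = coef h n + (1/4) * coef f n"
      unfolding h(1) by (subst ip_add_left[OF h(3) L2_scale[OF fL] eig_L2]) (subst ip_scale_left, rule refl)
    also have "coef h n = ev n * coef f n" using h(4)[OF eig_V(1)] a0_eig[OF h(2)] by simp
    finally show ?thesis unfolding lam_sq by (simp add: algebra_simps)
  qed
  moreover have "k \<in> L2 hmeas" unfolding h(1) by (intro L2_add L2_scale h(3) fL)
  ultimately show "f \<in> V_space \<and> k \<in> L2 hmeas \<and> (\<forall>n. coef k n = complex_of_real ((lam n)\<^sup>2) * coef f n)"
    using h(2) by blast
next
  assume a: "f \<in> V_space \<and> k \<in> L2 hmeas \<and> (\<forall>n. coef k n = complex_of_real ((lam n)\<^sup>2) * coef f n)"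
  then have f: "f \<in> V_space" and k: "k \<in> L2 hmeas" and c: "\<And>n. coef k n = complex_of_real ((lam n)\<^sup>2) * coef f n" by auto
  note fL = V_spaceD(1)[OF f]
  define h where "h x = k x - (1/4) * f x" for x
  have hL: "h \<in> L2 hmeas" unfolding h_def by (intro L2_diff L2_scale k fL)
  have "a0 f g = ip hmeas h g" if g: "g \<in> V_space" for g
  proof -
    note gL = V_spaceD(1)[OF g]
    have ch: "coef h n = ev n * coef f n" for n
    proof -
      have "coef h n = coef k n - (1/4) * coef f n"
        unfolding h_def by (subst ip_diff_left[OF k L2_scale[OF fL] eig_L2]) (subst ip_scale_left, rule refl)
      then show ?thesis unfolding c lam_sq by (simp add: algebra_simps)
    qed
    have "(\<lambda>n. ev n * (coef f n * cnj (coef g n))) sums ip hmeas h g"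
      using E.Parseval_ip[OF hL gL] unfolding ch by (simp add: mult.assoc)
    then show ?thesis using a0_Parseval[OF f g] by (rule sums_unique2[rotated])
  qed
  then have "(f, h) \<in> A0_op" using f hL by (simp add: A0_op_def H_space_L2 H_inner_ip)
  moreover have "k = (\<lambda>x. h x + (1/4) * f x)" by (simp add: h_def)
  ultimately show "(f, k) \<in> L0_op" by (auto simp: L0_op_def)
qed

lemma diag_sqrt_compose: "diag_sqrt O diag_sqrt = L0_op"
proof -
  have "(f, k) \<in> diag_sqrt O diag_sqrt \<longleftrightarrow> (f, k) \<in> L0_op" for f k
  proof
    assume "(f, k) \<in> diag_sqrt O diag_sqrt"
    then obtain z where z: "f \<in> L2 hmeas" "z \<in> L2 hmeas" "k \<in> L2 hmeas"
      "\<And>n. coef z n = lam n * coef f n" "\<And>n. coef k n = lam n * coef z n"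
      by (auto simp: diag_sqrt_def)
    have "summable (\<lambda>n. (cmod (coef z n))\<^sup>2)" using E.Parseval[OF z(2)] by (rule sums_summable)
    then have "summable (\<lambda>n. ev n * (cmod (coef f n))\<^sup>2)"
    proof (rule summable_comparison_test_ev[rotated], intro always_eventually allI)
      fix n
      have "(cmod (coef z n))\<^sup>2 = (lam n)\<^sup>2 * (cmod (coef f n))\<^sup>2"
        unfolding z(4) by (simp add: norm_mult power_mult_distrib)
      then show "norm (ev n * (cmod (coef f n))\<^sup>2) \<le> (cmod (coef z n))\<^sup>2"
        using ev_nonneg[of n] by (simp add: lam_sq distrib_right)
    qed
    then have "f \<in> V_space" using z(1) by (intro V_space_if_summable)
    then show "(f, k) \<in> L0_op" using z by (simp add: L0_op_iff power2_eq_square)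
  next
    assume "(f, k) \<in> L0_op"
    then have f: "f \<in> V_space" and k: "k \<in> L2 hmeas" "\<And>n. coef k n = complex_of_real ((lam n)\<^sup>2) * coef f n"
      by (auto simp: L0_op_iff)
    have "summable (\<lambda>n. (ev n + 1) * (cmod (coef f n))\<^sup>2)" using V_norm_sums[OF f] by (rule sums_summable)
    then have "summable (\<lambda>n. (cmod (complex_of_real (lam n) * coef f n))\<^sup>2)"
    proof (rule summable_comparison_test_ev[rotated], intro always_eventually allI)
      fix n show "norm ((cmod (complex_of_real (lam n) * coef f n))\<^sup>2) \<le> (ev n + 1) * (cmod (coef f n))\<^sup>2"
        using ev_nonneg[of n] by (simp add: norm_mult power_mult_distrib lam_sq mult_right_mono abs_mult)
    qed
    then obtain z where z: "z \<in> L2 hmeas" "\<And>n. coef z n = complex_of_real (lam n) * coef f n"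
      by (rule E.Riesz_Fischer) blast
    have "(f, z) \<in> diag_sqrt" "(z, k) \<in> diag_sqrt"
      using f k z V_spaceD(1)[OF f] by (auto simp: diag_sqrt_def power2_eq_square)
    then show "(f, k) \<in> diag_sqrt O diag_sqrt" by auto
  qed
  then show ?thesis by auto
qed

lemma diag_sqrt_symmetric:
  assumes "(f, h) \<in> diag_sqrt" "(y, z) \<in> diag_sqrt"
  shows "ip hmeas h y = ip hmeas f z"
proof -
  have L: "f \<in> L2 hmeas" "h \<in> L2 hmeas" "y \<in> L2 hmeas" "z \<in> L2 hmeas"
    and c: "\<And>n. coef h n = lam n * coef f n" "\<And>n. coef z n = lam n * coef y n"
    using assms by (auto simp: diag_sqrt_def)
  have "(\<lambda>n. coef h n * cnj (coef y n)) = (\<lambda>n. coef f n * cnj (coef z n))"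
    unfolding c by (simp add: mult_ac)
  then show ?thesis using E.Parseval_ip[OF L(2,3)] E.Parseval_ip[OF L(1,4)] by (metis sums_unique2)
qed

lemma eig_diag_sqrt: "(eig n, \<lambda>x. lam n * eig n x) \<in> diag_sqrt"
  by (auto simp: diag_sqrt_def eig_L2 eig_ip)

lemma diag_sqrt_is_sqrt: "is_nonneg_sqrt L0_op diag_sqrt"
  unfolding is_nonneg_sqrt_def
proof (intro conjI)
  show "diag_sqrt = H_adjoint diag_sqrt"
  proof (intro equalityI subsetI; clarify)
    fix y z assume yz: "(y, z) \<in> diag_sqrt"
    have "\<forall>(f, h)\<in>diag_sqrt. ip hmeas h y = ip hmeas f z"
      using diag_sqrt_symmetric[OF _ yz] by blast
    moreover have "y \<in> L2 hmeas" "z \<in> L2 hmeas" using yz by (auto simp: diag_sqrt_def)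
    ultimately show "(y, z) \<in> H_adjoint diag_sqrt"
      by (simp add: H_adjoint_def H_space_L2 H_inner_ip)
  next
    fix y z assume "(y, z) \<in> H_adjoint diag_sqrt"
    then have L: "y \<in> L2 hmeas" "z \<in> L2 hmeas" and
      a0: "\<forall>(f, h)\<in>diag_sqrt. ip hmeas h y = ip hmeas f z"
      by (simp_all add: H_adjoint_def H_space_L2 H_inner_ip)
    have a: "\<And>f h. (f, h) \<in> diag_sqrt \<Longrightarrow> ip hmeas h y = ip hmeas f z" using a0 by blast
    have "coef z n = lam n * coef y n" for n
    proof -
      have "lam n * ip hmeas (eig n) y = ip hmeas (eig n) z" using a[OF eig_diag_sqrt] by simp
      then have "cnj (lam n * ip hmeas (eig n) y) = cnj (ip hmeas (eig n) z)" by (rule arg_cong)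
      then show ?thesis by (simp add: ip_commute[of hmeas "eig n"])
    qed
    then show "(y, z) \<in> diag_sqrt" using L by (simp add: diag_sqrt_def)
  qed
  show "\<forall>(f, h)\<in>diag_sqrt. Im (H_inner h f) = 0 \<and> 0 \<le> Re (H_inner h f)"
  proof clarify
    fix f h assume "(f, h) \<in> diag_sqrt"
    then have L: "f \<in> L2 hmeas" "h \<in> L2 hmeas" and c: "\<And>n. coef h n = lam n * coef f n"
      by (auto simp: diag_sqrt_def)
    have "coef h n * cnj (coef f n) = complex_of_real (lam n * (cmod (coef f n))\<^sup>2)" for n
      unfolding c of_real_mult complex_norm_square by (simp only: mult.assoc)
    then have s: "(\<lambda>n. complex_of_real (lam n * (cmod (coef f n))\<^sup>2)) sums ip hmeas h f"
      using E.Parseval_ip[OF L(2,1)] by simp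
    have "(\<lambda>n. Im (complex_of_real (lam n * (cmod (coef f n))\<^sup>2))) sums Im (ip hmeas h f)"
      using s by (rule sums_Im)
    then have "Im (ip hmeas h f) = 0" by (simp add: sums_iff)
    moreover have s': "(\<lambda>n. lam n * (cmod (coef f n))\<^sup>2) sums Re (ip hmeas h f)"
      using sums_Re[OF s] by simp
    have "0 \<le> Re (ip hmeas h f)"
      by (rule sums_le[OF _ sums_zero s']) (simp add: less_imp_le[OF lam_pos])
    ultimately show "Im (H_inner h f) = 0 \<and> 0 \<le> Re (H_inner h f)"
      unfolding H_inner_ip by simp
  qed
qed (rule diag_sqrt_compose)

text \<open>Any nonnegative square root acts on \<open>eig n\<close> as \<open>lam n\<close>: otherwise the difference would be an
  eigenvector with eigenvalue \<open>- lam n\<close>.\<close>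

lemma sqrt_unique:
  assumes S: "is_nonneg_sqrt L0_op S"
  shows "S = diag_sqrt"
proof -
  have adj: "S = H_adjoint S" and nn: "\<And>f h. (f, h) \<in> S \<Longrightarrow> 0 \<le> Re (ip hmeas h f)" and comp: "S O S = L0_op"
    using S by (auto simp: is_nonneg_sqrt_def H_inner_ip)
  have memI: "(y, z) \<in> S" if "y \<in> L2 hmeas" "z \<in> L2 hmeas" "\<And>f h. (f, h) \<in> S \<Longrightarrow> ip hmeas h y = ip hmeas f z" for y z
  proof -
    have "\<forall>(f, h)\<in>S. ip hmeas h y = ip hmeas f z" using that(3) by blast
    then have "(y, z) \<in> H_adjoint S" using that(1,2) by (simp add: H_adjoint_def H_space_L2 H_inner_ip)
    then show ?thesis using adj by simp
  qed
  have memD: "y \<in> L2 hmeas \<and> z \<in> L2 hmeas \<and> (\<forall>f h. (f, h) \<in> S \<longrightarrow> ip hmeas h y = ip hmeas f z)" if "(y, z) \<in> S" for y z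
  proof -
    have "(y, z) \<in> H_adjoint S" using that adj by simp
    then show ?thesis by (auto simp: H_adjoint_def H_space_L2 H_inner_ip)
  qed
  have eigS: "(eig n, \<lambda>x. lam n * eig n x) \<in> S" for n
  proof -
    let ?l = "complex_of_real (lam n)"
    have "(eig n, \<lambda>x. complex_of_real ((lam n)\<^sup>2) * eig n x) \<in> L0_op"
      by (auto simp: L0_op_iff eig_V eig_L2 L2_scale eig_ip)
    then obtain z where z: "(eig n, z) \<in> S" "(z, \<lambda>x. complex_of_real ((lam n)\<^sup>2) * eig n x) \<in> S"
      unfolding comp[symmetric] by auto
    \<comment> \<open>unless it vanishes, \<open>w\<close> is an eigenvector of \<open>S\<close> with eigenvalue \<open>- lam n\<close>\<close>
    define w where "w x = z x - ?l * eig n x" for x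
    have zL: "z \<in> L2 hmeas" using memD[OF z(1)] by simp
    have wL: "w \<in> L2 hmeas" unfolding w_def by (intro L2_diff L2_scale zL eig_L2)
    have "(w, \<lambda>x. (- ?l) * w x) \<in> S"
    proof (rule memI[OF wL L2_scale[OF wL]])
      fix f h assume fh: "(f, h) \<in> S"
      have fL: "f \<in> L2 hmeas" "h \<in> L2 hmeas" using memD[OF fh] by auto
      have 1: "ip hmeas h (eig n) = ip hmeas f z" using memD[OF z(1)] fh by blast
      have 2: "ip hmeas h z = ?l * ?l * ip hmeas f (eig n)"
        using memD[OF z(2)] fh by (simp add: power2_eq_square)
      have "ip hmeas h w = ip hmeas h z - ?l * ip hmeas h (eig n)"
        unfolding w_def using zL eig_L2 fL by (subst ip_diff_right) auto
      also have "\<dots> = - ?l * (ip hmeas f z - ?l * ip hmeas f (eig n))" unfolding 1 2 by (simp add: algebra_simps)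
      also have "ip hmeas f z - ?l * ip hmeas f (eig n) = ip hmeas f w"
        unfolding w_def using zL eig_L2 fL by (subst ip_diff_right) auto
      finally show "ip hmeas h w = ip hmeas f (\<lambda>x. (- ?l) * w x)" by (subst ip_scale_right) simp
    qed
    from nn[OF this] have "0 \<le> Re (- ?l * ip hmeas w w)" by (simp only: ip_scale_left)
    then have "lam n * nsq hmeas w \<le> 0" by (simp add: ip_self)
    then have "nsq hmeas w = 0"
      using lam_pos[of n] nsq_nonneg[of hmeas w] by (metis antisym mult_le_0_iff not_le)
    then have w0: "AE x in hmeas. z x = ?l * eig n x" by (simp add: nsq_eq_0_iff[OF wL] w_def)
    show ?thesis
    proof (rule memI[OF eig_L2 L2_scale[OF eig_L2]])
      fix f h assume fh: "(f, h) \<in> S"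
      have "ip hmeas h (eig n) = ip hmeas f z" using memD[OF z(1)] fh by blast
      also have "\<dots> = ip hmeas f (\<lambda>x. ?l * eig n x)"
        using w0 zL L2_scale[OF eig_L2, of ?l n] memD[OF fh] by (intro ip_cong_AE) (auto dest: L2D)
      finally show "ip hmeas h (eig n) = ip hmeas f (\<lambda>x. ?l * eig n x)" .
    qed
  qed
  have sub: "S \<subseteq> diag_sqrt"
  proof clarify
    fix y z assume yz: "(y, z) \<in> S"
    have "coef z n = lam n * coef y n" for n
    proof -
      have "lam n * ip hmeas (eig n) y = ip hmeas (eig n) z" using memD[OF yz] eigS[of n] by (metis ip_scale_left)
      then have "cnj (lam n * ip hmeas (eig n) y) = cnj (ip hmeas (eig n) z)" by (rule arg_cong)
      then show ?thesis by (simp add: ip_commute[of hmeas "eig n"])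
    qed
    then show "(y, z) \<in> diag_sqrt" using memD[OF yz] by (simp add: diag_sqrt_def)
  qed
  moreover have "diag_sqrt \<subseteq> S"
  proof clarify
    fix y z assume yz: "(y, z) \<in> diag_sqrt"
    show "(y, z) \<in> S"
    proof (rule memI)
      show "y \<in> L2 hmeas" "z \<in> L2 hmeas" using yz by (auto simp: diag_sqrt_def)
      show "ip hmeas h y = ip hmeas f z" if "(f, h) \<in> S" for f h
        using diag_sqrt_symmetric[OF subsetD[OF sub that] yz] .
    qed
  qed
  ultimately show ?thesis by auto
qed

text \<open>The definite description in \<^const>\<open>L0_sqrt_op\<close> is therefore meaningful, and the square root is diagonal.\<close>

lemma L0_sqrt_op_eq: "L0_sqrt_op = diag_sqrt"
  unfolding L0_sqrt_op_def using diag_sqrt_is_sqrt sqrt_unique by (rule the_equality)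

lemma L0_sqrt_norm:
  assumes f: "f \<in> V_space"
  shows "(\<lambda>n. (lam n)\<^sup>2 * (cmod (coef f n))\<^sup>2) sums (H_norm (L0_sqrt f))\<^sup>2"
proof -
  have "summable (\<lambda>n. (ev n + 1) * (cmod (coef f n))\<^sup>2)" using V_norm_sums[OF f] by (rule sums_summable)
  then have "summable (\<lambda>n. (cmod (complex_of_real (lam n) * coef f n))\<^sup>2)"
  proof (rule summable_comparison_test_ev[rotated], intro always_eventually allI)
    fix n show "norm ((cmod (complex_of_real (lam n) * coef f n))\<^sup>2) \<le> (ev n + 1) * (cmod (coef f n))\<^sup>2"
      using ev_nonneg[of n] by (simp add: norm_mult power_mult_distrib lam_sq mult_right_mono abs_mult)
  qed
  then obtain z where z: "z \<in> L2 hmeas" "\<And>n. coef z n = complex_of_real (lam n) * coef f n"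
    by (rule E.Riesz_Fischer) blast
  then have "(f, z) \<in> L0_sqrt_op" using V_spaceD(1)[OF f] by (simp add: L0_sqrt_op_eq diag_sqrt_def)
  then have "(f, L0_sqrt f) \<in> L0_sqrt_op" unfolding L0_sqrt_def by (rule someI[of "\<lambda>h. (f, h) \<in> L0_sqrt_op"])
  then have L: "L0_sqrt f \<in> L2 hmeas" and c: "\<And>n. coef (L0_sqrt f) n = lam n * coef f n"
    by (auto simp: L0_sqrt_op_eq diag_sqrt_def)
  show ?thesis using E.Parseval[OF L] by (simp add: c norm_mult power_mult_distrib H_norm_nsq)
qed

section \<open>Fourier series on an interval\<close>

text \<open>The integer frequencies are enumerated by the natural numbers through \<^const>\<open>int_decode\<close>.\<close>

definition freq :: "real \<Rightarrow> nat \<Rightarrow> real" where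
  "freq T k = pi * of_int (int_decode k) / T"

definition fourier :: "real \<Rightarrow> nat \<Rightarrow> real \<Rightarrow> complex" where
  "fourier T k t = complex_of_real (1 / sqrt (2 * T)) * cis (freq T k * t)"

lemma continuous_complex_times_integrable:
  fixes h c :: "real \<Rightarrow> complex"
  assumes h: "integrable (lebesgue_on {-T<..<T}) h" and c: "continuous_on UNIV c"
  shows "integrable (lebesgue_on {-T<..<T}) (\<lambda>t. c t * h t)"
proof -
  obtain B where "\<forall>y\<in>c ` {-T..T}. norm y \<le> B"
    using compact_imp_bounded[OF compact_continuous_image[OF continuous_on_subset[OF c] compact_Icc]]
    unfolding bounded_iff by blast
  then have B: "\<And>x. x \<in> {-T..T} \<Longrightarrow> cmod (c x) \<le> B" by auto
  have cm: "c \<in> borel_measurable (lebesgue_on {-T<..<T})"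
    by (rule continuous_imp_measurable_on_sets_lebesgue[OF continuous_on_subset[OF c]]) auto
  show ?thesis
  proof (rule Bochner_Integration.integrable_bound[OF integrable_mult_right[of B, OF integrable_norm[OF h]]])
    show "(\<lambda>t. c t * h t) \<in> borel_measurable (lebesgue_on {-T<..<T})"
      using cm h by (intro borel_measurable_times) auto
    show "AE t in lebesgue_on {-T<..<T}. norm (c t * h t) \<le> norm (B * norm (h t))"
    proof (rule AE_I2)
      fix t assume "t \<in> space (lebesgue_on {-T<..<T})"
      then have "cmod (c t) \<le> \<bar>B\<bar>" using B[of t] by auto
      then show "norm (c t * h t) \<le> norm (B * norm (h t))"
        by (auto simp: norm_mult abs_mult intro!: mult_right_mono)
    qed
  qed
qed

lemma interval_L2_integrable:
  fixes T :: real
  assumes "f \<in> L2 (lebesgue_on {-T<..<T})"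
  shows "integrable (lebesgue_on {-T<..<T}) f"
proof -
  have "integrable (lebesgue_on {-T..T}) (\<lambda>x. 1::real)" by (intro continuous_imp_integrable_real continuous_on_const)
  then have "integrable (lebesgue_on {-T<..<T}) (\<lambda>x. 1::real)"
    by (rule integrable_lebesgue_on_subset) auto
  then have "(\<lambda>x. 1) \<in> L2 (lebesgue_on {-T<..<T})" by (intro L2I) auto
  from L2_mult_integrable(1)[OF assms this] show ?thesis by simp
qed

lemma continuous_interval_L2:
  fixes T :: real
  assumes "continuous_on UNIV c" shows "c \<in> L2 (lebesgue_on {-T<..<T})"
proof (rule L2I)
  show "c \<in> borel_measurable (lebesgue_on {-T<..<T})"
    by (rule continuous_imp_measurable_on_sets_lebesgue[OF continuous_on_subset[OF assms]]) auto
  have "integrable (lebesgue_on {-T..T}) (\<lambda>x. (cmod (c x))\<^sup>2)"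
    by (intro continuous_imp_integrable_real continuous_intros continuous_on_subset[OF assms]) auto
  then show "integrable (lebesgue_on {-T<..<T}) (\<lambda>x. (cmod (c x))\<^sup>2)"
    by (rule integrable_lebesgue_on_subset) auto
qed

lemma integral_cis:
  assumes T: "T > 0" and j: "j \<noteq> (0::int)"
  shows "(LINT t|lebesgue_on {-T<..<T}. cis (pi * of_int j / T * t)) = 0"
proof -
  define a where "a = pi * of_int j / T"
  have a: "a \<noteq> 0" using T j by (simp add: a_def)
  have "((\<lambda>t. cis (a * t)) has_integral (cis (a * T) / (\<i> * a) - cis (a * (-T)) / (\<i> * a))) {-T..T}"
  proof (rule fundamental_theorem_of_calculus)
    fix t
    have "((\<lambda>z. exp (\<i> * a * z) / (\<i> * a)) has_field_derivative exp (\<i> * a * t)) (at (complex_of_real t))"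
      using a by (auto intro!: derivative_eq_intros)
    from has_vector_derivative_real_field[OF this]
    have "((\<lambda>t. exp (\<i> * a * complex_of_real t) / (\<i> * a)) has_vector_derivative exp (\<i> * a * t)) (at t within {-T..T})" .
    then show "((\<lambda>t. cis (a * t) / (\<i> * a)) has_vector_derivative cis (a * t)) (at t within {-T..T})"
      by (simp add: cis_conv_exp mult.assoc)
  qed (use T in simp)
  also have "cis (a * T) / (\<i> * a) - cis (a * (-T)) / (\<i> * a) = 0"
  proof -
    have "cis (a * T) = cis (a * (-T)) * cis (2 * pi * of_int j)"
      using T by (subst cis_mult) (simp add: a_def)
    moreover have "cis (2 * pi * of_int j) = 1" by (intro cis_multiple_2pi) auto
    ultimately show ?thesis by simp
  qed
  finally have "((\<lambda>t. cis (a * t)) has_integral 0) {-T<..<T}"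
    by (simp add: has_integral_Icc_iff_Ioo)
  moreover have "((\<lambda>t. cis (a * t)) has_integral (LINT t|lebesgue_on {-T<..<T}. cis (a * t))) {-T<..<T}"
    by (intro has_integral_integral_lebesgue_on interval_L2_integrable continuous_interval_L2 continuous_intros) auto
  ultimately show ?thesis unfolding a_def by (rule has_integral_unique[rotated])
qed

text \<open>An arc of the circle is a superlevel set of the cosine, also for angles that leave \<open>{- pi..pi}\<close> by
  at most \<open>pi - r\<close>.\<close>

lemma cos_greater_iff:
  assumes r: "0 < r" "r < pi" and x: "\<bar>x\<bar> \<le> 2 * pi - r"
  shows "cos r < cos x \<longleftrightarrow> \<bar>x\<bar> < r"
proof -
  have e: "cos x = cos \<bar>x\<bar>" by (simp add: abs_if)
  show ?thesis
  proof (cases "\<bar>x\<bar> \<le> pi")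
    case True
    then show ?thesis unfolding e using r by (intro cos_mono_less_eq) auto
  next
    case False
    have "cos \<bar>x\<bar> = cos (2 * pi - \<bar>x\<bar>)" by (simp add: cos_diff)
    moreover have "cos (2 * pi - \<bar>x\<bar>) \<le> cos r"
      using False x r by (intro cos_monotone_0_pi_le) auto
    ultimately show ?thesis unfolding e using False r by auto
  qed
qed

text \<open>A function orthogonal to all exponentials stays so after multiplication by a
  trigonometric polynomial, hence, by the Stone--Weierstrass theorem on the circle, it is orthogonal to all continuous
  functions on the circle.\<close>

lemma trig_total:
  fixes h :: "real \<Rightarrow> complex"
  assumes T: "T > 0" and h: "integrable (lebesgue_on {-T<..<T}) h"
    and orth: "\<And>k::int. (LINT t|lebesgue_on {-T<..<T}. cis (pi * of_int k / T * t) * h t) = 0"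
  shows "AE t in lebesgue_on {-T<..<T}. h t = 0"
proof -
  let ?M = "lebesgue_on {-T<..<T}"
  let ?e = "\<lambda>k t. cis (pi * of_int (k::int) / T * t)"
  \<comment> \<open>the functions orthogonal to all exponentials\<close>
  define Ann where "Ann h \<longleftrightarrow> integrable ?M h \<and> (\<forall>k. (LINT t|?M. ?e k t * h t) = 0)" for h
  have ec: "continuous_on UNIV (?e k)" for k by (intro continuous_intros)
  have ei: "integrable ?M (\<lambda>t. ?e k t * h t)" if "integrable ?M h" for k h
    by (rule continuous_complex_times_integrable[OF that ec])
  have Ann_add: "Ann (\<lambda>t. f t + g t)" if "Ann f" "Ann g" for f g
    using that ei by (auto simp: Ann_def distrib_left)
  have Ann_mult: "Ann (\<lambda>t. c * f t)" if "Ann f" for c f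
    using that by (auto simp: Ann_def mult.left_commute[of _ c])
  have Ann_shift: "Ann (\<lambda>t. ?e j t * f t)" if "Ann f" for j f
  proof -
    have e: "?e k t * (?e j t * f t) = ?e (k + j) t * f t" for k t
      by (simp add: mult.assoc[symmetric] cis_mult add_divide_distrib distrib_left distrib_right)
    have "(LINT t|?M. ?e k t * (?e j t * f t)) = 0" for k
      using that unfolding Ann_def e by blast
    then show ?thesis using ei[of f j] that unfolding Ann_def by blast
  qed
  have Ann_poly: "Ann (\<lambda>t. complex_of_real (p (?e 1 t)) * f t)"
    if "real_polynomial_function p" "Ann f" for p :: "complex \<Rightarrow> real" and f
    using that
  proof (induction p arbitrary: f rule: real_polynomial_function.induct)
    case (linear p)
    note Af = \<open>Ann f\<close>
    from linear interpret bounded_linear p by simp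
    have pz: "p z = Re z * p 1 + Im z * p \<i>" for z
    proof -
      have "z = Re z *\<^sub>R 1 + Im z *\<^sub>R \<i>" by (simp add: complex_eq_iff)
      from arg_cong[OF this, of p] show ?thesis by (simp only: add scaleR real_scaleR_def)
    qed
    \<comment> \<open>a real-linear form is a combination of its argument and the complex conjugate\<close>
    have e: "complex_of_real (p (?e 1 t)) = ((p 1 - \<i> * p \<i>) / 2) * ?e 1 t + ((p 1 + \<i> * p \<i>) / 2) * ?e (-1) t" for t
    proof -
      have m: "?e (-1) t = cnj (?e 1 t)" by (simp add: cis_cnj)
      have "complex_of_real (Re c * a + Im c * b) = ((a - \<i> * b) / 2) * c + ((a + \<i> * b) / 2) * cnj c" for c a b
        by (rule complex_eqI) (simp_all add: field_simps)
      then show ?thesis unfolding m pz[of "?e 1 t"] .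
    qed
    have "(\<lambda>t. complex_of_real (p (?e 1 t)) * f t)
      = (\<lambda>t. ((p 1 - \<i> * p \<i>) / 2) * (?e 1 t * f t) + ((p 1 + \<i> * p \<i>) / 2) * (?e (-1) t * f t))"
      unfolding e by (simp only: distrib_right mult.assoc)
    then show ?case by (simp only:) (intro Ann_add Ann_mult Ann_shift Af)
  next
    case (const c)
    then show ?case by (intro Ann_mult)
  next
    case (add p q)
    have "Ann (\<lambda>t. complex_of_real (p (?e 1 t)) * f t + complex_of_real (q (?e 1 t)) * f t)"
      by (intro Ann_add add)
    then show ?case by (simp add: distrib_right)
  next
    case (mult p q)
    have "Ann (\<lambda>t. complex_of_real (p (?e 1 t)) * (complex_of_real (q (?e 1 t)) * f t))"
      by (intro mult)
    then show ?case by (simp add: mult.assoc)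
  qed
  have A: "Ann h" using h orth by (simp add: Ann_def)
  have C: "(LINT t|?M. complex_of_real (C (?e 1 t)) * h t) = 0" if C: "continuous_on UNIV C" for C :: "complex \<Rightarrow> real"
  proof -
    have Cc: "integrable ?M (\<lambda>t. complex_of_real (C (?e 1 t)) * h t)" if "continuous_on UNIV C" for C :: "complex \<Rightarrow> real"
      by (rule continuous_complex_times_integrable[OF h])
        (intro continuous_on_of_real continuous_on_compose2[OF that] ec, simp)
    have *: "cmod (LINT t|?M. complex_of_real (C (?e 1 t)) * h t) \<le> e * (1 + (LINT t|?M. cmod (h t)))" if e: "e > 0" for e
    proof -
      obtain g where g: "real_polynomial_function g" "\<And>x. x \<in> sphere 0 1 \<Longrightarrow> \<bar>C x - g x\<bar> < e"
        using Stone_Weierstrass_real_polynomial_function[OF compact_sphere continuous_on_subset[OF C subset_UNIV] e] by metis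
      have gc: "continuous_on UNIV g"
        using g(1) continuous_on_polymonial_function[of g UNIV] by (simp add: real_polynomial_function_eq)
      have "Ann (\<lambda>t. complex_of_real (g (?e 1 t)) * h t)" by (rule Ann_poly[OF g(1) A])
      then have "(LINT t|?M. ?e 0 t * (complex_of_real (g (?e 1 t)) * h t)) = 0" unfolding Ann_def by blast
      moreover have "?e 0 t = 1" for t by simp
      ultimately have g0: "(LINT t|?M. complex_of_real (g (?e 1 t)) * h t) = 0" by (simp only: mult_1_left)
      have "(LINT t|?M. complex_of_real (C (?e 1 t)) * h t)
         = (LINT t|?M. complex_of_real (C (?e 1 t)) * h t) - (LINT t|?M. complex_of_real (g (?e 1 t)) * h t)"
        by (simp only: g0 diff_0_right)
      also have "\<dots> = (LINT t|?M. complex_of_real (C (?e 1 t)) * h t - complex_of_real (g (?e 1 t)) * h t)"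
        by (intro Bochner_Integration.integral_diff[symmetric] Cc C gc)
      also have "cmod \<dots> \<le> (LINT t|?M. e * cmod (h t))"
      proof (rule order_trans[OF integral_norm_bound], rule integral_mono)
        show "integrable ?M (\<lambda>t. cmod (complex_of_real (C (?e 1 t)) * h t - complex_of_real (g (?e 1 t)) * h t))"
          by (intro integrable_norm Bochner_Integration.integrable_diff Cc C gc)
        show "cmod (complex_of_real (C (?e 1 t)) * h t - complex_of_real (g (?e 1 t)) * h t) \<le> e * cmod (h t)" for t
        proof -
          have "complex_of_real (C (?e 1 t)) * h t - complex_of_real (g (?e 1 t)) * h t = complex_of_real (C (?e 1 t) - g (?e 1 t)) * h t"
            by (simp add: left_diff_distrib)
          moreover have "\<bar>C (?e 1 t) - g (?e 1 t)\<bar> \<le> e" using g(2)[of "?e 1 t"] by (simp add: less_imp_le)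
          ultimately show ?thesis by (simp only: norm_mult norm_of_real mult_right_mono norm_ge_zero)
        qed
      qed (use h in auto)
      also have "\<dots> \<le> e * (1 + (LINT t|?M. cmod (h t)))" using e by simp
      finally show ?thesis .
    qed
    have p: "0 < 1 + (LINT t|?M. cmod (h t))"
    proof -
      have "0 \<le> (LINT t|?M. cmod (h t))" by (intro Bochner_Integration.integral_nonneg) simp
      then show ?thesis by linarith
    qed
    have "cmod (LINT t|?M. complex_of_real (C (?e 1 t)) * h t) \<le> 0"
    proof (rule field_le_epsilon)
      fix e :: real assume "e > 0"
      then show "cmod (LINT t|?M. complex_of_real (C (?e 1 t)) * h t) \<le> 0 + e"
        using *[of "e / (1 + (LINT t|?M. cmod (h t)))"] p by simp
    qed
    then show ?thesis by simp
  qed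
  show ?thesis
  proof (rule AE_zero_if_interval_integrals_zero_integrable[OF h])
    fix p q assume pq: "-T < p" "p < q" "q < T"
    \<comment> \<open>the interval is the arc of angular radius \<open>r\<close> about its midpoint\<close>
    define mid r where "mid = (p + q) / 2" and "r = pi * ((q - p) / 2) / T"
    define d where "d t = cos (pi * (t - mid) / T) - cos r" for t
    define C where "C j z = min 1 (real j * max 0 (Re (z * cnj (cis (pi * mid / T))) - cos r))" for j :: nat and z
    have Cd: "C j (?e 1 t) = min 1 (real j * max 0 (d t))" for j t
      unfolding C_def d_def cis_cnj cis_mult by (simp add: diff_divide_distrib right_diff_distrib)
    have d: "d t > 0 \<longleftrightarrow> t \<in> {p<..<q}" if t: "t \<in> {-T<..<T}" for t
    proof -
      have "0 < r" using pq T by (simp add: r_def)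
      moreover have "r < pi"
      proof -
        have "(q - p) / 2 < T" using pq by simp
        then have "pi * ((q - p) / 2) < pi * T" by (rule mult_strict_left_mono) simp
        then show ?thesis using T by (simp add: r_def divide_less_eq)
      qed
      moreover have "\<bar>pi * (t - mid) / T\<bar> \<le> 2 * pi - r"
      proof -
        have "\<bar>t - mid\<bar> + (q - p) / 2 \<le> 2 * T" using t pq by (auto simp: mid_def abs_if field_simps)
        then have "pi * (\<bar>t - mid\<bar> + (q - p) / 2) \<le> pi * (2 * T)" by (rule mult_left_mono) simp
        moreover define x where "x = \<bar>t - mid\<bar>"
        moreover have "\<bar>pi * (t - mid) / T\<bar> = pi * x / T" using T by (simp add: x_def abs_mult)
        ultimately show ?thesis using T by (simp add: r_def field_simps)
      qed
      ultimately have "d t > 0 \<longleftrightarrow> \<bar>pi * (t - mid) / T\<bar> < r"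
        unfolding d_def using cos_greater_iff[of r "pi * (t - mid) / T"] by auto
      also have "\<dots> \<longleftrightarrow> \<bar>t - mid\<bar> < (q - p) / 2"
      proof -
        have "pi * x / T < pi * y / T \<longleftrightarrow> x < y" for x y using T by (simp add: divide_less_cancel)
        moreover have "\<bar>pi * (t - mid) / T\<bar> = pi * \<bar>t - mid\<bar> / T" using T by (simp add: abs_mult)
        ultimately show ?thesis unfolding r_def by (simp only:)
      qed
      also have "\<dots> \<longleftrightarrow> t \<in> {p<..<q}" by (auto simp: mid_def abs_if field_simps)
      finally show ?thesis .
    qed
    have Cz: "(LINT t|?M. complex_of_real (C j (?e 1 t)) * h t) = 0" for j
      by (rule C) (auto simp: C_def[abs_def] intro!: continuous_intros)
    have "(\<lambda>j. LINT t|?M. complex_of_real (C j (?e 1 t)) * h t) \<longlonglongrightarrow> (LINT t|?M. indicator {p<..<q} t *\<^sub>R h t)"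
    proof (rule integral_dominated_convergence[where w="\<lambda>t. cmod (h t)"])
      show "integrable ?M (\<lambda>t. cmod (h t))" using h by simp
      show "(\<lambda>t. complex_of_real (C j (?e 1 t)) * h t) \<in> borel_measurable ?M" for j
        by (rule borel_measurable_integrable[OF continuous_complex_times_integrable[OF h]])
          (use T in \<open>auto simp: C_def[abs_def] intro!: continuous_intros\<close>)
      have "indicator {p<..<q} \<in> borel_measurable ?M"
        by (rule borel_lebesgue_on) simp
      then show "(\<lambda>t. indicator {p<..<q} t *\<^sub>R h t) \<in> borel_measurable ?M"
        using h by (intro borel_measurable_scaleR) auto
      show "AE t in ?M. cmod (complex_of_real (C j (?e 1 t)) * h t) \<le> cmod (h t)" for j
      proof (rule AE_I2)
        fix t
        have "0 \<le> C j (?e 1 t)" "C j (?e 1 t) \<le> 1" by (auto simp: C_def)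
        then show "cmod (complex_of_real (C j (?e 1 t)) * h t) \<le> cmod (h t)"
          by (auto simp: norm_mult intro: mult_left_le_one_le)
      qed
      show "AE t in ?M. (\<lambda>j. complex_of_real (C j (?e 1 t)) * h t) \<longlonglongrightarrow> indicator {p<..<q} t *\<^sub>R h t"
      proof (rule AE_I2)
        fix t assume "t \<in> space ?M"
        then have t: "t \<in> {-T<..<T}" by simp
        have "(\<lambda>j. complex_of_real (C j (?e 1 t)) * h t) \<longlonglongrightarrow> complex_of_real (if d t > 0 then 1 else 0) * h t"
          unfolding Cd by (intro tendsto_mult tendsto_of_real ramp_limit tendsto_const)
        then show "(\<lambda>j. complex_of_real (C j (?e 1 t)) * h t) \<longlonglongrightarrow> indicator {p<..<q} t *\<^sub>R h t"
          using d[OF t] by (simp split: if_splits)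
      qed
    qed
    then have "(LINT t|?M. indicator {p<..<q} t *\<^sub>R h t) = 0"
      unfolding Cz by (simp add: LIMSEQ_const_iff)
    moreover have "(LINT t|?M. indicator {p<..<q} t *\<^sub>R h t) = (LINT t|lebesgue_on {p<..<q}. indicator {p<..<q} t *\<^sub>R h t)"
      using pq by (intro integral_vanishing_outside) auto
    moreover have "\<dots> = (LINT t|lebesgue_on {p<..<q}. h t)"
      by (intro Bochner_Integration.integral_cong) auto
    ultimately show "(LINT t|lebesgue_on {p<..<q}. h t) = 0" by simp
  qed
qed

lemma fourier_basis:
  assumes T: "T > 0" shows "orthonormal_basis (lebesgue_on {-T<..<T}) (fourier T)"
proof
  let ?M = "lebesgue_on {-T<..<T}"
  let ?c = "complex_of_real (1 / sqrt (2 * T))"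
  show "fourier T n \<in> L2 ?M" for n
    unfolding fourier_def[abs_def] by (intro continuous_interval_L2 continuous_intros)
  show "ip ?M (fourier T m) (fourier T n) = of_bool (m = n)" for m n
  proof -
    have c2: "?c * ?c = complex_of_real (1 / (2 * T))"
      using T by (simp add: of_real_mult[symmetric] del: of_real_mult)
    have "ip ?M (fourier T m) (fourier T n) = (LINT t|?M. (?c * ?c) * cis (pi * of_int (int_decode m - int_decode n) / T * t))"
      unfolding ip_def
    proof (rule Bochner_Integration.integral_cong[OF refl])
      fix t
      have "cis (freq T m * t) * cnj (cis (freq T n * t)) = cis (pi * of_int (int_decode m - int_decode n) / T * t)"
        unfolding cis_cnj cis_mult freq_def by (simp add: left_diff_distrib right_diff_distrib diff_divide_distrib)
      then show "fourier T m t * cnj (fourier T n t) = (?c * ?c) * cis (pi * of_int (int_decode m - int_decode n) / T * t)"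
        unfolding fourier_def complex_cnj_mult complex_cnj_complex_of_real mult.assoc mult.left_commute[of "cis _" ?c]
        by (simp only:)
    qed
    also have "\<dots> = (?c * ?c) * (LINT t|?M. cis (pi * of_int (int_decode m - int_decode n) / T * t))"
      by (rule integral_mult_right_zero)
    also have "\<dots> = of_bool (m = n)"
    proof (cases "m = n")
      case True
      have "measure lebesgue {-T<..<T} = 2 * T" using T by simp
      then have "(LINT t|?M. 1::complex) = complex_of_real (2 * T)"
        by (simp add: measure_restrict_space scaleR_conv_of_real)
      then show ?thesis using True T unfolding c2 by simp
    next
      case False
      then have "int_decode m - int_decode n \<noteq> 0" by (simp add: int_decode_eq)
      from integral_cis[OF T this] show ?thesis using False by (simp only: mult_zero_right of_bool_def if_False)
    qed
    finally show ?thesis .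
  qed
  fix f assume f: "f \<in> L2 ?M" and z: "\<And>n. ip ?M f (fourier T n) = 0"
  show "AE t in ?M. f t = 0"
  proof (rule trig_total[OF T interval_L2_integrable[OF f]])
    fix k :: int
    have "0 = ip ?M f (fourier T (int_encode (-k)))" using z by simp
    also have "\<dots> = ?c * (LINT t|?M. cis (pi * of_int k / T * t) * f t)"
      unfolding ip_def by (subst integral_mult_right_zero[symmetric])
        (auto intro!: Bochner_Integration.integral_cong simp: fourier_def freq_def cis_cnj)
    finally show "(LINT t|?M. cis (pi * of_int k / T * t) * f t) = 0" using T by simp
  qed
qed

section \<open>Sums over the spectrum\<close>

lemma central_binomial_pos: "0 < central_binomial n"
  by (induction n) (auto simp: add_pos_nonneg)

lemma central_binomial_weighted_mono: "n \<le> m \<Longrightarrow> central_binomial n * (real n + 1) \<le> central_binomial m * (real m + 1)"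
proof (induction rule: dec_induct)
  case (step m)
  have "(real m + 1) * (2 * real m + 2) \<le> (2 * real m + 1) * (real m + 2)" by (simp add: algebra_simps)
  then have "real m + 1 \<le> (2 * real m + 1) * (real m + 2) / (2 * real m + 2)"
    by (simp add: pos_le_divide_eq add_pos_nonneg del: distrib_left_numeral)
  then have "central_binomial m * (real m + 1) \<le> central_binomial m * ((2 * real m + 1) * (real m + 2) / (2 * real m + 2))"
    using central_binomial_pos[of m] by (intro mult_left_mono) auto
  also have "\<dots> = central_binomial (Suc m) * (real (Suc m) + 1)" by (simp add: field_simps)
  finally show ?case using step.IH by simp
qed simp

lemma central_binomial_antimono: "n \<le> m \<Longrightarrow> central_binomial m \<le> central_binomial n"
proof (induction rule: dec_induct)
  case (step m)
  have "central_binomial (Suc m) \<le> central_binomial m * 1"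
    unfolding central_binomial.simps times_divide_eq_right[symmetric] using central_binomial_pos[of m] by (intro mult_left_mono) auto
  then show ?case using step.IH by simp
qed simp

lemma central_binomial_le: "central_binomial n \<le> 1 / sqrt (real n + 1)"
proof -
  have "(central_binomial n)\<^sup>2 * (real n + 1) \<le> 1"
  proof (induction n)
    case (Suc n)
    have "(2 * real n + 1)\<^sup>2 * (real n + 2) \<le> (2 * real n + 2)\<^sup>2 * (real n + 1)"
      by (simp add: power2_eq_square algebra_simps)
    then have "(2 * real n + 1)\<^sup>2 * (real n + 2) / (2 * real n + 2)\<^sup>2 \<le> real n + 1"
      by (subst pos_divide_le_eq) (auto simp: mult.commute add_pos_nonneg zero_less_power2 add_nonneg_eq_0_iff)
    then have "(central_binomial n)\<^sup>2 * ((2 * real n + 1)\<^sup>2 * (real n + 2) / (2 * real n + 2)\<^sup>2) \<le> (central_binomial n)\<^sup>2 * (real n + 1)"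
      by (intro mult_left_mono) auto
    moreover have "(central_binomial (Suc n))\<^sup>2 * (real (Suc n) + 1) = (central_binomial n)\<^sup>2 * ((2 * real n + 1)\<^sup>2 * (real n + 2) / (2 * real n + 2)\<^sup>2)"
      by (simp add: power_mult_distrib power_divide add.commute)
    ultimately have "(central_binomial (Suc n))\<^sup>2 * (real (Suc n) + 1) \<le> (central_binomial n)\<^sup>2 * (real n + 1)" by (simp only:)
    then show ?case using Suc by linarith
  qed simp
  then have "(central_binomial n)\<^sup>2 \<le> (1 / sqrt (real n + 1))\<^sup>2" by (simp add: power_divide field_simps)
  then show ?thesis by (rule power2_le_imp_le) simp
qed

text \<open>The sequence varies slowly because it decreases while its product with \<open>n + 1\<close> increases.\<close>

lemma central_binomial_diff:
  assumes "n \<le> m"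
  shows "0 \<le> central_binomial n - central_binomial m" "central_binomial n - central_binomial m \<le> (real m - real n) / ((real m + 1) * sqrt (real n + 1))"
proof -
  show "0 \<le> central_binomial n - central_binomial m" using central_binomial_antimono[OF assms] by simp
  have "central_binomial n * ((real n + 1) / (real m + 1)) \<le> central_binomial m"
    using central_binomial_weighted_mono[OF assms] by (simp add: field_simps)
  then have "central_binomial n - central_binomial m \<le> central_binomial n * (1 - (real n + 1) / (real m + 1))" by (simp add: algebra_simps)
  also have "\<dots> = central_binomial n * ((real m - real n) / (real m + 1))" by (simp add: field_simps)
  also have "\<dots> \<le> 1 / sqrt (real n + 1) * ((real m - real n) / (real m + 1))"
    using central_binomial_le assms by (intro mult_right_mono) auto
  finally show "central_binomial n - central_binomial m \<le> (real m - real n) / ((real m + 1) * sqrt (real n + 1))" by (simp add: field_simps)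
qed

lemma sum_inverse_sqrt: "(\<Sum>n<M. 1 / sqrt (real n + 1)) \<le> 2 * sqrt (real M)"
proof (induction M)
  case (Suc M)
  define a b where "a = sqrt (real M)" and "b = sqrt (real M + 1)"
  have ab: "0 \<le> a" "0 < b" "b\<^sup>2 = a\<^sup>2 + 1" by (auto simp: a_def b_def add_nonneg_pos)
  have "2 * a * b \<le> a\<^sup>2 + b\<^sup>2" by (rule sum_squares_bound)
  then have "2 * a * b + 1 \<le> 2 * b * b" using ab by (simp add: power2_eq_square)
  then have "2 * a + 1 / b \<le> 2 * b" using ab(2) by (simp add: field_simps)
  then show ?case using Suc by (simp add: a_def b_def add.commute)
qed simp

lemma tail_term_le:
  assumes "n > 0"
  shows "1 / (real n * sqrt (real n + 1)) \<le> 3 * (1 / sqrt (real n) - 1 / sqrt (real n + 1))"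
proof -
  define a b where "a = sqrt (real n)" and "b = sqrt (real n + 1)"
  have ab: "0 < a" "0 < b" "b\<^sup>2 = a\<^sup>2 + 1" "a \<le> b" "a\<^sup>2 \<ge> 1" "real n = a\<^sup>2"
    using assms by (auto simp: a_def b_def add_nonneg_pos)
  have "b\<^sup>2 \<le> (2 * a)\<^sup>2" using ab by (simp add: power_mult_distrib)
  then have b2: "b \<le> 2 * a" by (rule power2_le_imp_le) (use ab in simp)
  \<comment> \<open>\<open>1/a - 1/b = 1/(a b (a + b))\<close> since \<open>b\<^sup>2 - a\<^sup>2 = 1\<close>\<close>
  have e: "1 / a - 1 / b = 1 / (a * b * (a + b))"
  proof -
    have "(b - a) * (a + b) = 1" using ab(3) by (simp add: power2_eq_square algebra_simps)
    then have "1 / (a * b * (a + b)) = ((b - a) * (a + b)) / (a * b * (a + b))" by simp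
    also have "\<dots> = (b - a) / (a * b)" using ab(1,2) by simp
    also have "\<dots> = 1 / a - 1 / b" using ab(1,2) by (simp add: field_simps)
    finally show ?thesis by simp
  qed
  have "1 / (a\<^sup>2 * b) \<le> 3 * (1 / (a * b * (a + b)))"
  proof -
    have "a * b * (a + b) \<le> a * b * (3 * a)" using ab(1,2) b2 by (intro mult_left_mono) auto
    then have "3 / (a * b * (3 * a)) \<le> 3 / (a * b * (a + b))"
      using ab(1,2) by (intro divide_left_mono mult_pos_pos) auto
    then show ?thesis using ab(1,2) by (simp add: power2_eq_square mult_ac)
  qed
  then show ?thesis unfolding a_def[symmetric] b_def[symmetric] unfolding ab(6) e .
qed

lemma sum_tail:
  assumes "P > 0"
  shows "(\<Sum>n=P..<M. 1 / (real n * sqrt (real n + 1))) \<le> 3 / sqrt (real P)"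
proof (cases "P \<le> M")
  case True
  have "(\<Sum>n=P..<M. 1 / (real n * sqrt (real n + 1))) \<le> (\<Sum>n=P..<M. 3 * (1 / sqrt (real n) - 1 / sqrt (real n + 1)))"
    using assms by (intro sum_mono tail_term_le) auto
  also have "\<dots> = 3 * (1 / sqrt (real P) - 1 / sqrt (real M))"
    using True by (induction M rule: dec_induct) (auto simp: algebra_simps)
  also have "\<dots> \<le> 3 / sqrt (real P)" by simp
  finally show ?thesis .
qed simp

lemma sum_inverse_squares: "(\<Sum>j=1..M. 1 / (real j)\<^sup>2) \<le> 2"
proof (cases "M = 0")
  case False
  then have "1 \<le> M" by simp
  then have "(\<Sum>j=1..M. 1 / (real j)\<^sup>2) \<le> 2 - 1 / real M"
  proof (induction M rule: dec_induct)
    case (step M)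
    have "1 / (real M + 1)\<^sup>2 \<le> 1 / (real M * (real M + 1))"
      using step(1) by (intro divide_left_mono) (auto simp: power2_eq_square)
    also have "\<dots> = 1 / real M - 1 / (real M + 1)" using step(1) by (simp add: field_simps)
    finally show ?case using step.IH by (simp add: add.commute)
  qed simp
  also have "\<dots> \<le> 2" by simp
  finally show ?thesis .
qed simp

text \<open>A sum of Poisson kernels is bounded uniformly in the height \<open>y\<close>, by comparison with a telescoping
  sum of \<open>c / ((j - 1 + c) (j + c))\<close>.\<close>

lemma sum_Poisson: "(\<Sum>j=1..M. \<bar>y\<bar> / ((real j)\<^sup>2 + y\<^sup>2)) \<le> 2"
proof (cases "y = 0")
  case False
  define c where "c = \<bar>y\<bar>"
  have c: "c > 0" using False by (simp add: c_def)
  have "(\<Sum>j=1..M. c / ((real j)\<^sup>2 + c\<^sup>2)) \<le> 2 - 2 * c / (real M + c)"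
  proof (induction M)
    case (Suc M)
    define a where "a = real M"
    have a: "a \<ge> 0" by (simp add: a_def)
    have "(a + c) * (a + 1 + c) \<le> 2 * ((a + 1)\<^sup>2 + c\<^sup>2)"
    proof -
      have "(a + c) * (a + 1 + c) \<le> (a + 1 + c) * (a + 1 + c)" using a c by (intro mult_right_mono) auto
      also have "\<dots> = (a + 1)\<^sup>2 + c\<^sup>2 + 2 * (a + 1) * c" by (simp add: power2_eq_square algebra_simps)
      also have "\<dots> \<le> 2 * ((a + 1)\<^sup>2 + c\<^sup>2)" using sum_squares_bound[of "a + 1" c] by simp
      finally show ?thesis .
    qed
    then have "c / ((a + 1)\<^sup>2 + c\<^sup>2) \<le> 2 * c / ((a + c) * (a + 1 + c))"
    proof -
      have p: "0 < (a + 1)\<^sup>2 + c\<^sup>2" "0 < (a + c) * (a + 1 + c)" using a c by (auto intro!: add_nonneg_pos mult_pos_pos)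
      have "c * ((a + c) * (a + 1 + c)) \<le> c * (2 * ((a + 1)\<^sup>2 + c\<^sup>2))"
        using \<open>(a + c) * (a + 1 + c) \<le> _\<close> c by (intro mult_left_mono) auto
      then show ?thesis using p by (simp add: divide_le_eq pos_le_divide_eq mult_ac)
    qed
    also have "\<dots> = 2 * c / (a + c) - 2 * c / (a + 1 + c)"
      using a c by (simp add: divide_simps) (simp add: algebra_simps)
    finally show ?case using Suc by (simp add: a_def algebra_simps)
  qed (use c in simp)
  also have "\<dots> \<le> 2" using c by simp
  finally show ?thesis by (simp add: c_def)
qed simp


text \<open>The eigenvalue \<open>lam N\<close> is closest to \<open>\<tau>\<close>, and the window of the modes up to \<open>2 * N\<close> is symmetric about
  it. The last two conditions say that \<open>N\<close> is of the order of \<open>\<tau>\<close>.\<close>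

definition centred :: "real \<Rightarrow> real \<Rightarrow> nat \<Rightarrow> bool" where
  "centred \<delta> \<tau> N \<longleftrightarrow> 2 \<le> \<tau> \<and> 0 < \<delta> \<and> 1 \<le> N \<and> (\<forall>n. \<delta> \<le> \<bar>\<tau> - lam n\<bar>) \<and> \<bar>\<tau> - lam N\<bar> \<le> 1 \<and>
    \<tau> / 2 \<le> real N + 1 \<and> 2 * real N + 1 \<le> 2 * \<tau>"

lemma centred_exists:
  assumes "2 \<le> \<tau>" "0 < \<delta>" "\<And>n. \<delta> \<le> \<bar>\<tau> - lam n\<bar>"
  obtains N where "centred \<delta> \<tau> N"
proof -
  define N where "N = nat \<lfloor>(\<tau> + 1/2) / 2\<rfloor>"
  have N: "real N = of_int \<lfloor>(\<tau> + 1/2) / 2\<rfloor>" using assms(1) by (simp add: N_def)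
  have 1: "real N \<le> (\<tau> + 1/2) / 2" unfolding N by (rule of_int_floor_le)
  have 2: "(\<tau> + 1/2) / 2 < real N + 1" unfolding N by linarith
  note 1 2
  moreover have "0 < real N" using 2 assms(1) by (simp add: field_simps)
  ultimately have "centred \<delta> \<tau> N"
    using assms unfolding centred_def lam_def by (auto simp: abs_le_iff)
  then show ?thesis by (rule that)
qed

lemma centred_far:
  assumes "centred \<delta> \<tau> N" "n \<noteq> N"
  shows "\<bar>real n - real N\<bar> \<le> \<bar>\<tau> - lam n\<bar>"
proof -
  have "\<bar>\<tau> - lam N\<bar> \<le> 1" using assms by (simp add: centred_def)
  moreover have "1 \<le> \<bar>real n - real N\<bar>" using assms(2) by linarith
  moreover have "lam n - lam N = 2 * (real n - real N)" by (simp add: lam_def)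
  then have "\<bar>lam n - lam N\<bar> = 2 * \<bar>real n - real N\<bar>" by (simp only: abs_mult abs_numeral)
  moreover have "\<bar>lam n - lam N\<bar> \<le> \<bar>\<tau> - lam n\<bar> + \<bar>\<tau> - lam N\<bar>" by linarith
  moreover define d where "d = \<bar>real n - real N\<bar>"
  ultimately show ?thesis unfolding d_def[symmetric] by linarith
qed

lemma centred_tail:
  assumes "centred \<delta> \<tau> N" "2 * N + 1 \<le> n"
  shows "real n \<le> \<bar>\<tau> - lam n\<bar>" "real n \<le> \<tau> + lam n"
proof -
  have *: "\<tau> \<le> lam N + 1" "2 \<le> \<tau>" using assms(1) by (auto simp: centred_def)
  have "2 * real N + 1 \<le> real n" using assms(2) by linarith
  with * show "real n \<le> \<bar>\<tau> - lam n\<bar>" "real n \<le> \<tau> + lam n" unfolding lam_def by linarith+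
qed

lemma sum_symmetric_window:
  fixes f :: "nat \<Rightarrow> 'a::comm_monoid_add"
  shows "(\<Sum>n<2*N+1. f n) = f N + (\<Sum>j=1..N. f (N + j) + f (N - j))"
proof -
  have "(\<Sum>n<2*N+1. f n) = (\<Sum>n\<in>{..<N} \<union> ({N} \<union> {N<..2*N}). f n)"
    by (rule sum.cong) auto
  also have "\<dots> = (\<Sum>n<N. f n) + (f N + (\<Sum>n\<in>{N<..2*N}. f n))"
    by (subst sum.union_disjoint, auto)+
  also have "(\<Sum>n<N. f n) = (\<Sum>j=1..N. f (N - j))"
    by (rule sum.reindex_bij_witness[of _ "\<lambda>j. N - j" "\<lambda>n. N - n"]) auto
  also have "(\<Sum>n\<in>{N<..2*N}. f n) = (\<Sum>j=1..N. f (N + j))"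
    by (rule sum.reindex_bij_witness[of _ "\<lambda>j. N + j" "\<lambda>n. n - N"]) auto
  finally show ?thesis by (simp add: sum.distrib ac_simps)
qed

lemma sum_split_window:
  fixes f :: "nat \<Rightarrow> 'a::comm_monoid_add"
  assumes "2 * N + 1 \<le> M"
  shows "(\<Sum>n<M. f n) = (\<Sum>n<2*N+1. f n) + (\<Sum>n=2*N+1..<M. f n)"
  using sum.atLeastLessThan_concat[of 0 "2*N+1" M f] assms by (simp add: atLeast0LessThan)

lemma cmod_ge_real_part: "\<bar>\<tau> - l\<bar> \<le> cmod (Complex \<tau> \<xi> - complex_of_real l)"
  "\<bar>\<tau> + l\<bar> \<le> cmod (Complex \<tau> \<xi> + complex_of_real l)"
  using abs_Re_le_cmod[of "Complex \<tau> \<xi> - complex_of_real l"] abs_Re_le_cmod[of "Complex \<tau> \<xi> + complex_of_real l"] by auto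

text \<open>The slow variation of the numerators compensates for the small denominators, so that absolute
  values may be taken.\<close>

lemma window_central_binomial:
  assumes c: "centred \<delta> \<tau> N"
  shows "(\<Sum>n<2*N+1. \<bar>central_binomial n - central_binomial N\<bar> / \<bar>\<tau> - lam n\<bar>) \<le> 3 / sqrt (real N + 1)"
proof -
  let ?f = "\<lambda>n. \<bar>central_binomial n - central_binomial N\<bar> / \<bar>\<tau> - lam n\<bar>"
  have up: "?f (N + j) \<le> 1 / ((real N + 1) * sqrt (real N + 1))" if j: "j \<in> {1..N}" for j
  proof -
    have d: "real j \<le> \<bar>\<tau> - lam (N + j)\<bar>" using centred_far[OF c, of "N + j"] j by auto
    have b: "\<bar>central_binomial (N + j) - central_binomial N\<bar> \<le> real j / ((real (N + j) + 1) * sqrt (real N + 1))"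
      using central_binomial_diff[of N "N + j"] by (simp add: abs_if)
    have "?f (N + j) \<le> (real j / ((real (N + j) + 1) * sqrt (real N + 1))) / real j"
      using b d j by (intro frac_le) auto
    also have "\<dots> = 1 / ((real (N + j) + 1) * sqrt (real N + 1))" using j by simp
    also have "\<dots> \<le> 1 / ((real N + 1) * sqrt (real N + 1))"
      by (intro divide_left_mono mult_right_mono mult_pos_pos) (auto simp: add_pos_nonneg add_nonneg_pos)
    finally show ?thesis .
  qed
  have dn: "?f (N - j) \<le> 1 / (real N + 1) * (1 / sqrt (real (N - j) + 1))" if j: "j \<in> {1..N}" for j
  proof -
    have d: "real j \<le> \<bar>\<tau> - lam (N - j)\<bar>" using centred_far[OF c, of "N - j"] j by auto
    have b: "\<bar>central_binomial (N - j) - central_binomial N\<bar> \<le> real j / ((real N + 1) * sqrt (real (N - j) + 1))"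
      using central_binomial_diff[of "N - j" N] j by (simp add: abs_if of_nat_diff)
    have "?f (N - j) \<le> (real j / ((real N + 1) * sqrt (real (N - j) + 1))) / real j"
      using b d j by (intro frac_le) auto
    then show ?thesis using j by simp
  qed
  have "(\<Sum>n<2*N+1. ?f n) = (\<Sum>j=1..N. ?f (N + j)) + (\<Sum>j=1..N. ?f (N - j))"
    unfolding sum_symmetric_window by (simp add: sum.distrib)
  also have "\<dots> \<le> (\<Sum>j=1..N. 1 / ((real N + 1) * sqrt (real N + 1))) + (\<Sum>j=1..N. 1 / (real N + 1) * (1 / sqrt (real (N - j) + 1)))"
    by (intro add_mono sum_mono up dn)
  also have "(\<Sum>j=1..N. 1 / (real N + 1) * (1 / sqrt (real (N - j) + 1))) = 1 / (real N + 1) * (\<Sum>n<N. 1 / sqrt (real n + 1))"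
    unfolding sum_distrib_left[symmetric]
    by (intro arg_cong2[where f="(*)"] refl sum.reindex_bij_witness[of _ "\<lambda>n. N - n" "\<lambda>j. N - j"]) auto
  also have "\<dots> \<le> 1 / (real N + 1) * (2 * sqrt (real N))" by (intro mult_left_mono sum_inverse_sqrt) auto
  also have "\<dots> \<le> 1 / (real N + 1) * (2 * sqrt (real N + 1))" by (intro mult_left_mono) auto
  also have "\<dots> = 2 / sqrt (real N + 1)"
    using real_sqrt_mult_self[of "real N + 1"] by (simp add: field_simps)
  also have "(\<Sum>j=1..N. 1 / ((real N + 1) * sqrt (real N + 1))) \<le> 1 / sqrt (real N + 1)"
  proof -
    have "(\<Sum>j=1..N. 1 / ((real N + 1) * sqrt (real N + 1))) = real N / (real N + 1) * (1 / sqrt (real N + 1))" by simp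
    also have "\<dots> \<le> 1 * (1 / sqrt (real N + 1))" by (rule mult_right_mono) auto
    finally show ?thesis by simp
  qed
  finally show ?thesis by simp
qed

text \<open>The terms at distance \<open>j\<close> on the two sides of the centre nearly cancel, and the signs
  \<open>\<epsilon>\<^sup>n\<close> do not disturb this since \<open>N + j\<close> and \<open>N - j\<close> have the same parity. This principal value is what keeps
  a logarithm out of the trace estimate.\<close>

lemma window_principal_value:
  fixes \<epsilon> :: real
  assumes c: "centred \<delta> \<tau> N" and \<epsilon>: "\<epsilon> = 1 \<or> \<epsilon> = -1"
  shows "cmod (\<Sum>n<2*N+1. complex_of_real (\<epsilon> ^ n) / (Complex \<tau> \<xi> - lam n)) \<le> 8 + 1 / \<delta>"
proof -
  define z where "z = Complex \<tau> \<xi> - complex_of_real (lam N)"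
  have \<delta>: "0 < \<delta>" "\<delta> \<le> \<bar>Re z\<bar>" "\<bar>Re z\<bar> \<le> 1" using c by (auto simp: centred_def z_def)
  have Imz: "Im z = \<xi>" by (simp add: z_def)
  have zj: "Complex \<tau> \<xi> - lam (N + j) = z - complex_of_real (2 * real j)" for j
    by (simp add: z_def lam_def complex_eq_iff)
  have zj': "Complex \<tau> \<xi> - lam (N - j) = z + complex_of_real (2 * real j)" if "j \<le> N" for j
    using that by (simp add: z_def lam_def complex_eq_iff of_nat_diff)
  have e: "\<epsilon> ^ (N - j) = \<epsilon> ^ (N + j)" if "j \<le> N" for j
  proof -
    have "N + j = (N - j) + 2 * j" using that by simp
    then have "\<epsilon> ^ (N + j) = \<epsilon> ^ (N - j) * (\<epsilon> ^ 2) ^ j" by (metis power_add power_mult)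
    then show ?thesis using \<epsilon> by auto
  qed
  have ab: "\<bar>\<epsilon> ^ n\<bar> = 1" for n using \<epsilon> by (auto simp: power_abs)
  \<comment> \<open>the sum of the two fractions is \<open>2z / ((z - 2j)(z + 2j))\<close>, and \<open>\<bar>Re z\<bar> \<le> 1\<close>\<close>
  have pr: "cmod (1 / (z - complex_of_real (2 * real j)) + 1 / (z + complex_of_real (2 * real j)))
      \<le> 2 * (1 / (real j)\<^sup>2 + \<bar>\<xi>\<bar> / ((real j)\<^sup>2 + \<xi>\<^sup>2))" if j: "1 \<le> j" for j
  proof -
    let ?w = "complex_of_real (2 * real j)" and ?q = "(real j)\<^sup>2 + \<xi>\<^sup>2"
    have q: "?q > 0" using j by (auto intro: add_pos_nonneg)
    have ge: "sqrt ?q \<le> cmod (z - ?w)" "sqrt ?q \<le> cmod (z + ?w)"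
    proof -
      have 1: "(real j)\<^sup>2 \<le> (Re z - 2 * real j)\<^sup>2" "(real j)\<^sup>2 \<le> (Re z + 2 * real j)\<^sup>2"
        using j \<delta>(3) by (auto simp: abs_le_square_iff[symmetric])
      show "sqrt ?q \<le> cmod (z - ?w)" "sqrt ?q \<le> cmod (z + ?w)"
        unfolding cmod_def by (simp_all add: 1 Imz)
    qed
    have q': "sqrt ?q > 0" using q by simp
    have nz: "z - ?w \<noteq> 0" "z + ?w \<noteq> 0" using ge q' by auto
    have "1 / (z - ?w) + 1 / (z + ?w) = 2 * z / ((z - ?w) * (z + ?w))"
      using nz by (simp add: add_divide_eq_iff divide_add_eq_iff) 
    then have "cmod (1 / (z - ?w) + 1 / (z + ?w)) = 2 * cmod z / (cmod (z - ?w) * cmod (z + ?w))"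
      by (simp add: norm_divide norm_mult)
    also have "\<dots> \<le> 2 * cmod z / (sqrt ?q * sqrt ?q)"
      using ge q' by (intro divide_left_mono mult_mono mult_pos_pos) auto
    also have "\<dots> = 2 * cmod z / ?q" using q by simp
    also have "\<dots> \<le> 2 * (1 + \<bar>\<xi>\<bar>) / ?q"
      using cmod_le[of z] \<delta>(3) q by (intro divide_right_mono) (auto simp: Imz)
    also have "\<dots> = 2 * (1 / ?q + \<bar>\<xi>\<bar> / ?q)" by (simp add: add_divide_distrib)
    also have "1 / ?q \<le> 1 / (real j)\<^sup>2" using j q by (intro divide_left_mono mult_pos_pos) auto
    finally show ?thesis by simp
  qed
  have "(\<Sum>n<2*N+1. complex_of_real (\<epsilon> ^ n) / (Complex \<tau> \<xi> - lam n))
      = complex_of_real (\<epsilon> ^ N) / z + (\<Sum>j=1..N. complex_of_real (\<epsilon> ^ (N + j)) * (1 / (z - complex_of_real (2 * real j)) + 1 / (z + complex_of_real (2 * real j))))"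
    unfolding sum_symmetric_window z_def[symmetric]
    by (intro arg_cong2[where f="(+)"] refl sum.cong) (auto simp: zj zj' e distrib_left simp del: of_real_power of_real_mult)
  also have "cmod \<dots> \<le> 1 / cmod z + (\<Sum>j=1..N. 2 * (1 / (real j)\<^sup>2 + \<bar>\<xi>\<bar> / ((real j)\<^sup>2 + \<xi>\<^sup>2)))"
  proof (rule order_trans[OF norm_triangle_ineq], rule add_mono)
    show "cmod (complex_of_real (\<epsilon> ^ N) / z) \<le> 1 / cmod z" by (simp only: norm_divide norm_of_real ab order_refl)
    show "cmod (\<Sum>j=1..N. complex_of_real (\<epsilon> ^ (N + j)) * (1 / (z - complex_of_real (2 * real j)) + 1 / (z + complex_of_real (2 * real j))))
        \<le> (\<Sum>j=1..N. 2 * (1 / (real j)\<^sup>2 + \<bar>\<xi>\<bar> / ((real j)\<^sup>2 + \<xi>\<^sup>2)))"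
      by (rule order_trans[OF norm_sum], rule sum_mono) (simp only: norm_mult norm_of_real ab mult_1_left pr atLeastAtMost_iff)
  qed
  also have "(\<Sum>j=1..N. 2 * (1 / (real j)\<^sup>2 + \<bar>\<xi>\<bar> / ((real j)\<^sup>2 + \<xi>\<^sup>2)))
      = 2 * ((\<Sum>j=1..N. 1 / (real j)\<^sup>2) + (\<Sum>j=1..N. \<bar>\<xi>\<bar> / ((real j)\<^sup>2 + \<xi>\<^sup>2)))"
    by (simp add: sum_distrib_left sum.distrib distrib_left)
  also have "\<dots> \<le> 2 * (2 + 2)" using sum_inverse_squares[of N] sum_Poisson[of \<xi> N] by (intro mult_left_mono add_mono) auto
  also have "1 / cmod z \<le> 1 / \<delta>"
    using \<delta> abs_Re_le_cmod[of z] by (intro divide_left_mono mult_pos_pos) auto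
  finally show ?thesis by simp
qed

text \<open>In the window the numerators are replaced by the central one, at the cost of the sum in
  \<open>window_central_binomial\<close>. Beyond the window the terms are absolutely summable.\<close>

lemma minus_sum:
  fixes \<epsilon> :: real
  assumes c: "centred \<delta> \<tau> N" and \<epsilon>: "\<epsilon> = 1 \<or> \<epsilon> = -1" and M: "2 * N + 1 \<le> M"
  shows "cmod (\<Sum>n<M. complex_of_real (\<epsilon> ^ n * central_binomial n) / (Complex \<tau> \<xi> - lam n)) \<le> (14 + 1 / \<delta>) / sqrt (real N + 1)"
proof -
  let ?s = "Complex \<tau> \<xi>"
  have ab: "\<bar>\<epsilon> ^ n\<bar> = 1" for n using \<epsilon> by (auto simp: power_abs)
  have \<delta>: "0 < \<delta>" "\<And>n. \<delta> \<le> \<bar>\<tau> - lam n\<bar>" using c by (auto simp: centred_def)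
  have d: "\<delta> \<le> cmod (?s - lam n)" for n using \<delta>(2)[of n] cmod_ge_real_part(1)[of \<tau> "lam n" \<xi>] by simp
  have w: "(\<Sum>n<2*N+1. complex_of_real (\<epsilon> ^ n * central_binomial n) / (?s - lam n))
      = (\<Sum>n<2*N+1. complex_of_real (\<epsilon> ^ n * (central_binomial n - central_binomial N)) / (?s - lam n)) + complex_of_real (central_binomial N) * (\<Sum>n<2*N+1. complex_of_real (\<epsilon> ^ n) / (?s - lam n))"
    unfolding sum_distrib_left sum.distrib[symmetric]
    by (rule sum.cong) (auto simp: right_diff_distrib diff_divide_distrib mult.commute)
  have 1: "cmod (\<Sum>n<2*N+1. complex_of_real (\<epsilon> ^ n * (central_binomial n - central_binomial N)) / (?s - lam n)) \<le> 3 / sqrt (real N + 1)"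
  proof -
    have "cmod (\<Sum>n<2*N+1. complex_of_real (\<epsilon> ^ n * (central_binomial n - central_binomial N)) / (?s - lam n)) \<le> (\<Sum>n<2*N+1. \<bar>central_binomial n - central_binomial N\<bar> / \<bar>\<tau> - lam n\<bar>)"
    proof (rule order_trans[OF norm_sum], rule sum_mono)
      fix n
      have "0 < \<bar>\<tau> - lam n\<bar>" using \<delta>(1) \<delta>(2)[of n] by simp
      then show "cmod (complex_of_real (\<epsilon> ^ n * (central_binomial n - central_binomial N)) / (?s - lam n)) \<le> \<bar>central_binomial n - central_binomial N\<bar> / \<bar>\<tau> - lam n\<bar>"
        using cmod_ge_real_part(1)[of \<tau> "lam n" \<xi>]
        unfolding norm_divide norm_of_real abs_mult ab mult_1_left by (intro divide_left_mono mult_pos_pos) auto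
    qed
    then show ?thesis using window_central_binomial[OF c] by linarith
  qed
  have 2: "cmod (complex_of_real (central_binomial N) * (\<Sum>n<2*N+1. complex_of_real (\<epsilon> ^ n) / (?s - lam n))) \<le> 1 / sqrt (real N + 1) * (8 + 1 / \<delta>)"
    unfolding norm_mult norm_of_real using central_binomial_le[of N] central_binomial_pos[of N] window_principal_value[OF c \<epsilon>, of \<xi>]
    by (intro mult_mono) auto
  have 3: "cmod (\<Sum>n=2*N+1..<M. complex_of_real (\<epsilon> ^ n * central_binomial n) / (?s - lam n)) \<le> 3 / sqrt (real N + 1)"
  proof -
    have "cmod (\<Sum>n=2*N+1..<M. complex_of_real (\<epsilon> ^ n * central_binomial n) / (?s - lam n)) \<le> (\<Sum>n=2*N+1..<M. 1 / (real n * sqrt (real n + 1)))"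
    proof (rule order_trans[OF norm_sum], rule sum_mono)
      fix n assume n: "n \<in> {2*N+1..<M}"
      have "real n \<le> cmod (?s - lam n)" using centred_tail(1)[OF c, of n] n cmod_ge_real_part(1)[of \<tau> "lam n" \<xi>] by simp
      then have "cmod (complex_of_real (\<epsilon> ^ n * central_binomial n) / (?s - lam n)) \<le> (1 / sqrt (real n + 1)) / real n"
        unfolding norm_divide norm_of_real abs_mult ab mult_1_left using central_binomial_le[of n] central_binomial_pos[of n] n
        by (intro frac_le) auto
      then show "cmod (complex_of_real (\<epsilon> ^ n * central_binomial n) / (?s - lam n)) \<le> 1 / (real n * sqrt (real n + 1))"
        by (simp add: mult.commute)
    qed
    also have "\<dots> \<le> 3 / sqrt (real (2*N+1))" by (rule sum_tail) simp
    also have "\<dots> \<le> 3 / sqrt (real N + 1)" by (intro divide_left_mono) (auto simp: add_nonneg_pos)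
    finally show ?thesis .
  qed
  have "cmod (\<Sum>n<M. complex_of_real (\<epsilon> ^ n * central_binomial n) / (?s - lam n)) \<le> 3 / sqrt (real N + 1) + 1 / sqrt (real N + 1) * (8 + 1 / \<delta>) + 3 / sqrt (real N + 1)"
    unfolding sum_split_window[OF M] w by (intro order_trans[OF norm_triangle_ineq] add_mono 1 2 3)
  also have "\<dots> = (14 + 1 / \<delta>) / sqrt (real N + 1)" by (simp add: add_divide_distrib)
  finally show ?thesis .
qed

text \<open>There is no resonance: the denominators are at least \<open>\<tau>\<close> in the window and at least \<open>n\<close> beyond it.\<close>

lemma plus_sum:
  assumes c: "centred \<delta> \<tau> N" and M: "2 * N + 1 \<le> M"
  shows "(\<Sum>n<M. central_binomial n / cmod (Complex \<tau> \<xi> + lam n)) \<le> 7 / sqrt (real N + 1)"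
proof -
  let ?s = "Complex \<tau> \<xi>"
  have t: "2 \<le> \<tau>" "2 * real N + 1 \<le> 2 * \<tau>" using c by (auto simp: centred_def)
  have "(\<Sum>n<2*N+1. central_binomial n / cmod (?s + lam n)) \<le> (\<Sum>n<2*N+1. (1 / \<tau>) * (1 / sqrt (real n + 1)))"
  proof (rule sum_mono)
    fix n
    have "\<tau> \<le> cmod (?s + lam n)" using cmod_ge_real_part(2)[of \<tau> "lam n" \<xi>] lam_pos[of n] t by simp
    then have "central_binomial n / cmod (?s + lam n) \<le> (1 / sqrt (real n + 1)) / \<tau>"
      using central_binomial_le[of n] t by (intro frac_le) auto
    then show "central_binomial n / cmod (?s + lam n) \<le> (1 / \<tau>) * (1 / sqrt (real n + 1))" by (simp add: mult.commute)
  qed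
  also have "\<dots> \<le> (1 / \<tau>) * (2 * sqrt (real (2*N+1)))"
    unfolding sum_distrib_left[symmetric] using t by (intro mult_left_mono sum_inverse_sqrt) auto
  also have "\<dots> \<le> (2 / (2 * real N + 1)) * (2 * sqrt (2 * real N + 1))"
    using t by (intro mult_mono) (auto simp: field_simps)
  also have "\<dots> = 4 / sqrt (2 * real N + 1)"
    using real_sqrt_mult_self[of "2 * real N + 1"] by (simp add: field_simps)
  also have "\<dots> \<le> 4 / sqrt (real N + 1)" by (intro divide_left_mono) (auto simp: add_nonneg_pos)
  finally have 1: "(\<Sum>n<2*N+1. central_binomial n / cmod (?s + lam n)) \<le> 4 / sqrt (real N + 1)" .
  have "(\<Sum>n=2*N+1..<M. central_binomial n / cmod (?s + lam n)) \<le> (\<Sum>n=2*N+1..<M. 1 / (real n * sqrt (real n + 1)))"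
  proof (rule sum_mono)
    fix n assume n: "n \<in> {2*N+1..<M}"
    have "real n \<le> cmod (?s + lam n)" using centred_tail(2)[OF c, of n] n cmod_ge_real_part(2)[of \<tau> "lam n" \<xi>] by simp
    then have "central_binomial n / cmod (?s + lam n) \<le> (1 / sqrt (real n + 1)) / real n"
      using central_binomial_le[of n] n by (intro frac_le) auto
    then show "central_binomial n / cmod (?s + lam n) \<le> 1 / (real n * sqrt (real n + 1))" by (simp add: mult.commute)
  qed
  also have "\<dots> \<le> 3 / sqrt (real (2*N+1))" by (rule sum_tail) simp
  also have "\<dots> \<le> 3 / sqrt (real N + 1)" by (intro divide_left_mono) (auto simp: add_nonneg_pos)
  finally show ?thesis unfolding sum_split_window[OF M] using 1 by (simp add: add_divide_distrib[symmetric])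
qed

lemma inverse_zonal_nsq: "1 / zonal_nsq n = (1 / zonal_nsq 0) * (2 * lam n * central_binomial n)"
proof -
  have "zonal_nsq n * (2 * lam n * central_binomial n) = zonal_nsq 0" using zonal_nsq_explicit[of n] by (simp add: lam_def algebra_simps)
  then show ?thesis using zonal_nsq_pos[of n] zonal_nsq_pos[of 0] by (simp add: field_simps)
qed

lemma admissible_symbol_nonzero:
  assumes "centred \<delta> \<tau> N"
  shows "Complex \<tau> \<xi> - complex_of_real (lam n) \<noteq> 0" "Complex \<tau> \<xi> + complex_of_real (lam n) \<noteq> 0"
proof -
  have "0 < \<bar>\<tau> - lam n\<bar>" "0 < \<bar>\<tau> + lam n\<bar>" using assms lam_pos[of n] unfolding centred_def
    by (metis less_le_trans, force)
  then show "Complex \<tau> \<xi> - complex_of_real (lam n) \<noteq> 0" "Complex \<tau> \<xi> + complex_of_real (lam n) \<noteq> 0"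
    using cmod_ge_real_part[of \<tau> "lam n" \<xi>] by auto
qed

text \<open>By \<open>inverse_zonal_nsq\<close> the squared endpoint values carry the factor \<open>2 lam n\<close>, which the partial fraction
  decomposition \<open>2\<lambda> / (s\<^sup>2 - \<lambda>\<^sup>2) = 1 / (s - \<lambda>) - 1 / (s + \<lambda>)\<close> absorbs. What remains are the two preceding
  sums. Since \<open>N\<close> is of the order of \<open>\<tau>\<close>, the symbol has size \<open>\<tau>\<^sup>-\<^sup>1\<^sup>/\<^sup>2\<close>.\<close>

lemma trace_symbol:
  fixes \<epsilon> :: real
  assumes c: "centred \<delta> \<tau> N" and \<epsilon>: "\<epsilon> = 1 \<or> \<epsilon> = -1" and M: "2 * N + 1 \<le> M"
  shows "cmod (\<Sum>n<M. complex_of_real (\<epsilon> ^ n / zonal_nsq n) / ((Complex \<tau> \<xi>)\<^sup>2 - (complex_of_real (lam n))\<^sup>2))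
    \<le> (1 / zonal_nsq 0) * ((21 + 1 / \<delta>) / sqrt (real N + 1))"
proof -
  let ?s = "Complex \<tau> \<xi>"
  have pf: "complex_of_real (\<epsilon> ^ n / zonal_nsq n) / (?s\<^sup>2 - (complex_of_real (lam n))\<^sup>2)
      = complex_of_real (1 / zonal_nsq 0) * (complex_of_real (\<epsilon> ^ n * central_binomial n) / (?s - lam n) - complex_of_real (\<epsilon> ^ n * central_binomial n) / (?s + lam n))" for n
  proof -
    define l where "l = complex_of_real (lam n)"
    have nz: "?s - l \<noteq> 0" "?s + l \<noteq> 0" unfolding l_def using admissible_symbol_nonzero[OF c] by auto
    have "complex_of_real (\<epsilon> ^ n / zonal_nsq n) = complex_of_real (1 / zonal_nsq 0) * (2 * l * complex_of_real (\<epsilon> ^ n * central_binomial n))"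
      using arg_cong[OF inverse_zonal_nsq[of n], of "\<lambda>x. complex_of_real (\<epsilon> ^ n * x)"] by (simp add: l_def mult_ac)
    moreover have "?s\<^sup>2 - l\<^sup>2 = (?s - l) * (?s + l)" by (simp add: power2_eq_square algebra_simps)
    moreover have "2 * l * b / ((?s - l) * (?s + l)) = b / (?s - l) - b / (?s + l)" for b
      using nz by (simp add: diff_divide_eq_iff divide_diff_eq_iff) (simp add: divide_simps algebra_simps)
    ultimately show ?thesis unfolding l_def[symmetric] by (metis times_divide_eq_right)
  qed
  have ab: "\<bar>\<epsilon> ^ n\<bar> = 1" for n using \<epsilon> by (auto simp: power_abs)
  have p: "cmod (\<Sum>n<M. complex_of_real (\<epsilon> ^ n * central_binomial n) / (?s + lam n)) \<le> 7 / sqrt (real N + 1)"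
  proof (rule order_trans[OF norm_sum])
    show "(\<Sum>n<M. cmod (complex_of_real (\<epsilon> ^ n * central_binomial n) / (?s + lam n))) \<le> 7 / sqrt (real N + 1)"
      unfolding norm_divide norm_of_real abs_mult ab mult_1_left using plus_sum[OF c M, of \<xi>] central_binomial_pos
      by (simp add: abs_of_pos)
  qed
  have "cmod (\<Sum>n<M. complex_of_real (\<epsilon> ^ n / zonal_nsq n) / (?s\<^sup>2 - (complex_of_real (lam n))\<^sup>2))
     = (1 / zonal_nsq 0) * cmod ((\<Sum>n<M. complex_of_real (\<epsilon> ^ n * central_binomial n) / (?s - lam n)) - (\<Sum>n<M. complex_of_real (\<epsilon> ^ n * central_binomial n) / (?s + lam n)))"
    unfolding pf sum_distrib_left[symmetric] sum_subtractf[symmetric] norm_mult norm_of_real using zonal_nsq_pos[of 0] by simp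
  also have "\<dots> \<le> (1 / zonal_nsq 0) * ((14 + 1 / \<delta>) / sqrt (real N + 1) + 7 / sqrt (real N + 1))"
    using zonal_nsq_pos[of 0] by (intro mult_left_mono order_trans[OF norm_triangle_ineq4] add_mono minus_sum[OF c \<epsilon> M] p) auto
  also have "\<dots> = (1 / zonal_nsq 0) * ((21 + 1 / \<delta>) / sqrt (real N + 1))" by (simp add: add_divide_distrib)
  finally show ?thesis .
qed

text \<open>In the window the squared endpoint values are at most of order \<open>\<surd>N\<close> and the inverse squared
  distances to \<open>\<tau>\<close> are summable. Beyond it the terms decay like \<open>n\<^sup>-\<^sup>3\<^sup>/\<^sup>2\<close>.\<close>

lemma resonance_sum:
  assumes c: "centred \<delta> \<tau> N" and M: "2 * N + 1 \<le> M"
  shows "(\<Sum>n<M. (1 / zonal_nsq n) / (\<tau> - lam n)\<^sup>2) \<le> (1 / zonal_nsq 0) * ((40 + 4 / \<delta>\<^sup>2) * sqrt (2 * real N + 1))"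
proof -
  have \<delta>: "0 < \<delta>" "\<And>n. \<delta> \<le> \<bar>\<tau> - lam n\<bar>" using c by (auto simp: centred_def)
  define r where "r = sqrt (2 * real N + 1)"
  have r: "1 \<le> r" by (simp add: r_def)
  have num: "2 * lam n * central_binomial n \<le> 4 * sqrt (real n + 1)" for n
  proof -
    have "2 * lam n * central_binomial n \<le> (4 * (real n + 1)) * (1 / sqrt (real n + 1))"
      using central_binomial_le[of n] central_binomial_pos[of n] by - (rule mult_mono, auto simp: lam_def)
    also have "\<dots> = 4 * sqrt (real n + 1)" using real_sqrt_mult_self[of "real n + 1"] by (simp add: field_simps)
    finally show ?thesis .
  qed
  define f where "f n = 2 * lam n * central_binomial n / (\<tau> - lam n)\<^sup>2" for n
  have win: "f n \<le> 4 * r / (real j)\<^sup>2" if "n \<le> 2 * N" "1 \<le> j" "\<bar>real n - real N\<bar> = real j" for n j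
  proof -
    have "n \<noteq> N" using that by auto
    then have "(real j)\<^sup>2 \<le> (\<tau> - lam n)\<^sup>2" using centred_far[OF c, of n] that by (simp add: abs_le_square_iff[symmetric])
    moreover have "2 * lam n * central_binomial n \<le> 4 * r"
      using num[of n] that(1) unfolding r_def by (intro order_trans[OF num] mult_left_mono) auto
    ultimately show ?thesis unfolding f_def using that r by (intro frac_le) auto
  qed
  have "f N \<le> 4 * r / \<delta>\<^sup>2"
  proof -
    have "\<delta>\<^sup>2 \<le> (\<tau> - lam N)\<^sup>2" using \<delta>(1) \<delta>(2)[of N] by (simp add: abs_le_square_iff[symmetric])
    moreover have "2 * lam N * central_binomial N \<le> 4 * r" unfolding r_def by (intro order_trans[OF num] mult_left_mono) auto
    ultimately show ?thesis unfolding f_def using \<delta>(1) r by (intro frac_le) auto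
  qed
  moreover have "(\<Sum>j=1..N. f (N + j) + f (N - j)) \<le> (\<Sum>j=1..N. 8 * r * (1 / (real j)\<^sup>2))"
  proof (rule sum_mono)
    fix j assume j: "j \<in> {1..N}"
    have "f (N + j) \<le> 4 * r / (real j)\<^sup>2" "f (N - j) \<le> 4 * r / (real j)\<^sup>2"
      using j by (auto intro!: win simp: of_nat_diff)
    then show "f (N + j) + f (N - j) \<le> 8 * r * (1 / (real j)\<^sup>2)" by simp
  qed
  moreover have "(\<Sum>j=1..N. 8 * r * (1 / (real j)\<^sup>2)) \<le> 8 * r * 2"
    unfolding sum_distrib_left[symmetric] using r sum_inverse_squares[of N] by (intro mult_left_mono) auto
  ultimately have 1: "(\<Sum>n<2*N+1. f n) \<le> 4 * r / \<delta>\<^sup>2 + 16 * r" unfolding sum_symmetric_window by simp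
  have "(\<Sum>n=2*N+1..<M. f n) \<le> (\<Sum>n=2*N+1..<M. 8 * (1 / (real n * sqrt (real n + 1))))"
  proof (rule sum_mono)
    fix n assume n: "n \<in> {2*N+1..<M}"
    have "(real n)\<^sup>2 \<le> (\<tau> - lam n)\<^sup>2" using centred_tail(1)[OF c, of n] n by (simp add: abs_le_square_iff[symmetric])
    then have "f n \<le> 4 * sqrt (real n + 1) / (real n)\<^sup>2"
      unfolding f_def using num[of n] n by (intro frac_le) auto
    also have "\<dots> \<le> 8 * (1 / (real n * sqrt (real n + 1)))"
    proof -
      have n1: "1 \<le> real n" using n by simp
      have "sqrt (real n + 1) * sqrt (real n + 1) \<le> 2 * real n" using n1 by simp
      then have "(4 * sqrt (real n + 1)) * (real n * sqrt (real n + 1)) \<le> 8 * (real n)\<^sup>2"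
        using mult_left_mono[of "sqrt (real n + 1) * sqrt (real n + 1)" "2 * real n" "4 * real n"] n1
        by (simp add: power2_eq_square mult_ac)
      then show ?thesis using n1 by (simp add: divide_le_eq pos_le_divide_eq mult_pos_pos)
    qed
    finally show "f n \<le> 8 * (1 / (real n * sqrt (real n + 1)))" .
  qed
  also have "\<dots> \<le> 8 * (3 / sqrt (real (2*N+1)))"
    unfolding sum_distrib_left[symmetric] by (intro mult_left_mono sum_tail) auto
  also have "\<dots> \<le> 24 * r"
  proof -
    have "1 / r \<le> r" using r by (simp add: divide_le_eq) (metis mult_mono' mult_1 zero_le_one)
    moreover have "sqrt (real (2*N+1)) = r" by (simp add: r_def add.commute)
    ultimately show ?thesis by simp
  qed
  finally have 2: "(\<Sum>n=2*N+1..<M. f n) \<le> 24 * r" .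
  have "(\<Sum>n<M. (1 / zonal_nsq n) / (\<tau> - lam n)\<^sup>2) = (1 / zonal_nsq 0) * (\<Sum>n<M. f n)"
  proof -
    have "(1 / zonal_nsq n) / (\<tau> - lam n)\<^sup>2 = (1 / zonal_nsq 0) * f n" for n
      unfolding f_def by (subst inverse_zonal_nsq) (simp only: times_divide_eq_right)
    then show ?thesis by (simp only: sum_distrib_left)
  qed
  also have "\<dots> \<le> (1 / zonal_nsq 0) * ((4 * r / \<delta>\<^sup>2 + 16 * r) + 24 * r)"
    unfolding sum_split_window[OF M] using zonal_nsq_pos[of 0] 1 2 by (intro mult_left_mono add_mono) auto
  also have "\<dots> = (1 / zonal_nsq 0) * ((40 + 4 / \<delta>\<^sup>2) * sqrt (2 * real N + 1))" by (simp add: r_def algebra_simps)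
  finally show ?thesis .
qed


section \<open>The estimate at one frequency\<close>

lemma amp_mult: "amp n i * amp n j = (if i = j then 1 else -1) ^ n / zonal_nsq n"
  using exhaust_2[of i] exhaust_2[of j] zonal_nsq_pos[of n]
  by (auto simp: amp_def power_mult_distrib[symmetric])

lemma amp_sq: "(amp n i)\<^sup>2 = 1 / zonal_nsq n"
  using amp_mult[of n i i] by (simp add: power2_eq_square)

lemma norm_sq_2: "(norm (x :: complex^2))\<^sup>2 = (cmod (x $ 1))\<^sup>2 + (cmod (x $ 2))\<^sup>2"
  by (simp add: norm_vec_def L2_set_def sum_2)

text \<open>The three terms serve the trace of the response to the boundary source, the two applications of the
  resonance sum, and the energy of the response to \<open>F\<close>.\<close>

definition mode_const :: "real \<Rightarrow> real" where
  "mode_const \<delta> = 8 * ((1 / zonal_nsq 0) * (21 + 1 / \<delta>) * 2)\<^sup>2 + 4 * ((1 / zonal_nsq 0) * (40 + 4 / \<delta>\<^sup>2) * 2) + 2 / \<delta>\<^sup>2"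

lemma mode_const_parts:
  assumes "0 < \<delta>"
  shows "8 * ((1 / zonal_nsq 0) * (21 + 1 / \<delta>) * 2)\<^sup>2 \<le> mode_const \<delta>" "4 * ((1 / zonal_nsq 0) * (40 + 4 / \<delta>\<^sup>2) * 2) \<le> mode_const \<delta>"
    "2 / \<delta>\<^sup>2 \<le> mode_const \<delta>" "0 < mode_const \<delta>"
proof -
  have "0 \<le> 8 * ((1 / zonal_nsq 0) * (21 + 1 / \<delta>) * 2)\<^sup>2" "0 \<le> 4 * ((1 / zonal_nsq 0) * (40 + 4 / \<delta>\<^sup>2) * 2)" "0 < 2 / \<delta>\<^sup>2"
    using assms zonal_nsq_pos[of 0] by auto
  then show "8 * ((1 / zonal_nsq 0) * (21 + 1 / \<delta>) * 2)\<^sup>2 \<le> mode_const \<delta>" "4 * ((1 / zonal_nsq 0) * (40 + 4 / \<delta>\<^sup>2) * 2) \<le> mode_const \<delta>"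
    "2 / \<delta>\<^sup>2 \<le> mode_const \<delta>" "0 < mode_const \<delta>"
    unfolding mode_const_def by linarith+
qed

lemma centred_sqrt:
  assumes "centred \<delta> \<tau> N"
  shows "1 / sqrt (real N + 1) \<le> 2 / sqrt \<tau>" "sqrt (2 * real N + 1) \<le> 2 * sqrt \<tau>"
proof -
  have t: "2 \<le> \<tau>" "\<tau> / 2 \<le> real N + 1" "2 * real N + 1 \<le> 2 * \<tau>" using assms by (auto simp: centred_def)
  have "sqrt (\<tau> / 4) \<le> sqrt (real N + 1)" using t by (intro real_sqrt_le_mono) linarith
  then have "sqrt \<tau> / 2 \<le> sqrt (real N + 1)" by (simp add: real_sqrt_divide)
  then have "1 / sqrt (real N + 1) \<le> 1 / (sqrt \<tau> / 2)" using t by (intro divide_left_mono mult_pos_pos) (auto simp: add_nonneg_pos)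
  then show "1 / sqrt (real N + 1) \<le> 2 / sqrt \<tau>" by simp
  have "sqrt (2 * real N + 1) \<le> sqrt (4 * \<tau>)" using t by (intro real_sqrt_le_mono) linarith
  then show "sqrt (2 * real N + 1) \<le> 2 * sqrt \<tau>" by (simp add: real_sqrt_mult)
qed

text \<open>The factor \<open>s - \<lambda>\<close> is estimated by its real part. In \<open>s + \<lambda>\<close> the mixed term \<open>2 \<tau> \<lambda>\<close> is positive.\<close>

lemma symbol_lower_bounds:
  assumes t: "0 < \<tau>"
  shows "(\<tau> - lam n)\<^sup>2 * (\<tau>\<^sup>2 + \<xi>\<^sup>2 + (lam n)\<^sup>2) \<le> (cmod ((Complex \<tau> \<xi>)\<^sup>2 - (complex_of_real (lam n))\<^sup>2))\<^sup>2"
    "(\<tau> - lam n)\<^sup>2 * \<tau>\<^sup>2 \<le> (cmod ((Complex \<tau> \<xi>)\<^sup>2 - (complex_of_real (lam n))\<^sup>2))\<^sup>2"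
proof -
  let ?s = "Complex \<tau> \<xi>" and ?l = "complex_of_real (lam n)"
  have f: "?s\<^sup>2 - ?l\<^sup>2 = (?s - ?l) * (?s + ?l)" by (simp add: power2_eq_square algebra_simps)
  have 1: "(cmod (?s - ?l))\<^sup>2 = (\<tau> - lam n)\<^sup>2 + \<xi>\<^sup>2" "(cmod (?s + ?l))\<^sup>2 = (\<tau> + lam n)\<^sup>2 + \<xi>\<^sup>2"
    by (simp_all add: cmod_power2)
  have "0 \<le> 2 * \<tau> * lam n" using t lam_pos[of n] by simp
  then have 2: "\<tau>\<^sup>2 + \<xi>\<^sup>2 + (lam n)\<^sup>2 \<le> (cmod (?s + ?l))\<^sup>2" unfolding 1 by (simp add: power2_sum)
  then show 3: "(\<tau> - lam n)\<^sup>2 * (\<tau>\<^sup>2 + \<xi>\<^sup>2 + (lam n)\<^sup>2) \<le> (cmod (?s\<^sup>2 - ?l\<^sup>2))\<^sup>2"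
    unfolding f norm_mult power_mult_distrib by (intro mult_mono) (auto simp: 1(1))
  have "(\<tau> - lam n)\<^sup>2 * \<tau>\<^sup>2 \<le> (\<tau> - lam n)\<^sup>2 * (\<tau>\<^sup>2 + \<xi>\<^sup>2 + (lam n)\<^sup>2)" by (intro mult_left_mono) auto
  then show "(\<tau> - lam n)\<^sup>2 * \<tau>\<^sup>2 \<le> (cmod (?s\<^sup>2 - ?l\<^sup>2))\<^sup>2" using 3 by linarith
qed

lemma cmod_sum_sq: "(cmod (a + b))\<^sup>2 \<le> 2 * (cmod a)\<^sup>2 + 2 * (cmod b)\<^sup>2"
proof -
  have "(cmod (a + b))\<^sup>2 \<le> (cmod a + cmod b)\<^sup>2" by (intro power_mono norm_triangle_ineq) auto
  also have "\<dots> \<le> 2 * (cmod a)\<^sup>2 + 2 * (cmod b)\<^sup>2"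
    using sum_squares_bound[of "cmod a" "cmod b"] by (simp add: power2_sum)
  finally show ?thesis .
qed

text \<open>Split the mode into the response to the boundary source \<open>G\<close> and to \<open>F\<close>. The energy of both
  and the trace of the second are controlled by the resonance sum. The trace of the first is
  multiplication by the trace symbol.\<close>

lemma mode_estimate:
  fixes G X :: "complex^2"
  assumes c: "centred \<delta> \<tau> N"
    and eq: "\<And>n. ((Complex \<tau> \<xi>)\<^sup>2 - (complex_of_real (lam n))\<^sup>2) * V n = (\<Sum>j\<in>UNIV. G $ j * amp n j) + F n"
    and X: "\<And>i. (\<lambda>n. V n * amp n i) sums (X $ i)"
    and F: "(\<lambda>n. (cmod (F n))\<^sup>2) sums f"
  shows "(\<Sum>n<M. (\<tau>\<^sup>2 + \<xi>\<^sup>2 + (lam n)\<^sup>2) * (cmod (V n))\<^sup>2) \<le> mode_const \<delta> * (sqrt \<tau> * (norm G)\<^sup>2 + f)"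
    and "(norm X)\<^sup>2 \<le> mode_const \<delta> * ((norm G)\<^sup>2 / \<tau> + sqrt \<tau> / \<tau>\<^sup>2 * f)"
proof -
  define \<sigma> where "\<sigma> n = (Complex \<tau> \<xi>)\<^sup>2 - (complex_of_real (lam n))\<^sup>2" for n
  define \<alpha> \<beta> where "\<alpha> = (1 / zonal_nsq 0) * (21 + 1 / \<delta>) * 2" and "\<beta> = (1 / zonal_nsq 0) * (40 + 4 / \<delta>\<^sup>2) * 2"
  have t: "2 \<le> \<tau>" and \<delta>: "0 < \<delta>" "\<And>n. \<delta> \<le> \<bar>\<tau> - lam n\<bar>" using c by (auto simp: centred_def)
  have d0: "0 < (\<tau> - lam n)\<^sup>2" for n using \<delta>(1) \<delta>(2)[of n] by auto
  have \<delta>2: "\<delta>\<^sup>2 \<le> (\<tau> - lam n)\<^sup>2" for n using \<delta>(1) \<delta>(2)[of n] by (simp add: abs_le_square_iff[symmetric])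
  have \<sigma>1: "(\<tau> - lam n)\<^sup>2 * (\<tau>\<^sup>2 + \<xi>\<^sup>2 + (lam n)\<^sup>2) \<le> (cmod (\<sigma> n))\<^sup>2" and \<sigma>2: "(\<tau> - lam n)\<^sup>2 * \<tau>\<^sup>2 \<le> (cmod (\<sigma> n))\<^sup>2" for n
    unfolding \<sigma>_def using symbol_lower_bounds[of \<tau>] t by auto
  have \<sigma>0: "\<sigma> n \<noteq> 0" for n
  proof
    assume "\<sigma> n = 0"
    then have "(\<tau> - lam n)\<^sup>2 * \<tau>\<^sup>2 \<le> 0" using \<sigma>2[of n] by simp
    moreover have "0 < (\<tau> - lam n)\<^sup>2 * \<tau>\<^sup>2" using d0 t by (intro mult_pos_pos) auto
    ultimately show False by linarith
  qed
  have V: "V n = (\<Sum>j\<in>UNIV. G $ j * amp n j) / \<sigma> n + F n / \<sigma> n" for n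
    using eq[of n] \<sigma>0[of n] by (simp add: \<sigma>_def[symmetric] field_simps)
  have Ff: "(\<Sum>n<M. (cmod (F n))\<^sup>2) \<le> f" for M
    using sum_le_suminf[OF sums_summable[OF F], of "{..<M}"] sums_unique[OF F] by simp
  have f0: "0 \<le> f" using Ff[of 0] by simp
  have res: "(\<Sum>n<M. (1 / zonal_nsq n) / (\<tau> - lam n)\<^sup>2) \<le> \<beta> * sqrt \<tau>" for M
  proof -
    let ?M = "max M (2*N+1)"
    have "(\<Sum>n<M. (1 / zonal_nsq n) / (\<tau> - lam n)\<^sup>2) \<le> (\<Sum>n<?M. (1 / zonal_nsq n) / (\<tau> - lam n)\<^sup>2)"
    proof (rule sum_mono2)
      show "0 \<le> (1 / zonal_nsq n) / (\<tau> - lam n)\<^sup>2" for n using less_imp_le[OF zonal_nsq_pos[of n]] by simp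
    qed auto
    also have "\<dots> \<le> (1 / zonal_nsq 0) * ((40 + 4 / \<delta>\<^sup>2) * sqrt (2 * real N + 1))" by (intro resonance_sum[OF c]) simp
    also have "\<dots> \<le> (1 / zonal_nsq 0) * ((40 + 4 / \<delta>\<^sup>2) * (2 * sqrt \<tau>))"
      using centred_sqrt(2)[OF c] zonal_nsq_pos[of 0] \<delta>(1) by (intro mult_left_mono) (auto intro!: add_nonneg_nonneg)
    also have "\<dots> = \<beta> * sqrt \<tau>" by (simp add: \<beta>_def)
    finally show ?thesis .
  qed
  have GA: "(cmod (\<Sum>j\<in>UNIV. G $ j * amp n j))\<^sup>2 \<le> 2 * (norm G)\<^sup>2 * (1 / zonal_nsq n)" for n
  proof -
    have "(cmod (\<Sum>j\<in>UNIV. G $ j * amp n j))\<^sup>2 \<le> 2 * (cmod (G $ 1 * amp n 1))\<^sup>2 + 2 * (cmod (G $ 2 * amp n 2))\<^sup>2"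
      unfolding sum_2 by (rule cmod_sum_sq)
    also have "\<dots> = 2 * (norm G)\<^sup>2 * (1 / zonal_nsq n)"
      by (simp only: norm_mult norm_of_real power_mult_distrib power2_abs amp_sq norm_sq_2) (simp add: algebra_simps)
    finally show ?thesis .
  qed
  show "(\<Sum>n<M. (\<tau>\<^sup>2 + \<xi>\<^sup>2 + (lam n)\<^sup>2) * (cmod (V n))\<^sup>2) \<le> mode_const \<delta> * (sqrt \<tau> * (norm G)\<^sup>2 + f)"
  proof -
    have "(\<tau>\<^sup>2 + \<xi>\<^sup>2 + (lam n)\<^sup>2) * (cmod (V n))\<^sup>2 \<le> 4 * (norm G)\<^sup>2 * ((1 / zonal_nsq n) / (\<tau> - lam n)\<^sup>2) + 2 / \<delta>\<^sup>2 * (cmod (F n))\<^sup>2" for n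
    proof -
      define g where "g = (\<Sum>j\<in>UNIV. G $ j * amp n j)"
      have eV: "cmod (\<sigma> n) * cmod (V n) = cmod (g + F n)" using eq[of n] by (simp add: \<sigma>_def g_def norm_mult[symmetric])
      have "((\<tau> - lam n)\<^sup>2 * (\<tau>\<^sup>2 + \<xi>\<^sup>2 + (lam n)\<^sup>2)) * (cmod (V n))\<^sup>2 \<le> (cmod (\<sigma> n))\<^sup>2 * (cmod (V n))\<^sup>2"
        by (intro mult_right_mono \<sigma>1) simp
      also have "\<dots> = (cmod (g + F n))\<^sup>2" by (simp only: power_mult_distrib[symmetric] eV)
      also have "\<dots> \<le> 2 * (cmod g)\<^sup>2 + 2 * (cmod (F n))\<^sup>2" by (rule cmod_sum_sq)
      finally have "(\<tau>\<^sup>2 + \<xi>\<^sup>2 + (lam n)\<^sup>2) * (cmod (V n))\<^sup>2 \<le> (2 * (cmod g)\<^sup>2 + 2 * (cmod (F n))\<^sup>2) / (\<tau> - lam n)\<^sup>2"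
        using d0[of n] by (simp add: pos_le_divide_eq mult_ac)
      also have "\<dots> = 2 * (cmod g)\<^sup>2 / (\<tau> - lam n)\<^sup>2 + 2 * (cmod (F n))\<^sup>2 / (\<tau> - lam n)\<^sup>2" by (rule add_divide_distrib)
      also have "\<dots> \<le> (2 * (2 * (norm G)\<^sup>2 * (1 / zonal_nsq n))) / (\<tau> - lam n)\<^sup>2 + 2 * (cmod (F n))\<^sup>2 / \<delta>\<^sup>2"
        using GA[of n] d0[of n] \<delta>2[of n] \<delta>(1) unfolding g_def
        by (intro add_mono divide_right_mono divide_left_mono mult_left_mono mult_pos_pos) auto
      finally show ?thesis by simp
    qed
    then have "(\<Sum>n<M. (\<tau>\<^sup>2 + \<xi>\<^sup>2 + (lam n)\<^sup>2) * (cmod (V n))\<^sup>2)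
        \<le> (\<Sum>n<M. 4 * (norm G)\<^sup>2 * ((1 / zonal_nsq n) / (\<tau> - lam n)\<^sup>2) + 2 / \<delta>\<^sup>2 * (cmod (F n))\<^sup>2)"
      by (rule sum_mono)
    also have "\<dots> = 4 * (norm G)\<^sup>2 * (\<Sum>n<M. (1 / zonal_nsq n) / (\<tau> - lam n)\<^sup>2) + 2 / \<delta>\<^sup>2 * (\<Sum>n<M. (cmod (F n))\<^sup>2)"
      by (simp only: sum.distrib sum_distrib_left)
    also have "\<dots> \<le> 4 * (norm G)\<^sup>2 * (\<beta> * sqrt \<tau>) + 2 / \<delta>\<^sup>2 * f"
      by (intro add_mono mult_left_mono res Ff) auto
    also have "\<dots> = (4 * \<beta>) * (sqrt \<tau> * (norm G)\<^sup>2) + 2 / \<delta>\<^sup>2 * f" by simp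
    also have "\<dots> \<le> mode_const \<delta> * (sqrt \<tau> * (norm G)\<^sup>2) + mode_const \<delta> * f"
      using mode_const_parts[OF \<delta>(1)] f0 t unfolding \<beta>_def by (intro add_mono mult_right_mono) auto
    finally show ?thesis by (simp only: distrib_left)
  qed
  have tr: "(cmod (X $ i))\<^sup>2 \<le> 4 * (\<alpha> / sqrt \<tau>)\<^sup>2 * (norm G)\<^sup>2 + 2 * (\<beta> * sqrt \<tau> / \<tau>\<^sup>2 * f)" for i
  proof (rule tendsto_upperbound)
    show "(\<lambda>M. (cmod (\<Sum>n<M. V n * amp n i))\<^sup>2) \<longlonglongrightarrow> (cmod (X $ i))\<^sup>2"
      using X[of i] unfolding sums_def by (intro tendsto_power tendsto_norm)
    have "(cmod (\<Sum>n<M. V n * amp n i))\<^sup>2 \<le> 4 * (\<alpha> / sqrt \<tau>)\<^sup>2 * (norm G)\<^sup>2 + 2 * (\<beta> * sqrt \<tau> / \<tau>\<^sup>2 * f)" if M: "2 * N + 1 \<le> M" for M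
    proof -
      \<comment> \<open>truncations of the trace symbol act on \<open>G\<close>, while \<open>b\<close> is the trace of the response to \<open>F\<close>\<close>
      define k where "k j = (\<Sum>n<M. complex_of_real (amp n j * amp n i) / \<sigma> n)" for j
      have kb: "cmod (k j) \<le> \<alpha> / sqrt \<tau>" for j
      proof -
        have "cmod (k j) \<le> (1 / zonal_nsq 0) * ((21 + 1 / \<delta>) / sqrt (real N + 1))"
          unfolding k_def amp_mult \<sigma>_def by (rule trace_symbol[OF c _ M]) auto
        also have "\<dots> = (1 / zonal_nsq 0) * ((21 + 1 / \<delta>) * (1 / sqrt (real N + 1)))" by simp
        also have "\<dots> \<le> (1 / zonal_nsq 0) * ((21 + 1 / \<delta>) * (2 / sqrt \<tau>))"
          using centred_sqrt(1)[OF c] zonal_nsq_pos[of 0] \<delta>(1) by (intro mult_left_mono) auto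
        also have "\<dots> = \<alpha> / sqrt \<tau>" by (simp add: \<alpha>_def)
        finally show ?thesis .
      qed
      define a where "a = G $ 1 * k 1 + G $ 2 * k 2"
      define b where "b = (\<Sum>n<M. F n * (complex_of_real (amp n i) / \<sigma> n))"
      have "(\<Sum>n<M. V n * amp n i) = a + b"
        unfolding a_def b_def k_def V sum_2 sum_distrib_left sum.distrib[symmetric]
        by (rule sum.cong) (auto simp: algebra_simps add_divide_distrib)
      then have "(cmod (\<Sum>n<M. V n * amp n i))\<^sup>2 \<le> 2 * (cmod a)\<^sup>2 + 2 * (cmod b)\<^sup>2" by (simp only: cmod_sum_sq)
      moreover have "(cmod a)\<^sup>2 \<le> 2 * (\<alpha> / sqrt \<tau>)\<^sup>2 * (norm G)\<^sup>2"
      proof -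
        have "(cmod a)\<^sup>2 \<le> 2 * (cmod (G $ 1 * k 1))\<^sup>2 + 2 * (cmod (G $ 2 * k 2))\<^sup>2" unfolding a_def by (rule cmod_sum_sq)
        also have "\<dots> \<le> 2 * ((cmod (G $ 1))\<^sup>2 * (\<alpha> / sqrt \<tau>)\<^sup>2) + 2 * ((cmod (G $ 2))\<^sup>2 * (\<alpha> / sqrt \<tau>)\<^sup>2)"
          unfolding norm_mult power_mult_distrib by (intro add_mono mult_left_mono power_mono kb) auto
        also have "\<dots> = 2 * (\<alpha> / sqrt \<tau>)\<^sup>2 * (norm G)\<^sup>2" unfolding norm_sq_2 by (simp add: algebra_simps)
        finally show ?thesis .
      qed
      moreover have "(cmod b)\<^sup>2 \<le> \<beta> * sqrt \<tau> / \<tau>\<^sup>2 * f"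
      proof -
        have "cmod b \<le> (\<Sum>n<M. cmod (F n) * (\<bar>amp n i\<bar> / cmod (\<sigma> n)))"
          unfolding b_def by (rule order_trans[OF norm_sum]) (simp add: norm_mult norm_divide)
        then have "(cmod b)\<^sup>2 \<le> (\<Sum>n<M. cmod (F n) * (\<bar>amp n i\<bar> / cmod (\<sigma> n)))\<^sup>2" by (rule power_mono) simp
        also have "\<dots> \<le> (\<Sum>n<M. (cmod (F n))\<^sup>2) * (\<Sum>n<M. (\<bar>amp n i\<bar> / cmod (\<sigma> n))\<^sup>2)"
          by (rule Cauchy_Schwarz_ineq_sum)
        also have "\<dots> \<le> f * (\<Sum>n<M. (1 / \<tau>\<^sup>2) * ((1 / zonal_nsq n) / (\<tau> - lam n)\<^sup>2))"
        proof (intro mult_mono Ff sum_mono)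
          fix n
          have "(\<bar>amp n i\<bar> / cmod (\<sigma> n))\<^sup>2 = (1 / zonal_nsq n) / (cmod (\<sigma> n))\<^sup>2" by (simp only: power_divide power2_abs amp_sq)
          also have "\<dots> \<le> (1 / zonal_nsq n) / ((\<tau> - lam n)\<^sup>2 * \<tau>\<^sup>2)"
            using \<sigma>2[of n] d0[of n] t zonal_nsq_pos[of n] \<sigma>0[of n] by (intro divide_left_mono mult_pos_pos) auto
          finally show "(\<bar>amp n i\<bar> / cmod (\<sigma> n))\<^sup>2 \<le> (1 / \<tau>\<^sup>2) * ((1 / zonal_nsq n) / (\<tau> - lam n)\<^sup>2)" by (simp add: mult_ac)
        qed (auto intro!: sum_nonneg f0)
        also have "\<dots> = f * ((1 / \<tau>\<^sup>2) * (\<Sum>n<M. (1 / zonal_nsq n) / (\<tau> - lam n)\<^sup>2))" by (simp only: sum_distrib_left)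
        also have "\<dots> \<le> f * ((1 / \<tau>\<^sup>2) * (\<beta> * sqrt \<tau>))" by (intro mult_left_mono res f0) auto
        also have "\<dots> = \<beta> * sqrt \<tau> / \<tau>\<^sup>2 * f" by simp
        finally show ?thesis .
      qed
      ultimately show ?thesis by linarith
    qed
    then show "\<forall>\<^sub>F M in sequentially. (cmod (\<Sum>n<M. V n * amp n i))\<^sup>2 \<le> 4 * (\<alpha> / sqrt \<tau>)\<^sup>2 * (norm G)\<^sup>2 + 2 * (\<beta> * sqrt \<tau> / \<tau>\<^sup>2 * f)"
      unfolding eventually_sequentially by blast
  qed simp
  have "(norm X)\<^sup>2 \<le> 8 * (\<alpha> / sqrt \<tau>)\<^sup>2 * (norm G)\<^sup>2 + 4 * (\<beta> * sqrt \<tau> / \<tau>\<^sup>2 * f)"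
    unfolding norm_sq_2[of X] using tr[of 1] tr[of 2] by linarith
  also have "\<dots> = (8 * \<alpha>\<^sup>2) * ((norm G)\<^sup>2 / \<tau>) + (4 * \<beta>) * (sqrt \<tau> / \<tau>\<^sup>2 * f)"
    using t by (simp add: power_divide)
  also have "\<dots> \<le> mode_const \<delta> * ((norm G)\<^sup>2 / \<tau>) + mode_const \<delta> * (sqrt \<tau> / \<tau>\<^sup>2 * f)"
    using mode_const_parts[OF \<delta>(1)] f0 t unfolding \<alpha>_def \<beta>_def by (intro add_mono mult_right_mono) auto
  finally show "(norm X)\<^sup>2 \<le> mode_const \<delta> * ((norm G)\<^sup>2 / \<tau> + sqrt \<tau> / \<tau>\<^sup>2 * f)" by (simp only: distrib_left)
qed

section \<open>Functions of time\<close>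

abbreviation ivl :: "real \<Rightarrow> real measure" where "ivl T \<equiv> lebesgue_on {-T<..<T}"

lemma measurable_AE_limit:
  fixes s :: "nat \<Rightarrow> real \<Rightarrow> complex"
  assumes "\<And>j. s j \<in> borel_measurable lebesgue" "AE t in lebesgue. (\<lambda>j. s j t) \<longlonglongrightarrow> f t"
  shows "f \<in> borel_measurable lebesgue"
proof (rule borel_measurable_AE)
  show "(\<lambda>t. lim (\<lambda>j. s j t)) \<in> borel_measurable lebesgue"
    using assms(1) by (rule borel_measurable_lim_metric)
  show "AE t in lebesgue. lim (\<lambda>j. s j t) = f t"
    using assms(2) by eventually_elim (rule limI)
qed

text \<open>Coefficients of the approximating simple functions are simple, and they converge by continuity of
  the inner product. Strong measurability thus becomes scalar measurability.\<close>

lemma L2_time_coef: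
  assumes u: "u \<in> L2_time H_space H_norm"
  shows "(\<lambda>t. coef (u t) n) \<in> L2 lebesgue"
proof -
  have uH: "AE t in lebesgue. u t \<in> L2 hmeas" and i: "integrable lebesgue (\<lambda>t. nsq hmeas (u t))"
    using u by (auto simp: L2_time_def H_space_L2 H_norm_nsq)
  obtain s :: "nat \<Rightarrow> real \<Rightarrow> real \<Rightarrow> complex" where s: "\<And>j. simple_function lebesgue (s j)" "\<And>j. range (s j) \<subseteq> L2 hmeas"
    "AE t in lebesgue. (\<lambda>j. H_norm (\<lambda>x. s j t x - u t x)) \<longlonglongrightarrow> 0"
    using u by (auto simp: L2_time_def strongly_measurable_def H_space_L2)
  have m: "(\<lambda>t. coef (u t) n) \<in> borel_measurable lebesgue"
  proof (rule measurable_AE_limit)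
    show "(\<lambda>t. coef (s j t) n) \<in> borel_measurable lebesgue" for j
      using simple_function_compose1[OF s(1), of "\<lambda>f. coef f n"] by (rule borel_measurable_simple_function)
    show "AE t in lebesgue. (\<lambda>j. coef (s j t) n) \<longlonglongrightarrow> coef (u t) n"
      using uH s(3)
    proof eventually_elim
      case (elim t)
      have sL: "s j t \<in> L2 hmeas" for j using s(2)[of j] by auto
      have "(\<lambda>j. (H_norm (\<lambda>x. s j t x - u t x))\<^sup>2) \<longlonglongrightarrow> 0\<^sup>2" using elim(2) by (rule tendsto_power)
      then have "(\<lambda>j. nsq hmeas (\<lambda>x. u t x - s j t x)) \<longlonglongrightarrow> 0"
        by (simp add: H_norm_nsq nsq_diff_commute[of hmeas "u t"])
      then show ?case by (rule ip_tendsto[OF sL elim(1) eig_L2])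
    qed
  qed
  show ?thesis
  proof (rule L2I[OF m], rule Bochner_Integration.integrable_bound[OF i])
    show "(\<lambda>t. (cmod (coef (u t) n))\<^sup>2) \<in> borel_measurable lebesgue" using m by measurable
    show "AE t in lebesgue. norm ((cmod (coef (u t) n))\<^sup>2) \<le> norm (nsq hmeas (u t))"
      using uH
    proof eventually_elim
      case (elim t)
      have "(cmod (coef (u t) n))\<^sup>2 \<le> (\<Sum>m<Suc n. (cmod (coef (u t) m))\<^sup>2)" by (simp add: sum_nonneg)
      also have "\<dots> \<le> nsq hmeas (u t)" by (rule E.Bessel[OF elim])
      finally show ?case by simp
    qed
  qed
qed

lemma L2_lebesgue_restrict:
  fixes f :: "real \<Rightarrow> complex"
  assumes "f \<in> L2 lebesgue" "S \<in> sets lebesgue" shows "f \<in> L2 (lebesgue_on S)"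
proof (rule L2I)
  show "f \<in> borel_measurable (lebesgue_on S)" using L2D(1)[OF assms(1)] by (rule measurable_restrict_space1)
  have "integrable (lebesgue_on UNIV) (\<lambda>x. (cmod (f x))\<^sup>2)" using L2D(2)[OF assms(1)] by (simp add: lebesgue_on_UNIV_eq)
  then show "integrable (lebesgue_on S) (\<lambda>x. (cmod (f x))\<^sup>2)"
    by (rule integrable_lebesgue_on_subset) (use assms in auto)
qed

lemma L2_lebesgue_integrable_ivl:
  fixes f :: "real \<Rightarrow> complex"
  assumes "f \<in> L2 lebesgue" shows "integrable (lebesgue_on {p..q}) f"
proof -
  have "(\<lambda>x. 1) \<in> L2 (lebesgue_on {p..q})"
    by (intro L2I) (simp_all add: continuous_imp_integrable_real)
  from L2_mult_integrable(1)[OF L2_lebesgue_restrict[OF assms] this] show ?thesis by simp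
qed

lemma ennreal_suminf_swap: "(\<Sum>i. \<Sum>j. f i j) = (\<Sum>j. \<Sum>i. f i j :: ennreal)"
  using nn_integral_suminf[of "\<lambda>j i. f i j" "count_space UNIV"]
  by (simp add: nn_integral_count_space_nat)

lemma ennreal_suminf_le:
  fixes f :: "nat \<Rightarrow> ennreal"
  assumes "\<And>N. sum f {..<N} \<le> x" shows "suminf f \<le> x"
  unfolding suminf_eq_SUP using assms by (intro SUP_least)

text \<open>Parseval in space and in time: the weighted energy over a period, mode by mode and
  frequency by frequency. The sums are taken in the extended
  nonnegative numbers, where they may be interchanged.\<close>

lemma space_time_Parseval:
  assumes T: "T > 0" and c: "\<And>n. c n \<in> L2 (ivl T)" and w: "\<And>n. 0 \<le> w n"
    and q: "AE t in ivl T. (\<lambda>n. w n * (cmod (c n t))\<^sup>2) sums q t"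
  shows "(\<integral>\<^sup>+t. ennreal (q t) \<partial>ivl T) = (\<Sum>k. \<Sum>n. ennreal (w n * (cmod (ip (ivl T) (c n) (fourier T k)))\<^sup>2))"
proof -
  interpret orthonormal_basis "ivl T" "fourier T" by (rule fourier_basis[OF T])
  note [measurable] = L2D(1)[OF c]
  have "(\<integral>\<^sup>+t. ennreal (q t) \<partial>ivl T) = (\<integral>\<^sup>+t. (\<Sum>n. ennreal (w n * (cmod (c n t))\<^sup>2)) \<partial>ivl T)"
  proof (rule nn_integral_cong_AE)
    show "AE t in ivl T. ennreal (q t) = (\<Sum>n. ennreal (w n * (cmod (c n t))\<^sup>2))"
      using q by eventually_elim (rule suminf_ennreal_eq[symmetric], simp_all add: w)
  qed
  also have "\<dots> = (\<Sum>n. \<integral>\<^sup>+t. ennreal (w n * (cmod (c n t))\<^sup>2) \<partial>ivl T)"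
    by (rule nn_integral_suminf) measurable
  also have "\<dots> = (\<Sum>n. \<Sum>k. ennreal (w n * (cmod (ip (ivl T) (c n) (fourier T k)))\<^sup>2))"
  proof (rule suminf_cong)
    fix n
    have "(\<integral>\<^sup>+t. ennreal (w n * (cmod (c n t))\<^sup>2) \<partial>ivl T) = ennreal (w n * nsq (ivl T) (c n))"
      using w[of n] by (simp add: ennreal_mult nn_integral_cmult L2_nn[OF c])
    moreover have s: "(\<lambda>k. w n * (cmod (ip (ivl T) (c n) (fourier T k)))\<^sup>2) sums (w n * nsq (ivl T) (c n))"
      by (intro sums_mult Parseval c)
    ultimately show "(\<integral>\<^sup>+t. ennreal (w n * (cmod (c n t))\<^sup>2) \<partial>ivl T) = (\<Sum>k. ennreal (w n * (cmod (ip (ivl T) (c n) (fourier T k)))\<^sup>2))"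
      by (subst suminf_ennreal_eq[OF _ s]) (simp_all add: w)
  qed
  also have "\<dots> = (\<Sum>k. \<Sum>n. ennreal (w n * (cmod (ip (ivl T) (c n) (fourier T k)))\<^sup>2))"
    by (rule ennreal_suminf_swap)
  finally show ?thesis .
qed

text \<open>If \<open>q\<close> is not integrable, then its Bochner integral is zero by convention.\<close>

lemma integral_le_nn_integral: "(\<And>t. 0 \<le> q t) \<Longrightarrow> ennreal (integral\<^sup>L M q) \<le> (\<integral>\<^sup>+t. ennreal (q t) \<partial>M)"
  by (cases "integrable M q") (simp_all add: nn_integral_eq_integral not_integrable_integral_eq)

lemma integral_le_nn_integral_ivl:
  assumes "\<And>t. 0 \<le> q t" "AE t in lebesgue. t \<notin> {-T<..<T} \<longrightarrow> q t = 0"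
  shows "ennreal (LINT t|lebesgue. q t) \<le> (\<integral>\<^sup>+t. ennreal (q t) \<partial>ivl T)"
proof -
  have "ennreal (LINT t|lebesgue. q t) \<le> (\<integral>\<^sup>+t. ennreal (q t) \<partial>lebesgue)"
    by (rule integral_le_nn_integral[OF assms(1)])
  also have "\<dots> = (\<integral>\<^sup>+t. ennreal (q t) * indicator {-T<..<T} t \<partial>lebesgue)"
  proof (rule nn_integral_cong_AE)
    show "AE t in lebesgue. ennreal (q t) = ennreal (q t) * indicator {-T<..<T} t"
      using assms(2) by eventually_elim (auto simp: indicator_def)
  qed
  also have "\<dots> = (\<integral>\<^sup>+t. ennreal (q t) \<partial>ivl T)" by (subst nn_integral_restrict_space) auto
  finally show ?thesis .
qed

subsection \<open>Time derivatives\<close>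

lemma smooth_cos: "smooth (\<lambda>t. cos (a * t))" and smooth_sin: "smooth (\<lambda>t. sin (a * t))"
  using smooth_trig[of 1 a 0] smooth_trig[of 0 a 1] by simp_all

lemma deriv_cos_scaled: "deriv (\<lambda>t. cos (a * t)) t = - a * sin (a * t)"
  and deriv_sin_scaled: "deriv (\<lambda>t. sin (a * t)) t = a * cos (a * t)" for a t :: real
  by (rule DERIV_imp_deriv, auto intro!: derivative_eq_intros)+

lemma ip_fourier:
  assumes "integrable (lebesgue_on {-T..T}) w"
  shows "ip (ivl T) w (fourier T k) = complex_of_real (1 / sqrt (2 * T)) *
    ((LINT t|ivl T. complex_of_real (cos (freq T k * t)) * w t) - \<i> * (LINT t|ivl T. complex_of_real (sin (freq T k * t)) * w t))"
proof -
  have i: "integrable (ivl T) (\<lambda>t. complex_of_real (g t) * w t)" if "continuous_on {-T..T} g" for g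
    by (rule continuous_times_integrable[OF assms that]) auto
  have ci: "integrable (ivl T) (\<lambda>t. complex_of_real (cos (freq T k * t)) * w t)"
    and si: "integrable (ivl T) (\<lambda>t. \<i> * (complex_of_real (sin (freq T k * t)) * w t))"
    by (intro integrable_mult_right i continuous_intros)+
  have "ip (ivl T) w (fourier T k) = (LINT t|ivl T. complex_of_real (1 / sqrt (2 * T)) *
      (complex_of_real (cos (freq T k * t)) * w t - \<i> * (complex_of_real (sin (freq T k * t)) * w t)))"
    unfolding ip_def
  proof (rule Bochner_Integration.integral_cong[OF refl])
    fix t
    have e: "cnj (cis x) = complex_of_real (cos x) - \<i> * complex_of_real (sin x)" for x by (simp add: complex_eq_iff)
    show "w t * cnj (fourier T k t) = complex_of_real (1 / sqrt (2 * T)) *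
      (complex_of_real (cos (freq T k * t)) * w t - \<i> * (complex_of_real (sin (freq T k * t)) * w t))"
      unfolding fourier_def complex_cnj_mult complex_cnj_complex_of_real e by (simp only: right_diff_distrib mult_ac)
  qed
  also have "\<dots> = complex_of_real (1 / sqrt (2 * T)) * ((LINT t|ivl T. complex_of_real (cos (freq T k * t)) * w t)
      - (LINT t|ivl T. \<i> * (complex_of_real (sin (freq T k * t)) * w t)))"
    by (simp only: integral_mult_right_zero Bochner_Integration.integral_diff[OF ci si])
  also have "(LINT t|ivl T. \<i> * (complex_of_real (sin (freq T k * t)) * w t)) = \<i> * (LINT t|ivl T. complex_of_real (sin (freq T k * t)) * w t)"
    by (rule integral_mult_right_zero)
  finally show ?thesis .
qed

definition weak_time_deriv :: "(real \<Rightarrow> complex) \<Rightarrow> (real \<Rightarrow> complex) \<Rightarrow> bool" where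
  "weak_time_deriv u w \<longleftrightarrow> (\<forall>\<theta>\<in>test_functions UNIV.
     (LINT t|lebesgue. complex_of_real (deriv \<theta> t) * u t) = - (LINT t|lebesgue. complex_of_real (\<theta> t) * w t))"

text \<open>Since \<open>u\<close> vanishes near the ends of the interval, cosines and sines may serve as test functions.\<close>

lemma fourier_coefficient_deriv:
  assumes u: "integrable (lebesgue_on {-T..T}) u" and w: "integrable (lebesgue_on {-T..T}) w"
    and d: "weak_time_deriv u w" and R: "R < T" and van: "AE t in lebesgue. R < \<bar>t\<bar> \<longrightarrow> u t = 0"
  shows "ip (ivl T) w (fourier T k) = \<i> * freq T k * ip (ivl T) u (fourier T k)"
proof -
  let ?\<xi> = "freq T k"
  have van': "AE t in lebesgue. t \<in> {-T<..<T} \<longrightarrow> t \<notin> {-T + (T - R)..T - (T - R)} \<longrightarrow> u t = 0"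
    using van by eventually_elim auto
  have *: "(LINT t|ivl T. complex_of_real (deriv g t) * u t) = - (LINT t|ivl T. complex_of_real (g t) * w t)" if "smooth g" for g
    by (rule weak_derivative_supported_inside[OF u w _ _ van' that]) (use d R in \<open>auto simp: weak_time_deriv_def\<close>)
  have 1: "(LINT t|ivl T. complex_of_real (cos (?\<xi> * t)) * w t) = ?\<xi> * (LINT t|ivl T. complex_of_real (sin (?\<xi> * t)) * u t)"
  proof -
    have "(LINT t|ivl T. complex_of_real (deriv (\<lambda>t. cos (?\<xi> * t)) t) * u t)
        = - complex_of_real ?\<xi> * (LINT t|ivl T. complex_of_real (sin (?\<xi> * t)) * u t)"
      unfolding deriv_cos_scaled by (subst integral_mult_right_zero[symmetric]) (simp add: mult.assoc)
    then show ?thesis using *[OF smooth_cos, of ?\<xi>] by simp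
  qed
  have 2: "(LINT t|ivl T. complex_of_real (sin (?\<xi> * t)) * w t) = - ?\<xi> * (LINT t|ivl T. complex_of_real (cos (?\<xi> * t)) * u t)"
  proof -
    have "(LINT t|ivl T. complex_of_real (deriv (\<lambda>t. sin (?\<xi> * t)) t) * u t)
        = complex_of_real ?\<xi> * (LINT t|ivl T. complex_of_real (cos (?\<xi> * t)) * u t)"
      unfolding deriv_sin_scaled by (subst integral_mult_right_zero[symmetric]) (simp add: mult.assoc)
    then have "complex_of_real ?\<xi> * (LINT t|ivl T. complex_of_real (cos (?\<xi> * t)) * u t)
        = - (LINT t|ivl T. complex_of_real (sin (?\<xi> * t)) * w t)"
      using *[OF smooth_sin, of ?\<xi>] by (rule trans[OF sym])
    then show ?thesis by (simp add: minus_equation_iff)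
  qed
  show ?thesis unfolding ip_fourier[OF u] ip_fourier[OF w] 1 2 by (simp add: algebra_simps complex_i_mult_minus)
qed

text \<open>On an interval where \<open>u\<close> vanishes, testing with the constant \<open>1\<close> shows that the integrals of \<open>w\<close> over
  subintervals are zero.\<close>

lemma weak_time_deriv_vanishes:
  assumes u: "u \<in> L2 lebesgue" and w: "w \<in> L2 lebesgue" and d: "weak_time_deriv u w"
    and van: "AE t in lebesgue. R < \<bar>t\<bar> \<longrightarrow> u t = 0"
  shows "AE t in lebesgue. R < \<bar>t\<bar> \<longrightarrow> w t = 0"
proof -
  have *: "AE t in lebesgue. t \<in> {a<..<b} \<longrightarrow> w t = 0" if ab: "\<And>t. t \<in> {a<..<b} \<Longrightarrow> R < \<bar>t\<bar>" for a b
  proof -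
    have "L1_loc a b w" unfolding L1_loc_def using L2_lebesgue_integrable_ivl[OF w] by auto
    then have "AE t in lebesgue_on {a<..<b}. w t = 0"
    proof (rule AE_zero_if_interval_integrals_zero)
      fix p q assume pq: "a < p" "p < q" "q < b"
      have u0: "AE t in lebesgue. t \<in> {p<..<q} \<longrightarrow> t \<notin> {p + 1..q - 1} \<longrightarrow> u t = 0"
        using van by eventually_elim (use ab pq in auto)
      have "(LINT t|lebesgue_on {p<..<q}. complex_of_real (deriv (\<lambda>t. 1) t) * u t) = - (LINT t|lebesgue_on {p<..<q}. complex_of_real 1 * w t)"
        by (rule weak_derivative_supported_inside[OF L2_lebesgue_integrable_ivl[OF u] L2_lebesgue_integrable_ivl[OF w] _ _ u0 smooth_const])
          (use d in \<open>auto simp: weak_time_deriv_def\<close>)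
      then show "(LINT t|lebesgue_on {p<..<q}. w t) = 0" by simp
    qed
    then show ?thesis by (subst (asm) AE_restrict_space_iff) auto
  qed
  have "AE t in lebesgue. \<forall>m::nat. (t \<in> {max R 0<..<R + real m} \<longrightarrow> w t = 0) \<and> (t \<in> {- R - real m<..<- max R 0} \<longrightarrow> w t = 0) \<and> (t \<in> {- real m<..<real m} \<and> R < 0 \<longrightarrow> w t = 0)"
  proof (subst AE_all_countable, rule allI)
    fix m :: nat
    have 1: "AE t in lebesgue. t \<in> {max R 0<..<R + real m} \<longrightarrow> w t = 0" by (rule *) auto
    have 2: "AE t in lebesgue. t \<in> {- R - real m<..<- max R 0} \<longrightarrow> w t = 0" by (rule *) auto
    have 3: "AE t in lebesgue. t \<in> {- real m<..<real m} \<and> R < 0 \<longrightarrow> w t = 0"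
    proof (cases "R < 0")
      case True
      have "AE t in lebesgue. t \<in> {- real m<..<real m} \<longrightarrow> w t = 0" by (rule *) (use True in auto)
      then show ?thesis by eventually_elim simp
    qed simp
    show "AE t in lebesgue. (t \<in> {max R 0<..<R + real m} \<longrightarrow> w t = 0) \<and> (t \<in> {- R - real m<..<- max R 0} \<longrightarrow> w t = 0) \<and> (t \<in> {- real m<..<real m} \<and> R < 0 \<longrightarrow> w t = 0)"
      using 1 2 3 by eventually_elim blast
  qed
  then show ?thesis
  proof eventually_elim
    case (elim t)
    show ?case
    proof
      assume t: "R < \<bar>t\<bar>"
      obtain m :: nat where m: "\<bar>t\<bar> + \<bar>R\<bar> < real m" using reals_Archimedean2 by blast
      show "w t = 0"
      proof (cases "R < 0")
        case True
        have "t \<in> {- real m<..<real m}" using m by auto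
        then show ?thesis using elim True by blast
      next
        case False
        then have "t \<in> {max R 0<..<R + real m} \<or> t \<in> {- R - real m<..<- max R 0}" using m t by (auto simp: abs_if split: if_splits)
        then show ?thesis using elim by blast
      qed
    qed
  qed
qed

subsection \<open>The traces as functions of time\<close>

lemma coef_AE_zero:
  assumes "AE x in hmeas. f x = 0" "f \<in> L2 hmeas" shows "coef f n = 0"
proof -
  have "ip hmeas f (eig n) = ip hmeas (\<lambda>x. 0) (eig n)"
    using assms eig_L2[of n] by (intro ip_cong_AE) (auto dest: L2D)
  then show ?thesis by simp
qed

lemma trace_limit:
  assumes f: "f \<in> V_space"
  shows "(\<lambda>N. \<Sum>n<N. coef f n * amp n i) \<longlonglongrightarrow> trace_op f $ i"
proof -
  have r: "(\<lambda>N. (V_norm f)\<^sup>2 - (\<Sum>n<N. (ev n + 1) * (cmod (coef f n))\<^sup>2)) \<longlonglongrightarrow> (V_norm f)\<^sup>2 - (V_norm f)\<^sup>2"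
    using V_norm_sums[OF f] unfolding sums_def by (intro tendsto_diff tendsto_const)
  have "(\<lambda>N. trace_op f $ i - (\<Sum>n<N. coef f n * amp n i)) \<longlonglongrightarrow> 0"
  proof (rule Lim_null_comparison)
    show "\<forall>\<^sub>F N in sequentially. norm (trace_op f $ i - (\<Sum>n<N. coef f n * amp n i))
        \<le> sqrt (trace_const * ((V_norm f)\<^sup>2 - (\<Sum>n<N. (ev n + 1) * (cmod (coef f n))\<^sup>2)))"
      using trace_expansion_error[OF f] by (intro always_eventually allI real_le_rsqrt)
    show "(\<lambda>N. sqrt (trace_const * ((V_norm f)\<^sup>2 - (\<Sum>n<N. (ev n + 1) * (cmod (coef f n))\<^sup>2)))) \<longlonglongrightarrow> 0"
      using tendsto_real_sqrt[OF tendsto_mult_left[OF r, of trace_const]] by simp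
  qed
  from tendsto_diff[OF tendsto_const this, of "trace_op f $ i"] show ?thesis by simp
qed

lemma trace_const_nonneg: "0 \<le> trace_const"
  unfolding trace_const_def using inverse_weight_total_nonneg weight_total_pos by (intro mult_nonneg_nonneg add_nonneg_nonneg divide_nonneg_nonneg) auto

lemma trace_time_L2:
  fixes v :: "real \<Rightarrow> real \<Rightarrow> complex"
  assumes v: "AE t in lebesgue. v t \<in> V_space" and iV: "integrable lebesgue (\<lambda>t. (V_norm (v t))\<^sup>2)"
    and c: "\<And>n. (\<lambda>t. coef (v t) n) \<in> L2 lebesgue"
  shows "(\<lambda>t. trace_op (v t) $ i) \<in> L2 lebesgue"
proof -
  have m: "(\<lambda>t. trace_op (v t) $ i) \<in> borel_measurable lebesgue"
  proof (rule measurable_AE_limit)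
    show "(\<lambda>t. \<Sum>n<N. coef (v t) n * amp n i) \<in> borel_measurable lebesgue" for N
      using L2D(1)[OF c] by measurable
    show "AE t in lebesgue. (\<lambda>N. \<Sum>n<N. coef (v t) n * amp n i) \<longlonglongrightarrow> trace_op (v t) $ i"
      using v by eventually_elim (rule trace_limit)
  qed
  show ?thesis
  proof (rule L2I[OF m], rule Bochner_Integration.integrable_bound[OF integrable_mult_right[OF iV, of trace_const]])
    show "(\<lambda>t. (cmod (trace_op (v t) $ i))\<^sup>2) \<in> borel_measurable lebesgue" using m by measurable
    show "AE t in lebesgue. norm ((cmod (trace_op (v t) $ i))\<^sup>2) \<le> norm (trace_const * (V_norm (v t))\<^sup>2)"
      using v by eventually_elim (simp add: trace_bound trace_const_nonneg)
  qed
qed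

text \<open>The traces of the spectral truncations converge for almost every time. The bound on the trace by the
  norm of the form domain dominates them, so they converge in the mean over time.\<close>

lemma trace_fourier_sums:
  assumes T: "T > 0" and v: "AE t in lebesgue. v t \<in> V_space" and iV: "integrable lebesgue (\<lambda>t. (V_norm (v t))\<^sup>2)"
    and c: "\<And>n. (\<lambda>t. coef (v t) n) \<in> L2 lebesgue"
  shows "(\<lambda>n. ip (ivl T) (\<lambda>t. coef (v t) n) (fourier T k) * amp n i) sums ip (ivl T) (\<lambda>t. trace_op (v t) $ i) (fourier T k)"
proof -
  interpret orthonormal_basis "ivl T" "fourier T" by (rule fourier_basis[OF T])
  let ?S = "\<lambda>N t. \<Sum>n<N. complex_of_real (amp n i) * coef (v t) n"
  have cT: "(\<lambda>t. coef (v t) n) \<in> L2 (ivl T)" for n by (rule L2_lebesgue_restrict[OF c]) auto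
  have XT: "(\<lambda>t. trace_op (v t) $ i) \<in> L2 (ivl T)" by (rule L2_lebesgue_restrict[OF trace_time_L2[OF v iV c]]) auto
  have ST: "?S N \<in> L2 (ivl T)" for N by (intro L2_sum L2_scale cT)
  have vT: "AE t in ivl T. v t \<in> V_space"
    by (subst AE_restrict_space_iff) (use v in \<open>auto elim: eventually_mono\<close>)
  define r where "r N t = trace_const * ((V_norm (v t))\<^sup>2 - (\<Sum>n<N. (ev n + 1) * (cmod (coef (v t) n))\<^sup>2))" for N t
  have iVT: "integrable (ivl T) (\<lambda>t. (V_norm (v t))\<^sup>2)"
    by (rule integrable_lebesgue_on_subset[of UNIV]) (use iV in \<open>auto simp: lebesgue_on_UNIV_eq\<close>)
  have ri: "integrable (ivl T) (r N)" for N
    unfolding r_def by (intro integrable_mult_right Bochner_Integration.integrable_diff iVT Bochner_Integration.integrable_sum L2D(2)[OF cT])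
  have "(\<lambda>N. LINT t|ivl T. r N t) \<longlonglongrightarrow> (LINT t|ivl T. 0)"
  proof (rule integral_dominated_convergence[where w="\<lambda>t. trace_const * (V_norm (v t))\<^sup>2"])
    show "integrable (ivl T) (\<lambda>t. trace_const * (V_norm (v t))\<^sup>2)" using iVT by simp
    show "AE t in ivl T. (\<lambda>N. r N t) \<longlonglongrightarrow> 0"
      using vT
    proof eventually_elim
      case (elim t)
      have "(\<lambda>N. r N t) \<longlonglongrightarrow> trace_const * ((V_norm (v t))\<^sup>2 - (V_norm (v t))\<^sup>2)"
        unfolding r_def using V_norm_sums[OF elim] unfolding sums_def by (intro tendsto_intros)
      then show ?case by simp
    qed
    show "AE t in ivl T. norm (r N t) \<le> trace_const * (V_norm (v t))\<^sup>2" for N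
      using vT
    proof eventually_elim
      case (elim t)
      have "(\<Sum>n<N. (ev n + 1) * (cmod (coef (v t) n))\<^sup>2) \<le> (V_norm (v t))\<^sup>2"
        using sum_le_suminf[OF sums_summable[OF V_norm_sums[OF elim]], of "{..<N}"] sums_unique[OF V_norm_sums[OF elim]] ev_nonneg
        by simp
      moreover have "0 \<le> (\<Sum>n<N. (ev n + 1) * (cmod (coef (v t) n))\<^sup>2)"
        using ev_nonneg by (intro sum_nonneg mult_nonneg_nonneg add_nonneg_nonneg) auto
      ultimately show ?case unfolding r_def using trace_const_nonneg
        by (simp add: abs_mult mult_left_mono)
    qed
  qed (use ri in auto)
  then have r0: "(\<lambda>N. LINT t|ivl T. r N t) \<longlonglongrightarrow> 0" by simp
  have "(\<lambda>N. nsq (ivl T) (\<lambda>t. trace_op (v t) $ i - ?S N t)) \<longlonglongrightarrow> 0"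
  proof (rule Lim_null_comparison[OF _ r0], intro always_eventually allI)
    fix N
    have "nsq (ivl T) (\<lambda>t. trace_op (v t) $ i - ?S N t) \<le> (LINT t|ivl T. r N t)"
      unfolding nsq_def
    proof (rule integral_mono_AE)
      show "integrable (ivl T) (\<lambda>t. (cmod (trace_op (v t) $ i - ?S N t))\<^sup>2)" by (rule L2D(2)[OF L2_diff[OF XT ST]])
      show "AE t in ivl T. (cmod (trace_op (v t) $ i - ?S N t))\<^sup>2 \<le> r N t"
        using vT unfolding r_def by eventually_elim (subst mult.commute, rule trace_expansion_error)
    qed (rule ri)
    then show "norm (nsq (ivl T) (\<lambda>t. trace_op (v t) $ i - ?S N t)) \<le> (LINT t|ivl T. r N t)" by simp
  qed
  from ip_tendsto[OF ST XT e_L2 this, of k]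
  have "(\<lambda>N. ip (ivl T) (?S N) (fourier T k)) \<longlonglongrightarrow> ip (ivl T) (\<lambda>t. trace_op (v t) $ i) (fourier T k)" .
  moreover have "ip (ivl T) (?S N) (fourier T k) = (\<Sum>n<N. ip (ivl T) (\<lambda>t. coef (v t) n) (fourier T k) * amp n i)" for N
    by (subst ip_sum_left) (auto intro!: L2_scale cT e_L2 simp: mult.commute)
  ultimately show ?thesis by (simp add: sums_def)
qed

section \<open>Absorbing the boundary term\<close>

lemma ennreal_suminf_term:
  fixes f :: "nat \<Rightarrow> ennreal" shows "f k \<le> suminf f"
  unfolding suminf_eq_SUP by (rule SUP_upper2[of "Suc k"]) auto

text \<open>The boundary source costs a factor \<open>\<mu>\<^sup>2\<close> over the trace, and the trace symbol returns a factor
  \<open>1 / \<tau>\<close> in the square. A threshold for \<open>\<tau>\<close> that is quadratic in \<open>\<mu>\<close> therefore makes the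
  boundary contribution at most half of the left-hand side.\<close>

lemma absorption:
  fixes G X :: "nat \<Rightarrow> complex^2"
  assumes c: "centred \<delta> \<tau> N"
    and eq: "\<And>k n. ((Complex \<tau> (\<xi> k))\<^sup>2 - (complex_of_real (lam n))\<^sup>2) * V k n = (\<Sum>j\<in>UNIV. G k $ j * amp n j) + F k n"
    and X: "\<And>k i. (\<lambda>n. V k n * amp n i) sums (X k $ i)"
    and F: "(\<Sum>k. \<Sum>n. ennreal ((cmod (F k n))\<^sup>2)) \<le> ennreal \<phi>" and \<phi>: "0 \<le> \<phi>"
    and x: "(\<lambda>k. (norm (X k))\<^sup>2) sums x" and g: "(\<lambda>k. (norm (G k))\<^sup>2) sums g"
    and gx: "g \<le> \<mu>\<^sup>2 * x" and \<tau>: "2 * mode_const \<delta> * \<mu>\<^sup>2 \<le> \<tau>"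
  shows "\<tau> * sqrt \<tau> * x \<le> 2 * mode_const \<delta> * \<phi>"
    and "(\<Sum>k. \<Sum>n. ennreal ((\<tau>\<^sup>2 + (\<xi> k)\<^sup>2 + (lam n)\<^sup>2) * (cmod (V k n))\<^sup>2)) \<le> ennreal (2 * mode_const \<delta> * \<phi>)"
proof -
  let ?K = "mode_const \<delta>"
  have t: "2 \<le> \<tau>" and \<delta>: "0 < \<delta>" using c by (auto simp: centred_def)
  have K: "0 < ?K" using mode_const_parts(4)[OF \<delta>] .
  have x0: "0 \<le> x" using suminf_nonneg[OF sums_summable[OF x]] sums_unique[OF x] by simp
  define s where "s = sqrt \<tau>"
  have s: "0 < s" "s * s = \<tau>" using t by (auto simp: s_def)
  define f where "f k = (\<Sum>n. (cmod (F k n))\<^sup>2)" for k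
  have fin: "(\<Sum>n. ennreal ((cmod (F k n))\<^sup>2)) \<noteq> top" for k
  proof -
    have "(\<Sum>n. ennreal ((cmod (F k n))\<^sup>2)) \<le> (\<Sum>k. \<Sum>n. ennreal ((cmod (F k n))\<^sup>2))"
      by (rule ennreal_suminf_term)
    then have "(\<Sum>n. ennreal ((cmod (F k n))\<^sup>2)) < top" using F ennreal_less_top by (meson le_less_trans)
    then show ?thesis by (rule less_imp_neq)
  qed
  have Fs: "(\<lambda>n. (cmod (F k n))\<^sup>2) sums f k" for k
    unfolding f_def using summable_suminf_not_top[OF _ fin[of k]] by (intro summable_sums) auto
  have f0: "0 \<le> f k" for k unfolding f_def by (intro suminf_nonneg sums_summable[OF Fs]) auto
  have fe: "(\<Sum>n. ennreal ((cmod (F k n))\<^sup>2)) = ennreal (f k)" for k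
    by (rule suminf_ennreal_eq[OF _ Fs]) simp
  have F': "(\<Sum>k. ennreal (f k)) \<le> ennreal \<phi>" using F by (simp add: fe)
  have sf: "summable f"
  proof (rule summable_suminf_not_top)
    show "(\<Sum>k. ennreal (f k)) \<noteq> top" using le_less_trans[OF F' ennreal_less_top] by simp
  qed (rule f0)
  have f\<phi>: "suminf f \<le> \<phi>"
    using F' suminf_ennreal2[OF f0 sf] \<phi> by (simp add: ennreal_le_iff)
  have me: "(\<Sum>n<M. (\<tau>\<^sup>2 + (\<xi> k)\<^sup>2 + (lam n)\<^sup>2) * (cmod (V k n))\<^sup>2) \<le> ?K * (s * (norm (G k))\<^sup>2 + f k)"
    and mx: "(norm (X k))\<^sup>2 \<le> ?K * ((norm (G k))\<^sup>2 / \<tau> + s / \<tau>\<^sup>2 * f k)" for k M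
    unfolding s_def by (rule mode_estimate[OF c eq X Fs])+
  have "(\<lambda>k. ?K * ((norm (G k))\<^sup>2 / \<tau> + s / \<tau>\<^sup>2 * f k)) sums (?K * (g / \<tau> + s / \<tau>\<^sup>2 * suminf f))"
    by (intro sums_mult sums_add sums_divide g summable_sums sf)
  then have "x \<le> ?K * (g / \<tau> + s / \<tau>\<^sup>2 * suminf f)" by (rule sums_le[OF mx x])
  also have "\<dots> \<le> ?K * ((\<mu>\<^sup>2 * x) / \<tau> + s / \<tau>\<^sup>2 * \<phi>)"
    using K t s gx f\<phi> by (intro mult_left_mono add_mono divide_right_mono) auto
  also have "\<dots> = (2 * ?K * \<mu>\<^sup>2) * (x / (2 * \<tau>)) + ?K * (s / \<tau>\<^sup>2 * \<phi>)" using t by (simp add: field_simps)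
  also have "\<dots> \<le> \<tau> * (x / (2 * \<tau>)) + ?K * (s / \<tau>\<^sup>2 * \<phi>)"
    using t x0 \<tau> by (intro add_right_mono mult_right_mono) auto
  finally have "x \<le> \<tau> * (x / (2 * \<tau>)) + ?K * (s / \<tau>\<^sup>2 * \<phi>)" .
  moreover have "\<tau> * (x / (2 * \<tau>)) = x / 2" using t by simp
  ultimately have "x / 2 \<le> ?K * (s / \<tau>\<^sup>2 * \<phi>)" by linarith
  then have "\<tau> * s * (x / 2) \<le> \<tau> * s * (?K * (s / \<tau>\<^sup>2 * \<phi>))"
    using t s by (intro mult_left_mono) auto
  also have "\<tau> * s * (?K * (s / \<tau>\<^sup>2 * \<phi>)) = (s * s) * \<tau> / \<tau>\<^sup>2 * (?K * \<phi>)" by simp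
  also have "\<dots> = ?K * \<phi>" using t unfolding s(2) by (simp add: power2_eq_square)
  finally show b: "\<tau> * sqrt \<tau> * x \<le> 2 * ?K * \<phi>" unfolding s_def by simp
  have "2 * ?K * (s * g) \<le> 2 * ?K * (s * (\<mu>\<^sup>2 * x))"
    using K s gx by (intro mult_left_mono) auto
  also have "\<dots> = (2 * ?K * \<mu>\<^sup>2) * (s * x)" by simp
  also have "\<dots> \<le> \<tau> * (s * x)" using \<tau> s x0 by (intro mult_right_mono) auto
  also have "\<dots> \<le> 2 * ?K * \<phi>" using b by (simp add: s_def)
  finally have sg: "s * g \<le> \<phi>" using K by simp
  have "(\<Sum>k. \<Sum>n. ennreal ((\<tau>\<^sup>2 + (\<xi> k)\<^sup>2 + (lam n)\<^sup>2) * (cmod (V k n))\<^sup>2))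
      \<le> (\<Sum>k. ennreal (?K * (s * (norm (G k))\<^sup>2 + f k)))"
  proof (intro suminf_le summableI ennreal_suminf_le)
    fix k M
    show "(\<Sum>n<M. ennreal ((\<tau>\<^sup>2 + (\<xi> k)\<^sup>2 + (lam n)\<^sup>2) * (cmod (V k n))\<^sup>2)) \<le> ennreal (?K * (s * (norm (G k))\<^sup>2 + f k))"
      using me[of k M] by (subst sum_ennreal) (auto intro!: ennreal_leI)
  qed
  also have "\<dots> = ennreal (?K * (s * g + suminf f))"
  proof (rule suminf_ennreal_eq)
    show "(\<lambda>k. ?K * (s * (norm (G k))\<^sup>2 + f k)) sums (?K * (s * g + suminf f))"
      by (intro sums_mult sums_add g summable_sums sf)
    show "0 \<le> ?K * (s * (norm (G k))\<^sup>2 + f k)" for k using K s f0[of k] by simp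
  qed
  also have "\<dots> \<le> ennreal (2 * ?K * \<phi>)"
  proof (rule ennreal_leI)
    have "?K * (s * g + suminf f) \<le> ?K * (\<phi> + \<phi>)" using K sg f\<phi> by (intro mult_left_mono add_mono) auto
    then show "?K * (s * g + suminf f) \<le> 2 * ?K * \<phi>" by simp
  qed
  finally show "(\<Sum>k. \<Sum>n. ennreal ((\<tau>\<^sup>2 + (\<xi> k)\<^sup>2 + (lam n)\<^sup>2) * (cmod (V k n))\<^sup>2)) \<le> ennreal (2 * ?K * \<phi>)" .
qed

text \<open>A real matrix acts separately on real and imaginary parts, so its norm over the complex
  numbers is its norm over the reals.\<close>

lemma complex_matrix_bound:
  "norm (complex_matrix A *v x) \<le> onorm ((*v) A) * norm x"
proof -
  define p q where "p = (\<chi> i. Re (x $ i))" and "q = (\<chi> i. Im (x $ i))"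
  have nrm: "(norm y)\<^sup>2 = (norm (\<chi> i. Re (y $ i)))\<^sup>2 + (norm (\<chi> i. Im (y $ i)))\<^sup>2" for y :: "complex^2"
    by (simp add: norm_vec_def L2_set_def sum_2 cmod_power2)
  have o: "0 \<le> onorm ((*v) A)" "norm (A *v y) \<le> onorm ((*v) A) * norm y" for y
    using onorm_pos_le[of "(*v) A"] onorm[of "(*v) A" y] by (auto intro: linear_conv_bounded_linear[THEN iffD1] matrix_vector_mul_linear)
  have "(norm (complex_matrix A *v x))\<^sup>2 = (norm (A *v p))\<^sup>2 + (norm (A *v q))\<^sup>2"
    unfolding nrm[of "complex_matrix A *v x"]
    by (simp add: norm_vec_def L2_set_def sum_2 matrix_vector_mult_def complex_matrix_def p_def q_def)
  also have "\<dots> \<le> (onorm ((*v) A) * norm p)\<^sup>2 + (onorm ((*v) A) * norm q)\<^sup>2"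
    by (intro add_mono power_mono o) auto
  also have "\<dots> = (onorm ((*v) A) * norm x)\<^sup>2"
    unfolding power_mult_distrib nrm[of x] by (simp add: p_def q_def algebra_simps)
  finally show ?thesis by (rule power2_le_imp_le) (simp add: o(1))
qed

lemma admissible_lam:
  assumes "admissible \<delta> \<tau>" shows "\<delta> \<le> \<bar>\<tau> - lam n\<bar>"
proof -
  have "infdist \<tau> (range (\<lambda>n::nat. 2 * real n + 1/2)) \<le> dist \<tau> (2 * real n + 1/2)" by (rule infdist_le) simp
  then show ?thesis using assms by (simp add: admissible_def dist_real_def lam_def)
qed

lemma trace_dual_eig: "trace_dual z (eig n) = (\<Sum>j\<in>UNIV. z $ j * amp n j)"
  by (simp add: trace_dual_def trace_eig)

lemma nsq_sum_components:
  fixes X :: "'a \<Rightarrow> complex^2"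
  assumes "\<And>i. (\<lambda>t. X t $ i) \<in> L2 M"
  shows "integrable M (\<lambda>t. (norm (X t))\<^sup>2)" "(LINT t|M. (norm (X t))\<^sup>2) = (\<Sum>i\<in>UNIV. nsq M (\<lambda>t. X t $ i))"
  using L2D(2)[OF assms] by (simp_all add: norm_sq_2 nsq_def sum_2)

section \<open>Solutions mode by mode\<close>

text \<open>A solution that vanishes for \<open>R < \<bar>t\<bar>\<close>, expanded on a strictly larger time interval. The margin lets
  its time derivatives be tested with exponentials.\<close>

locale conjugated_solution =
  fixes \<mu> \<tau> R T :: real and \<Gamma> :: "real \<Rightarrow> real^2^2" and v vt F :: "real \<Rightarrow> real \<Rightarrow> complex"
    and vtt :: "real \<Rightarrow> (real \<Rightarrow> complex) \<Rightarrow> complex"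
  assumes coeff: "bounded_symmetric_coeff \<mu> \<Gamma>"
    and support: "AE t in lebesgue. R < \<bar>t\<bar> \<longrightarrow> (AE x in hmeas. v t x = 0)"
    and T: "0 < T" "R < T"
    and energy: "finite_energy v vt vtt"
    and F: "F \<in> L2_time H_space H_norm"
    and equation: "solves_conjugated \<tau> \<Gamma> v vt vtt F"
begin

lemma in_L2: "AE t in lebesgue. v t \<in> L2 hmeas" "AE t in lebesgue. vt t \<in> L2 hmeas" "AE t in lebesgue. F t \<in> L2 hmeas"
  using energy F by (auto simp: finite_energy_def L2_time_def H_space_L2)

lemma in_V: "AE t in lebesgue. v t \<in> V_space" "integrable lebesgue (\<lambda>t. (V_norm (v t))\<^sup>2)"
  using energy by (auto simp: finite_energy_def L2_time_def)

lemma coef_L2: "(\<lambda>t. coef (v t) n) \<in> L2 lebesgue" "(\<lambda>t. coef (vt t) n) \<in> L2 lebesgue" "(\<lambda>t. coef (F t) n) \<in> L2 lebesgue"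
  using energy F by (auto simp: finite_energy_def intro: L2_time_coef)

lemma coef_deriv: "weak_time_deriv (\<lambda>t. coef (v t) n) (\<lambda>t. coef (vt t) n)"
  using energy eig_L2[of n] by (auto simp: finite_energy_def is_time_deriv_def weak_time_deriv_def H_inner_ip H_space_L2)

lemma coef_vanishes:
  "AE t in lebesgue. R < \<bar>t\<bar> \<longrightarrow> coef (v t) n = 0" "AE t in lebesgue. R < \<bar>t\<bar> \<longrightarrow> coef (vt t) n = 0"
proof -
  show z: "AE t in lebesgue. R < \<bar>t\<bar> \<longrightarrow> coef (v t) n = 0"
    using support in_L2(1) by eventually_elim (blast intro: coef_AE_zero)
  show "AE t in lebesgue. R < \<bar>t\<bar> \<longrightarrow> coef (vt t) n = 0"
    by (rule weak_time_deriv_vanishes[OF coef_L2(1,2) coef_deriv z])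
qed

definition source :: "real \<Rightarrow> complex^2" where
  "source t = complex_matrix (\<Gamma> t) *v trace_op (v t)"

lemma trace_L2: "(\<lambda>t. trace_op (v t) $ i) \<in> L2 lebesgue"
  by (rule trace_time_L2[OF in_V coef_L2(1)])

lemma source_le: "AE t in lebesgue. (norm (source t))\<^sup>2 \<le> \<mu>\<^sup>2 * (norm (trace_op (v t)))\<^sup>2"
proof -
  have e: "esssup lebesgue (\<lambda>t. ereal (onorm (\<lambda>x. \<Gamma> t *v x))) \<le> ereal \<mu>" using coeff by (simp add: bounded_symmetric_coeff_def)
  have "AE t in lebesgue. ereal (onorm (\<lambda>x. \<Gamma> t *v x)) \<le> esssup lebesgue (\<lambda>t. ereal (onorm (\<lambda>x. \<Gamma> t *v x)))"
    by (rule esssup_AE)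
  then show ?thesis
  proof eventually_elim
    case (elim t)
    have "ereal (onorm (\<lambda>x. \<Gamma> t *v x)) \<le> ereal \<mu>" using elim e by (rule order_trans)
    then have "onorm ((*v) (\<Gamma> t)) * norm (trace_op (v t)) \<le> \<mu> * norm (trace_op (v t))"
      by (intro mult_right_mono) auto
    then have "norm (source t) \<le> \<mu> * norm (trace_op (v t))"
      unfolding source_def using complex_matrix_bound[of "\<Gamma> t" "trace_op (v t)"] by linarith
    then have "(norm (source t))\<^sup>2 \<le> (\<mu> * norm (trace_op (v t)))\<^sup>2" by (intro power_mono) auto
    then show ?case by (simp add: power_mult_distrib)
  qed
qed

lemma source_L2: "(\<lambda>t. source t $ j) \<in> L2 lebesgue"
proof -
  have "\<Gamma> \<in> borel_measurable lebesgue" using coeff by (simp add: bounded_symmetric_coeff_def)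
  then have G: "(\<lambda>t. \<Gamma> t $ j $ l) \<in> borel_measurable lebesgue" for l
    by (rule borel_measurable_continuous_on[rotated]) (intro continuous_intros)
  have m: "(\<lambda>t. source t $ j) \<in> borel_measurable lebesgue"
    unfolding source_def matrix_vector_mult_def complex_matrix_def
    using G L2D(1)[OF trace_L2] by (simp add: borel_measurable_sum)
  show ?thesis
  proof (rule L2I[OF m], rule Bochner_Integration.integrable_bound[OF integrable_mult_right[OF nsq_sum_components(1)[OF trace_L2], of "\<mu>\<^sup>2"]])
    show "(\<lambda>t. (cmod (source t $ j))\<^sup>2) \<in> borel_measurable lebesgue" using m by measurable
    show "AE t in lebesgue. norm ((cmod (source t $ j))\<^sup>2) \<le> norm (\<mu>\<^sup>2 * (norm (trace_op (v t)))\<^sup>2)"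
      using source_le
    proof eventually_elim
      case (elim t)
      have "(cmod (source t $ j))\<^sup>2 \<le> (norm (source t))\<^sup>2" by (intro power_mono Finite_Cartesian_Product.norm_nth_le) auto
      from order_trans[OF this elim] show ?case by simp
    qed
  qed
qed

text \<open>The second time derivative of the \<open>n\<close>-th coefficient according to the equation. Unlike \<open>vtt t (eig n)\<close>, it
  is a combination of functions that are known to be square-integrable in time.\<close>

definition mode_rhs :: "nat \<Rightarrow> real \<Rightarrow> complex" where
  "mode_rhs n t = (((\<Sum>j\<in>UNIV. complex_of_real (amp n j) * source t $ j) + coef (F t) n)
     + complex_of_real ((lam n)\<^sup>2 - \<tau>\<^sup>2) * coef (v t) n) - complex_of_real (2 * \<tau>) * coef (vt t) n"

lemma mode_rhs_L2: "mode_rhs n \<in> L2 lebesgue"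
  unfolding mode_rhs_def[abs_def] by (intro L2_diff L2_add L2_sum L2_scale source_L2 coef_L2)

lemma mode_rhs_eq: "AE t in lebesgue. mode_rhs n t = vtt t (eig n)"
  using equation[unfolded solves_conjugated_def] in_V(1)
proof eventually_elim
  case (elim t)
  have "vtt t (eig n) + 2 * complex_of_real \<tau> * H_inner (vt t) (eig n) + (complex_of_real \<tau>)\<^sup>2 * H_inner (v t) (eig n) - L0_form (v t) (eig n)
      = trace_dual (complex_matrix (\<Gamma> t) *v trace_op (v t)) (eig n) + H_inner (F t) (eig n)"
    using elim(1) eig_V(1) by blast
  then have "vtt t (eig n) + 2 * complex_of_real \<tau> * coef (vt t) n + (complex_of_real \<tau>)\<^sup>2 * coef (v t) n - complex_of_real ((lam n)\<^sup>2) * coef (v t) n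
      = (\<Sum>j\<in>UNIV. source t $ j * amp n j) + coef (F t) n"
    unfolding H_inner_ip L0_form_eig[OF elim(2)] trace_dual_eig source_def .
  then show ?case unfolding mode_rhs_def by (simp add: algebra_simps)
qed

lemma coef_deriv2: "weak_time_deriv (\<lambda>t. coef (vt t) n) (mode_rhs n)"
  unfolding weak_time_deriv_def
proof
  fix \<theta> :: "real \<Rightarrow> real" assume \<theta>: "\<theta> \<in> test_functions UNIV"
  have "(\<lambda>t. \<theta> t) \<in> borel_measurable lebesgue"
  proof -
    have "((deriv ^^ 0) \<theta>) differentiable (at x)" for x using \<theta> unfolding test_functions_def by blast
    then have "continuous_on UNIV \<theta>" by (simp add: continuous_at_imp_continuous_on differentiable_imp_continuous_within)
    then show ?thesis by (simp add: borel_measurable_continuous_onI measurable_completion)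
  qed
  then have m: "(\<lambda>t. complex_of_real (\<theta> t) * mode_rhs n t) \<in> borel_measurable lebesgue"
    using L2D(1)[OF mode_rhs_L2[of n]] by measurable
  have e: "AE t in lebesgue. complex_of_real (\<theta> t) * mode_rhs n t = complex_of_real (\<theta> t) * vtt t (eig n)"
    using mode_rhs_eq[of n] by eventually_elim simp
  have "(LINT t|lebesgue. complex_of_real (\<theta> t) * mode_rhs n t) = (LINT t|lebesgue. complex_of_real (\<theta> t) * vtt t (eig n))"
    by (rule integral_cong_AE[OF m borel_measurable_AE[OF m e] e])
  then show "(LINT t|lebesgue. complex_of_real (deriv \<theta> t) * coef (vt t) n) = - (LINT t|lebesgue. complex_of_real (\<theta> t) * mode_rhs n t)"
    using energy \<theta> eig_V(1)[of n] by (auto simp: finite_energy_def is_time_deriv_def H_inner_ip)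
qed

abbreviation hat :: "(real \<Rightarrow> complex) \<Rightarrow> nat \<Rightarrow> complex" where
  "hat u k \<equiv> ip (ivl T) u (fourier T k)"

lemma restrict_L2: "f \<in> L2 lebesgue \<Longrightarrow> f \<in> L2 (ivl T)"
  by (rule L2_lebesgue_restrict) auto

lemma hat_vt: "hat (\<lambda>t. coef (vt t) n) k = \<i> * freq T k * hat (\<lambda>t. coef (v t) n) k"
  by (rule fourier_coefficient_deriv[OF L2_lebesgue_integrable_ivl[OF coef_L2(1)] L2_lebesgue_integrable_ivl[OF coef_L2(2)]
      coef_deriv T(2) coef_vanishes(1)])

text \<open>In both expansions the equation is the algebraic one with symbol
  \<open>(\<tau> + \<i> \<xi>)\<^sup>2 - \<lambda>\<^sup>2\<close>.\<close>

lemma hat_equation: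
  "((Complex \<tau> (freq T k))\<^sup>2 - (complex_of_real (lam n))\<^sup>2) * hat (\<lambda>t. coef (v t) n) k
    = (\<Sum>j\<in>UNIV. hat (\<lambda>t. source t $ j) k * amp n j) + hat (\<lambda>t. coef (F t) n) k"
proof -
  have e4: "fourier T k \<in> L2 (ivl T)" using fourier_basis[OF T(1)] by (simp add: orthonormal_basis_def orthonormal_def)
  let ?c = "hat (\<lambda>t. coef (v t) n) k" and ?\<xi> = "complex_of_real (freq T k)"
  note L = restrict_L2[OF coef_L2(1)] restrict_L2[OF coef_L2(2)] restrict_L2[OF coef_L2(3)] restrict_L2[OF source_L2]
  have "hat (mode_rhs n) k = (((\<Sum>j\<in>UNIV. complex_of_real (amp n j) * hat (\<lambda>t. source t $ j) k) + hat (\<lambda>t. coef (F t) n) k)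
     + complex_of_real ((lam n)\<^sup>2 - \<tau>\<^sup>2) * ?c) - complex_of_real (2 * \<tau>) * hat (\<lambda>t. coef (vt t) n) k"
    unfolding mode_rhs_def[abs_def]
    by (subst ip_diff_left ip_add_left ip_sum_left; (intro e4 L2_diff L2_add L2_sum L2_scale L)?)+ simp
  moreover have "hat (mode_rhs n) k = \<i> * ?\<xi> * hat (\<lambda>t. coef (vt t) n) k"
    by (rule fourier_coefficient_deriv[OF L2_lebesgue_integrable_ivl[OF coef_L2(2)] L2_lebesgue_integrable_ivl[OF mode_rhs_L2]
      coef_deriv2 T(2) coef_vanishes(2)])
  ultimately have e: "\<i> * ?\<xi> * (\<i> * ?\<xi> * ?c) = (((\<Sum>j\<in>UNIV. complex_of_real (amp n j) * hat (\<lambda>t. source t $ j) k) + hat (\<lambda>t. coef (F t) n) k)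
     + complex_of_real ((lam n)\<^sup>2 - \<tau>\<^sup>2) * ?c) - complex_of_real (2 * \<tau>) * (\<i> * ?\<xi> * ?c)"
    unfolding hat_vt by (rule trans[OF sym, rotated])
  have s2: "(Complex \<tau> (freq T k))\<^sup>2 = complex_of_real (\<tau>\<^sup>2) - ?\<xi>\<^sup>2 + 2 * \<i> * complex_of_real \<tau> * ?\<xi>"
    by (simp add: complex_eq_iff power2_eq_square)
  have solve: "(t\<^sup>2 - x\<^sup>2 + 2 * \<i> * t * x - l\<^sup>2) * c = p"
    if "\<i> * x * (\<i> * x * c) = (p + (l\<^sup>2 - t\<^sup>2) * c) - (2 * t) * (\<i> * x * c)" "\<i> * \<i> = -1" for t x l c p :: complex
    using that by algebra
  have "((Complex \<tau> (freq T k))\<^sup>2 - (complex_of_real (lam n))\<^sup>2) * ?c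
      = (\<Sum>j\<in>UNIV. complex_of_real (amp n j) * hat (\<lambda>t. source t $ j) k) + hat (\<lambda>t. coef (F t) n) k"
    unfolding s2 of_real_power by (rule solve) (use e in simp_all)
  then show ?thesis by (simp add: mult.commute)
qed

lemma vanishing_outside:
  "AE t in lebesgue. t \<notin> {-T<..<T} \<longrightarrow> nsq hmeas (v t) = 0 \<and> nsq hmeas (vt t) = 0 \<and> (H_norm (L0_sqrt (v t)))\<^sup>2 = 0 \<and>
     (norm (trace_op (v t)))\<^sup>2 = 0"
proof -
  have "AE t in lebesgue. \<forall>n. R < \<bar>t\<bar> \<longrightarrow> coef (v t) n = 0" "AE t in lebesgue. \<forall>n. R < \<bar>t\<bar> \<longrightarrow> coef (vt t) n = 0"
    unfolding AE_all_countable by (intro allI coef_vanishes)+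
  then show ?thesis using in_V(1) in_L2(1,2)
  proof eventually_elim
    case (elim t)
    show ?case
    proof (intro impI)
      assume "t \<notin> {-T<..<T}"
      then have "R < \<bar>t\<bar>" using T by auto
      then have z: "coef (v t) n = 0" "coef (vt t) n = 0" for n using elim(1,2) by blast+
      have "(V_norm (v t))\<^sup>2 = 0" using sums_unique[OF V_norm_sums[OF elim(3)]] by (simp add: z)
      then have "(cmod (trace_op (v t) $ i))\<^sup>2 \<le> 0" for i using trace_bound[OF elim(3), of i] by simp
      then show "nsq hmeas (v t) = 0 \<and> nsq hmeas (vt t) = 0 \<and> (H_norm (L0_sqrt (v t)))\<^sup>2 = 0 \<and> (norm (trace_op (v t)))\<^sup>2 = 0"
        using sums_unique[OF E.Parseval[OF elim(4)]] sums_unique[OF E.Parseval[OF elim(5)]] sums_unique[OF L0_sqrt_norm[OF elim(3)]]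
        by (simp add: z norm_sq_2)
    qed
  qed
qed

lemma AE_ivl: "AE t in lebesgue. P t \<Longrightarrow> AE t in ivl T. P t"
  by (subst AE_restrict_space_iff) (auto elim: eventually_mono)

text \<open>Each of the energies in the estimate is diagonal in the modes and dominated, frequency by frequency, by
  the total energy \<open>m\<close> of the Fourier coefficients.\<close>

lemma energy_by_modes:
  assumes c: "\<And>n. (\<lambda>t. c n t) \<in> L2 lebesgue" and w: "\<And>n. 0 \<le> w n" and q0: "\<And>t. 0 \<le> q t"
    and q: "AE t in lebesgue. (\<lambda>n. w n * (cmod (c n t))\<^sup>2) sums q t"
    and out: "AE t in lebesgue. t \<notin> {-T<..<T} \<longrightarrow> q t = 0"
    and le: "\<And>k n. w n * (cmod (hat (c n) k))\<^sup>2 \<le> m k n" and m: "(\<Sum>k. \<Sum>n. ennreal (m k n)) \<le> ennreal B" and B: "0 \<le> B"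
  shows "(LINT t|lebesgue. q t) \<le> B"
proof -
  have "ennreal (LINT t|lebesgue. q t) \<le> (\<integral>\<^sup>+t. ennreal (q t) \<partial>ivl T)"
    by (rule integral_le_nn_integral_ivl[OF q0 out])
  also have "\<dots> = (\<Sum>k. \<Sum>n. ennreal (w n * (cmod (hat (c n) k))\<^sup>2))"
    by (rule space_time_Parseval[OF T(1) restrict_L2[OF c] w AE_ivl[OF q]])
  also have "\<dots> \<le> (\<Sum>k. \<Sum>n. ennreal (m k n))"
    by (intro suminf_le summableI ennreal_leI le)
  finally show ?thesis using m B by (meson ennreal_le_iff order_trans)
qed

lemma energy_estimate:
  assumes c: "centred \<delta> \<tau> N" and \<tau>: "2 * mode_const \<delta> * \<mu>\<^sup>2 \<le> \<tau>"
  defines "B \<equiv> 2 * mode_const \<delta> * (LINT t|lebesgue. (H_norm (F t))\<^sup>2)"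
  shows "(LINT t|lebesgue. \<tau>\<^sup>2 * (H_norm (v t))\<^sup>2) \<le> B" "(LINT t|lebesgue. (H_norm (vt t))\<^sup>2) \<le> B"
    "(LINT t|lebesgue. (H_norm (L0_sqrt (v t)))\<^sup>2) \<le> B" "\<tau> * sqrt \<tau> * (LINT t|lebesgue. (norm (trace_op (v t)))\<^sup>2) \<le> B"
proof -
  interpret Four: orthonormal_basis "ivl T" "fourier T" by (rule fourier_basis[OF T(1)])
  define \<phi> where "\<phi> = (LINT t|lebesgue. (H_norm (F t))\<^sup>2)"
  have \<phi>: "0 \<le> \<phi>" unfolding \<phi>_def by simp
  have K: "0 < mode_const \<delta>" using c by (auto simp: centred_def intro: mode_const_parts(4))
  have B: "B = 2 * mode_const \<delta> * \<phi>" "0 \<le> B" using K \<phi> by (auto simp: B_def \<phi>_def)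
  have \<tau>0: "0 < \<tau>" using c by (simp add: centred_def)
  define X where "X k = (\<chi> i. hat (\<lambda>t. trace_op (v t) $ i) k)" for k
  define G where "G k = (\<chi> i. hat (\<lambda>t. source t $ i) k)" for k
  have trL: "(\<lambda>t. trace_op (v t) $ i) \<in> L2 (ivl T)" and soL: "(\<lambda>t. source t $ i) \<in> L2 (ivl T)" for i
    by (rule restrict_L2[OF trace_L2] restrict_L2[OF source_L2])+
  have vec: "(\<lambda>k. (norm (\<chi> i. hat (\<lambda>t. Y t $ i) k))\<^sup>2) sums (LINT t|ivl T. (norm (Y t))\<^sup>2)"
    if "\<And>i. (\<lambda>t. Y t $ i) \<in> L2 (ivl T)" for Y :: "real \<Rightarrow> complex^2"
    unfolding nsq_sum_components(2)[OF that] unfolding norm_sq_2 sum_2 vec_lambda_beta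
    by (intro sums_add Four.Parseval that)
  define x where "x = (LINT t|ivl T. (norm (trace_op (v t)))\<^sup>2)"
  define g where "g = (LINT t|ivl T. (norm (source t))\<^sup>2)"
  have gx: "g \<le> \<mu>\<^sup>2 * x"
    unfolding g_def x_def integral_mult_right_zero[symmetric]
    by (intro integral_mono_AE integrable_mult_right nsq_sum_components(1) trL soL AE_ivl source_le)
  have Fsum: "(\<Sum>k. \<Sum>n. ennreal ((cmod (hat (\<lambda>t. coef (F t) n) k))\<^sup>2)) \<le> ennreal \<phi>"
  proof -
    have q: "AE t in ivl T. (\<lambda>n. 1 * (cmod (coef (F t) n))\<^sup>2) sums (H_norm (F t))\<^sup>2"
      using AE_ivl[OF in_L2(3)] by eventually_elim (simp add: H_norm_nsq E.Parseval)
    have "(\<Sum>k. \<Sum>n. ennreal (1 * (cmod (hat (\<lambda>t. coef (F t) n) k))\<^sup>2)) = (\<integral>\<^sup>+t. ennreal ((H_norm (F t))\<^sup>2) \<partial>ivl T)"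
      by (rule space_time_Parseval[OF T(1) restrict_L2[OF coef_L2(3)] _ q, symmetric]) simp
    also have "\<dots> = (\<integral>\<^sup>+t. ennreal ((H_norm (F t))\<^sup>2) * indicator {-T<..<T} t \<partial>lebesgue)"
      by (subst nn_integral_restrict_space) auto
    also have "\<dots> \<le> (\<integral>\<^sup>+t. ennreal ((H_norm (F t))\<^sup>2) \<partial>lebesgue)"
      by (intro nn_integral_mono) (auto simp: indicator_def)
    also have "\<dots> = ennreal \<phi>"
      unfolding \<phi>_def using F by (intro nn_integral_eq_integral) (auto simp: L2_time_def)
    finally show ?thesis by simp
  qed
  have Xs: "(\<lambda>n. hat (\<lambda>t. coef (v t) n) k * amp n i) sums (X k $ i)" for k i
    unfolding X_def using trace_fourier_sums[OF T(1) in_V coef_L2(1), of k i] by simp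
  have eq: "((Complex \<tau> (freq T k))\<^sup>2 - (complex_of_real (lam n))\<^sup>2) * hat (\<lambda>t. coef (v t) n) k
      = (\<Sum>j\<in>UNIV. G k $ j * amp n j) + hat (\<lambda>t. coef (F t) n) k" for k n
    using hat_equation[of k n] by (simp add: G_def)
  note ab = absorption[OF c eq Xs Fsum \<phi> vec[OF trL, folded X_def x_def] vec[OF soL, folded G_def g_def] gx \<tau>, folded B(1)]
  note modes = energy_by_modes[OF _ _ _ _ _ _ ab(2) B(2)]
  show "(LINT t|lebesgue. \<tau>\<^sup>2 * (H_norm (v t))\<^sup>2) \<le> B"
  proof (rule modes[of "\<lambda>n t. coef (v t) n" "\<lambda>_. \<tau>\<^sup>2"])
    show "AE t in lebesgue. (\<lambda>n. \<tau>\<^sup>2 * (cmod (coef (v t) n))\<^sup>2) sums (\<tau>\<^sup>2 * (H_norm (v t))\<^sup>2)"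
      using in_L2(1) by eventually_elim (intro sums_mult, simp add: H_norm_nsq E.Parseval)
    show "AE t in lebesgue. t \<notin> {-T<..<T} \<longrightarrow> \<tau>\<^sup>2 * (H_norm (v t))\<^sup>2 = 0"
      using vanishing_outside by eventually_elim (simp add: H_norm_nsq)
  qed (auto intro!: mult_right_mono coef_L2)
  show "(LINT t|lebesgue. (H_norm (vt t))\<^sup>2) \<le> B"
  proof (rule modes[of "\<lambda>n t. coef (vt t) n" "\<lambda>_. 1"])
    show "AE t in lebesgue. (\<lambda>n. 1 * (cmod (coef (vt t) n))\<^sup>2) sums ((H_norm (vt t))\<^sup>2)"
      using in_L2(2) by eventually_elim (simp add: H_norm_nsq E.Parseval)
    show "AE t in lebesgue. t \<notin> {-T<..<T} \<longrightarrow> (H_norm (vt t))\<^sup>2 = 0"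
      using vanishing_outside by eventually_elim (simp add: H_norm_nsq)
    show "1 * (cmod (hat (\<lambda>t. coef (vt t) n) k))\<^sup>2 \<le> (\<tau>\<^sup>2 + (freq T k)\<^sup>2 + (lam n)\<^sup>2) * (cmod (hat (\<lambda>t. coef (v t) n) k))\<^sup>2" for k n
      unfolding hat_vt norm_mult power_mult_distrib by (simp add: mult_right_mono)
  qed (auto intro!: coef_L2)
  show "(LINT t|lebesgue. (H_norm (L0_sqrt (v t)))\<^sup>2) \<le> B"
  proof (rule modes[of "\<lambda>n t. coef (v t) n" "\<lambda>n. (lam n)\<^sup>2"])
    show "AE t in lebesgue. (\<lambda>n. (lam n)\<^sup>2 * (cmod (coef (v t) n))\<^sup>2) sums ((H_norm (L0_sqrt (v t)))\<^sup>2)"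
      using in_V(1) by eventually_elim (rule L0_sqrt_norm)
    show "AE t in lebesgue. t \<notin> {-T<..<T} \<longrightarrow> (H_norm (L0_sqrt (v t)))\<^sup>2 = 0"
      using vanishing_outside by eventually_elim blast
  qed (auto intro!: mult_right_mono coef_L2)
  have "ennreal (LINT t|lebesgue. (norm (trace_op (v t)))\<^sup>2) \<le> (\<integral>\<^sup>+t. ennreal ((norm (trace_op (v t)))\<^sup>2) \<partial>ivl T)"
    by (rule integral_le_nn_integral_ivl) (use vanishing_outside in \<open>auto elim: eventually_mono\<close>)
  also have "\<dots> = ennreal x"
    unfolding x_def by (intro nn_integral_eq_integral nsq_sum_components(1) trL) auto
  finally have "(LINT t|lebesgue. (norm (trace_op (v t)))\<^sup>2) \<le> x" by (subst (asm) ennreal_le_iff) (auto simp: x_def)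
  then have "\<tau> * sqrt \<tau> * (LINT t|lebesgue. (norm (trace_op (v t)))\<^sup>2) \<le> \<tau> * sqrt \<tau> * x"
    using \<tau>0 by (intro mult_left_mono) auto
  then show "\<tau> * sqrt \<tau> * (LINT t|lebesgue. (norm (trace_op (v t)))\<^sup>2) \<le> B" using ab(1) by linarith
qed

end

theorem theorem14p1:
  fixes \<delta> :: real
  assumes "0 < \<delta>" and "\<delta> < 1/4"
  shows "\<exists>C1>0. \<forall>(\<mu>::real) (\<Gamma> :: real \<Rightarrow> real^2^2) (\<tau>::real)
      (v :: real \<Rightarrow> real \<Rightarrow> complex) (vt :: real \<Rightarrow> real \<Rightarrow> complex)
      (vtt :: real \<Rightarrow> (real \<Rightarrow> complex) \<Rightarrow> complex) (F :: real \<Rightarrow> real \<Rightarrow> complex).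
    \<mu> \<ge> 0 \<longrightarrow> bounded_symmetric_coeff \<mu> \<Gamma> \<longrightarrow>
    compactly_supported_in_time v \<longrightarrow> finite_energy v vt vtt \<longrightarrow>
    F \<in> L2_time H_space H_norm \<longrightarrow>
    solves_conjugated \<tau> \<Gamma> v vt vtt F \<longrightarrow>
    admissible \<delta> \<tau> \<longrightarrow> \<tau> \<ge> C1 * (1 + \<mu>\<^sup>2) \<longrightarrow>
    \<tau> * L2_time_norm H_norm v + L2_time_norm H_norm vt
      + L2_time_norm H_norm (\<lambda>t. L0_sqrt (v t))
      + \<tau> powr (3/4) * L2_time_norm norm (\<lambda>t. trace_op (v t))
    \<le> C1 * L2_time_norm H_norm F"
proof -
  define K where "K = mode_const \<delta>"
  have K: "0 < K" unfolding K_def by (rule mode_const_parts(4)[OF assms(1)])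
  \<comment> \<open>fourier terms of size \<open>sqrt (2 * K)\<close>, and enough for the absorption threshold\<close>
  define C where "C = 4 * sqrt (2 * K) + 2 * K + 1"
  have C: "0 < C" "2 * K \<le> C" "4 * sqrt (2 * K) \<le> C" using K by (simp_all add: C_def add_pos_pos)
  show ?thesis
  proof (rule exI[of _ C], intro conjI C(1) allI impI)
    fix \<mu> \<tau> :: real and \<Gamma> :: "real \<Rightarrow> real^2^2" and v vt F :: "real \<Rightarrow> real \<Rightarrow> complex"
      and vtt :: "real \<Rightarrow> (real \<Rightarrow> complex) \<Rightarrow> complex"
    assume a: "0 \<le> \<mu>" "bounded_symmetric_coeff \<mu> \<Gamma>" "compactly_supported_in_time v" "finite_energy v vt vtt"
      "F \<in> L2_time H_space H_norm" "solves_conjugated \<tau> \<Gamma> v vt vtt F" "admissible \<delta> \<tau>" "C * (1 + \<mu>\<^sup>2) \<le> \<tau>"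
    obtain R where R: "AE t in lebesgue. R < \<bar>t\<bar> \<longrightarrow> (AE x in hmeas. v t x = 0)"
      using a(3) by (auto simp: compactly_supported_in_time_def)
    interpret conjugated_solution \<mu> \<tau> R "\<bar>R\<bar> + 1" \<Gamma> v vt F vtt
      by unfold_locales (use a R in auto)
    have \<tau>2: "2 \<le> \<tau>" using a(7) by (simp add: admissible_def)
    obtain N where N: "centred \<delta> \<tau> N"
      by (rule centred_exists[OF \<tau>2 assms(1) admissible_lam[OF a(7)]])
    have "2 * K * \<mu>\<^sup>2 \<le> C * (1 + \<mu>\<^sup>2)" using C by (intro mult_mono) auto
    then have thr: "2 * mode_const \<delta> * \<mu>\<^sup>2 \<le> \<tau>" using a(8) by (simp add: K_def)
    note e = energy_estimate[OF N thr, folded K_def]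
    define B where "B = 2 * K * (LINT t|lebesgue. (H_norm (F t))\<^sup>2)"
    have sB: "sqrt B = sqrt (2 * K) * L2_time_norm H_norm F"
      by (simp add: B_def L2_time_norm_def real_sqrt_mult)
    have F0: "0 \<le> L2_time_norm H_norm F" by (simp add: L2_time_norm_def)
    have 1: "\<tau> * L2_time_norm H_norm v \<le> sqrt B"
    proof -
      have "\<tau> * L2_time_norm H_norm v = sqrt (LINT t|lebesgue. \<tau>\<^sup>2 * (H_norm (v t))\<^sup>2)"
        using \<tau>2 by (simp add: L2_time_norm_def real_sqrt_mult)
      then show ?thesis using e(1) by (simp add: B_def)
    qed
    have 2: "L2_time_norm H_norm vt \<le> sqrt B" "L2_time_norm H_norm (\<lambda>t. L0_sqrt (v t)) \<le> sqrt B"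
      using e(2,3) by (simp_all add: L2_time_norm_def B_def)
    have 3: "\<tau> powr (3/4) * L2_time_norm norm (\<lambda>t. trace_op (v t)) \<le> sqrt B"
    proof -
      have "(\<tau> powr (3/4))\<^sup>2 = \<tau> powr (1 + 1/2)"
        by (simp add: power2_eq_square powr_add[symmetric])
      also have "\<dots> = \<tau> powr 1 * \<tau> powr (1/2)" by (rule powr_add)
      also have "\<dots> = \<tau> * sqrt \<tau>" using \<tau>2 by (simp add: powr_half_sqrt)
      finally have "\<tau> powr (3/4) = sqrt (\<tau> * sqrt \<tau>)" by (metis powr_ge_zero real_sqrt_unique)
      then have "\<tau> powr (3/4) * L2_time_norm norm (\<lambda>t. trace_op (v t))
          = sqrt (\<tau> * sqrt \<tau> * (LINT t|lebesgue. (norm (trace_op (v t)))\<^sup>2))"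
        by (simp add: L2_time_norm_def real_sqrt_mult)
      then show ?thesis using e(4) by (simp add: B_def)
    qed
    have "4 * sqrt B \<le> C * L2_time_norm H_norm F"
      using mult_right_mono[OF C(3) F0] by (simp add: sB mult.assoc)
    then show "\<tau> * L2_time_norm H_norm v + L2_time_norm H_norm vt + L2_time_norm H_norm (\<lambda>t. L0_sqrt (v t))
        + \<tau> powr (3/4) * L2_time_norm norm (\<lambda>t. trace_op (v t)) \<le> C * L2_time_norm H_norm F"
      using 1 2 3 by linarith
  qed
qed

end
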